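(* For every $r\ge2$, the distance $d_{\mathfrak h}$ is finite on $\mathcal X^1(\mathbb F_r)$ and the metric topology of $(\mathcal X^1(\mathbb F_r),d_{\mathfrak h})$ coincides with the weak topology on $\mathcal X^1(\mathbb F_r)$.
   Context: Graphs are finite connected graphs in Serre's sense ($E$ oriented edges, involution $e\mapsto\bar e$, orientation $E_+$); $\mathcal M(G)=\mathbb R_{>0}^{|E_+|}$ is the set of length functions; entropy $\mathfrak h_G(\ell)=\lim_{t\to\infty}\frac1t\log\#\{\text{based circuits }\gamma:\ell(\gamma)\le t\}$ (based circuit = reduced closed edge path $(e_1,\ldots,e_n)$ with $e_{i+1}\neq\bar e_i$, $e_n\ne\bar e_1$); $\mathcal M^1(G)=\{\mathfrak h_G=1\}$ with entropy norm $\|(\ell,v)\|^2_{\mathfrak h,G}=\langle v,\operatorname{Hess}\mathfrak h_G(\ell)v\rangle$ on tangent vectors. Outer space: marked metric graphs $(G,\rho,\ell)$ with $G$ without valence 1 or 2 vertices, $\rho\colon\mathcal R_r\to G$ a homotopy equivalence from the $r$-rose, $\ell\in\mathcal M(G)$, modulo isomorphisms respecting lengths and markings up to homotopy; $\mathcal X(\mathbb F_r)$ the set of classes, $\mathcal X^1(\mathbb F_r)$ those of unit entropy, and $\mathcal X(G,\rho)$, $\mathcal X^1(G,\rho)$ the (unit entropy) classes with marked graph $(G,\rho)$. A collapse $c\colon G\to G_0$ (surjection sending edges to edges or vertices with contractible point preimages) induces $c^*\colon\mathcal M(G_0)\to\mathbb R^{|E_+|}_{\ge0}$, $c^*(\ell)(e)=\ell(c(e))$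 or $0$ if $c(e)$ is a vertex; $(G_0,\rho_0)\le(G,\rho)$ if some collapse $c$ has $\rho_0\simeq c\circ\rho$. The closed cell $\overline{\mathcal X}(G,\rho)=\bigcup_{(G_0,\rho_0)\le(G,\rho)}\mathcal X(G_0,\rho_0)$ is identified via these $c^*$ with a subset of $\mathbb R_{\ge0}^{|E_+|}$. The weak topology: $U$ is open iff $U\cap\overline{\mathcal X}(G,\rho)$ is open in this subset for every marked graph $(G,\rho)$; $\mathcal X^1(\mathbb F_r)$ gets the subspace topology. $d_{\mathfrak h}$ is the infimum of lengths of continuous paths in $\mathcal X^1(\mathbb F_r)$ which, off a finite partition of $[0,1]$, are smooth paths in single cells $\mathcal X^1(G_k,\rho_k)\cong\mathcal M^1(G_k)$, the length being the sum of entropy lengths of the pieces. *)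

theory Defs
  imports "HOL-Analysis.Analysis"
begin

record sgraph =
  gV :: "nat set"
  gE :: "nat set"
  gorg :: "nat \<Rightarrow> nat"
  gbar :: "nat \<Rightarrow> nat"
  gEp :: "nat set"

definition tm :: "sgraph \<Rightarrow> nat \<Rightarrow> nat" where
  "tm G e = gorg G (gbar G e)"

definition serre_graph :: "sgraph \<Rightarrow> bool" where
  "serre_graph G \<longleftrightarrow> finite (gV G) \<and> finite (gE G) \<and> gV G \<noteq> {} \<and> gEp G \<subseteq> gE G \<and>
     (\<forall>e\<in>gE G. gorg G e \<in> gV G \<and> gbar G e \<in> gE G \<and> gbar G e \<noteq> e \<and>
        gbar G (gbar G e) = e \<and> (e \<in> gEp G \<longleftrightarrow> gbar G e \<notin> gEp G))"

fun walk :: "sgraph \<Rightarrow> nat set \<Rightarrow> nat list \<Rightarrow> nat \<Rightarrow> nat \<Rightarrow> bool" where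
  "walk G F [] a b \<longleftrightarrow> a = b \<and> a \<in> gV G"
| "walk G F (e # p) a b \<longleftrightarrow> e \<in> F \<and> gorg G e = a \<and> walk G F p (tm G e) b"

definition connected_graph :: "sgraph \<Rightarrow> bool" where
  "connected_graph G \<longleftrightarrow> (\<forall>a\<in>gV G. \<forall>b\<in>gV G. \<exists>p. walk G (gE G) p a b)"

text \<open>Graphs allowed in Outer space: finite connected, no vertices of valence 1 or 2
  (and, being connected with a marking, no isolated vertex either).\<close>
definition outer_graph :: "sgraph \<Rightarrow> bool" where
  "outer_graph G \<longleftrightarrow> serre_graph G \<and> connected_graph G \<and>
     (\<forall>v\<in>gV G. card {e\<in>gE G. gorg G e = v} \<ge> 3)"

fun red :: "sgraph \<Rightarrow> nat list \<Rightarrow> nat list" where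
  "red G [] = []"
| "red G (e # p) = (case red G p of [] \<Rightarrow> [e] | f # q \<Rightarrow> (if f = gbar G e then q else e # f # q))"

definition rev_path :: "sgraph \<Rightarrow> nat list \<Rightarrow> nat list" where
  "rev_path G p = rev (map (gbar G) p)"

definition reduced :: "sgraph \<Rightarrow> nat list \<Rightarrow> bool" where
  "reduced G p \<longleftrightarrow> (\<forall>i. Suc i < length p \<longrightarrow> p ! Suc i \<noteq> gbar G (p ! i))"

text \<open>Words in the free group on r generators: letters (i, True) = x_i, (i, False) = x_i^-1.\<close>
definition letter_img :: "sgraph \<Rightarrow> nat list list \<Rightarrow> nat \<times> bool \<Rightarrow> nat list" where
  "letter_img G ws x = (if snd x then ws ! fst x else rev_path G (ws ! fst x))"

definition eval_word :: "sgraph \<Rightarrow> nat list list \<Rightarrow> (nat \<times> bool) list \<Rightarrow> nat list" where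
  "eval_word G ws u = red G (concat (map (letter_img G ws) u))"

definition freely_reduced :: "(nat \<times> bool) list \<Rightarrow> bool" where
  "freely_reduced u \<longleftrightarrow> (\<forall>i. Suc i < length u \<longrightarrow>
      \<not> (fst (u ! Suc i) = fst (u ! i) \<and> snd (u ! Suc i) \<noteq> snd (u ! i)))"

text \<open>A marking \<rho> : R_r \<rightarrow> G, taken cellular: the vertex of the rose goes to v and the
  i-th petal to the reduced closed edge path ws!i at v.  It is a homotopy equivalence iff
  the induced map F_r \<rightarrow> \<pi>_1(G,v) is bijective.\<close>
definition valid_marking :: "nat \<Rightarrow> sgraph \<Rightarrow> nat \<times> nat list list \<Rightarrow> bool" where
  "valid_marking r G M \<longleftrightarrow> (case M of (v, ws) \<Rightarrow>
     v \<in> gV G \<and> length ws = r \<and>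
     (\<forall>i<r. walk G (gE G) (ws ! i) v v \<and> reduced G (ws ! i)) \<and>
     (\<forall>c. walk G (gE G) c v v \<and> reduced G c \<longrightarrow>
         (\<exists>u. set (map fst u) \<subseteq> {..<r} \<and> eval_word G ws u = c)) \<and>
     (\<forall>u. set (map fst u) \<subseteq> {..<r} \<and> freely_reduced u \<and> eval_word G ws u = [] \<longrightarrow> u = []))"

text \<open>Free homotopy of (cellular) maps R_r \<rightarrow> G: change of base point along an edge path p.\<close>
definition marking_equiv :: "sgraph \<Rightarrow> nat \<times> nat list list \<Rightarrow> nat \<times> nat list list \<Rightarrow> bool" where
  "marking_equiv G M M' \<longleftrightarrow> (case M of (v, ws) \<Rightarrow> case M' of (v', ws') \<Rightarrow>
     length ws = length ws' \<and>
     (\<exists>p. walk G (gE G) p v v' \<and> (\<forall>i<length ws. ws' ! i = red G (rev_path G p @ ws ! i @ p))))"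

definition len :: "sgraph \<Rightarrow> (nat \<Rightarrow> real) \<Rightarrow> nat \<Rightarrow> real" where
  "len G l e = (if e \<in> gEp G then l e else l (gbar G e))"

definition lengths :: "sgraph \<Rightarrow> (nat \<Rightarrow> real) set" where
  "lengths G = {l. (\<forall>e\<in>gEp G. l e > 0) \<and> (\<forall>e. e \<notin> gEp G \<longrightarrow> l e = 0)}"

definition based_circuit :: "sgraph \<Rightarrow> nat list \<Rightarrow> bool" where
  "based_circuit G p \<longleftrightarrow> p \<noteq> [] \<and> walk G (gE G) p (gorg G (hd p)) (gorg G (hd p)) \<and>
     reduced G p \<and> last p \<noteq> gbar G (hd p)"

definition circuit_count :: "sgraph \<Rightarrow> (nat \<Rightarrow> real) \<Rightarrow> real \<Rightarrow> nat" where
  "circuit_count G l t = card {p. based_circuit G p \<and> sum_list (map (len G l) p) \<le> t}"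

definition entropy :: "sgraph \<Rightarrow> (nat \<Rightarrow> real) \<Rightarrow> real" where
  "entropy G l = Lim at_top (\<lambda>t. ln (real (circuit_count G l t)) / t)"

definition partial_der :: "((nat \<Rightarrow> real) \<Rightarrow> real) \<Rightarrow> nat \<Rightarrow> (nat \<Rightarrow> real) \<Rightarrow> real" where
  "partial_der F e l = deriv (\<lambda>s. F (l(e := l e + s))) 0"

definition hess_form :: "sgraph \<Rightarrow> (nat \<Rightarrow> real) \<Rightarrow> (nat \<Rightarrow> real) \<Rightarrow> real" where
  "hess_form G l v = (\<Sum>e\<in>gEp G. \<Sum>f\<in>gEp G.
      v e * v f * partial_der (\<lambda>m. partial_der (entropy G) f m) e l)"

type_synonym mmg = "sgraph \<times> (nat \<times> nat list list) \<times> (nat \<Rightarrow> real)"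

definition valid_mmg :: "nat \<Rightarrow> mmg \<Rightarrow> bool" where
  "valid_mmg r t \<longleftrightarrow> (case t of (G, M, l) \<Rightarrow>
     outer_graph G \<and> valid_marking r G M \<and> l \<in> lengths G)"

definition graph_iso :: "sgraph \<Rightarrow> sgraph \<Rightarrow> (nat \<Rightarrow> nat) \<Rightarrow> (nat \<Rightarrow> nat) \<Rightarrow> bool" where
  "graph_iso G G' fV fE \<longleftrightarrow> bij_betw fV (gV G) (gV G') \<and> bij_betw fE (gE G) (gE G') \<and>
     (\<forall>e\<in>gE G. gorg G' (fE e) = fV (gorg G e) \<and> fE (gbar G e) = gbar G' (fE e))"

definition mmg_equiv :: "mmg \<Rightarrow> mmg \<Rightarrow> bool" where
  "mmg_equiv t t' \<longleftrightarrow> (case t of (G, M, l) \<Rightarrow> case t' of (G', M', l') \<Rightarrow>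
     (\<exists>fV fE. graph_iso G G' fV fE \<and> (\<forall>e\<in>gE G. len G' l' (fE e) = len G l e) \<and>
        marking_equiv G' (fV (fst M), map (map fE) (snd M)) M'))"

definition cls :: "nat \<Rightarrow> mmg \<Rightarrow> mmg set" where
  "cls r t = {t'. valid_mmg r t' \<and> mmg_equiv t t'}"

definition outer_space :: "nat \<Rightarrow> mmg set set" where
  "outer_space r = cls r ` {t. valid_mmg r t}"

definition outer_space1 :: "nat \<Rightarrow> mmg set set" where
  "outer_space1 r = cls r ` {(G, M, l). valid_mmg r (G, M, l) \<and> entropy G l = 1}"

definition collapse :: "sgraph \<Rightarrow> sgraph \<Rightarrow> (nat \<Rightarrow> nat) \<Rightarrow> (nat \<Rightarrow> nat option) \<Rightarrow> bool" where
  "collapse G G0 cV cE \<longleftrightarrow> cV ` gV G = gV G0 \<and>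
     (\<forall>e\<in>gE G. case cE e of
         Some f \<Rightarrow> f \<in> gE G0 \<and> gorg G0 f = cV (gorg G e) \<and> cE (gbar G e) = Some (gbar G0 f)
       | None \<Rightarrow> cV (gorg G e) = cV (tm G e) \<and> cE (gbar G e) = None) \<and>
     (\<forall>f\<in>gE G0. \<exists>!e. e \<in> gE G \<and> cE e = Some f) \<and>
     (\<forall>w\<in>gV G0.
        (\<forall>a\<in>{v\<in>gV G. cV v = w}. \<forall>b\<in>{v\<in>gV G. cV v = w}.
            \<exists>p. walk G {e\<in>gE G. cE e = None \<and> cV (gorg G e) = w} p a b) \<and>
        card {e\<in>gE G. cE e = None \<and> cV (gorg G e) = w} = 2 * (card {v\<in>gV G. cV v = w} - 1))"

definition collapse_path :: "(nat \<Rightarrow> nat option) \<Rightarrow> nat list \<Rightarrow> nat list" where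
  "collapse_path cE p = concat (map (\<lambda>e. case cE e of None \<Rightarrow> [] | Some f \<Rightarrow> [f]) p)"

definition comp_marking :: "sgraph \<Rightarrow> (nat \<Rightarrow> nat) \<Rightarrow> (nat \<Rightarrow> nat option) \<Rightarrow>
    nat \<times> nat list list \<Rightarrow> nat \<times> nat list list" where
  "comp_marking G0 cV cE M = (cV (fst M), map (\<lambda>w. red G0 (collapse_path cE w)) (snd M))"

definition pullback :: "sgraph \<Rightarrow> (nat \<Rightarrow> nat option) \<Rightarrow> sgraph \<Rightarrow> (nat \<Rightarrow> real) \<Rightarrow> nat \<Rightarrow> real" where
  "pullback G cE G0 l0 = (\<lambda>e. if e \<in> gEp G then (case cE e of Some f \<Rightarrow> len G0 l0 f | None \<Rightarrow> 0) else 0)"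

text \<open>cell_rel r G M lam x: the point x of the closed cell of (G,M) has coordinates lam \<in> R_{\<ge>0}^{E_+}.\<close>
definition cell_rel :: "nat \<Rightarrow> sgraph \<Rightarrow> nat \<times> nat list list \<Rightarrow> (nat \<Rightarrow> real) \<Rightarrow> mmg set \<Rightarrow> bool" where
  "cell_rel r G M lam x \<longleftrightarrow> (\<exists>G0 M0 l0 cV cE. valid_mmg r (G0, M0, l0) \<and> collapse G G0 cV cE \<and>
     marking_equiv G0 M0 (comp_marking G0 cV cE M) \<and> lam = pullback G cE G0 l0 \<and> x = cls r (G0, M0, l0))"

definition weak_open :: "nat \<Rightarrow> mmg set set \<Rightarrow> bool" where
  "weak_open r U \<longleftrightarrow> U \<subseteq> outer_space r \<and>
     (\<forall>G M. outer_graph G \<and> valid_marking r G M \<longrightarrow>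
        openin (top_of_set {lam. \<exists>x. cell_rel r G M lam x}) {lam. \<exists>x\<in>U. cell_rel r G M lam x})"

definition smooth_on :: "real set \<Rightarrow> (real \<Rightarrow> real) \<Rightarrow> bool" where
  "smooth_on S f \<longleftrightarrow> (\<forall>n. \<forall>x\<in>S. ((deriv ^^ n) f) differentiable (at x))"

definition weak_cont :: "nat \<Rightarrow> (real \<Rightarrow> mmg set) \<Rightarrow> bool" where
  "weak_cont r \<gamma> \<longleftrightarrow> (\<forall>V. weak_open r V \<longrightarrow> openin (top_of_set {0..1}) {t\<in>{0..1}. \<gamma> t \<in> V})"

definition smooth_piece :: "nat \<Rightarrow> real \<Rightarrow> real \<Rightarrow> (real \<Rightarrow> mmg set) \<Rightarrow> real \<Rightarrow> bool" where
  "smooth_piece r a b \<gamma> I \<longleftrightarrow> (\<exists>G M L. outer_graph G \<and> valid_marking r G M \<and>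
     (\<forall>t\<in>{a<..<b}. L t \<in> lengths G \<and> entropy G (L t) = 1 \<and> \<gamma> t = cls r (G, M, L t)) \<and>
     (\<forall>e\<in>gEp G. smooth_on {a<..<b} (\<lambda>t. L t e)) \<and>
     ((\<lambda>t. sqrt (hess_form G (L t) (\<lambda>e. deriv (\<lambda>s. L s e) t))) has_integral I) {a..b})"

definition path_lengths :: "nat \<Rightarrow> mmg set \<Rightarrow> mmg set \<Rightarrow> real set" where
  "path_lengths r x y = {s. \<exists>\<gamma> ts I. \<gamma> 0 = x \<and> \<gamma> 1 = y \<and>
     (\<forall>t\<in>{0..1}. \<gamma> t \<in> outer_space1 r) \<and> weak_cont r \<gamma> \<and>
     length ts \<ge> 2 \<and> hd ts = 0 \<and> last ts = 1 \<and> sorted_wrt (<) ts \<and>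
     (\<forall>k. Suc k < length ts \<longrightarrow> smooth_piece r (ts ! k) (ts ! Suc k) \<gamma> (I k)) \<and>
     s = (\<Sum>k<length ts - 1. I k)}"

definition d_h :: "nat \<Rightarrow> mmg set \<Rightarrow> mmg set \<Rightarrow> ereal" where
  "d_h r x y = Inf (ereal ` path_lengths r x y)"

end

theory Submission
  imports Defs "HOL-Real_Asymp.Real_Asymp"
begin

text \<open>
  Cutting a nonbacktracking circuit at its visits to a fixed oriented edge shows that the entropy is the
  unique zero of the pressure of the first-return loops: \<open>h(l) = 1\<close> iff the sum of \<open>exp (- l(p))\<close> over these
  loops \<open>p\<close> is 1. Differentiating this identity gives, for \<open>v\<close> tangent to the unit entropy hypersurface,
  \<open>\<langle>v, Hess h(l) v\<rangle>\<close> as the sum of \<open>v(p)^2 exp (- l(p))\<close> divided by the sum of \<open>l(p) exp (- l(p))\<close>.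
  The numerator stays bounded along normalized segments into a face of a closed cell, so that weakly close
  points are metrically close; conversely it dominates the squares of the coordinates of \<open>v\<close>, uniformly on
  the finitely many cells around a point, so that short paths cannot leave a weak neighbourhood. Finiteness
  amounts to connecting every marked graph to the rose by collapses and expansions; these are found by
  labelling the edges with words of the free group and shortening the labels by folds.
\<close>

section \<open>Reduction of edge paths\<close>

definition cons_red :: "sgraph => nat => nat list => nat list" where
 "cons_red G e q = (case q of [] => [e] | f#q' => (if f = gbar G e then q' else e#f#q'))"

lemma red_Cons: "red G (e#p) = cons_red G e (red G p)"
 by (simp add: cons_red_def)

declare red.simps(2)[simp del]

lemma reduced_iff: "reduced G p \<longleftrightarrow> successively (%e f. f ~= gbar G e) p"
 by (auto simp: reduced_def successively_conv_nth)

lemma reduced_Nil [simp]: "reduced G []" by (simp add: reduced_def)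
lemma reduced_single [simp]: "reduced G [e]" by (simp add: reduced_def)

lemma reduced_Cons: "reduced G (e#p) \<longleftrightarrow> (p = [] | hd p ~= gbar G e) & reduced G p"
 by (auto simp: reduced_iff successively_Cons)

lemma reduced_append:
 "reduced G (p@q) \<longleftrightarrow> reduced G p & reduced G q & (p = [] | q = [] | hd q ~= gbar G (last p))"
 by (auto simp: reduced_iff successively_append_iff)

lemma cons_red_reduced: "reduced G q ==> reduced G (cons_red G e q)"
 by (cases q) (auto simp: cons_red_def reduced_Cons)

lemma red_reduced [simp]: "reduced G (red G p)"
 by (induction p) (auto simp: red_Cons cons_red_reduced)

lemma red_id: "reduced G p ==> red G p = p"
 by (induction p) (auto simp: red_Cons reduced_Cons cons_red_def split: list.splits)

lemma red_red [simp]: "red G (red G p) = red G p"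
 by (simp add: red_id)

lemma set_red: "set (red G p) <= set p"
proof (induction p)
 case (Cons e p)
 then show ?case by (cases "red G p") (auto simp: red_Cons cons_red_def)
qed simp

lemma length_red: "length (red G p) <= length p"
proof (induction p)
 case (Cons e p)
 then show ?case by (cases "red G p") (auto simp: red_Cons cons_red_def)
qed simp

lemma serreD:
 assumes "serre_graph G" "e:gE G"
 shows "gorg G e:gV G" "gbar G e:gE G" "gbar G e ~= e" "gbar G (gbar G e) = e"
  "tm G e:gV G" "tm G (gbar G e) = gorg G e"
  "gorg G (gbar G e) = tm G e"
proof -
 have e: "gorg G e:gV G" "gbar G e:gE G" "gbar G e ~= e" "gbar G (gbar G e) = e"
  using assms unfolding serre_graph_def by blast+
 have "gorg G (gbar G e):gV G" using assms(1) e(2) unfolding serre_graph_def by blast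
 then show "gorg G e:gV G" "gbar G e:gE G" "gbar G e ~= e" "gbar G (gbar G e) = e"
  "tm G e:gV G" "tm G (gbar G e) = gorg G e" "gorg G (gbar G e) = tm G e"
  using e by (simp_all add: tm_def)
qed

lemma serre_Ep: "serre_graph G ==> e:gE G ==> gbar G e:gEp G \<longleftrightarrow> e ~: gEp G"
 unfolding serre_graph_def by blast

lemma serre_fin:
 assumes "serre_graph G"
 shows "finite (gV G)" "finite (gE G)" "gEp G <= gE G" "gV G ~= {}" "finite (gEp G)"
 using assms unfolding serre_graph_def by (blast intro: finite_subset)+

lemma gbar_eq_iff:
 assumes "serre_graph G" "e:gE G" "f:gE G"
 shows "gbar G e = gbar G f \<longleftrightarrow> e = f" "gbar G e = f \<longleftrightarrow> e = gbar G f"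
 using serreD(4)[OF assms(1,2)] serreD(4)[OF assms(1,3)] by metis+

lemma cons_red_cancel:
 assumes "serre_graph G" "e:gE G" "reduced G q"
 shows "cons_red G e (cons_red G (gbar G e) q) = q"
proof (cases q)
 case Nil
 then show ?thesis by (simp add: cons_red_def)
next
 case (Cons f q')
 show ?thesis
 proof (cases "f = e")
  case True
  then show ?thesis using assms Cons
   by (cases q') (auto simp: cons_red_def serreD reduced_Cons)
 next
  case False
  then show ?thesis using assms Cons by (auto simp: cons_red_def serreD)
 qed
qed

lemma red_append_right: "red G (p@red G q) = red G (p@q)"
 by (induction p) (auto simp: red_Cons)

lemma red_append_left:
 assumes "serre_graph G" "set p <= gE G"
 shows "red G (red G p@q) = red G (p@q)"
 using assms(2)
proof (induction p)
 case (Cons e p)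
 have red_p: "red G (red G p@q) = red G (p@q)" using Cons by auto
 show ?case
 proof (cases "red G p")
  case Nil
  then show ?thesis using red_p by (simp add: red_Cons cons_red_def)
 next
  case (Cons f s)
  show ?thesis
  proof (cases "f = gbar G e")
   case True
   have "red G (e#p@q) = cons_red G e (red G (red G p@q))" by (simp add: red_Cons red_p)
   also have "... = red G (s@q)"
    using True Cons cons_red_cancel[OF assms(1), of e "red G (s@q)"] \<open>set (e # p) <= gE G\<close>
    by (simp add: red_Cons)
   finally show ?thesis using True Cons by (simp add: red_Cons cons_red_def)
  next
   case False
   then show ?thesis using Cons red_p by (auto simp: red_Cons cons_red_def)
  qed
 qed
qed simp

lemma red_append_cong:
 assumes "serre_graph G" "set p <= gE G" "set p' <= gE G" "red G p = red G p'" "red G q = red G q'"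
 shows "red G (p@q) = red G (p'@q')"
 by (metis assms red_append_left red_append_right)

lemma rev_path_simps [simp]:
 "rev_path G [] = []" "rev_path G (e#p) = rev_path G p@[gbar G e]"
 "rev_path G (p@q) = rev_path G q@rev_path G p"
 "length (rev_path G p) = length p" "rev_path G p = [] \<longleftrightarrow> p = []"
 by (auto simp: rev_path_def)

lemma set_rev_path: "serre_graph G ==> set p <= gE G ==> set (rev_path G p) <= gE G"
 by (auto simp: rev_path_def serreD)

lemma rev_path_rev_path: "serre_graph G ==> set p <= gE G ==> rev_path G (rev_path G p) = p"
 by (induction p) (auto simp: serreD)

lemma red_rev_path_left:
 assumes "serre_graph G" "set p <= gE G"
 shows "red G (rev_path G p@p@q) = red G q"
 using assms(2)
proof (induction p arbitrary: q)
 case (Cons e p)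
 have "red G (gbar G e#e#p@q) = red G (p@q)"
  using Cons cons_red_cancel[OF assms(1), of "gbar G e" "red G (p@q)"] assms(1)
  by (simp add: red_Cons serreD)
 then have "red G (rev_path G p@gbar G e#e#p@q) = red G (rev_path G p@p@q)"
  by (metis red_append_right)
 then show ?case using Cons by simp
qed simp

lemma red_rev_path_right:
 assumes "serre_graph G" "set p <= gE G"
 shows "red G (p@rev_path G p@q) = red G q"
 using red_rev_path_left[OF assms(1) set_rev_path[OF assms], of q] by (simp add: rev_path_rev_path assms)

lemma red_rev_path_Nil:
 assumes "serre_graph G" "set p <= gE G"
 shows "red G (p@rev_path G p) = []" "red G (rev_path G p@p) = []"
 using red_rev_path_left[OF assms, of "[]"] red_rev_path_right[OF assms, of "[]"] by auto

lemma reduced_rev_path: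
 assumes "serre_graph G" "set p <= gE G" "reduced G p"
 shows "reduced G (rev_path G p)"
 using assms(2,3)
proof (induction p)
 case (Cons e p)
 have "p ~= [] ==> last (rev_path G p) = gbar G (hd p)" by (cases p) auto
 then show ?case using Cons assms(1) by (auto simp: reduced_append reduced_Cons serreD hd_in_set subset_iff)
qed simp

lemma red_rev_path:
 assumes "serre_graph G" "set p <= gE G"
 shows "red G (rev_path G p) = rev_path G (red G p)"
proof -
 let ?r = "red G p"
 have red_E: "set ?r <= gE G" using set_red assms(2) by blast
 have "red G (rev_path G p) = red G (rev_path G p@p@rev_path G ?r)"
  using red_rev_path_Nil(1)[OF assms(1) red_E] red_append_left[OF assms, of "rev_path G ?r"]
  by (metis append_Nil2 red_append_right red.simps(1))
 also have "... = red G (rev_path G ?r)" using red_rev_path_left[OF assms] by simp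
 also have "... = rev_path G ?r" using reduced_rev_path[OF assms(1) red_E] by (simp add: red_id)
 finally show ?thesis .
qed

lemma red_eq_iff:
 assumes "serre_graph G" "set p <= gE G" "set q <= gE G"
 shows "red G p = red G q \<longleftrightarrow> red G (p@rev_path G q) = []"
proof
 assume "red G p = red G q"
 then show "red G (p@rev_path G q) = []"
  using red_append_cong[OF assms, of "rev_path G q"] red_rev_path_Nil assms by metis
next
 assume pq: "red G (p@rev_path G q) = []"
 have "red G p = red G (p@rev_path G q@q)"
  using red_rev_path_left[OF assms(1,3), of "[]"] by (metis append_Nil2 red_append_right red.simps(1))
 also have "... = red G (red G (p@rev_path G q)@q)"
  using red_append_left[OF assms(1), of "p@rev_path G q" q] set_rev_path[OF assms(1,3)] assms by auto
 finally show "red G p = red G q" using pq by simp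
qed

lemma walk_append:
 "walk G F (p@q) a c \<longleftrightarrow> (EX b. walk G F p a b & walk G F q b c)" if "serre_graph G" "F <= gE G"
proof (induction p arbitrary: a)
 case Nil
 have "walk G F q a c ==> a:gV G" for a using that
  by (cases q) (auto simp: serreD)
 then show ?case by auto
qed auto

lemma walk_ends:
 assumes "serre_graph G" "F <= gE G" "walk G F p a b"
 shows "a:gV G" "b:gV G" "set p <= F"
proof -
 show "b:gV G" "set p <= F" using assms(3) by (induction p arbitrary: a) auto
 show "a:gV G" using assms by (cases p) (auto simp: serreD)
qed

lemma walk_E: "serre_graph G ==> walk G (gE G) p a b ==> set p <= gE G"
 by (rule walk_ends(3)[OF _ order_refl])

lemma walk_mono: "F <= F' ==> walk G F p a b ==> walk G F' p a b"
 by (induction p arbitrary: a) auto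

lemma walk_restrict: "walk G F p a b ==> set p <= F' ==> walk G F' p a b"
 by (induction p arbitrary: a) auto

lemma walk_rev:
 assumes "serre_graph G" "F <= gE G" "!!e. e:F ==> gbar G e:F" "walk G F p a b"
 shows "walk G F (rev_path G p) b a"
 using assms(4)
proof (induction p arbitrary: a)
 case (Cons e p)
 then have "walk G F (rev_path G p) b (tm G e)" "e:F" "gorg G e = a" by auto
 moreover have "walk G F [gbar G e] (tm G e) a"
  using assms \<open>e : F\<close> \<open>gorg G e = a\<close> by (auto simp: serreD subset_iff)
 ultimately show ?case using walk_append[OF assms(1,2)] by auto
qed auto

lemma walk_rev_E:
 "serre_graph G ==> walk G (gE G) p a b ==> walk G (gE G) (rev_path G p) b a"
 by (rule walk_rev) (auto simp: serreD)

lemma walk_red: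
 assumes "serre_graph G" "F <= gE G" "walk G F p a b"
 shows "walk G F (red G p) a b"
 using assms(3)
proof (induction p arbitrary: a)
 case (Cons e p)
 then have red_p: "walk G F (red G p) (tm G e) b" and e: "e:F" "gorg G e = a" by auto
 show ?case
 proof (cases "red G p")
  case Nil
  then show ?thesis using red_p e by (auto simp: red_Cons cons_red_def)
 next
  case (Cons f q)
  then show ?thesis using red_p e assms(1,2) by (auto simp: red_Cons cons_red_def serreD subset_iff)
 qed
qed auto

subsection \<open>Substitutions of paths for edges\<close>

definition subst :: "(nat => nat list) => nat list => nat list" where
 "subst \<phi> p = concat (map \<phi> p)"

lemma subst_simps [simp]:
 "subst \<phi> [] = []" "subst \<phi> (e#p) = \<phi> e@subst \<phi> p" "subst \<phi> (p@q) = subst \<phi> p@subst \<phi> q"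
 by (auto simp: subst_def)

definition hom_map :: "sgraph => sgraph => (nat => nat list) => bool" where
 "hom_map G H \<phi> \<longleftrightarrow> (ALL e:gE G. set (\<phi> e) <= gE H & red H (\<phi> (gbar G e)) = red H (rev_path H (\<phi> e)))"

lemma set_subst: "hom_map G H \<phi> ==> set p <= gE G ==> set (subst \<phi> p) <= gE H"
 by (induction p) (auto simp: hom_map_def)

lemma red_subst_cancel:
 assumes "serre_graph G" "serre_graph H" "hom_map G H \<phi>" "e:gE G"
 shows "red H (\<phi> e@\<phi> (gbar G e)@q) = red H q"
proof -
 have s: "set (\<phi> e) <= gE H" "set (\<phi> (gbar G e)) <= gE H"
  using assms by (auto simp: hom_map_def serreD)
 have "red H (\<phi> (gbar G e)@q) = red H (rev_path H (\<phi> e)@q)"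
  using assms s by (intro red_append_cong) (auto simp: hom_map_def set_rev_path)
 then show ?thesis using red_rev_path_right[OF assms(2) s(1), of q] by (metis red_append_right)
qed

lemma red_subst_red:
 assumes "serre_graph G" "serre_graph H" "hom_map G H \<phi>" "set p <= gE G"
 shows "red H (subst \<phi> (red G p)) = red H (subst \<phi> p)"
 using assms(4)
proof (induction p)
 case (Cons e p)
 then have red_p: "red H (subst \<phi> (red G p)) = red H (subst \<phi> p)" by auto
 then have red_ep: "red H (\<phi> e@subst \<phi> (red G p)) = red H (\<phi> e@subst \<phi> p)"
  by (metis red_append_right)
 show ?case
 proof (cases "red G p")
  case Nil
  then show ?thesis using red_ep by (simp add: red_Cons cons_red_def)
 next
  case (Cons f s)
  have "e:gE G" using \<open>set (e # p) <= gE G\<close> by auto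
  then show ?thesis
   using Cons red_ep red_subst_cancel[OF assms(1-3), of e "subst \<phi> s"]
   by (auto simp: red_Cons cons_red_def)
 qed
qed simp

lemma red_subst_cong:
 assumes "serre_graph G" "serre_graph H" "hom_map G H \<phi>" "set p <= gE G" "set q <= gE G"
  "red G p = red G q"
 shows "red H (subst \<phi> p) = red H (subst \<phi> q)"
 by (metis assms red_subst_red)

lemma red_subst_rev_path:
 assumes "serre_graph G" "serre_graph H" "hom_map G H \<phi>" "set p <= gE G"
 shows "red H (subst \<phi> (rev_path G p)) = red H (rev_path H (subst \<phi> p))"
 using assms(4)
proof (induction p)
 case (Cons e p)
 have s: "set (subst \<phi> (rev_path G p)) <= gE H" "set (rev_path H (subst \<phi> p)) <= gE H"
  using Cons.prems set_subst[OF assms(3)] set_rev_path[OF assms(1)] set_rev_path[OF assms(2)] by auto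
 have "red H (\<phi> (gbar G e)) = red H (rev_path H (\<phi> e))"
  using assms(3) Cons.prems by (auto simp: hom_map_def)
 then show ?case using Cons red_append_cong[OF assms(2) s] by simp
qed simp

lemma red_subst_eq_iff:
 assumes "serre_graph G" "serre_graph H" "hom_map G H \<phi>" "set p <= gE G" "set q <= gE G"
 shows "red H (subst \<phi> p) = red H (subst \<phi> q) \<longleftrightarrow> red H (subst \<phi> (p@rev_path G q)) = []"
proof -
 have "red H (subst \<phi> (p@rev_path G q)) = red H (subst \<phi> p@rev_path H (subst \<phi> q))"
  using red_subst_rev_path[OF assms(1-3,5)] by (metis red_append_right subst_simps(3))
 then show ?thesis using red_eq_iff[OF assms(2)] set_subst[OF assms(3)] assms(4,5) by simp
qed

lemma red_subst_letterwise:
 assumes "serre_graph H" "!!e. e:set p ==> set (\<phi> e) <= gE H & set (\<psi> e) <= gE H & red H (\<phi> e) = red H (\<psi> e)"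
 shows "red H (subst \<phi> p) = red H (subst \<psi> p)"
 using assms(2)
proof (induction p)
 case (Cons e p)
 then show ?case using red_append_cong[OF assms(1), of "\<phi> e" "\<psi> e"] by simp
qed simp

section \<open>First-return loops in a strongly connected digraph\<close>

lemma successively_join: "successively R (p@[y]) ==> successively R (y#w) ==> successively R (p@y#w)"
 by (simp add: successively_append_iff)

lemma successively_split: "successively R (p@y#w) ==> successively R (p@[y]) & successively R (y#w)"
 by (cases w) (auto simp: successively_append_iff)

locale strong_digraph =
 fixes E :: "nat set" and R :: "nat => nat => bool" and e0 :: nat
 assumes finE: "finite E" and e0E: "e0:E" and RE: "R e f ==> e:E & f:E"
  and strong: "e:E ==> f:E ==> EX p. p ~= [] & successively R (e#p) & last p = f"
begin

definition hit :: "nat => nat list set" where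
 "hit e = {p. p ~= [] & successively R (e#p) & last p = e0 & e0 ~: set (butlast p)}"

definition wt :: "(nat => real) => nat list => real" where
 "wt L p = exp (- sum_list (map L p))"

definition hitsum :: "(nat => real) => nat => nat => real" where
 "hitsum L n e = (\<Sum>p\<in>{p:hit e. length p = n}. wt L p)"

lemma wt_pos: "wt L p > 0" by (simp add: wt_def)

lemma wt_nonneg [simp]: "0 <= wt L p" by (simp add: wt_def)

lemma wt_append: "wt L (p@q) = wt L p * wt L q"
 by (simp add: wt_def exp_add[symmetric])

lemma path_set: "successively R (e#p) ==> set p <= E"
 by (induction p arbitrary: e) (auto simp: RE)

lemma hit_set: "p:hit e ==> set p <= E"
 by (auto simp: hit_def dest: path_set)

lemma card_E_pos: "0 < card E" using finE e0E card_gt_0_iff by blast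

lemma finite_slice: "finite {p:hit e. length p = n}"
 by (rule finite_subset[OF _ finite_lists_length_eq[OF finE, of n]]) (use hit_set in auto)

lemma hit_Cons: "f#p:hit e \<longleftrightarrow> R e f & (if p = [] then f = e0 else f ~= e0 & p:hit f)"
 by (auto simp: hit_def)

lemma hitsum_nonneg: "hitsum L n e >= 0"
 unfolding hitsum_def by (intro sum_nonneg) simp

lemma hitsum_0: "hitsum L 0 e = 0"
proof -
 have "{p:hit e. length p = 0} = {}" by (auto simp: hit_def)
 then show ?thesis unfolding hitsum_def by (simp only: sum.empty)
qed

lemma wt_le_hitsum: "p:hit e ==> wt L p <= hitsum L (length p) e"
 unfolding hitsum_def by (rule member_le_sum) (auto simp: finite_slice)

lemma hitsum_Suc:
 assumes "n > 0"
 shows "hitsum L (Suc n) e = (\<Sum>f\<in>{f. R e f & f ~= e0}. exp (- L f) * hitsum L n f)"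
proof -
 let ?N = "{f. R e f & f ~= e0}"
 let ?S = "SIGMA f:?N. {p:hit f. length p = n}"
 have fin: "finite ?N" by (rule finite_subset[OF _ finE]) (auto simp: RE)
 have slice: "{p:hit e. length p = Suc n} = (%(f,p). f#p) ` ?S"
 proof (intro set_eqI iffI)
  fix p assume "p:{p:hit e. length p = Suc n}"
  then obtain f q where "p = f#q" "length q = n" "f#q:hit e" by (cases p) auto
  moreover have "q ~= []" using assms \<open>length q = n\<close> by auto
  ultimately show "p:(%(f,p). f#p) ` ?S" by (auto simp: hit_Cons intro!: image_eqI[of _ _ "(f,q)"])
 qed (use assms in \<open>auto simp: hit_Cons\<close>)
 have "hitsum L (Suc n) e = (\<Sum>x\<in>?S. wt L (fst x#snd x))"
  unfolding hitsum_def slice by (subst sum.reindex) (auto simp: inj_on_def case_prod_beta)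
 also have "... = (\<Sum>f\<in>?N. \<Sum>p\<in>{p:hit f. length p = n}. wt L (f#p))"
  by (subst sum.Sigma) (auto simp: fin finite_slice case_prod_beta)
 also have "... = (\<Sum>f\<in>?N. exp (- L f) * hitsum L n f)"
  unfolding hitsum_def by (intro sum.cong) (auto simp: sum_distrib_left wt_def exp_diff exp_minus field_simps)
 finally show ?thesis .
qed

lemma hitsum_le_card_power:
 assumes "!!e. e:E ==> x <= L e"
 shows "hitsum L n e <= (real (card E) * exp (- x))^n"
proof -
 have "wt L p <= exp (- x)^n" if p: "p:hit e" "length p = n" for p
 proof -
  have "real (length p) * x <= sum_list (map L p)"
   using hit_set[OF p(1)] by (induction p) (auto simp: algebra_simps intro: add_mono assms)
  then show ?thesis using p(2) by (simp add: wt_def exp_of_nat_mult[symmetric])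
 qed
 then have "hitsum L n e <= real (card {p:hit e. length p = n}) * exp (- x)^n"
  unfolding hitsum_def by (intro sum_bounded_above[where K = "exp (- x)^n"]) simp
 also have "card {p:hit e. length p = n} <= card {p. set p <= E & length p = n}"
  by (rule card_mono[OF finite_lists_length_eq[OF finE]]) (use hit_set in auto)
 then have "real (card {p:hit e. length p = n}) * exp (- x)^n <= real (card E)^n * exp (- x)^n"
  by (intro mult_right_mono) (simp_all add: card_lists_length_eq[OF finE] flip: of_nat_power)
 finally show ?thesis by (simp add: power_mult_distrib)
qed

lemma short_path:
 assumes "e:E" "f:E"
 shows "EX p. p ~= [] & successively R (e#p) & last p = f & length p <= card E &
  f ~: set (butlast p) & e ~: set (butlast p)"
proof -
 define is_path where "is_path p \<longleftrightarrow> p ~= [] & successively R (e#p) & last p = f" for p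
 obtain p0 where "is_path p0" using strong[OF assms] is_path_def by auto
 then obtain p where p: "is_path p" and shortest: "!!q. is_path q ==> length p <= length q"
  using ex_has_least_nat[of is_path p0 length] by auto
 have "distinct p"
 proof (rule ccontr)
  assume "~ distinct p"
  then obtain x y z w where p_eq: "p = x@[y]@z@[y]@w" using not_distinct_decomp by blast
  have "successively R ((e#x)@y#z@y#w)" using p unfolding is_path_def p_eq by simp
  then have "successively R ((e#x)@[y])" "successively R ((y#z)@y#w)" using successively_split by fastforce+
  then have "successively R ((e#x)@y#w)" using successively_split successively_join by metis
  then have "is_path (x@y#w)" using p unfolding is_path_def p_eq by auto
  from shortest[OF this] show False unfolding p_eq by auto
 qed
 moreover have "e ~: set (butlast p)"
 proof
  assume "e:set (butlast p)"
  then obtain x w where "butlast p = x@e#w" by (meson split_list)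
  then have p_eq: "p = x@e#(w@[last p])" using p unfolding is_path_def
   by (metis append_butlast_last_id append.assoc append_Cons)
  have "successively R ((e#x)@(e#w@[last p]))" using p p_eq unfolding is_path_def by (metis append_Cons)
  then have "is_path (w@[last p])" using p successively_split unfolding is_path_def by fastforce
  from shortest[OF this] show False using arg_cong[OF p_eq, of length] by auto
 qed
 moreover have "length p <= card E" using \<open>distinct p\<close> p path_set[of e p] finE unfolding is_path_def
  by (metis card_mono distinct_card)
 moreover have "f ~: set (butlast p)" using \<open>distinct p\<close> p unfolding is_path_def
  by (metis append_butlast_last_id distinct_butlast not_distinct_conv_prefix)
 ultimately show ?thesis using p is_path_def by blast
qed

lemma short_path_from_base:
 assumes "e:E" "e ~= e0"
 obtains q where "q ~= []" "successively R (e0#q)" "last q = e" "length q <= card E" "e0 ~: set q"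
proof -
 obtain q where q: "q ~= []" "successively R (e0#q)" "last q = e" "length q <= card E" "e0 ~: set (butlast q)"
  using short_path[OF e0E assms(1)] by blast
 have "e0 ~: set q" using q assms(2) by (metis append_butlast_last_id set_ConsD rotate1.simps(2) set_rotate1)
 with q that show ?thesis by blast
qed

lemma short_hit:
 assumes "e:E"
 obtains p where "p:hit e" "length p <= card E"
 using short_path[OF assms e0E] unfolding hit_def by blast

lemma wt_ge:
 assumes "set p <= E" "!!e. e:E ==> L e <= m" "0 <= m" "length p <= N"
 shows "wt L p >= exp (- (real N * m))"
proof -
 have "sum_list (map L p) <= real (length p) * m"
  using assms(1) by (induction p) (auto simp: algebra_simps intro: add_mono assms(2))
 also have "... <= real N * m" using assms by (intro mult_right_mono) auto
 finally show ?thesis by (simp add: wt_def)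
qed

lemma wt_mult_hitsum_le:
 assumes q: "q ~= []" "successively R (e0#q)" "last q = e" "e0 ~: set q"
 shows "wt L q * hitsum L n e <= hitsum L (n+length q) e0"
proof -
 have "wt L q * hitsum L n e = (\<Sum>p\<in>{p:hit e. length p = n}. wt L (q@p))"
  by (simp add: hitsum_def sum_distrib_left wt_append)
 also have "... = (\<Sum>p\<in>(@) q ` {p:hit e. length p = n}. wt L p)"
  by (subst sum.reindex) (auto simp: inj_on_def)
 also have "... <= hitsum L (n+length q) e0"
  unfolding hitsum_def
 proof (rule sum_mono2[OF finite_slice])
  show "(@) q ` {p:hit e. length p = n} <= {p:hit e0. length p = n+length q}"
   using q by (auto simp: hit_def successively_append_iff butlast_append successively_Cons)
 qed simp
 finally show ?thesis .
qed

definition (in -) tail_rate :: "nat => real => real => real" where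
 "tail_rate N m g = 1-exp (- (2 * real N * m))/g"

text \<open>From every edge a return of at most \<open>N\<close> steps starts, so \<open>N\<close> further steps lose a fixed
 proportion of the mass of the returns that are still pending.\<close>

context
 fixes L :: "nat => real" and N :: nat and m g :: real
 assumes summ: "summable (%n. hitsum L n e0)" and g: "(\<Sum>n. hitsum L n e0) = g"
  and N: "card E <= N" and Lm: "!!e. e:E ==> L e <= m" and m: "0 <= m"
begin

lemma hitsum_total_pos: "0 < g"
proof -
 obtain p where p: "p:hit e0" using short_hit[OF e0E] by blast
 have "0 < hitsum L (length p) e0" using wt_le_hitsum[OF p] wt_pos less_le_trans by blast
 then show ?thesis unfolding g[symmetric] by (intro suminf_pos2[OF summ, of "length p"] hitsum_nonneg)
qed

lemma
 assumes "e:E"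
 shows summable_hitsum: "summable (%n. hitsum L n e)"
  and suminf_hitsum_le: "(\<Sum>n. hitsum L n e) <= g * exp (real N * m)"
proof -
 have "summable (%n. hitsum L n e) & (\<Sum>n. hitsum L n e) <= g * exp (real N * m)"
 proof (cases "e = e0")
  case True
  then show ?thesis using summ g hitsum_total_pos m mult_left_mono[of 1 "exp (real N * m)" g] by auto
 next
  case False
  obtain q where q: "q ~= []" "successively R (e0#q)" "last q = e" "length q <= card E" "e0 ~: set q"
   using short_path_from_base[OF assms False] .
  note prepend = wt_mult_hitsum_le[OF q(1,2,3,5), of L]
  note shifted = summable_ignore_initial_segment[OF summ, of "length q"]
  have "summable (%n. wt L q * hitsum L n e)"
   by (rule summable_comparison_test'[OF shifted, of 0]) (use prepend hitsum_nonneg in \<open>auto simp: abs_mult\<close>)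
  then have summable: "summable (%n. hitsum L n e)" using wt_pos[of L q] by (subst (asm) summable_cmult_iff) auto
  have "exp (- (real N * m))*(\<Sum>n. hitsum L n e) <= wt L q*(\<Sum>n. hitsum L n e)"
   using wt_ge[OF path_set[OF q(2)] Lm m] q(4) N by (intro mult_right_mono suminf_nonneg summable hitsum_nonneg) auto
  also have "... = (\<Sum>n. wt L q * hitsum L n e)" using summable by (simp add: suminf_mult)
  also have "... <= (\<Sum>n. hitsum L (n+length q) e0)"
   by (rule suminf_le[OF prepend]) (use summable shifted in \<open>auto intro: summable_mult\<close>)
  also have "... <= g" unfolding g[symmetric] suminf_split_initial_segment[OF summ, of "length q"]
   by (simp add: sum_nonneg hitsum_nonneg)
  finally show ?thesis using summable by (simp add: exp_minus field_simps)
 qed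
 then show "summable (%n. hitsum L n e)" "(\<Sum>n. hitsum L n e) <= g * exp (real N * m)" by auto
qed

private definition tail where "tail n e = (\<Sum>i. hitsum L (i+Suc n) e)"

private lemma summable_tail: "e:E ==> summable (%i. hitsum L (i+Suc n) e)"
 by (rule summable_ignore_initial_segment[OF summable_hitsum])

private lemma tail_nonneg: "e:E ==> tail n e >= 0"
 unfolding tail_def by (intro suminf_nonneg hitsum_nonneg summable_tail)

private lemma tail_eq: "e:E ==> tail n e = hitsum L (Suc n) e+tail (Suc n) e"
 using suminf_split_head[OF summable_tail, of e n] by (simp add: tail_def)

private lemma tail_0: "e:E ==> tail 0 e = (\<Sum>n. hitsum L n e)"
 using suminf_split_head[OF summable_hitsum] by (simp add: tail_def hitsum_0)

private lemma tail_Suc: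
 assumes "e:E"
 shows "tail (Suc n) e = (\<Sum>f\<in>{f. R e f & f ~= e0}. exp (- L f) * tail n f)"
proof -
 have "tail (Suc n) e = (\<Sum>i. \<Sum>f\<in>{f. R e f & f ~= e0}. exp (- L f) * hitsum L (i+Suc n) f)"
  unfolding tail_def by (simp add: hitsum_Suc)
 also have "... = (\<Sum>f\<in>{f. R e f & f ~= e0}. \<Sum>i. exp (- L f) * hitsum L (i+Suc n) f)"
  by (rule suminf_sum) (use summable_tail RE in \<open>auto intro!: summable_mult\<close>)
 also have "... = (\<Sum>f\<in>{f. R e f & f ~= e0}. exp (- L f) * tail n f)"
  unfolding tail_def by (intro sum.cong refl suminf_mult) (use summable_tail RE in auto)
 finally show ?thesis .
qed

private lemma tail_N_le:
 assumes "e:E"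
 shows "tail N e <= tail_rate N m g * tail 0 e"
proof -
 let ?H = "\<Sum>n. hitsum L n e"
 obtain p where p: "p:hit e" "length p <= card E" using short_hit[OF assms] .
 have "exp (- (real N * m)) <= wt L p" using wt_ge[OF hit_set[OF p(1)] Lm m] p N by auto
 also have "... <= hitsum L (length p) e" by (rule wt_le_hitsum[OF p(1)])
 also have "... <= (\<Sum>n<Suc N. hitsum L n e)"
  by (rule member_le_sum) (use p N hitsum_nonneg in auto)
 finally have "tail N e <= ?H-exp (- (real N * m))"
  using suminf_split_initial_segment[OF summable_hitsum[OF assms], of "Suc N"] by (simp add: tail_def)
 also have "exp (- (2 * real N * m))/g*?H <= exp (- (2 * real N * m))/g*(g * exp (real N * m))"
  using suminf_hitsum_le[OF assms] hitsum_total_pos by (intro mult_left_mono) auto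
 then have "?H-exp (- (real N * m)) <= tail_rate N m g*?H"
  using hitsum_total_pos by (simp add: tail_rate_def algebra_simps exp_add[symmetric])
 finally show ?thesis using tail_0[OF assms] by simp
qed

private lemma tail_add_N_le: "e:E ==> tail (n+N) e <= tail_rate N m g * tail n e"
proof (induction n arbitrary: e)
 case 0
 then show ?case using tail_N_le by simp
next
 case (Suc n)
 have "tail (Suc n+N) e = (\<Sum>f\<in>{f. R e f & f ~= e0}. exp (- L f) * tail (n+N) f)"
  using tail_Suc[OF Suc.prems, of "n+N"] by simp
 also have "... <= (\<Sum>f\<in>{f. R e f & f ~= e0}. exp (- L f)*(tail_rate N m g * tail n f))"
  using Suc.IH RE by (intro sum_mono mult_left_mono) auto
 also have "... = tail_rate N m g * tail (Suc n) e" using tail_Suc[OF Suc.prems, of n]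
  by (simp add: sum_distrib_left mult_ac)
 finally show ?case .
qed

lemma tail_rate_nonneg: "0 <= tail_rate N m g"
proof -
 have "0 <= tail N e0" by (rule tail_nonneg[OF e0E])
 also have "... <= tail_rate N m g * g" using tail_N_le[OF e0E] tail_0[OF e0E] g by simp
 finally show ?thesis using hitsum_total_pos by (simp add: zero_le_mult_iff)
qed

lemma tail_rate_less_1: "tail_rate N m g < 1" using hitsum_total_pos by (simp add: tail_rate_def)

lemma hitsum_le_power:
 assumes "n >= 1"
 shows "hitsum L n e0 <= g*(tail_rate N m g)^((n-1) div N)"
proof -
 let ?\<theta> = "tail_rate N m g" and ?k = "(n-1) div N"
 have multiple: "tail (k * N+j) e0 <= ?\<theta>^k * tail j e0" for k j
 proof (induction k)
  case (Suc k)
  have "tail (Suc k * N+j) e0 <= ?\<theta> * tail (k * N+j) e0"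
   using tail_add_N_le[OF e0E, of "k * N+j"] by (simp add: add_ac)
  also have "... <= ?\<theta>*(?\<theta>^k * tail j e0)" using Suc tail_rate_nonneg by (intro mult_left_mono) auto
  finally show ?case by simp
 qed simp
 have "tail (Suc j) e0 <= tail j e0" for j using tail_eq[OF e0E, of j] hitsum_nonneg[of L "Suc j" e0] by simp
 then have decreasing: "tail j e0 <= tail 0 e0" for j by (induction j) (auto intro: order_trans)
 have "hitsum L n e0 <= tail (n-1) e0" using tail_eq[OF e0E, of "n-1"] tail_nonneg[OF e0E] assms by simp
 also have "... = tail (?k * N+(n-1) mod N) e0" by simp
 also have "... <= ?\<theta>^?k * tail ((n-1) mod N) e0" by (rule multiple)
 also have "... <= ?\<theta>^?k * g" using decreasing[of "(n-1) mod N"] tail_0[OF e0E] g tail_rate_nonneg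
  by (intro mult_left_mono) auto
 finally show ?thesis by (simp add: mult.commute)
qed

end

end

lemma power_div_le_geometric:
 fixes \<theta> :: real
 assumes "0 < N" "0 <= \<theta>" "\<theta> < 1"
 obtains \<rho> C where "0 < \<rho>" "\<rho> < 1" "0 <= C" "!!n. n >= 1 ==> \<theta>^((n-1) div N) <= C*\<rho>^n"
proof
 define t where "t = max \<theta> (1/2)"
 have t: "0 < t" "t < 1" "\<theta> <= t" using assms by (auto simp: t_def)
 let ?\<rho> = "root N t"
 show \<rho>: "0 < ?\<rho>" "?\<rho> < 1" using t assms(1) by auto
 have pow: "?\<rho>^N = t" using t assms(1) by (simp add: real_root_pow_pos2)
 show "0 <= 1/?\<rho>^N" using \<rho> by simp
 fix n :: nat assume "n >= 1"
 then have n: "n <= N*((n-1) div N)+N"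
  using mult_div_mod_eq[of N "n-1"] mod_less_divisor[OF assms(1), of "n-1"] by linarith
 have "\<theta>^((n-1) div N) <= t^((n-1) div N)" using t assms by (intro power_mono) auto
 also have "... = ?\<rho>^(N*((n-1) div N)+N)/?\<rho>^N" using pow t(1) by (simp add: power_mult power_add)
 also have "... <= ?\<rho>^n/?\<rho>^N" using \<rho> n by (intro divide_right_mono power_decreasing) auto
 finally show "\<theta>^((n-1) div N) <= 1/?\<rho>^N*?\<rho>^n" by simp
qed

lemma summable_real_mult_geometric:
 fixes f :: "nat => real"
 assumes \<rho>: "0 < \<rho>" "\<rho> < 1" and f: "!!n. n >= 1 ==> \<bar>f n\<bar> <= C*\<rho>^n"
 shows "summable (%n. real n * f n)"
proof (rule summable_comparison_test'[of "%n. C*(real (Suc n)*\<rho>^n)" 1])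
 have "summable (%n. diffs (%n. 1::real) n*\<rho>^n)"
  by (rule termdiff_converges[of _ 1]) (use \<rho> in \<open>auto intro: summable_geometric\<close>)
 then show "summable (%n. C*(real (Suc n)*\<rho>^n))" by (intro summable_mult) (simp add: diffs_def)
 fix n :: nat assume "1 <= n"
 then have "real n*\<bar>f n\<bar> <= real (Suc n)*(C*\<rho>^n)" by (intro mult_mono f) auto
 then show "norm (real n * f n) <= C*(real (Suc n)*\<rho>^n)" by (simp add: abs_mult mult_ac)
qed

lemma summable_exp_mult_geometric:
 fixes f :: "nat => real"
 assumes \<rho>: "0 < \<rho>" "\<rho> < 1" and f: "!!n. n >= 1 ==> \<bar>f n\<bar> <= C*\<rho>^n"
 obtains \<eta> where "\<eta> > 0" "summable (%n. exp (\<eta> * real n) * f n)"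
proof
 let ?\<eta> = "- ln \<rho>/2"
 show "?\<eta> > 0" using \<rho> by simp
 have "exp ?\<eta> * exp (ln \<rho>) = exp (ln \<rho>/2)" unfolding exp_add[symmetric] by simp
 also have "... < 1" using \<rho> by simp
 finally have "exp ?\<eta>*\<rho> < 1" using \<rho> by simp
 then have "summable (%n. C*(exp ?\<eta>*\<rho>)^n)" using \<rho> by (intro summable_mult summable_geometric) auto
 then show "summable (%n. exp (?\<eta> * real n) * f n)"
 proof (rule summable_comparison_test'[of _ 1])
  fix n :: nat assume "1 <= n"
  then have "exp (?\<eta> * real n)*\<bar>f n\<bar> <= exp (?\<eta> * real n)*(C*\<rho>^n)" using f by (intro mult_left_mono) auto
  then show "norm (exp (?\<eta> * real n) * f n) <= C*(exp ?\<eta>*\<rho>)^n"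
   by (simp add: abs_mult power_mult_distrib exp_of_nat_mult[symmetric] mult_ac)
 qed
qed

lemma
 fixes f :: "'a => real" and size :: "'a => nat"
 assumes fin: "!!n. finite {p:P. size p = n}" and nonneg: "!!p. p:P ==> f p >= 0"
 shows summable_on_iff_slices: "f summable_on P \<longleftrightarrow> summable (%n. \<Sum>p\<in>{p:P. size p = n}. f p)"
  and infsum_eq_suminf_slices: "f summable_on P ==> infsum f P = (\<Sum>n. \<Sum>p\<in>{p:P. size p = n}. f p)"
proof -
 let ?B = "%n. {p:P. size p = n}" and ?f = "%z. f (snd z)"
 have bij: "bij_betw snd (Sigma UNIV ?B) P" by (rule bij_betwI[of _ _ _ "%p. (size p,p)"]) auto
 have slice: "((%p. ?f (n,p)) has_sum sum f (?B n)) (?B n)" for n using fin by (auto intro: has_sum_finiteI)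
 have sums: "(%n. sum f (?B n)) sums infsum f P" if "f summable_on P"
 proof (rule has_sum_imp_sums, rule has_sum_SigmaD[OF _ slice])
  show "(?f has_sum infsum f P) (Sigma UNIV ?B)"
   using has_sum_infsum[OF that] has_sum_reindex_bij_betw[OF bij, of f] by simp
 qed
 have "f summable_on P" if "summable (%n. sum f (?B n))"
 proof -
  have "(%n. sum f (?B n)) summable_on UNIV"
   using that nonneg by (subst summable_on_UNIV_nonneg_real_iff) (auto intro: sum_nonneg)
  then have "?f summable_on Sigma UNIV ?B" by (rule summable_on_SigmaI[OF slice]) (use nonneg in auto)
  then show ?thesis using summable_on_reindex_bij_betw[OF bij, of f] by simp
 qed
 with sums show "f summable_on P \<longleftrightarrow> summable (%n. sum f (?B n))" using sums_summable by blast
 show "infsum f P = (\<Sum>n. sum f (?B n))" if "f summable_on P" using sums[OF that] sums_unique by blast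
qed

context strong_digraph
begin

lemma hitsum_scaled: "c n * hitsum L n e = (\<Sum>p\<in>{p:hit e. length p = n}. c (length p) * wt L p)"
 unfolding hitsum_def sum_distrib_left by (intro sum.cong) auto

lemma summable_on_hit_iff:
 assumes "!!n. 0 <= (c n :: real)"
 shows "(%p. c (length p) * wt L p) summable_on hit e \<longleftrightarrow> summable (%n. c n * hitsum L n e)"
  "(%p. c (length p) * wt L p) summable_on hit e ==>
   infsum (%p. c (length p) * wt L p) (hit e) = (\<Sum>n. c n * hitsum L n e)"
 unfolding hitsum_scaled
 by (rule summable_on_iff_slices[OF finite_slice] infsum_eq_suminf_slices[OF finite_slice]; simp add: assms)+

lemmas summable_on_hit = summable_on_hit_iff[of "%_. 1", simplified]

lemma
 assumes long: "!!e. e:E ==> x <= L e" and small: "real (card E) * exp (- x) <= 1/2"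
 shows wt_summable_if_long: "wt L summable_on hit e0" and wt_infsum_le_1_if_long: "infsum (wt L) (hit e0) <= 1"
proof -
 have bound: "hitsum L n e0 <= (1/2)^n" for n
  using order_trans[OF hitsum_le_card_power[OF long] power_mono[OF small]] by simp
 have summable: "summable (%n. hitsum L n e0)"
  by (rule summable_comparison_test'[of "%n. (1/2)^n" 0]) (use bound hitsum_nonneg in \<open>auto intro: summable_geometric\<close>)
 have "(\<Sum>n. hitsum L n e0) = (\<Sum>n. hitsum L (n+1) e0)" using suminf_split_head[OF summable] hitsum_0 by simp
 also have "... <= (\<Sum>n. (1/2)^Suc n)"
  using summable_ignore_initial_segment[OF summable, of 1] bound[of "Suc _"] power_half_series
  by (intro suminf_le) (auto dest: sums_summable)
 finally have "(\<Sum>n. hitsum L n e0) <= 1" using sums_unique[OF power_half_series] by simp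
 then show "wt L summable_on hit e0" "infsum (wt L) (hit e0) <= 1" using summable_on_hit[of L e0] summable by auto
qed

lemma exp_slack:
 assumes "wt L summable_on hit e0"
 shows "EX \<eta>::real. \<eta> > 0 & (%p. exp (\<eta> * real (length p)) * wt L p) summable_on hit e0"
proof -
 have summable: "summable (%n. hitsum L n e0)" using assms summable_on_hit(1) by simp
 define m g where "m = Max (insert 0 (L ` E))" and "g = (\<Sum>n. hitsum L n e0)"
 have m: "!!e. e:E ==> L e <= m" "0 <= m" using finE by (auto simp: m_def)
 note ctx = summable g_def[symmetric] order_refl m
 obtain \<rho> C where r: "0 < \<rho>" "\<rho> < 1" "0 <= C"
  "!!n. n >= 1 ==> (tail_rate (card E) m g)^((n-1) div card E) <= C*\<rho>^n"
  using power_div_le_geometric[OF card_E_pos tail_rate_nonneg[OF ctx] tail_rate_less_1[OF ctx]] by blast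
 have "\<bar>hitsum L n e0\<bar> <= g * C*\<rho>^n" if "n >= 1" for n
  using order_trans[OF hitsum_le_power[OF ctx that] mult_left_mono[OF r(4)[OF that], of g]] hitsum_total_pos[OF ctx]
  by (simp add: hitsum_nonneg mult.assoc)
 then obtain \<eta> where "\<eta> > 0" "summable (%n. exp (\<eta> * real n) * hitsum L n e0)"
  using summable_exp_mult_geometric[OF r(1,2), of "%n. hitsum L n e0"] by blast
 then show ?thesis using summable_on_hit_iff(1)[of "%n. exp (\<eta> * real n)" L e0] by auto
qed

lemma
 assumes "N > 0" "m >= 0" and wt: "wt L summable_on hit e0" "infsum (wt L) (hit e0) = 1"
  and N: "card E <= N" and Lm: "!!e. e:E ==> L e <= m"
 shows summable_length_wt: "(%p. length p * wt L p) summable_on hit e0"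
  and infsum_length_wt_le: "infsum (%p. length p * wt L p) (hit e0) <= (\<Sum>n. real n*(tail_rate N m 1)^((n-1) div N))"
proof -
 let ?\<theta> = "tail_rate N m 1"
 have "summable (%n. hitsum L n e0)" "(\<Sum>n. hitsum L n e0) = 1" using wt summable_on_hit[of L e0] by auto
 note ctx = this N Lm assms(2)
 obtain \<rho> C where "0 < \<rho>" "\<rho> < 1" "0 <= C" "!!n. n >= 1 ==> ?\<theta>^((n-1) div N) <= C*\<rho>^n"
  using power_div_le_geometric[OF assms(1) tail_rate_nonneg[OF ctx] tail_rate_less_1[OF ctx]] by blast
 then have summable: "summable (%n. real n*?\<theta>^((n-1) div N))"
  using tail_rate_nonneg[OF ctx] by (intro summable_real_mult_geometric[of \<rho> _ C]) auto
 have hitsum_le: "real n * hitsum L n e0 <= real n*?\<theta>^((n-1) div N)" for n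
  using hitsum_le_power[OF ctx, of n] by (cases "n = 0") (auto intro!: mult_left_mono)
 have "summable (%n. real n * hitsum L n e0)"
  by (rule summable_comparison_test'[OF summable, of 0]) (use hitsum_le hitsum_nonneg in \<open>auto simp: abs_mult\<close>)
 then show "(%p. length p * wt L p) summable_on hit e0"
  "infsum (%p. length p * wt L p) (hit e0) <= (\<Sum>n. real n*?\<theta>^((n-1) div N))"
  using summable_on_hit_iff[of real L e0] suminf_le[OF hitsum_le _ summable] by auto
qed

definition returns :: "nat list set" where
 "returns = {p. p = [] | successively R (e0#p) & last p = e0}"

definition circuits :: "nat list set" where
 "circuits = {p. p ~= [] & successively R p & R (last p) (hd p)}"

lemma circuits_set: "p:circuits ==> set p <= E"
proof -
 assume "p:circuits"
 then have "successively R (last p#p)" by (cases p) (auto simp: circuits_def)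
 then show ?thesis by (rule path_set)
qed

lemma returns_set: "p:returns ==> set p <= E" by (auto simp: returns_def dest: path_set)

lemma hitE:
 assumes "p:hit e"
 obtains a where "p = a@[e0]" "e0 ~: set a"
proof -
 have "p = butlast p@[e0]" using assms append_butlast_last_id[of p] by (simp add: hit_def)
 moreover have "e0 ~: set (butlast p)" using assms by (simp add: hit_def)
 ultimately show ?thesis using that by blast
qed

lemma hit_prepend:
 assumes a: "successively R (e0#a)" "last (e0#a) = e" "e0 ~: set a" and q: "q:hit e"
 shows "a@q:hit e0"
proof (cases "a = []")
 case True
 then show ?thesis using a q by auto
next
 case False
 then have a_eq: "e0#a = (e0#butlast a)@[e]" using a(2) append_butlast_last_id[OF False] by simp
 have q': "q ~= []" "successively R (e#q)" "last q = e0" "e0 ~: set (butlast q)" using q by (auto simp: hit_def)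
 have "successively R ((e0#butlast a)@e#q)" using successively_join a(1) a_eq q'(2) by metis
 also have "(e0#butlast a)@e#q = e0#a@q" using a_eq by simp
 finally show ?thesis using q' a(3) by (auto simp: hit_def butlast_append)
qed

lemma hit_prefix_unique:
 assumes "p:hit e" "p':hit e'" "p@q = p'@q'"
 shows "p = p'"
proof -
 obtain a where a: "p = a@[e0]" "e0 ~: set a" using hitE[OF assms(1)] .
 obtain a' where a': "p' = a'@[e0]" "e0 ~: set a'" using hitE[OF assms(2)] .
 have "a@e0#q = a'@e0#q'" using assms(3) a a' by simp
 moreover have "takeWhile (%x. x ~= e0) (b@e0#w) = b" if "e0 ~: set b" for b w
  using that by (induction b) auto
 ultimately show ?thesis using a a' by metis
qed

lemma hit_append_returns:
 assumes "\<gamma>:hit e0" "p:returns"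
 shows "\<gamma>@p:returns-{[]}"
 using assms unfolding hit_def returns_def
 by (cases "p = []") (auto simp: successively_append_iff successively_Cons)

lemma returns_decomp:
 assumes "p:returns" "p ~= []"
 obtains \<gamma> q where "\<gamma>:hit e0" "q:returns" "p = \<gamma>@q"
proof -
 have p: "successively R (e0#p)" "last p = e0" using assms by (auto simp: returns_def)
 then have "e0:set p" using assms(2) last_in_set by metis
 then obtain a q where a: "p = a@e0#q" "e0 ~: set a" by (meson split_list_first)
 then have "successively R (e0#a@[e0])" "successively R (e0#q)" using p successively_split[of R "e0#a"] by auto
 moreover have "q ~= [] ==> last q = e0" using p a by auto
 ultimately have "a@[e0]:hit e0" "q:returns" using a by (auto simp: hit_def returns_def)
 then show ?thesis using a that by simp
qed

lemma returns_circuits: "returns-{[]} <= circuits"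
 by (auto simp: returns_def circuits_def successively_Cons)

lemma circuit_through_base:
 assumes a: "a ~= []" "successively R (e0#a)" "last a = e" and b: "b ~= []" "successively R (e#b)" "last b = e0"
  and p: "p:circuits" "hd p = e"
 shows "a@tl p@[e]@b:returns"
proof -
 obtain q where q: "p = e#q" using p by (cases p) (auto simp: circuits_def)
 have "successively R (e#q)" "R (last (e#q)) e" using p q by (auto simp: circuits_def)
 then have "successively R ((e#q)@[e])" by (auto simp: successively_append_iff successively_Cons split: if_splits)
 then have loop: "successively R (e#q@e#b)" using successively_join[of R "e#q" e b] b(2) by simp
 have a_eq: "e0#a = (e0#butlast a)@[e]" using a append_butlast_last_id[OF a(1)] by simp
 then have "successively R ((e0#butlast a)@e#q@e#b)" using successively_join loop a(2) by metis
 also have "(e0#butlast a)@e#q@e#b = e0#a@q@e#b" using a_eq by simp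
 finally show ?thesis using b q by (simp add: returns_def)
qed

context
 fixes l :: "nat => real" and s :: real
 assumes lpos: "!!e. e:E ==> l e > 0" and spos: "s > 0"
  and unit_sum: "wt (%e. s * l e) summable_on hit e0" "infsum (wt (%e. s * l e)) (hit e0) = 1"
begin

private abbreviation lg :: "nat list => real" where "lg p \<equiv> sum_list (map l p)"
private abbreviation \<mu> :: real where "\<mu> \<equiv> l e0"
private definition nret :: "real => nat" where "nret t = card {p:returns. lg p <= t}"
private definition ncirc :: "real => nat" where "ncirc t = card {p:circuits. lg p <= t}"

private lemma mu_pos: "\<mu> > 0" using lpos e0E by auto

private lemma wt_scaled: "wt (%e. s * l e) p = exp (- s * lg p)"
 by (simp add: wt_def sum_list_const_mult)

private lemma lg_nonneg: "set p <= E ==> lg p >= 0"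
 by (induction p) (auto simp: lpos less_imp_le add_nonneg_nonneg)

private lemma finite_short: "finite {p. set p <= E & lg p <= t}"
proof -
 define k where "k = Min (l ` E)"
 have "l ` E ~= {}" using e0E by auto
 then have k: "k > 0" unfolding k_def using finE lpos by simp
 have k_le: "k <= l e" if "e:E" for e unfolding k_def using finE that by simp
 have length_le: "set p <= E ==> lg p >= real (length p) * k" for p
  by (induction p) (auto simp: algebra_simps intro: add_mono k_le)
 have "{p. set p <= E & lg p <= t} <= {p. set p <= E & length p <= nat \<lfloor>t/k\<rfloor>}"
 proof safe
  fix p assume p: "set p <= E" "lg p <= t"
  then have "real (length p) <= t/k" using length_le[OF p(1)] k by (simp add: field_simps)
  then show "length p <= nat \<lfloor>t/k\<rfloor>" by linarith
 qed
 then show ?thesis by (rule finite_subset) (rule finite_lists_length_le[OF finE])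
qed

private lemma finite_short_subset: "(!!p. p:X ==> set p <= E) ==> finite {p:X. lg p <= t}"
 by (rule finite_subset[OF _ finite_short[of t]]) auto

private lemmas finite_returns = finite_short_subset[where X = returns, OF returns_set]
private lemmas finite_circuits = finite_short_subset[where X = circuits, OF circuits_set]
private lemmas finite_hit = finite_short_subset[where X = "hit e0", OF hit_set]

private lemma hit_lg: "p:hit e0 ==> lg p >= \<mu>"
 using hit_set[of p e0] lg_nonneg[of "butlast p"] by (auto elim!: hitE)

private lemma nret_le: "real (nret t) <= 1+(\<Sum>\<gamma>\<in>{p:hit e0. lg p <= t}. real (nret (t-lg \<gamma>)))"
proof -
 let ?G = "{p:hit e0. lg p <= t}"
 let ?U = "\<Union>\<gamma>\<in>?G. (@) \<gamma> ` {p:returns. lg p <= t-lg \<gamma>}"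
 have "{p:returns. lg p <= t} <= insert [] ?U"
 proof
  fix p assume p: "p:{p:returns. lg p <= t}"
  show "p:insert [] ?U"
  proof (cases "p = []")
   case False
   then obtain \<gamma> q where q: "\<gamma>:hit e0" "q:returns" "p = \<gamma>@q" using returns_decomp p by blast
   then have "lg \<gamma> <= t" "lg q <= t-lg \<gamma>" using p lg_nonneg[OF returns_set[OF q(2)]] by auto
   then show ?thesis using q by auto
  qed auto
 qed
 then have "nret t <= card (insert [] ?U)"
  unfolding nret_def using finite_hit finite_returns by (intro card_mono) auto
 also have "... <= 1+card ?U" using finite_hit finite_returns by (simp add: card_insert_if)
 also have "card ?U <= (\<Sum>\<gamma>\<in>?G. card ((@) \<gamma> ` {p:returns. lg p <= t-lg \<gamma>}))" by (rule card_UN_le[OF finite_hit])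
 also have "... <= (\<Sum>\<gamma>\<in>?G. nret (t-lg \<gamma>))" unfolding nret_def by (intro sum_mono card_image_le finite_returns)
 finally show ?thesis by (simp flip: of_nat_sum)
qed

private lemma nret_ge:
 assumes "finite \<Gamma>" "\<Gamma> <= hit e0"
 shows "(\<Sum>\<gamma>\<in>\<Gamma>. real (nret (t-lg \<gamma>))) <= real (nret t)"
proof -
 let ?T = "%\<gamma>. (@) \<gamma> ` {p:returns. lg p <= t-lg \<gamma>}"
 have "(\<Sum>\<gamma>\<in>\<Gamma>. nret (t-lg \<gamma>)) = (\<Sum>\<gamma>\<in>\<Gamma>. card (?T \<gamma>))"
  unfolding nret_def by (intro sum.cong card_image[symmetric] refl) (auto simp: inj_on_def)
 also have "... = card (\<Union>\<gamma>\<in>\<Gamma>. ?T \<gamma>)"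
 proof (rule card_UN_disjoint[symmetric, OF assms(1)])
  have "i@p ~= j@q" if "i:\<Gamma>" "j:\<Gamma>" "i ~= j" for i j p q
   using hit_prefix_unique[of i e0 j e0 p q] assms(2) that by auto
  then show "ALL i:\<Gamma>. ALL j:\<Gamma>. i ~= j --> ?T i \<inter> ?T j = {}" unfolding disjoint_iff image_iff by metis
 qed (use finite_returns in auto)
 also have "... <= nret t" unfolding nret_def
  by (rule card_mono[OF finite_returns]) (use hit_append_returns assms(2) in auto)
 finally show ?thesis by (simp flip: of_nat_sum)
qed

private lemma nret_upper: "0 <= t ==> t < real k*\<mu> ==> real (nret t) <= (1+t/\<mu>) * exp (s * t)"
proof (induction k arbitrary: t)
 case 0
 then show ?case using mu_pos by auto
next
 case (Suc k)
 let ?G = "{p:hit e0. lg p <= t}"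
 have "(\<Sum>\<gamma>\<in>?G. real (nret (t-lg \<gamma>))) <= (\<Sum>\<gamma>\<in>?G. (t/\<mu> * exp (s * t)) * wt (%e. s * l e) \<gamma>)"
 proof (rule sum_mono)
  fix \<gamma> assume \<gamma>: "\<gamma>:?G"
  have long: "lg \<gamma> >= \<mu>" using hit_lg \<gamma> by auto
  have "real (nret (t-lg \<gamma>)) <= (1+(t-lg \<gamma>)/\<mu>) * exp (s*(t-lg \<gamma>))"
   using \<gamma> long Suc.prems by (intro Suc.IH) (auto simp: algebra_simps)
  also have "... <= (t/\<mu>) * exp (s*(t-lg \<gamma>))"
   using long mu_pos by (intro mult_right_mono) (auto simp: field_simps)
  also have "... = (t/\<mu> * exp (s * t)) * wt (%e. s * l e) \<gamma>"
   by (simp add: wt_scaled exp_add[symmetric] algebra_simps exp_diff exp_minus divide_inverse)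
  finally show "real (nret (t-lg \<gamma>)) <= (t/\<mu> * exp (s * t)) * wt (%e. s * l e) \<gamma>" .
 qed
 also have "... <= (t/\<mu> * exp (s * t))*1"
  unfolding unit_sum(2)[symmetric] sum_distrib_left[symmetric] using Suc.prems mu_pos
  by (intro mult_left_mono finite_sum_le_infsum[OF unit_sum(1)] finite_hit) auto
 finally have "real (nret t) <= 1+t/\<mu> * exp (s * t)" using nret_le[of t] by simp
 also have "1 <= exp (s * t)" using spos Suc.prems by simp
 finally show ?case by (simp add: algebra_simps)
qed

private lemma finite_subcritical:
 assumes "s' < s"
 obtains \<Gamma> where "finite \<Gamma>" "\<Gamma> <= hit e0" "1 <= (\<Sum>\<gamma>\<in>\<Gamma>. exp (- s' * lg \<gamma>))"
proof -
 let ?c = "exp ((s-s')*\<mu>)"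
 have "1/?c < infsum (wt (%e. s * l e)) (hit e0)" using unit_sum(2) assms mu_pos by simp
 then obtain \<Gamma> where \<Gamma>: "finite \<Gamma>" "\<Gamma> <= hit e0" "1/?c < (\<Sum>\<gamma>\<in>\<Gamma>. wt (%e. s * l e) \<gamma>)"
  using infsum_le_finite_sums[OF unit_sum(1), of "1/?c"] by (meson not_le)
 then have "1 <= (\<Sum>\<gamma>\<in>\<Gamma>. ?c * exp (- s * lg \<gamma>))"
  by (simp add: wt_scaled sum_distrib_left[symmetric] divide_less_eq mult.commute)
 also have "... <= (\<Sum>\<gamma>\<in>\<Gamma>. exp (- s' * lg \<gamma>))"
 proof (rule sum_mono)
  fix \<gamma> assume "\<gamma>:\<Gamma>"
  then have "(s-s')*\<mu> <= (s-s') * lg \<gamma>" using hit_lg \<Gamma>(2) assms by (intro mult_left_mono) auto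
  then show "?c * exp (- s * lg \<gamma>) <= exp (- s' * lg \<gamma>)"
   unfolding exp_add[symmetric] by (simp add: algebra_simps)
 qed
 finally show ?thesis using \<Gamma>(1,2) that by blast
qed

private lemma nret_lower:
 assumes "0 < s'" "s' < s"
 obtains K where "!!t. t >= 0 ==> real (nret t) >= exp (s'*(t-K))"
proof -
 obtain \<Gamma> where \<Gamma>: "finite \<Gamma>" "\<Gamma> <= hit e0" "1 <= (\<Sum>\<gamma>\<in>\<Gamma>. exp (- s' * lg \<gamma>))"
  using finite_subcritical[OF assms(2)] .
 define K where "K = Max (insert 0 (lg ` \<Gamma>))"
 have K: "lg \<gamma> <= K" if "\<gamma>:\<Gamma>" for \<gamma> using \<Gamma>(1) that by (auto simp: K_def)
 have "real (nret t) >= exp (s'*(t-K))" if "0 <= t" "t < real k*\<mu>" for k t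
  using that
 proof (induction k arbitrary: t)
  case (Suc k)
  show ?case
  proof (cases "t <= K")
   case True
   have "[]:{p:returns. lg p <= t}" using Suc.prems by (auto simp: returns_def)
   then have "nret t >= 1" unfolding nret_def using finite_returns[of t] by (metis One_nat_def Suc_leI card_gt_0_iff empty_iff)
   moreover have "exp (s'*(t-K)) <= 1" using True assms by (simp add: mult_le_0_iff)
   ultimately show ?thesis by linarith
  next
   case False
   have "exp (s'*(t-K)) <= exp (s'*(t-K))*(\<Sum>\<gamma>\<in>\<Gamma>. exp (- s' * lg \<gamma>))" using \<Gamma>(3) by simp
   also have "... <= (\<Sum>\<gamma>\<in>\<Gamma>. real (nret (t-lg \<gamma>)))" unfolding sum_distrib_left
   proof (rule sum_mono)
    fix \<gamma> assume \<gamma>: "\<gamma>:\<Gamma>"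
    then have "lg \<gamma> >= \<mu>" "lg \<gamma> <= K" using \<Gamma>(2) hit_lg K by auto
    then have "exp (s'*(t-lg \<gamma>-K)) <= real (nret (t-lg \<gamma>))"
     using Suc.prems False by (intro Suc.IH) (auto simp: algebra_simps)
    then show "exp (s'*(t-K)) * exp (- s' * lg \<gamma>) <= real (nret (t-lg \<gamma>))"
     unfolding exp_add[symmetric] by (simp add: algebra_simps)
   qed
   finally show ?thesis using nret_ge[OF \<Gamma>(1,2), of t] by linarith
  qed
 qed auto
 moreover have "EX k. t < real k*\<mu>" for t using mu_pos reals_Archimedean3 by blast
 ultimately show ?thesis using that by blast
qed

private lemma ncirc_lower:
 assumes "0 < s'" "s' < s"
 obtains K where "!!t. t >= K ==> real (ncirc t) >= exp (s'*(t-K))"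
proof -
 obtain K where K: "!!t. t >= 0 ==> real (nret t) >= exp (s'*(t-K))" using nret_lower[OF assms] by blast
 obtain \<gamma> where \<gamma>: "\<gamma>:hit e0" using short_hit[OF e0E] .
 have "real (ncirc t) >= exp (s'*(t-(\<bar>K\<bar>+lg \<gamma>)))" if "t >= \<bar>K\<bar>+lg \<gamma>" for t
 proof -
  have "(@) \<gamma> ` {p:returns. lg p <= t-lg \<gamma>} <= {p:circuits. lg p <= t}"
   using hit_append_returns[OF \<gamma>] returns_circuits by (auto simp del: Diff_iff)
  from card_mono[OF finite_circuits this] have "nret (t-lg \<gamma>) <= ncirc t"
   unfolding nret_def ncirc_def by (simp add: card_image inj_on_def)
  moreover have "exp (s'*(t-lg \<gamma>-K)) <= real (nret (t-lg \<gamma>))" using that by (intro K) auto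
  moreover have "exp (s'*(t-(\<bar>K\<bar>+lg \<gamma>))) <= exp (s'*(t-lg \<gamma>-K))"
   using assms by (auto intro!: mult_left_mono)
  ultimately show ?thesis by linarith
 qed
 then show ?thesis using that by blast
qed

private lemma ncirc_le_nret:
 obtains K where "K >= 0" "!!t. ncirc t <= card E * nret (t+K)"
proof -
 have "ALL e:E. EX a. a ~= [] & successively R (e0#a) & last a = e" using strong e0E by blast
 then obtain a where a: "!!e. e:E ==> a e ~= [] & successively R (e0#a e) & last (a e) = e" by metis
 have "ALL e:E. EX b. b ~= [] & successively R (e#b) & last b = e0" using strong e0E by blast
 then obtain b where b: "!!e. e:E ==> b e ~= [] & successively R (e#b e) & last (b e) = e0" by metis
 define f where "f p = a (hd p)@tl p@[hd p]@b (hd p)" for p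
 define K where "K = Max (insert 0 ((%e. lg (a e)+lg (b e)) ` E))"
 have K: "lg (a e)+lg (b e) <= K" if "e:E" for e unfolding K_def using that finE by auto
 have p_hd: "p ~= []" "hd p:E" if "p:circuits" for p
  using circuits_set[OF that] that hd_in_set[of p] by (auto simp: circuits_def)
 have "inj_on f {p:circuits. hd p = e & lg p <= t}" for e t
  by (rule inj_onI) (auto simp: f_def circuits_def, metis list.collapse)
 moreover have "f p:returns & lg (f p) <= lg p+K" if p: "p:circuits" for p
 proof
  note e = p_hd(2)[OF p]
  show "f p:returns" unfolding f_def using a[OF e] b[OF e] p by (intro circuit_through_base) auto
  show "lg (f p) <= lg p+K" using K[OF e] p_hd(1)[OF p] by (cases p) (auto simp: f_def)
 qed
 then have "f ` {p:circuits. hd p = e & lg p <= t} <= {p:returns. lg p <= t+K}" for e t by fastforce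
 ultimately have fiber: "card {p:circuits. hd p = e & lg p <= t} <= nret (t+K)" for e t
  unfolding nret_def by (rule card_inj_on_le[OF _ _ finite_returns])
 have "ncirc t <= card E * nret (t+K)" for t
 proof -
  have "{p:circuits. lg p <= t} = (\<Union>e\<in>E. {p:circuits. hd p = e & lg p <= t})" using p_hd(2) by auto
  then have "ncirc t <= (\<Sum>e\<in>E. card {p:circuits. hd p = e & lg p <= t})"
   unfolding ncirc_def by (simp only: card_UN_le[OF finE])
  also have "... <= (\<Sum>e\<in>E. nret (t+K))" by (rule sum_mono[OF fiber])
  finally show ?thesis by simp
 qed
 moreover have "K >= 0" unfolding K_def using finE by simp
 ultimately show ?thesis using that by blast
qed

private lemma ncirc_upper:
 obtains A B where "A > 0" "B > 0" "!!t. t >= 0 ==> real (ncirc t) <= (A+B * t) * exp (s * t)"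
proof -
 obtain K where K: "K >= 0" "!!t. ncirc t <= card E * nret (t+K)" using ncirc_le_nret by blast
 define D where "D = real (card E) * exp (s * K)"
 have D: "D > 0" using card_E_pos by (simp add: D_def)
 have "real (ncirc t) <= (D*(1+K/\<mu>)+D/\<mu> * t) * exp (s * t)" if "t >= 0" for t
 proof -
  obtain k where "t+K < real k*\<mu>" using mu_pos reals_Archimedean3 by blast
  then have "real (nret (t+K)) <= (1+(t+K)/\<mu>) * exp (s*(t+K))" using nret_upper that K(1) by auto
  then have "real (card E) * real (nret (t+K)) <= real (card E)*((1+(t+K)/\<mu>) * exp (s*(t+K)))"
   by (intro mult_left_mono) auto
  moreover have "real (ncirc t) <= real (card E) * real (nret (t+K))" using K(2)[of t] by (metis of_nat_le_iff of_nat_mult)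
  ultimately have "real (ncirc t) <= real (card E)*((1+(t+K)/\<mu>) * exp (s*(t+K)))" by linarith
  also have "... = (D*(1+K/\<mu>)+D/\<mu> * t) * exp (s * t)"
   by (simp add: D_def algebra_simps exp_add add_divide_distrib)
  finally show ?thesis .
 qed
 moreover have "D*(1+K/\<mu>) > 0" "D/\<mu> > 0" using D mu_pos K(1) by (auto intro!: mult_pos_pos add_pos_nonneg)
 ultimately show ?thesis using that by blast
qed

lemma circuit_growth:
 "((%t. ln (real (card {p:circuits. sum_list (map l p) <= t}))/t) \<longlongrightarrow> s) at_top"
 unfolding ncirc_def[symmetric]
proof (rule order_tendstoI)
 fix a assume "a < s"
 define s' where "s' = (max a 0+s)/2"
 have s': "0 < s'" "a < s'" "s' < s" using \<open>a < s\<close> spos by (auto simp: s'_def max_def)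
 obtain K where K: "!!t. t >= K ==> real (ncirc t) >= exp (s'*(t-K))" using ncirc_lower[OF s'(1,3)] by blast
 have "((%t. s'*(t-K)/t) \<longlongrightarrow> s') at_top" by real_asymp
 then have "eventually (%t. a < s'*(t-K)/t) at_top" using s'(2) by (rule order_tendstoD)
 then show "eventually (%t. a < ln (real (ncirc t))/t) at_top"
  using eventually_ge_at_top[of K] eventually_gt_at_top[of 0]
 proof eventually_elim
  case (elim t)
  have "s'*(t-K) <= ln (real (ncirc t))"
   using K[OF elim(2)] by (metis exp_gt_zero ln_exp ln_le_cancel_iff less_le_trans)
  then have "s'*(t-K)/t <= ln (real (ncirc t))/t" using elim by (intro divide_right_mono) auto
  then show ?case using elim by linarith
 qed
next
 fix a assume "s < a"
 obtain A B where AB: "A > 0" "B > 0" "!!t. t >= 0 ==> real (ncirc t) <= (A+B * t) * exp (s * t)" using ncirc_upper by blast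
 obtain K where K: "!!t. t >= K ==> real (ncirc t) >= exp (s/2*(t-K))" using ncirc_lower[of "s/2"] spos by auto
 have "((%t. ln (A+B * t)/t+s) \<longlongrightarrow> s) at_top" using AB(1,2) by real_asymp
 then have "eventually (%t. ln (A+B * t)/t+s < a) at_top" using \<open>s < a\<close> by (rule order_tendstoD)
 then show "eventually (%t. ln (real (ncirc t))/t < a) at_top"
  using eventually_ge_at_top[of K] eventually_gt_at_top[of 0]
 proof eventually_elim
  case (elim t)
  have pos: "real (ncirc t) > 0" using K[OF elim(2)] by (meson exp_gt_zero less_le_trans)
  have "ln (real (ncirc t)) <= ln ((A+B * t) * exp (s * t))" using AB elim pos by (intro ln_mono) auto
  also have "... = ln (A+B * t)+s * t" using add_pos_pos[OF AB(1) mult_pos_pos[OF AB(2) elim(3)]] by (simp add: ln_mult)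
  finally have "ln (real (ncirc t))/t <= (ln (A+B * t)+s * t)/t" using elim by (intro divide_right_mono) auto
  also have "... = ln (A+B * t)/t+s" using elim by (simp add: field_simps)
  finally show ?case using elim by linarith
 qed
qed

end

end

section \<open>Exponential sums over loops\<close>

lemma has_sum_sum_finite:
 fixes f :: "'i => 'a => real"
 assumes "finite A" "!!i. i:A ==> (f i has_sum s i) P"
 shows "((%p. \<Sum>i\<in>A. f i p) has_sum (\<Sum>i\<in>A. s i)) P"
 using assms by (induction A rule: finite_induct) (auto intro!: has_sum_add)

lemma power_le_exp:
 fixes \<epsilon> :: real
 assumes "\<epsilon> > 0"
 obtains C where "C >= 0" "!!x. x >= 0 ==> (1+x)^k <= C * exp (\<epsilon> * x)"
proof (cases "k = 0")
 case True
 then show ?thesis using assms that[of 1] by auto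
next
 case False
 define d where "d = max 1 (real k/\<epsilon>)"
 have d: "d >= 1" "d*(\<epsilon>/real k) >= 1" using assms False by (auto simp: d_def max_def field_simps)
 have "(1+x)^k <= d^k * exp (\<epsilon> * x)" if "x >= 0" for x
 proof -
  have "1+x <= d*(1+\<epsilon>/real k * x)"
   using d that mult_right_mono[OF d(2) that] by (simp add: algebra_simps)
  also have "... <= d * exp (\<epsilon>/real k * x)" using d exp_ge_add_one_self by (intro mult_left_mono) auto
  finally have "(1+x)^k <= (d * exp (\<epsilon>/real k * x))^k" using that by (intro power_mono) auto
  also have "... = d^k * exp (\<epsilon> * x)" using False
   by (simp add: power_mult_distrib exp_of_nat_mult[symmetric])
  finally show ?thesis .
 qed
 then show ?thesis using d that[of "d^k"] by simp
qed

lemma exp_remainder: "\<bar>exp (- x)-1+x\<bar> <= x\<^sup>2 * exp \<bar>x::real\<bar>"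
proof -
 obtain t where t: "\<bar>t\<bar> <= \<bar>-x\<bar>" "exp (-x) = (\<Sum>m<2. (-x)^m/fact m)+exp t/fact 2*(-x)^2"
  using Maclaurin_exp_le[of "-x" 2] by blast
 have "\<bar>exp (- x)-1+x\<bar> = \<bar>exp t/2 * x\<^sup>2\<bar>" using t(2) by (simp add: numeral_2_eq_2)
 moreover have "exp t/2 <= exp \<bar>x\<bar>" using t(1) exp_gt_zero[of t] exp_le_cancel_iff[of t "\<bar>x\<bar>"] by linarith
 ultimately show ?thesis using mult_right_mono[of "exp t/2" "exp \<bar>x\<bar>" "x\<^sup>2"] by (simp add: abs_mult mult.commute)
qed

lemma sum_mult_sgn_correction:
 fixes x N :: "'i => real"
 assumes "(\<Sum>i\<in>A. \<bar>x i\<bar>) = 0 ==> R = 0"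
 shows "(\<Sum>i\<in>A. x i*(N i-sgn (x i)*(R/(\<Sum>i\<in>A. \<bar>x i\<bar>)))) = (\<Sum>i\<in>A. x i * N i)-R"
proof -
 let ?S = "\<Sum>i\<in>A. \<bar>x i\<bar>"
 have "(\<Sum>i\<in>A. x i*(N i-sgn (x i)*(R/?S))) = (\<Sum>i\<in>A. x i * N i)-?S*(R/?S)"
  by (simp only: right_diff_distrib mult.assoc[symmetric] abs_sgn[symmetric] sum_subtractf sum_distrib_right)
 then show ?thesis using assms by (cases "?S = 0") auto
qed

lemma sgn_correction_tendsto_0:
 fixes c :: "'y => 'i => real"
 assumes c: "!!i. i:A ==> ((%y. c y i) \<longlongrightarrow> L i) net" and bound: "eventually (%y. \<bar>R y\<bar> <= K*(\<Sum>i\<in>A. \<bar>c y i-L i\<bar>)\<^sup>2) net"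
 shows "((%y. sgn (c y i-L i)*(R y/(\<Sum>i\<in>A. \<bar>c y i-L i\<bar>))) \<longlongrightarrow> 0) net"
proof -
 define S where "S y = (\<Sum>i\<in>A. \<bar>c y i-L i\<bar>)" for y
 have S_nonneg: "S y >= 0" for y by (auto simp: S_def intro: sum_nonneg)
 have "((%y. K * S y) \<longlongrightarrow> K*(\<Sum>i\<in>A. \<bar>L i-L i\<bar>)) net" unfolding S_def by (intro tendsto_intros c)
 then have "((%y. K * S y) \<longlongrightarrow> 0) net" by simp
 moreover have "eventually (%y. norm (sgn (c y i-L i)*(R y/S y)) <= K * S y) net" using bound
 proof eventually_elim
  case (elim y)
  then have "\<bar>R y/S y\<bar> <= K * S y" using S_nonneg[of y]
   by (cases "S y = 0") (auto simp: S_def[symmetric] power2_eq_square abs_divide divide_le_eq mult.assoc)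
  moreover have "\<bar>sgn (c y i-L i)*(R y/S y)\<bar> <= 1*\<bar>R y/S y\<bar>"
   unfolding abs_mult by (intro mult_right_mono) (auto simp: sgn_if)
  ultimately show ?case by simp
 qed
 ultimately show ?thesis unfolding S_def by (rule Lim_null_comparison[rotated])
qed

locale exp_sums =
 fixes I :: "nat set" and P :: "'a set" and n :: "'a => nat => real"
 assumes finI: "finite I" and n_nonneg: "!!p i. n p i >= 0"
begin

definition ev :: "(nat => real) => 'a => real" where "ev L p = (\<Sum>i\<in>I. n p i * L i)"
definition sz :: "'a => real" where "sz p = (\<Sum>i\<in>I. n p i)"
definition exp_summable :: "(nat => real) => bool" where
 "exp_summable L \<longleftrightarrow> (EX \<eta>>0. (%p. exp (\<eta> * sz p-ev L p)) summable_on P)"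
definition F :: "('a => real) => (nat => real) => real" where
 "F w L = infsum (%p. w p * exp (- ev L p)) P"
definition tempered :: "('a => real) => bool" where
 "tempered w \<longleftrightarrow> (EX C k. ALL p:P. \<bar>w p\<bar> <= C*(1+sz p)^k)"
definition critical :: "(nat => real) => bool" where "critical L \<longleftrightarrow> F (%_. 1) L = 1"

lemma sz_nonneg: "sz p >= 0" unfolding sz_def by (intro sum_nonneg) (simp add: n_nonneg)

lemma n_le_sz: "i:I ==> n p i <= sz p"
 unfolding sz_def by (rule member_le_sum) (auto simp: n_nonneg finI)

lemma ev_diff: "ev (%i. L i-M i) p = ev L p-ev M p"
 by (simp add: ev_def sum_subtractf algebra_simps)

lemma ev_scale: "ev (%i. k * L i) p = k * ev L p"
 by (simp add: ev_def sum_distrib_left mult_ac)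

lemma abs_ev_le: "(!!i. i:I ==> \<bar>L i\<bar> <= b) ==> \<bar>ev L p\<bar> <= b * sz p"
proof -
 assume b: "!!i. i:I ==> \<bar>L i\<bar> <= b"
 have "\<bar>ev L p\<bar> <= (\<Sum>i\<in>I. \<bar>n p i * L i\<bar>)" unfolding ev_def by (rule sum_abs)
 also have "... <= (\<Sum>i\<in>I. n p i * b)"
  by (intro sum_mono) (auto simp: abs_mult n_nonneg intro!: mult_left_mono b)
 finally show ?thesis by (simp add: sz_def sum_distrib_left mult.commute)
qed

lemma tempered_const [simp]: "tempered (%p. c)" unfolding tempered_def by (intro exI[of _ "\<bar>c\<bar>"] exI[of _ 0]) auto

lemma tempered_n: "i:I ==> tempered (%p. n p i)"
 unfolding tempered_def using n_le_sz[of i] n_nonneg by (intro exI[of _ 1]) (auto intro!: add_increasing)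

lemma tempered_sz: "tempered sz"
 unfolding tempered_def using sz_nonneg by (intro exI[of _ 1]) auto

lemma tempered_mult:
 assumes "tempered w" "tempered w'"
 shows "tempered (%p. w p * w' p)"
proof -
 obtain C k where w: "ALL p:P. \<bar>w p\<bar> <= C*(1+sz p)^k" using assms(1) tempered_def by auto
 obtain D j where w': "ALL p:P. \<bar>w' p\<bar> <= D*(1+sz p)^j" using assms(2) tempered_def by auto
 have "\<bar>w p * w' p\<bar> <= (C * D)*(1+sz p)^(k+j)" if "p:P" for p
 proof -
  have "\<bar>w p\<bar>*\<bar>w' p\<bar> <= (C*(1+sz p)^k)*(D*(1+sz p)^j)"
   using w w' that by (intro mult_mono) (auto intro: order_trans[OF abs_ge_zero])
  then show ?thesis by (simp add: abs_mult power_add mult_ac)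
 qed
 then show ?thesis unfolding tempered_def by blast
qed

lemma tempered_add:
 assumes "tempered w" "tempered w'"
 shows "tempered (%p. w p+w' p)"
proof -
 obtain C k where w: "ALL p:P. \<bar>w p\<bar> <= C*(1+sz p)^k" using assms(1) tempered_def by auto
 obtain D j where w': "ALL p:P. \<bar>w' p\<bar> <= D*(1+sz p)^j" using assms(2) tempered_def by auto
 have bounds: "C*(1+sz p)^k <= \<bar>C\<bar>*(1+sz p)^(max k j)" "D*(1+sz p)^j <= \<bar>D\<bar>*(1+sz p)^(max k j)" for p
  using sz_nonneg[of p] by (intro mult_mono power_increasing; simp)+
 have "\<bar>w p+w' p\<bar> <= (\<bar>C\<bar>+\<bar>D\<bar>)*(1+sz p)^(max k j)" if "p:P" for p
  using bspec[OF w that] bspec[OF w' that] bounds[of p] abs_triangle_ineq[of "w p" "w' p"]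
  by (simp only: distrib_right)
 then show ?thesis unfolding tempered_def by blast
qed

lemma tempered_sum: "finite A ==> (!!i. i:A ==> tempered (w i)) ==> tempered (%p. \<Sum>i\<in>A. w i p)"
 by (induction A rule: finite_induct) (auto intro: tempered_add)

lemma tempered_ev: "tempered (ev L)"
 unfolding ev_def[abs_def] by (intro tempered_sum finI tempered_mult tempered_n) auto

lemma exp_summable_slack:
 assumes "exp_summable L" "tempered w"
 obtains \<eta> where "\<eta> > 0" "(%p. \<bar>w p\<bar> * exp (\<eta> * sz p-ev L p)) summable_on P"
proof -
 obtain \<eta> where \<eta>: "\<eta> > 0" "(%p. exp (\<eta> * sz p-ev L p)) summable_on P" using assms(1) exp_summable_def by auto
 obtain C k where w: "ALL p:P. \<bar>w p\<bar> <= C*(1+sz p)^k" using assms(2) tempered_def by auto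
 obtain D where D: "D >= 0" "!!x. x >= 0 ==> (1+x)^k <= D * exp (\<eta>/2 * x)"
  using power_le_exp[of "\<eta>/2" k] \<eta>(1) by auto
 have "(%p. \<bar>w p\<bar> * exp (\<eta>/2 * sz p-ev L p)) summable_on P"
 proof (rule summable_on_comparison_test[OF summable_on_cmult_right[OF \<eta>(2), of "\<bar>C\<bar> * D"]])
  fix p assume p: "p:P"
  have "C*(1+sz p)^k <= \<bar>C\<bar>*(1+sz p)^k" using sz_nonneg[of p] by (intro mult_right_mono) auto
  with w p have "\<bar>w p\<bar> <= \<bar>C\<bar>*(1+sz p)^k" by (metis order_trans)
  also have "... <= \<bar>C\<bar>*(D * exp (\<eta>/2 * sz p))" using D(2)[OF sz_nonneg] by (intro mult_left_mono) auto
  finally have "\<bar>w p\<bar> * exp (\<eta>/2 * sz p-ev L p) <= (\<bar>C\<bar>*(D * exp (\<eta>/2 * sz p))) * exp (\<eta>/2 * sz p-ev L p)"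
   by (intro mult_right_mono) auto
  also have "... = \<bar>C\<bar> * D * exp (\<eta> * sz p-ev L p)" by (simp add: mult.assoc exp_add[symmetric])
  finally show "\<bar>w p\<bar> * exp (\<eta>/2 * sz p-ev L p) <= \<bar>C\<bar> * D * exp (\<eta> * sz p-ev L p)" .
 qed simp
 then show ?thesis using \<eta>(1) that[of "\<eta>/2"] by simp
qed

lemma F_abs_summable:
 assumes "exp_summable L" "tempered w"
 shows "(%p. \<bar>w p\<bar> * exp (- ev L p)) summable_on P"
proof -
 obtain \<eta> where \<eta>: "\<eta> > 0" "(%p. \<bar>w p\<bar> * exp (\<eta> * sz p-ev L p)) summable_on P" using exp_summable_slack[OF assms] .
 show ?thesis
  by (rule summable_on_comparison_test[OF \<eta>(2)]) (use \<eta>(1) sz_nonneg in \<open>auto intro!: mult_left_mono\<close>)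
qed

lemma F_summable:
 assumes "exp_summable L" "tempered w"
 shows "(%p. w p * exp (- ev L p)) summable_on P"
 using F_abs_summable[OF assms] by (rule_tac abs_summable_summable) (simp add: abs_mult)

lemma F_has_sum: "exp_summable L ==> tempered w ==> ((%p. w p * exp (- ev L p)) has_sum F w L) P"
 unfolding F_def by (intro has_sum_infsum F_summable)

lemma exp_summable_near:
 assumes "exp_summable L"
 obtains \<eta> where "\<eta> > 0" "!!M. (!!i. i:I ==> \<bar>M i-L i\<bar> <= \<eta>) ==> exp_summable M"
proof -
 obtain \<eta> where \<eta>: "\<eta> > 0" "(%p. exp (\<eta> * sz p-ev L p)) summable_on P" using assms(1) exp_summable_def by auto
 have "exp_summable M" if M: "!!i. i:I ==> \<bar>M i-L i\<bar> <= \<eta>/2" for M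
 proof -
  have "(%p. exp (\<eta>/2 * sz p-ev M p)) summable_on P"
  proof (rule summable_on_comparison_test[OF \<eta>(2)])
   fix p
   have "\<bar>ev M p-ev L p\<bar> <= \<eta>/2 * sz p" using abs_ev_le[of "%i. M i-L i" "\<eta>/2" p] M by (simp add: ev_diff)
   then show "exp (\<eta>/2 * sz p-ev M p) <= exp (\<eta> * sz p-ev L p)" unfolding exp_le_cancel_iff
    using abs_ge_self[of "ev L p-ev M p"] by (simp add: field_simps abs_minus_commute)
  qed auto
  then show ?thesis using \<eta>(1) unfolding exp_summable_def by (intro exI[of _ "\<eta>/2"]) auto
 qed
 then show ?thesis using \<eta>(1) that[of "\<eta>/2"] by simp
qed

lemma F_linear:
 assumes "exp_summable L" "tempered w"
 shows "F (%p. w p * ev v p) L = (\<Sum>i\<in>I. v i * F (%p. w p * n p i) L)"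
proof -
 have "((%p. \<Sum>i\<in>I. v i*(w p * n p i * exp (- ev L p))) has_sum (\<Sum>i\<in>I. v i * F (%p. w p * n p i) L)) P"
  by (intro has_sum_sum_finite finI has_sum_cmult_right F_has_sum assms tempered_mult tempered_n)
 moreover have "(\<Sum>i\<in>I. v i*(w p * n p i * exp (- ev L p))) = w p * ev v p * exp (- ev L p)" for p
  by (simp add: ev_def sum_distrib_left sum_distrib_right mult_ac)
 ultimately show ?thesis by (simp add: F_def infsumI)
qed

lemma F_ev: "exp_summable L ==> F (ev v) L = (\<Sum>i\<in>I. v i * F (%p. n p i) L)"
 using F_linear[of L "%_. 1" v] by simp

lemma exp_ev_remainder:
 assumes "!!i. i:I ==> \<bar>M i-L i\<bar> <= \<eta>"
 shows "\<bar>exp (- ev M p)-exp (- ev L p)+ev (%i. M i-L i) p * exp (- ev L p)\<bar>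
  <= (\<Sum>i\<in>I. \<bar>M i-L i\<bar>)\<^sup>2*((sz p)\<^sup>2 * exp (\<eta> * sz p-ev L p))"
proof -
 let ?d = "ev (%i. M i-L i) p" and ?S = "\<Sum>i\<in>I. \<bar>M i-L i\<bar>"
 have "exp (- ev M p) = exp (- ev L p) * exp (- ?d)" by (simp add: ev_diff exp_add[symmetric])
 then have "\<bar>exp (- ev M p)-exp (- ev L p)+?d * exp (- ev L p)\<bar> = \<bar>(exp (- ?d)-1+?d) * exp (- ev L p)\<bar>"
  by (simp add: algebra_simps)
 also have "... = \<bar>exp (- ?d)-1+?d\<bar> * exp (- ev L p)" by (simp only: abs_mult abs_exp_cancel)
 also have "\<bar>exp (- ?d)-1+?d\<bar> <= \<bar>?d\<bar>\<^sup>2 * exp \<bar>?d\<bar>" using exp_remainder[of ?d] by simp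
 also have "... <= (?S * sz p)\<^sup>2 * exp (\<eta> * sz p)"
 proof (intro mult_mono power_mono)
  show "\<bar>?d\<bar> <= ?S * sz p" by (rule abs_ev_le) (auto simp: finI intro: member_le_sum)
  show "exp \<bar>?d\<bar> <= exp (\<eta> * sz p)" using abs_ev_le[OF assms] by simp
 qed auto
 finally show ?thesis by (simp add: power_mult_distrib mult_ac exp_diff exp_minus divide_inverse)
qed

lemma F_remainder:
 assumes L: "exp_summable L" and w: "tempered w"
 obtains K \<eta> where "\<eta> > 0" "!!M. (!!i. i:I ==> \<bar>M i-L i\<bar> <= \<eta>) ==> exp_summable M &
  \<bar>F w M-F w L+(\<Sum>i\<in>I. (M i-L i) * F (%p. w p * n p i) L)\<bar> <= K*(\<Sum>i\<in>I. \<bar>M i-L i\<bar>)\<^sup>2"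
proof -
 have "tempered (%p. w p*(sz p)\<^sup>2)" unfolding power2_eq_square by (intro tempered_mult w tempered_sz)
 then obtain \<eta>1 where \<eta>1: "\<eta>1 > 0" "(%p. \<bar>w p*(sz p)\<^sup>2\<bar> * exp (\<eta>1 * sz p-ev L p)) summable_on P"
  using exp_summable_slack[OF L] by blast
 obtain \<eta>2 where \<eta>2: "\<eta>2 > 0" "!!M. (!!i. i:I ==> \<bar>M i-L i\<bar> <= \<eta>2) ==> exp_summable M"
  using exp_summable_near[OF L] by blast
 let ?g = "%p. \<bar>w p*(sz p)\<^sup>2\<bar> * exp (\<eta>1 * sz p-ev L p)"
 have bound: "exp_summable M & \<bar>F w M-F w L+(\<Sum>i\<in>I. (M i-L i) * F (%p. w p * n p i) L)\<bar> <= infsum ?g P*(\<Sum>i\<in>I. \<bar>M i-L i\<bar>)\<^sup>2"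
  if M: "!!i. i:I ==> \<bar>M i-L i\<bar> <= min \<eta>1 \<eta>2" for M
 proof
  let ?S = "\<Sum>i\<in>I. \<bar>M i-L i\<bar>" and ?u = "%i. M i-L i"
  show sM: "exp_summable M" using M by (intro \<eta>2(2)) auto
  let ?R = "%p. w p*(exp (- ev M p)-exp (- ev L p)+ev ?u p * exp (- ev L p))"
  have "((%p. w p * exp (- ev M p)+(- (w p * exp (- ev L p)))+w p * ev ?u p * exp (- ev L p)) has_sum
    F w M+(- F w L)+F (%p. w p * ev ?u p) L) P"
   by (intro has_sum_add has_sum_uminusI F_has_sum L sM w tempered_mult tempered_ev)
  then have "(?R has_sum F w M-F w L+F (%p. w p * ev ?u p) L) P" by (simp add: algebra_simps)
  moreover have "((%p. ?S\<^sup>2*?g p) has_sum ?S\<^sup>2 * infsum ?g P) P"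
   by (intro has_sum_cmult_right has_sum_infsum \<eta>1)
  moreover have "norm (?R p) <= ?S\<^sup>2*?g p" for p
   using mult_left_mono[OF exp_ev_remainder[of M L \<eta>1 p], of "\<bar>w p\<bar>"] M by (simp add: abs_mult mult_ac)
  ultimately have "norm (F w M-F w L+F (%p. w p * ev ?u p) L) <= ?S\<^sup>2 * infsum ?g P" by (rule norm_infsum_le)
  then show "\<bar>F w M-F w L+(\<Sum>i\<in>I. ?u i * F (%p. w p * n p i) L)\<bar> <= infsum ?g P*?S\<^sup>2"
   by (simp add: F_linear[OF L w] mult.commute)
 qed
 have "min \<eta>1 \<eta>2 > 0" using \<eta>1(1) \<eta>2(1) by simp
 then show ?thesis using bound by (rule that)
qed

text \<open>Caratheodory's form of differentiability: limits and derivatives of \<open>F\<close> along any family,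
 and of implicitly defined scaling factors, follow from it by passing to the limit in quotients.\<close>

lemma F_caratheodory:
 assumes c: "!!i. i:I ==> ((%y. c y i) \<longlongrightarrow> L i) net" and L: "exp_summable L" and w: "tempered w"
 obtains G where "!!i. i:I ==> ((%y. G y i) \<longlongrightarrow> F (%p. w p * n p i) L) net"
  "eventually (%y. exp_summable (c y) & F w (c y) = F w L-(\<Sum>i\<in>I. (c y i-L i) * G y i)) net"
proof -
 obtain K \<eta> where K: "\<eta> > 0" "!!M. (!!i. i:I ==> \<bar>M i-L i\<bar> <= \<eta>) ==> exp_summable M &
  \<bar>F w M-F w L+(\<Sum>i\<in>I. (M i-L i) * F (%p. w p * n p i) L)\<bar> <= K*(\<Sum>i\<in>I. \<bar>M i-L i\<bar>)\<^sup>2"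
  using F_remainder[OF L w] by blast
 define S where "S y = (\<Sum>i\<in>I. \<bar>c y i-L i\<bar>)" for y
 define R where "R y = F w (c y)-F w L+(\<Sum>i\<in>I. (c y i-L i) * F (%p. w p * n p i) L)" for y
 define G where "G y i = F (%p. w p * n p i) L-sgn (c y i-L i)*(R y/S y)" for y i
 have "eventually (%y. ALL i:I. \<bar>c y i-L i\<bar> <= \<eta>) net"
 proof (rule eventually_ball_finite[OF finI, rule_format])
  fix i assume "i:I"
  from tendstoD[OF c[OF this] K(1)] show "eventually (%y. \<bar>c y i-L i\<bar> <= \<eta>) net"
   by eventually_elim (simp add: dist_real_def)
 qed
 then have bound: "eventually (%y. exp_summable (c y) & \<bar>R y\<bar> <= K*(S y)\<^sup>2) net"
  by eventually_elim (use K(2) in \<open>simp add: R_def S_def\<close>)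
 have correction: "((%y. sgn (c y i-L i)*(R y/S y)) \<longlongrightarrow> 0) net" for i
  unfolding S_def by (rule sgn_correction_tendsto_0[OF c]) (use bound in \<open>auto simp: S_def elim: eventually_mono\<close>)
 have "((%y. G y i) \<longlongrightarrow> F (%p. w p * n p i) L) net" for i
  unfolding G_def using tendsto_diff[OF tendsto_const correction[of i]] by simp
 moreover have "eventually (%y. exp_summable (c y) & F w (c y) = F w L-(\<Sum>i\<in>I. (c y i-L i) * G y i)) net" using bound
 proof eventually_elim
  case (elim y)
  then have "(\<Sum>i\<in>I. (c y i-L i) * G y i) = (\<Sum>i\<in>I. (c y i-L i) * F (%p. w p * n p i) L)-R y"
   unfolding G_def S_def by (intro sum_mult_sgn_correction) auto
  then show ?case using elim by (simp add: R_def)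
 qed
 ultimately show ?thesis using that by blast
qed

lemma
 assumes c: "!!i. i:I ==> ((%y. c y i) \<longlongrightarrow> L i) net" and L: "exp_summable L" and w: "tempered w"
 shows F_tendsto: "((%y. F w (c y)) \<longlongrightarrow> F w L) net"
  and eventually_exp_summable: "eventually (%y. exp_summable (c y)) net"
proof -
 obtain G where G: "!!i. i:I ==> ((%y. G y i) \<longlongrightarrow> F (%p. w p * n p i) L) net"
  "eventually (%y. exp_summable (c y) & F w (c y) = F w L-(\<Sum>i\<in>I. (c y i-L i) * G y i)) net"
  using F_caratheodory[OF c L w] by blast
 have "((%y. F w L-(\<Sum>i\<in>I. (c y i-L i) * G y i)) \<longlongrightarrow> F w L-(\<Sum>i\<in>I. (L i-L i) * F (%p. w p * n p i) L)) net"
  by (intro tendsto_intros c G(1))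
 moreover have "eventually (%y. F w L-(\<Sum>i\<in>I. (c y i-L i) * G y i) = F w (c y)) net"
  using G(2) by eventually_elim simp
 ultimately show "((%y. F w (c y)) \<longlongrightarrow> F w L) net" by (simp add: tendsto_cong)
 show "eventually (%y. exp_summable (c y)) net" using G(2) by eventually_elim simp
qed

lemma F_DERIV:
 fixes c :: "real => nat => real"
 assumes c: "!!i. i:I ==> ((%y. c y i) has_real_derivative c' i) (at x)"
  and L: "exp_summable (c x)" and w: "tempered w"
 shows "((%y. F w (c y)) has_real_derivative-(\<Sum>i\<in>I. c' i * F (%p. w p * n p i) (c x))) (at x)"
proof -
 have lim: "((%y. c y i) \<longlongrightarrow> c x i) (at x)" if "i:I" for i using DERIV_isCont[OF c[OF that]] by (simp add: isCont_def)
 obtain G where G: "!!i. i:I ==> ((%y. G y i) \<longlongrightarrow> F (%p. w p * n p i) (c x)) (at x)"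
  "eventually (%y. exp_summable (c y) & F w (c y) = F w (c x)-(\<Sum>i\<in>I. (c y i-c x i) * G y i)) (at x)"
  using F_caratheodory[OF lim L w] by blast
 have "((%y. - (\<Sum>i\<in>I. (c y i-c x i)/(y-x) * G y i)) \<longlongrightarrow> - (\<Sum>i\<in>I. c' i * F (%p. w p * n p i) (c x))) (at x)"
  by (intro tendsto_intros G(1) c[unfolded has_field_derivative_iff])
 moreover have "eventually (%y. - (\<Sum>i\<in>I. (c y i-c x i)/(y-x) * G y i) = (F w (c y)-F w (c x))/(y-x)) (at x)"
  using G(2) by eventually_elim (simp add: sum_divide_distrib)
 ultimately show ?thesis unfolding has_field_derivative_iff by (simp add: tendsto_cong)
qed

lemma critical_summable: "critical L ==> (%p. exp (- ev L p)) summable_on P"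
 using infsum_not_exists[of "%p. exp (- ev L p)" P] by (auto simp: critical_def F_def)

lemma F_square:
 assumes "exp_summable L"
 shows "F (%p. (ev v p)\<^sup>2) L = (\<Sum>e\<in>I. \<Sum>f\<in>I. v e * v f * F (%p. n p f * n p e) L)"
proof -
 have "F (%p. (ev v p)\<^sup>2) L = F (%p. ev v p * ev v p) L" by (simp add: power2_eq_square)
 also have "... = (\<Sum>e\<in>I. v e * F (%p. n p e * ev v p) L)"
  using F_linear[OF assms tempered_ev, of v v] by (simp add: mult.commute)
 also have "... = (\<Sum>e\<in>I. v e*(\<Sum>f\<in>I. v f * F (%p. n p e * n p f) L))"
  by (intro sum.cong refl arg_cong2[of _ _ _ _ "(*)"] F_linear[OF assms] tempered_n)
 finally show ?thesis by (simp add: sum_distrib_left mult_ac)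
qed

end

locale loop_sums = exp_sums +
 fixes i0 :: nat
 assumes i0: "i0:I" and n_i0: "p:P ==> n p i0 >= 1"
  and slack: "(%p. exp (- ev L p)) summable_on P ==> exp_summable L"
begin

definition cone :: "(nat => real) => bool" where "cone c \<longleftrightarrow> (ALL i:I. c i >= 0) & c i0 > 0"

lemma positive_cone: "ALL i:I. c i > 0 ==> cone c" using i0 by (auto simp: cone_def less_imp_le)

lemma ev_cone: "cone c ==> p:P ==> ev c p >= c i0"
proof -
 assume c: "cone c" "p:P"
 have "c i0 <= n p i0 * c i0" using n_i0[OF c(2)] c(1) mult_right_mono[of 1 "n p i0" "c i0"] by (auto simp: cone_def)
 also have "... <= ev c p" unfolding ev_def
  by (rule member_le_sum) (use c i0 finI n_nonneg in \<open>auto simp: cone_def\<close>)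
 finally show ?thesis .
qed

lemma critical_exp_summable: "critical L ==> exp_summable L" using critical_summable slack by blast

lemma F_one_scale:
 assumes "cone c" "k <= k'" "(%p. exp (- ev (%i. k * c i) p)) summable_on P"
 shows "(%p. exp (- ev (%i. k' * c i) p)) summable_on P"
  "F (%_. 1) (%i. k' * c i) <= exp (- ((k'-k) * c i0)) * F (%_. 1) (%i. k * c i)"
proof -
 have exp_le: "exp (- ev (%i. k' * c i) p) <= exp (- ((k'-k) * c i0)) * exp (- ev (%i. k * c i) p)" if "p:P" for p
 proof -
  have "(k'-k) * c i0 <= (k'-k) * ev c p" using ev_cone[OF assms(1) that] assms(2) by (intro mult_left_mono) auto
  then show ?thesis unfolding exp_add[symmetric] exp_le_cancel_iff ev_scale by (simp add: algebra_simps)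
 qed
 note scaled = summable_on_cmult_right[OF assms(3), of "exp (- ((k'-k) * c i0))"]
 show summable: "(%p. exp (- ev (%i. k' * c i) p)) summable_on P"
  by (rule summable_on_comparison_test[OF scaled]) (use exp_le in auto)
 show "F (%_. 1) (%i. k' * c i) <= exp (- ((k'-k) * c i0)) * F (%_. 1) (%i. k * c i)"
  using infsum_mono[OF summable scaled exp_le] by (simp add: F_def infsum_cmult_right')
qed

lemma F_one_scale_less:
 assumes "cone c" "k < k'" "(%p. exp (- ev (%i. k * c i) p)) summable_on P" "0 < F (%_. 1) (%i. k * c i)"
 shows "F (%_. 1) (%i. k' * c i) < F (%_. 1) (%i. k * c i)"
proof -
 have "exp (- ((k'-k) * c i0)) < 1" using assms by (auto simp: cone_def)
 then have "exp (- ((k'-k) * c i0)) * F (%_. 1) (%i. k * c i) < F (%_. 1) (%i. k * c i)" using assms(4) by simp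
 then show ?thesis using F_one_scale(2)[OF assms(1) _ assms(3), of k'] assms(2) by simp
qed

lemma critical_scale_less_iff:
 assumes "cone c" "critical (%i. k * c i)" "(%p. exp (- ev (%i. b * c i) p)) summable_on P"
 shows "F (%_. 1) (%i. b * c i) < 1 \<longleftrightarrow> k < b" "F (%_. 1) (%i. b * c i) > 1 \<longleftrightarrow> b < k"
proof -
 have k: "F (%_. 1) (%i. k * c i) = 1" using assms(2) by (simp add: critical_def)
 have "k < b ==> F (%_. 1) (%i. b * c i) < 1"
  using F_one_scale_less[OF assms(1) _ critical_summable[OF assms(2)], of b] k by simp
 moreover have "F (%_. 1) (%i. b * c i) > 1" if "b < k"
 proof -
  have "1 <= exp (- ((k-b) * c i0)) * F (%_. 1) (%i. b * c i)"
   using F_one_scale(2)[OF assms(1) _ assms(3), of k] that k by simp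
  then have "F (%_. 1) (%i. b * c i) > 0" using less_le_trans[OF zero_less_one] zero_less_mult_iff exp_gt_zero not_exp_less_zero by metis
  from F_one_scale_less[OF assms(1) that assms(3) this] show ?thesis using k by simp
 qed
 ultimately show "F (%_. 1) (%i. b * c i) < 1 \<longleftrightarrow> k < b" "F (%_. 1) (%i. b * c i) > 1 \<longleftrightarrow> b < k"
  using k by (cases b k rule: linorder_cases; force)+
qed

lemma critical_scale_unique: "cone c ==> critical (%i. k * c i) ==> critical (%i. k' * c i) ==> k = k'"
 using critical_scale_less_iff[of c k k'] critical_summable[of "%i. k' * c i"]
 by (cases k k' rule: linorder_cases) (auto simp: critical_def)

lemma F_ev_ge: "cone c ==> critical L ==> F (ev c) L >= c i0"
proof -
 assume c: "cone c" "critical L"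
 have sums: "((%p. c i0*(1 * exp (- ev L p))) has_sum c i0 * F (%_. 1) L) P" "((%p. ev c p * exp (- ev L p)) has_sum F (ev c) L) P"
  by (intro has_sum_cmult_right F_has_sum critical_exp_summable[OF c(2)] tempered_const tempered_ev)+
 have "c i0 * F (%_. 1) L <= F (ev c) L"
  by (rule has_sum_mono[OF sums]) (use ev_cone[OF c(1)] in \<open>auto intro!: mult_right_mono\<close>)
 then show ?thesis using c(2) by (simp add: critical_def)
qed

lemma F_ev_pos: "cone c ==> critical L ==> F (ev c) L > 0"
 using F_ev_ge[of c L] by (auto simp: cone_def)

lemma exp_summable_below:
 assumes "exp_summable (%i. k * c i)" "a < k"
 obtains b where "a < b" "b < k" "exp_summable (%i. b * c i)"
proof -
 have "((%b. b * c i) \<longlongrightarrow> k * c i) (at_left k)" for i by (intro tendsto_intros)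
 from eventually_exp_summable[OF this assms(1) tempered_const] eventually_at_left_real[OF assms(2)]
 have "eventually (%b. a < b & b < k & exp_summable (%i. b * c i)) (at_left k)" by eventually_elim simp
 then show ?thesis using that eventually_happens'[OF trivial_limit_at_left_real] by blast
qed

lemma critical_scale_tendsto:
 assumes c: "!!i. i:I ==> ((%y. c y i) \<longlongrightarrow> c0 i) net" and c0: "cone c0" "critical (%i. k0 * c0 i)"
  and crit: "eventually (%y. cone (c y) & critical (%i. k y * c y i)) net"
 shows "(k \<longlongrightarrow> k0) net"
proof -
 have lim: "((%y. F (%_. 1) (%i. b * c y i)) \<longlongrightarrow> F (%_. 1) (%i. b * c0 i)) net"
  "eventually (%y. exp_summable (%i. b * c y i)) net" if "exp_summable (%i. b * c0 i)" for b
  by (rule F_tendsto[OF _ that] eventually_exp_summable[OF _ that, of _ net "%_. 1"];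
    use c in \<open>auto intro!: tendsto_intros\<close>)+
 have summable: "(%p. exp (- ev L p)) summable_on P" if "exp_summable L" for L using F_summable[OF that, of "%_. 1"] by simp
 show ?thesis
 proof (rule order_tendstoI)
  fix a assume "a < k0"
  then obtain b where b: "a < b" "b < k0" "exp_summable (%i. b * c0 i)"
   using exp_summable_below[OF critical_exp_summable[OF c0(2)]] by blast
  have "F (%_. 1) (%i. b * c0 i) > 1" using critical_scale_less_iff(2)[OF c0 summable[OF b(3)]] b(2) by simp
  from order_tendstoD(1)[OF lim(1)[OF b(3)] this] lim(2)[OF b(3)] crit
  show "eventually (%y. a < k y) net"
  proof eventually_elim
   case (elim y)
   then have "b < k y" using critical_scale_less_iff(2)[of "c y" "k y" b] summable by blast
   then show ?case using b(1) by simp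
  qed
 next
  fix b assume b: "k0 < b"
  have summable_b: "exp_summable (%i. b * c0 i)"
   by (rule slack[OF F_one_scale(1)[OF c0(1) less_imp_le[OF b] critical_summable[OF c0(2)]]])
  then have "F (%_. 1) (%i. b * c0 i) < 1" using critical_scale_less_iff(1)[OF c0 summable[OF summable_b]] b by simp
  from order_tendstoD(2)[OF lim(1)[OF summable_b] this] lim(2)[OF summable_b] crit
  show "eventually (%y. k y < b) net"
   by eventually_elim (use critical_scale_less_iff(1) summable in blast)
 qed
qed

text \<open>The rate at which the critical factor changes when \<open>c\<close> moves in direction \<open>u\<close>, and the velocity of
 the normalized vector \<open>k c\<close>.\<close>

definition rate :: "(nat => real) => (nat => real) => real => real" where
 "rate c u k = - (k * F (ev u) (%i. k * c i))/F (ev c) (%i. k * c i)"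

definition velocity :: "(nat => real) => (nat => real) => real => nat => real" where
 "velocity c u k = (%i. rate c u k * c i+k * u i)"

lemma critical_scale_DERIV:
 fixes c :: "real => nat => real"
 assumes c: "!!i. i:I ==> ((%t. c t i) has_real_derivative c' i) (at t0)"
  and crit: "eventually (%t. cone (c t) & critical (%i. k t * c t i)) (nhds t0)"
 shows "(k has_real_derivative rate (c t0) c' (k t0)) (at t0)"
proof -
 let ?L = "%i. k t0 * c t0 i"
 have crit0: "cone (c t0)" "critical ?L" using eventually_nhds_x_imp_x[OF crit] by auto
 have crit_at: "eventually (%t. cone (c t) & critical (%i. k t * c t i)) (at t0)"
  using crit by (simp add: eventually_nhds_conv_at)
 note L = critical_exp_summable[OF crit0(2)]
 have clim: "((%t. c t i) \<longlongrightarrow> c t0 i) (at t0)" if "i:I" for i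
  using DERIV_isCont[OF c[OF that]] by (simp add: isCont_def)
 have klim: "(k \<longlongrightarrow> k t0) (at t0)" by (rule critical_scale_tendsto[OF clim crit0 crit_at])
 have "((%t. k t * c t i) \<longlongrightarrow> ?L i) (at t0)" if "i:I" for i by (intro tendsto_intros klim clim that)
 then obtain G where G: "!!i. i:I ==> ((%t. G t i) \<longlongrightarrow> F (%p. 1 * n p i) ?L) (at t0)"
  "eventually (%t. exp_summable (%i. k t * c t i) &
    F (%_. 1) (%i. k t * c t i) = F (%_. 1) ?L-(\<Sum>i\<in>I. (k t * c t i-?L i) * G t i)) (at t0)"
  using F_caratheodory[OF _ L tempered_const, of "%t i. k t * c t i" "at t0" 1] by blast
 let ?A = "%t. \<Sum>i\<in>I. c t i * G t i" and ?B = "%t. \<Sum>i\<in>I. (c t i-c t0 i)/(t-t0) * G t i"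
 have A: "(?A \<longlongrightarrow> F (ev (c t0)) ?L) (at t0)" unfolding F_ev[OF L] using G(1) by (intro tendsto_intros clim) auto
 have B: "(?B \<longlongrightarrow> F (ev c') ?L) (at t0)" unfolding F_ev[OF L]
  using G(1) by (intro tendsto_intros c[unfolded has_field_derivative_iff]) auto
 note pos = F_ev_pos[OF crit0]
 have "((%t. - (k t0*?B t)/?A t) \<longlongrightarrow> rate (c t0) c' (k t0)) (at t0)"
  unfolding rate_def using pos by (intro tendsto_intros A B) auto
 moreover have "eventually (%t. - (k t0*?B t)/?A t = (k t-k t0)/(t-t0)) (at t0)"
  using G(2) crit_at order_tendstoD(1)[OF A pos] eventually_neq_at_within[of t0 t0 UNIV]
 proof eventually_elim
  case (elim t)
  have "(\<Sum>i\<in>I. (k t * c t i-?L i) * G t i) = 0" using elim crit0(2) by (simp add: critical_def)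
  also have "(\<Sum>i\<in>I. (k t * c t i-?L i) * G t i) = (\<Sum>i\<in>I. (k t-k t0)*(c t i * G t i)+(t-t0)*(k t0*((c t i-c t0 i)/(t-t0) * G t i)))"
   using elim by (intro sum.cong) (auto simp: field_simps)
  finally have "(k t-k t0)*?A t = - ((t-t0)*(k t0*?B t))" by (simp add: sum.distrib sum_distrib_left)
  then show ?case using elim by (simp add: field_simps)
 qed
 ultimately show ?thesis unfolding has_field_derivative_iff by (simp add: tendsto_cong)
qed

lemma critical_scale_exists:
 assumes c: "cone c" and k1: "k1 > 0" "(%p. exp (- ev (%i. k1 * c i) p)) summable_on P" "F (%_. 1) (%i. k1 * c i) <= 1"
  and pq: "p:P" "q:P" "p ~= q"
 obtains k where "k > 0" "critical (%i. k * c i)"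
proof -
 define S where "S = {k. k > 0 & (%p. exp (- ev (%i. k * c i) p)) summable_on P & F (%_. 1) (%i. k * c i) <= 1}"
 define k where "k = Inf S"
 have S: "S ~= {}" "bdd_below S" using k1 by (auto simp: S_def intro: bdd_belowI[of _ 0])
 have fin: "(\<Sum>p\<in>X. exp (- (k * ev c p))) <= 1" if X: "finite X" "X <= P" for X
 proof -
  have "S <= {k. (\<Sum>p\<in>X. exp (- (k * ev c p))) <= 1}"
   using X by (auto simp: S_def F_def ev_scale intro: order_trans[OF finite_sum_le_infsum])
  moreover have "closed {k. (\<Sum>p\<in>X. exp (- (k * ev c p))) <= 1}" by (intro closed_Collect_le continuous_intros)
  ultimately show ?thesis unfolding k_def using closed_subset_contains_Inf[OF _ _ S] by blast
 qed
 have summable: "(%p. exp (- ev (%i. k * c i) p)) summable_on P"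
  unfolding ev_scale
  by (rule nonneg_bdd_above_summable_on) (use fin in \<open>auto intro!: bdd_aboveI[of _ 1]\<close>)
 have "0 <= k" unfolding k_def by (rule cInf_greatest[OF S(1)]) (auto simp: S_def)
 moreover have "k ~= 0" using fin[of "{p,q}"] pq by auto
 ultimately have "k > 0" by simp
 have "F (%_. 1) (%i. k * c i) <= 1" unfolding F_def
  using infsum_le_finite_sums[OF summable, of 1] fin by (simp add: ev_scale)
 moreover have False if less: "F (%_. 1) (%i. k * c i) < 1"
 proof -
  have lim: "((%s. s * c i) \<longlongrightarrow> k * c i) (at_left k)" for i by (intro tendsto_intros)
  note L = slack[OF summable]
  have "eventually (%s. s < k & s:S) (at_left k)"
   using order_tendstoD(2)[OF F_tendsto[OF lim L tempered_const] less] eventually_exp_summable[OF lim L tempered_const[of 1]]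
    eventually_at_left_real[OF \<open>k > 0\<close>]
   by eventually_elim (use F_summable[of _ "%_. 1"] in \<open>auto simp: S_def\<close>)
  then obtain s where "s < k" "s:S" using eventually_happens'[OF trivial_limit_at_left_real] by blast
  then show False using cInf_lower[OF _ S(2)] by (force simp: k_def)
 qed
 ultimately have "critical (%i. k * c i)" by (force simp: critical_def)
 with \<open>k > 0\<close> show ?thesis by (rule that)
qed

context
 fixes h :: "(nat => real) => real"
 assumes h: "!!l. (ALL i:I. l i > 0) ==> critical (%i. h l * l i)"
begin

private abbreviation pos :: "(nat => real) => bool" where "pos l \<equiv> (ALL i:I. l i > 0)"
private abbreviation hl :: "(nat => real) => nat => real" where "hl l \<equiv> (%i. h l * l i)"
private definition N :: "nat => (nat => real) => real" where "N f l = F (%p. n p f) (hl l)"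
private definition M :: "(nat => real) => real" where "M l = F (ev l) (hl l)"
private definition h' :: "nat => (nat => real) => real" where "h' f l = - (h l * N f l)/M l"

private lemma M_pos: "pos l ==> M l > 0"
 unfolding M_def by (intro F_ev_pos positive_cone h)

private lemma hl_summable: "pos l ==> exp_summable (hl l)" by (intro critical_exp_summable h)

private lemma pos_near: "pos l ==> eventually (%s. pos (l(e := l e+s))) (nhds 0)"
proof -
 assume l: "pos l"
 have "eventually (%s. ALL i:I. (l(e := l e+s)) i > 0) (nhds (0::real))"
 proof (rule eventually_ball_finite[OF finI, rule_format])
  fix i assume i: "i:I"
  have "((%s. (l(e := l e+s)) i) \<longlongrightarrow> l i) (nhds 0)"
   by (cases "i = e") (auto intro!: tendsto_eq_intros filterlim_ident)
  then show "eventually (%s. (l(e := l e+s)) i > 0) (nhds 0)" using l i by (intro order_tendstoD(1)) auto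
 qed
 then show ?thesis .
qed

private lemma update_DERIV: "((%s. (l(e := l e+s)) i) has_real_derivative (if i = e then 1 else 0)) (at 0)"
 by (cases "i = e") (auto intro!: derivative_eq_intros)

private lemma h_DERIV:
 assumes l: "pos l" and f: "f:I"
 shows "((%s. h (l(f := l f+s))) has_real_derivative h' f l) (at 0)"
proof -
 let ?c = "%s. l(f := l f+s)" and ?c' = "%i. if i = f then 1 else 0"
 have "eventually (%t. cone (?c t) & critical (hl (?c t))) (nhds 0)"
  using pos_near[OF l] by eventually_elim (use h positive_cone in blast)
 then have "((%s. h (?c s)) has_real_derivative rate (?c 0) ?c' (h (?c 0))) (at 0)"
  by (intro critical_scale_DERIV update_DERIV)
 moreover have "?c 0 = l" by auto
 moreover have "ev ?c' = (%p. n p f)" using f finI by (auto simp: ev_def if_distrib sum.delta cong: if_cong)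
 ultimately show ?thesis by (simp only: rate_def h'_def N_def M_def)
qed

private lemma partial_der_h: "pos l ==> f:I ==> partial_der h f l = h' f l"
 unfolding partial_der_def by (rule DERIV_imp_deriv[OF h_DERIV])

private definition N' :: "nat => nat => (nat => real) => real" where
 "N' f e l = - (h' e l * F (%p. n p f * ev l p) (hl l)+h l * F (%p. n p f * n p e) (hl l))"

private lemma N_DERIV:
 assumes l: "pos l" and f: "f:I" and e: "e:I"
 shows "((%s. N f (l(e := l e+s))) has_real_derivative N' f e l) (at 0)"
proof -
 let ?c = "%s. l(e := l e+s)" and ?E = "%i. F (%p. n p f * n p i) (hl l)"
 let ?d = "%i. h' e l * l i+h l*(if i = e then 1 else 0)"
 note summable = hl_summable[OF l]
 have c0: "?c 0 = l" by auto
 have "((%t. h (?c t)*?c t i) has_real_derivative ?d i) (at 0)" for i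
  using DERIV_mult[OF h_DERIV[OF l e] update_DERIV[of l e i]] by (simp add: add.commute mult.commute)
 from F_DERIV[OF this _ tempered_n[OF f]] summable
 have "((%s. N f (?c s)) has_real_derivative-(\<Sum>i\<in>I. ?d i*?E i)) (at 0)"
  unfolding N_def by (simp add: c0 fun_upd_def cong: if_cong)
 moreover have "(\<Sum>i\<in>I. ?d i*?E i) = h' e l*(\<Sum>i\<in>I. l i*?E i)+(\<Sum>i\<in>I. if i = e then h l*?E i else 0)"
  unfolding sum_distrib_left sum.distrib[symmetric] by (intro sum.cong) (auto simp: algebra_simps)
 ultimately show ?thesis using F_linear[OF summable tempered_n[OF f], of l] e finI
  by (simp add: N'_def sum.delta)
qed

private definition M' :: "nat => (nat => real) => real" where "M' e l = deriv (%s. M (l(e := l e+s))) 0"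

private lemma M_DERIV:
 assumes l: "pos l" and e: "e:I"
 shows "((%s. M (l(e := l e+s))) has_real_derivative M' e l) (at 0)"
proof -
 let ?c = "%s. l(e := l e+s)"
 have "((%s. \<Sum>i\<in>I. ?c s i * N i (?c s)) has_real_derivative (\<Sum>i\<in>I. (if i = e then 1 else 0) * N i (?c 0)+N' i e l*?c 0 i)) (at 0)"
  by (intro DERIV_sum DERIV_mult update_DERIV N_DERIV l e)
 moreover have "eventually (%s. (\<Sum>i\<in>I. ?c s i * N i (?c s)) = M (?c s)) (nhds 0)"
  using pos_near[OF l, of e] unfolding M_def N_def by eventually_elim (rule F_ev[OF hl_summable, symmetric])
 ultimately have "EX D. ((%s. M (?c s)) has_real_derivative D) (at 0)"
  using DERIV_cong_ev[OF refl _ refl, of "%s. \<Sum>i\<in>I. ?c s i * N i (?c s)"] by fast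
 then show ?thesis unfolding M'_def using DERIV_imp_deriv by blast
qed

private lemma second_partial_der_h:
 assumes l: "pos l" and e: "e:I" and f: "f:I"
 shows "partial_der (%m. partial_der h f m) e l =
  - (h' e l * M l-h l * M' e l)/(M l)\<^sup>2 * N f l-h l/M l * N' f e l"
proof -
 let ?c = "%s. l(e := l e+s)"
 have c0: "?c 0 = l" by auto
 note M = M_pos[OF l]
 have D: "((%s. h' f (?c s)) has_real_derivative
  (- (h' e l * N f (?c 0)+N' f e l * h (?c 0)) * M (?c 0)-(- (h (?c 0) * N f (?c 0))) * M' e l)/(M (?c 0) * M (?c 0))) (at 0)"
  unfolding h'_def[of f] using M c0
  by (intro DERIV_divide DERIV_minus DERIV_mult h_DERIV[OF l e] N_DERIV[OF l f e] M_DERIV[OF l e]) auto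
 have h': "eventually (%s. partial_der h f (?c s) = h' f (?c s)) (nhds 0)"
  using pos_near[OF l] by eventually_elim (use partial_der_h f in blast)
 have "deriv (%s. partial_der h f (?c s)) 0 =
   (- (h' e l * N f l+N' f e l * h l) * M l-(- (h l * N f l)) * M' e l)/(M l * M l)"
  by (rule DERIV_imp_deriv[OF iffD2[OF DERIV_cong_ev[OF refl h' refl] D[unfolded c0]]])
 also have "... = - (h' e l * M l-h l * M' e l)/(M l)\<^sup>2 * N f l-h l/M l * N' f e l"
  using M by (simp add: field_simps power2_eq_square)
 finally show ?thesis unfolding partial_der_def[of "%m. partial_der h f m"] .
qed

lemma hessian_critical_scale:
 assumes l: "pos l" and v: "F (ev v) (%i. h l * l i) = 0"
 shows "(\<Sum>e\<in>I. \<Sum>f\<in>I. v e * v f * partial_der (%m. partial_der h f m) e l)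
  = (h l)\<^sup>2 * F (%p. (ev v p)\<^sup>2) (%i. h l * l i)/F (ev l) (%i. h l * l i)"
proof -
 note summable = hl_summable[OF l]
 have v_N: "(\<Sum>f\<in>I. v f * N f l) = 0" using v F_ev[OF summable, of v] by (simp add: N_def)
 have "(\<Sum>e\<in>I. v e * h' e l) = - (h l/M l)*(\<Sum>f\<in>I. v f * N f l)"
  unfolding h'_def sum_distrib_left by (intro sum.cong) auto
 then have v_h': "(\<Sum>e\<in>I. v e * h' e l) = 0" using v_N by simp
 define B where "B f = F (%p. n p f * ev l p) (hl l)" for f
 define A where "A e = - (h' e l * M l-h l * M' e l)/(M l)\<^sup>2" for e
 have "partial_der (%m. partial_der h f m) e l = A e * N f l+h l/M l*(h' e l * B f+h l * F (%p. n p f * n p e) (hl l))"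
  if "e:I" "f:I" for e f unfolding second_partial_der_h[OF l that] A_def B_def N'_def by (simp add: algebra_simps)
 then have "(\<Sum>e\<in>I. \<Sum>f\<in>I. v e * v f * partial_der (%m. partial_der h f m) e l)
  = (\<Sum>e\<in>I. \<Sum>f\<in>I. (v e * A e)*(v f * N f l)+(h l/M l)*((v e * h' e l)*(v f * B f))
    + ((h l)\<^sup>2/M l)*(v e * v f * F (%p. n p f * n p e) (hl l)))"
  by (intro sum.cong refl) (auto simp: algebra_simps power2_eq_square)
 also have "... = (\<Sum>e\<in>I. v e * A e)*(\<Sum>f\<in>I. v f * N f l)+(h l/M l)*((\<Sum>e\<in>I. v e * h' e l)*(\<Sum>f\<in>I. v f * B f))
    + ((h l)\<^sup>2/M l)*(\<Sum>e\<in>I. \<Sum>f\<in>I. v e * v f * F (%p. n p f * n p e) (hl l))"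
  unfolding sum_product by (simp only: sum.distrib sum_distrib_left)
 also have "... = (h l)\<^sup>2/M l * F (%p. (ev v p)\<^sup>2) (hl l)" using v_N v_h' F_square[OF summable] by simp
 finally show ?thesis by (simp add: M_def)
qed

end

end

subsection \<open>Smoothness of normalized segments\<close>

lemma smooth_on_if_derivatives:
 assumes "open U" "S f" and step: "!!f. S f ==> EX g. S g & (ALL t:U. (f has_real_derivative g t) (at t))"
 shows "smooth_on U f"
proof -
 have transfer: "(f' has_real_derivative D) (at t)" if "ALL t:U. f' t = g t" "(g has_real_derivative D) (at t)" "t:U" for f' g D t
 proof -
  have "eventually (%s. f' s = g s) (nhds t)"
   using eventually_nhds_in_open[OF assms(1) that(3)] by eventually_elim (use that(1) in blast)
  from DERIV_cong_ev[OF refl this refl] show ?thesis using that(2) by blast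
 qed
 have iter: "EX g. S g & (ALL t:U. (deriv ^^ m) f t = g t)" for m
 proof (induction m)
  case 0
  then show ?case using assms(2) by auto
 next
  case (Suc m)
  then obtain g where g: "S g" "ALL t:U. (deriv ^^ m) f t = g t" by auto
  obtain g' where g': "S g'" "ALL t:U. (g has_real_derivative g' t) (at t)" using step[OF g(1)] by auto
  have "(deriv ^^ Suc m) f t = g' t" if "t:U" for t
   using DERIV_imp_deriv[OF transfer[OF g(2) _ that]] g'(2) that by simp
  then show ?case using g'(1) by blast
 qed
 show ?thesis unfolding smooth_on_def
 proof (intro allI ballI)
  fix m and t :: real assume t: "t:U"
  obtain g where g: "S g" "ALL t:U. (deriv ^^ m) f t = g t" using iter by auto
  then obtain g' where "ALL t:U. (g has_real_derivative g' t) (at t)" using step by blast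
  then show "(deriv ^^ m) f differentiable (at t)" using transfer[OF g(2) _ t] t real_differentiable_def by blast
 qed
qed

context loop_sums
begin

context
 fixes a b :: "nat => real" and k :: "real => real"
 assumes seg: "!!t. t:{0<..<1} ==> cone (%i. a i+t*(b i-a i)) & critical (%i. k t*(a i+t*(b i-a i)))"
begin

private abbreviation sg :: "real => nat => real" where "sg t \<equiv> (%i. a i+t*(b i-a i))"
private abbreviation L :: "real => nat => real" where "L t \<equiv> (%i. k t*(a i+t*(b i-a i)))"
private abbreviation Nt :: "nat => real => real" where "Nt i t \<equiv> F (%p. n p i) (L t)"
private definition k' :: "real => real" where "k' t = rate (sg t) (%i. b i-a i) (k t)"

private lemma sg_DERIV: "((%t. sg t i) has_real_derivative b i-a i) (at t)" by (auto intro!: derivative_eq_intros)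

private lemma k_DERIV:
 assumes t: "t:{0<..<1}"
 shows "(k has_real_derivative k' t) (at t)"
 unfolding k'_def
proof (rule critical_scale_DERIV[OF sg_DERIV])
 show "eventually (%t. cone (sg t) & critical (L t)) (nhds t)"
  using eventually_nhds_in_open[OF open_greaterThanLessThan t] by eventually_elim (use seg in blast)
qed

lemma segment_DERIV:
 "t:{0<..<1} ==> ((%t. k t*(a i+t*(b i-a i))) has_real_derivative
  velocity (%i. a i+t*(b i-a i)) (%i. b i-a i) (k t) i) (at t)"
 using DERIV_mult[OF k_DERIV sg_DERIV] by (simp add: velocity_def k'_def add.commute mult.commute)

private lemma F_segment_DERIV:
 assumes "t:{0<..<1}" "tempered w"
 shows "((%t. F w (L t)) has_real_derivative-(\<Sum>i\<in>I. (k' t * sg t i+k t*(b i-a i)) * F (%p. w p * n p i) (L t))) (at t)"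
 using F_DERIV[OF segment_DERIV[OF assms(1)] critical_exp_summable assms(2)] seg[OF assms(1)]
 by (simp add: velocity_def k'_def)

private inductive smooth_expr :: "(real => real) => bool" where
 const: "smooth_expr (%t. C)"
| ident: "smooth_expr (%t. t)"
| scale: "smooth_expr k"
| sums: "tempered w ==> smooth_expr (%t. F w (L t))"
| inv: "smooth_expr (%t. inverse (\<Sum>i\<in>I. sg t i * Nt i t))"
| add: "smooth_expr f ==> smooth_expr g ==> smooth_expr (%t. f t+g t)"
| mult: "smooth_expr f ==> smooth_expr g ==> smooth_expr (%t. f t * g t)"

private lemma smooth_expr_sum: "finite A ==> (!!i. i:A ==> smooth_expr (f i)) ==> smooth_expr (%t. \<Sum>i\<in>A. f i t)"
 by (induction A rule: finite_induct) (auto intro: const add)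

private lemma smooth_expr_minus: "smooth_expr f ==> smooth_expr (%t. - f t)"
 using mult[OF const[of "-1"], of f] by simp

private lemma smooth_expr_sg: "smooth_expr (%t. sg t i)" by (intro add mult const ident)

private lemmas smooth_expr_intros = smooth_expr_minus smooth_expr_sum smooth_expr_sg smooth_expr.intros finI
 tempered_n tempered_mult

private definition k'_expr :: "real => real" where
 "k'_expr t = - (k t*(\<Sum>i\<in>I. (b i-a i) * Nt i t)) * inverse (\<Sum>i\<in>I. sg t i * Nt i t)"

private lemma k'_expr: "t:{0<..<1} ==> k' t = k'_expr t"
 using F_ev[OF critical_exp_summable] seg unfolding k'_def rate_def k'_expr_def by (simp add: divide_inverse)

private definition F'_expr where
 "F'_expr w t = - (\<Sum>i\<in>I. (k'_expr t * sg t i+k t*(b i-a i)) * F (%p. w p * n p i) (L t))"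

private lemma smooth_expr_k': "smooth_expr k'_expr"
 unfolding k'_expr_def[abs_def] by (intro smooth_expr_intros)

private lemma smooth_expr_F': "tempered w ==> smooth_expr (F'_expr w)"
 unfolding F'_expr_def[abs_def] by (intro smooth_expr_intros smooth_expr_k')

private lemma F'_expr: "t:{0<..<1} ==> tempered w ==> ((%t. F w (L t)) has_real_derivative F'_expr w t) (at t)"
 using F_segment_DERIV k'_expr by (simp add: F'_expr_def)

private lemma inverse_segment_DERIV:
 assumes t: "t:{0<..<1}"
 defines "S \<equiv> %t. \<Sum>i\<in>I. sg t i * Nt i t"
 shows "((%t. inverse (S t)) has_real_derivative
  - (inverse (S t)*(\<Sum>i\<in>I. (b i-a i) * Nt i t+F'_expr (%p. n p i) t * sg t i) * inverse (S t))) (at t)"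
proof (rule DERIV_inverse')
 show "(S has_real_derivative (\<Sum>i\<in>I. (b i-a i) * Nt i t+F'_expr (%p. n p i) t * sg t i)) (at t)"
  unfolding S_def by (intro DERIV_sum DERIV_mult sg_DERIV F'_expr t tempered_n)
 have "F (ev (sg t)) (L t) = S t" using F_ev[OF critical_exp_summable] seg[OF t] by (simp add: S_def)
 then show "S t ~= 0" using F_ev_pos[of "sg t" "L t"] seg[OF t] by simp
qed

private lemma smooth_expr_DERIV: "smooth_expr f ==> EX g. smooth_expr g & (ALL t:{0<..<1}. (f has_real_derivative g t) (at t))"
proof (induction rule: smooth_expr.induct)
 case (const C)
 show ?case by (rule exI[of _ "%_. 0"]) (auto intro: smooth_expr.const)
next
 case ident
 show ?case by (rule exI[of _ "%_. 1"]) (auto intro: smooth_expr.const)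
next
 case scale
 show ?case using k_DERIV k'_expr smooth_expr_k' by (intro exI[of _ k'_expr]) auto
next
 case (sums w)
 then show ?case using F'_expr smooth_expr_F' by blast
next
 case inv
 have "smooth_expr (%t. - (inverse (\<Sum>i\<in>I. sg t i * Nt i t)*
   (\<Sum>i\<in>I. (b i-a i) * Nt i t+F'_expr (%p. n p i) t * sg t i) * inverse (\<Sum>i\<in>I. sg t i * Nt i t)))"
  by (intro smooth_expr_intros smooth_expr_F')
 then show ?case using inverse_segment_DERIV by blast
next
 case (add f g)
 then obtain f' g' where "smooth_expr f'" "smooth_expr g'" "ALL t:{0<..<1}. (f has_real_derivative f' t) (at t)"
  "ALL t:{0<..<1}. (g has_real_derivative g' t) (at t)" by auto
 then show ?case by (intro exI[of _ "%t. f' t+g' t"]) (auto intro: smooth_expr.add DERIV_add)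
next
 case (mult f g)
 then obtain f' g' where "smooth_expr f'" "smooth_expr g'" "ALL t:{0<..<1}. (f has_real_derivative f' t) (at t)"
  "ALL t:{0<..<1}. (g has_real_derivative g' t) (at t)" by auto
 then show ?case using mult.hyps
  by (intro exI[of _ "%t. f' t * g t+g' t * f t"]) (auto intro!: smooth_expr.add smooth_expr.mult DERIV_mult)
qed

lemma segment_smooth: "smooth_on {0<..<1} (%t. k t*(a i+t*(b i-a i)))"
 by (rule smooth_on_if_derivatives[where S = smooth_expr, OF _ _ smooth_expr_DERIV]) (intro open_greaterThanLessThan mult scale smooth_expr_sg)+

end

end

section \<open>Nonbacktracking paths in graphs\<close>

definition nb :: "sgraph => nat => nat => bool" where
 "nb G e f \<longleftrightarrow> e:gE G & f:gE G & gorg G f = tm G e & f ~= gbar G e"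

lemma outerD:
 assumes "outer_graph G"
 shows "serre_graph G" "connected_graph G" "v:gV G ==> card {e:gE G. gorg G e = v} >= 3"
 using assms unfolding outer_graph_def by blast+

lemma outer_not_subset_pair:
 assumes "outer_graph G" "v:gV G" and "{e:gE G. gorg G e = v} <= {a,b}"
 shows False
proof -
 have "card {e:gE G. gorg G e = v} <= card {a,b}" by (rule card_mono[OF _ assms(3)]) simp
 also have "... <= 2" by (simp add: card_insert_if)
 finally show False using outerD(3)[OF assms(1,2)] by simp
qed

lemma common_nb_successor:
 assumes "outer_graph G" "e:gE G" "f:gE G" "tm G e = tm G f"
 shows "EX g. nb G e g & nb G f g"
proof (rule ccontr)
 note sg = outerD(1)[OF assms(1)]
 assume "\<nexists>g. nb G e g & nb G f g"
 then have "{g:gE G. gorg G g = tm G e} <= {gbar G e,gbar G f}" using assms unfolding nb_def by auto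
 then show False by (rule outer_not_subset_pair[OF assms(1) serreD(5)[OF sg assms(2)]])
qed

lemma nb_bar:
 assumes "serre_graph G" "nb G e f"
 shows "nb G (gbar G f) (gbar G e)"
 using assms unfolding nb_def by (auto simp: serreD gbar_eq_iff)

lemma nb_rtrancl_bar:
 assumes "serre_graph G" "(nb G)\<^sup>*\<^sup>* e f"
 shows "(nb G)\<^sup>*\<^sup>* (gbar G f) (gbar G e)"
 using assms(2) by (induction rule: rtranclp_induct) (auto intro: converse_rtranclp_into_rtranclp nb_bar[OF assms(1)])

lemma nb_rtrancl_E: "(nb G)\<^sup>*\<^sup>* e f ==> e:gE G ==> f:gE G"
 by (induction rule: rtranclp_induct) (auto simp: nb_def)

lemma nb_reachable_gbar:
 assumes "outer_graph G" "e:gE G"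
 shows "(nb G)\<^sup>*\<^sup>* e (gbar G e)"
proof (rule ccontr)
 note sg = outerD(1)[OF assms(1)]
 assume neg: "~ (nb G)\<^sup>*\<^sup>* e (gbar G e)"
 define S where "S = {f. (nb G)\<^sup>*\<^sup>* e f}"
 have SE: "S <= gE G" using nb_rtrancl_E assms(2) by (auto simp: S_def)
 have finS: "finite S" using SE serre_fin(2)[OF sg] finite_subset by blast
 have closed: "g:S" if "f:S" "nb G f g" for f g using that by (auto simp: S_def)
 have disj: "gbar G f ~: S" if "f:S" for f
  using that neg nb_rtrancl_bar[OF sg, of e f] unfolding S_def by (auto dest: rtranclp_trans)
 have inj: "inj_on (tm G) S"
 proof (rule inj_onI, rule ccontr)
  fix f f' assume f: "f:S" "f':S" "tm G f = tm G f'" "f ~= f'"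
  have fE: "f:gE G" "f':gE G" using f SE by auto
  then have "nb G f (gbar G f')" using f(3,4) gbar_eq_iff(1)[OF sg fE] by (simp add: nb_def serreD[OF sg])
  then show False using closed[OF f(1)] disj[OF f(2)] by blast
 qed
 have two: "2 <= card {g:S. gorg G g = w}" if w: "w:tm G ` S" for w
 proof -
  obtain f where f: "f:S" "w = tm G f" using w by auto
  have "{g:gE G. gorg G g = w} <= insert (gbar G f) {g:S. gorg G g = w}"
   using closed[OF f(1)] f SE by (auto simp: nb_def)
  then have "card {g:gE G. gorg G g = w} <= card (insert (gbar G f) {g:S. gorg G g = w})"
   using finS by (intro card_mono) auto
  also have "... <= Suc (card {g:S. gorg G g = w})" using finS by (simp add: card_insert_if)
  finally show ?thesis using outerD(3)[OF assms(1), of w] serreD(5)[OF sg] f SE by fastforce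
 qed
 have "2 * card (tm G ` S) = (\<Sum>w\<in>tm G ` S. 2)" by simp
 also have "... <= (\<Sum>w\<in>tm G ` S. card {g:S. gorg G g = w})" by (rule sum_mono[OF two])
 also have "... = card (\<Union>w\<in>tm G ` S. {g:S. gorg G g = w})"
  by (subst card_UN_disjoint) (use finS in auto)
 also have "... <= card S" by (rule card_mono[OF finS]) auto
 finally have "2 * card S <= card S" by (simp add: card_image[OF inj])
 then have "S = {}" using finS by simp
 then show False by (auto simp: S_def)
qed

lemma nb_reachable:
 assumes "outer_graph G" "e:gE G" "f:gE G"
 shows "(nb G)\<^sup>*\<^sup>* e f"
proof -
 note sg = outerD(1)[OF assms(1)]
 have step: "(nb G)\<^sup>*\<^sup>* e d" if "(nb G)\<^sup>*\<^sup>* e g" "d:gE G" "gorg G d = tm G g" for g d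
 proof (cases "d = gbar G g")
  case True
  then show ?thesis using that nb_reachable_gbar[OF assms(1) nb_rtrancl_E[OF that(1) assms(2)]] by auto
 next
  case False
  then have "nb G g d" using that nb_rtrancl_E[OF that(1) assms(2)] by (auto simp: nb_def)
  then show ?thesis using that by auto
 qed
 have along_walk: "EX g. (nb G)\<^sup>*\<^sup>* e g & tm G g = b" if "walk G (gE G) p a b" "EX g. (nb G)\<^sup>*\<^sup>* e g & tm G g = a" for p a b
  using that
 proof (induction p arbitrary: a)
  case (Cons d p)
  then obtain g where g: "(nb G)\<^sup>*\<^sup>* e g" "tm G g = a" by auto
  have "(nb G)\<^sup>*\<^sup>* e d" using step[OF g(1)] Cons.prems(1) g(2) by auto
  then show ?case using Cons by auto
 qed auto
 obtain p where p: "walk G (gE G) p (tm G e) (gorg G f)"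
  using bspec[OF bspec[OF outerD(2)[OF assms(1), unfolded connected_graph_def] serreD(5)[OF sg assms(2)]] serreD(1)[OF sg assms(3)]] by (rule exE)
 obtain g where "(nb G)\<^sup>*\<^sup>* e g" "tm G g = gorg G f" using along_walk[OF p] by blast
 then show ?thesis using step[of g f] assms(3) by simp
qed

lemma rtranclp_imp_successively:
 assumes "R\<^sup>*\<^sup>* e f"
 shows "EX p. successively R (e#p) & last (e#p) = f"
 using assms
proof (induction rule: rtranclp_induct)
 case base
 show ?case by (rule exI[of _ "[]"]) auto
next
 case (step y z)
 then obtain p where "successively R (e#p)" "last (e#p) = y" by auto
 then have "successively R (e#p@[z])" "last (e#p@[z]) = z" using step successively_append_iff[of R "e#p" "[z]"] by auto
 then show ?case by blast
qed

lemma nb_strong: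
 assumes "outer_graph G" "e:gE G" "f:gE G"
 shows "EX p. p ~= [] & successively (nb G) (e#p) & last p = f"
proof -
 obtain g where g: "nb G e g" using common_nb_successor[OF assms(1,2,2)] by auto
 then have "(nb G)\<^sup>*\<^sup>* g f" using nb_reachable[OF assms(1) _ assms(3)] by (auto simp: nb_def)
 from rtranclp_imp_successively[OF this] obtain p where "successively (nb G) (g#p)" "last (g#p) = f" by blast
 then show ?thesis using g by (intro exI[of _ "g#p"]) auto
qed

lemma walk_reduced_iff:
 assumes "serre_graph G" "p ~= []"
 shows "walk G (gE G) p a b & reduced G p \<longleftrightarrow>
  set p <= gE G & successively (nb G) p & gorg G (hd p) = a & tm G (last p) = b"
 using assms(2)
proof (induction p arbitrary: a)
 case (Cons e p)
 show ?case
 proof (cases "p = []")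
  case True
  then show ?thesis by (auto simp: serreD[OF assms(1)])
 next
  case False
  have "walk G (gE G) (e#p) a b & reduced G (e#p) \<longleftrightarrow> e:gE G & gorg G e = a & hd p ~= gbar G e &
   (walk G (gE G) p (tm G e) b & reduced G p)" using False by (auto simp: reduced_Cons)
  also have "... \<longleftrightarrow> set (e#p) <= gE G & successively (nb G) (e#p) & gorg G (hd (e#p)) = a & tm G (last (e#p)) = b"
   unfolding Cons.IH[OF False] using False hd_in_set[OF False] by (auto simp: successively_Cons nb_def)
  finally show ?thesis .
 qed
qed simp

definition edge_count :: "sgraph => nat list => nat => real" where
 "edge_count G p i = real (count_list p i+count_list p (gbar G i))"

lemma sum_edge_count:
 assumes "serre_graph G" "set p <= gE G"
 shows "(\<Sum>i\<in>gEp G. edge_count G p i * L i) = sum_list (map (len G L) p)"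
 using assms(2)
proof (induction p)
 case (Cons e p)
 have e: "e:gE G" using Cons by auto
 define j where "j = (if e:gEp G then e else gbar G e)"
 have j: "j:gEp G" "L j = len G L e" using e serre_Ep[OF assms(1) e] by (auto simp: j_def len_def)
 have "edge_count G (e#p) i = edge_count G p i+(if i = j then 1 else 0)" if i: "i:gEp G" for i
 proof -
  have iE: "i:gE G" using i serre_fin(3)[OF assms(1)] by auto
  have "e = gbar G i \<longleftrightarrow> gbar G e = i" using gbar_eq_iff(2)[OF assms(1) e iE] by auto
  moreover have "gbar G i ~: gEp G" using serre_Ep[OF assms(1) iE] i by auto
  ultimately show ?thesis using i serreD(3)[OF assms(1) iE] by (auto simp: edge_count_def j_def)
 qed
 then have "(\<Sum>i\<in>gEp G. edge_count G (e#p) i * L i) = (\<Sum>i\<in>gEp G. edge_count G p i * L i+(if i = j then L i else 0))"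
  by (intro sum.cong) (auto simp: algebra_simps)
 also have "... = (\<Sum>i\<in>gEp G. edge_count G p i * L i)+L j"
  using j(1) serre_fin(5)[OF assms(1)] by (simp add: sum.distrib sum.delta)
 finally show ?case using Cons j by simp
qed (simp add: edge_count_def)

abbreviation pos_len :: "sgraph => (nat => real) => bool" where
 "pos_len G l \<equiv> (ALL i:gEp G. l i > 0)"

lemma len_const: "len G (%_. c) = (%_. c)" by (auto simp: len_def)

lemma len_scale: "len G (%i. s * l i) = (%e. s * len G l e)" by (auto simp: len_def)

lemma len_pos: "serre_graph G ==> pos_len G l ==> e:gE G ==> len G l e > 0"
 using serre_Ep[of G e] by (auto simp: len_def)

lemma len_gbar: "serre_graph G ==> e:gE G ==> len G v (gbar G e) = len G v e"
 using serre_Ep[of G e] serreD(4)[of G e] by (auto simp: len_def)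

locale outer_loops =
 fixes G :: sgraph and e0 :: nat
 assumes og: "outer_graph G" and e0: "e0:gE G"
begin

lemma sg: "serre_graph G" by (rule outerD(1)[OF og])

sublocale strong_digraph "gE G" "nb G" e0
 by standard (use serre_fin[OF sg] e0 nb_strong[OF og] in \<open>auto simp: nb_def\<close>)

sublocale exp_sums "gEp G" "hit e0" "edge_count G"
 by standard (use serre_fin[OF sg] in \<open>auto simp: edge_count_def\<close>)

lemma ev_eq: "set p <= gE G ==> ev L p = sum_list (map (len G L) p)"
 unfolding ev_def by (rule sum_edge_count[OF sg])

lemma sz_eq: "set p <= gE G ==> sz p = real (length p)"
 unfolding sz_def using sum_edge_count[OF sg, of p "%_. 1"] by (simp add: len_const sum_list_triv)

lemma wt_ev: "set p <= gE G ==> wt (len G L) p = exp (- ev L p)"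
 by (simp add: wt_def ev_eq)

lemma wt_summable_iff: "(%p. c p * wt (len G L) p) summable_on hit e0 \<longleftrightarrow> (%p. c p * exp (- ev L p)) summable_on hit e0"
 by (rule summable_on_cong) (simp add: wt_ev hit_set)

lemmas wt_summable = wt_summable_iff[of "%_. 1", simplified]

lemma F_one_eq: "F (%_. 1) L = infsum (wt (len G L)) (hit e0)"
 unfolding F_def by (rule infsum_cong) (simp add: wt_ev hit_set)

definition i0 :: nat where "i0 = (if e0:gEp G then e0 else gbar G e0)"

lemma len_i0: "len G L e0 = L i0" by (simp add: len_def i0_def)

sublocale loop_sums "gEp G" "hit e0" "edge_count G" i0
proof
 show "i0:gEp G" using e0 serre_Ep[OF sg e0] by (auto simp: i0_def)
 fix p assume p: "p:hit e0"
 then have "e0:set p" using hitE by force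
 then have "count_list p e0 ~= 0" by (simp add: count_list_0_iff)
 then show "1 <= edge_count G p i0" using serreD(4)[OF sg e0] by (simp add: edge_count_def i0_def)
next
 fix L assume "(%p. exp (- ev L p)) summable_on hit e0"
 then obtain \<eta> :: real where \<eta>: "\<eta> > 0" "(%p. exp (\<eta> * real (length p)) * wt (len G L) p) summable_on hit e0"
  using exp_slack wt_summable by blast
 have "(%p. exp (\<eta> * sz p-ev L p)) summable_on hit e0"
  using \<eta>(2) by (rule summable_on_cong[THEN iffD1, rotated])
   (simp add: wt_ev hit_set sz_eq exp_diff exp_minus divide_inverse)
 then show "exp_summable L" using \<eta>(1) unfolding exp_summable_def by blast
qed

lemma circuits_iff: "p:circuits \<longleftrightarrow> based_circuit G p"
proof (cases "p = []")
 case False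
 have ends: "hd p:gE G" "last p:gE G" if "set p <= gE G" using that False by auto
 have "p:circuits \<longleftrightarrow> set p <= gE G & successively (nb G) p & gorg G (hd p) = tm G (last p) & hd p ~= gbar G (last p)"
  (is "_ \<longleftrightarrow> ?R")
 proof
  show "p:circuits ==> ?R" using circuits_set[of p] by (simp add: circuits_def nb_def)
  show "?R ==> p:circuits" using ends False by (simp add: circuits_def nb_def)
 qed
 also have "... \<longleftrightarrow> set p <= gE G & successively (nb G) p & gorg G (hd p) = tm G (last p) & last p ~= gbar G (hd p)"
  using gbar_eq_iff(2)[OF sg ends(2,1)] by metis
 also have "... \<longleftrightarrow> (walk G (gE G) p (gorg G (hd p)) (gorg G (hd p)) & reduced G p) & last p ~= gbar G (hd p)"
  unfolding walk_reduced_iff[OF sg False] by auto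
 finally show ?thesis unfolding based_circuit_def using False by blast
qed (simp add: circuits_def based_circuit_def)

lemma entropy_eq:
 assumes l: "pos_len G l" and s: "s > 0" and crit: "critical (%i. s * l i)"
 shows "entropy G l = s"
proof -
 have "((%t. ln (real (card {p:circuits. sum_list (map (len G l) p) <= t}))/t) \<longlongrightarrow> s) at_top"
 proof (rule circuit_growth[OF _ s])
  show "infsum (wt (%e. s * len G l e)) (hit e0) = 1" "wt (%e. s * len G l e) summable_on hit e0"
   using crit critical_summable[OF crit] by (simp_all add: critical_def F_one_eq wt_summable[symmetric] len_scale)
 qed (use len_pos[OF sg l] in auto)
 then show ?thesis unfolding entropy_def circuit_count_def circuits_iff
  by (intro tendsto_Lim) auto
qed

lemma two_loops: obtains p q where "p:hit e0" "q:hit e0" "p ~= q"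
proof -
 obtain f where f: "nb G e0 f" using common_nb_successor[OF og e0 e0] by auto
 have "EX g. nb G e0 g & f ~= g"
 proof (rule ccontr)
  assume "~ ?thesis"
  then have "{g:gE G. gorg G g = tm G e0} <= {gbar G e0,f}" using f e0 by (auto simp: nb_def)
  then show False by (rule outer_not_subset_pair[OF og serreD(5)[OF sg e0]])
 qed
 then obtain g where g: "nb G e0 g" "f ~= g" by blast
 have "EX p. p:hit e0 & hd p = f" if f: "nb G e0 f" for f
 proof (cases "f = e0")
  case True
  then show ?thesis using f by (intro exI[of _ "[e0]"]) (auto simp: hit_def)
 next
  case False
  obtain p where "p:hit f" using short_hit[of f] f unfolding nb_def by blast
  then have "f#p:hit e0" using f False by (auto simp: hit_Cons) (auto simp: hit_def)
  then show ?thesis by (intro exI[of _ "f#p"]) auto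
 qed
 then obtain p q where "p:hit e0" "hd p = f" "q:hit e0" "hd q = g" using f g(1) by blast
 then show ?thesis using g(2) that by blast
qed

lemma critical_exists:
 assumes l: "pos_len G l"
 obtains s where "s > 0" "critical (%i. s * l i)"
proof -
 define k where "k = Min (len G l ` gE G)"
 have lengths_nonempty: "len G l ` gE G ~= {}" using e0 by auto
 have k: "k > 0" unfolding k_def using finE lengths_nonempty len_pos[OF sg l] by simp
 define N where "N = real (card (gE G))"
 have N: "N >= 1" using card_E_pos by (simp add: N_def)
 define s where "s = ln (2 * N)/k"
 have s: "s > 0" "N * exp (- (s * k)) = 1/2" using k N by (simp_all add: s_def exp_minus field_simps)
 have long: "s * k <= len G (%i. s * l i) e" if "e:gE G" for e
  unfolding len_scale k_def using finE that s(1) by (intro mult_left_mono Min_le) auto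
 have small: "real (card (gE G)) * exp (- (s * k)) <= 1/2" using s(2) by (simp add: N_def)
 have "(%p. exp (- ev (%i. s * l i) p)) summable_on hit e0" "F (%_. 1) (%i. s * l i) <= 1"
  unfolding wt_summable[symmetric] F_one_eq
  by (rule wt_summable_if_long[OF long small] wt_infsum_le_1_if_long[OF long small]; assumption)+
 then show ?thesis
  using critical_scale_exists[OF positive_cone[OF l] s(1)] two_loops that by metis
qed

lemma
 assumes "pos_len G l"
 shows critical_entropy: "critical (%i. entropy G l * l i)" and entropy_pos: "entropy G l > 0"
proof -
 obtain s where "s > 0" "critical (%i. s * l i)" using critical_exists[OF assms] .
 then show "critical (%i. entropy G l * l i)" "entropy G l > 0" using entropy_eq[OF assms] by auto
qed

lemma entropy_1_iff:
 assumes "pos_len G l"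
 shows "entropy G l = 1 \<longleftrightarrow> critical l"
 using critical_entropy[OF assms] entropy_eq[OF assms, of 1] by auto

lemma hess_form_eq:
 assumes l: "pos_len G l" "critical l" and v: "F (ev v) l = 0"
 shows "hess_form G l v = F (%p. (ev v p)\<^sup>2) l/F (ev l) l"
proof -
 have "entropy G l = 1" using entropy_1_iff[OF l(1)] l(2) by simp
 then show ?thesis unfolding hess_form_def
  using hessian_critical_scale[of "entropy G" l v, OF critical_entropy l(1)] v by simp
qed

lemma hess_form_nonneg:
 assumes l: "pos_len G l" "critical l" and v: "F (ev v) l = 0"
 shows "hess_form G l v >= 0"
 unfolding hess_form_eq[OF assms] F_def[of "%p. (ev v p)\<^sup>2"]
 using F_ev_pos[OF positive_cone[OF l(1)] l(2)] by (intro divide_nonneg_pos infsum_nonneg) auto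

definition (in -) mean_length_const :: "nat => real => real" where
 "mean_length_const N m = (\<Sum>n. real n*(tail_rate N m 1)^((n-1) div N))"

definition (in -) speed_const :: "nat => real => real" where
 "speed_const N m = 6 * sqrt (m * mean_length_const N m * exp (real (2 * N+1) * m))"

context
 fixes l :: "nat => real" and N :: nat and m :: real
 assumes l: "pos_len G l" "critical l" and m: "m >= 0" "ALL i:gEp G. l i <= m" and N: "card (gE G) <= N"
begin

lemma len_le: "e:gE G ==> len G l e <= m"
 using m(2) serre_Ep[OF sg, of e] by (auto simp: len_def)

lemma ev_le: "set p <= gE G ==> ev l p <= m * real (length p)"
 unfolding ev_eq by (induction p) (auto simp: algebra_simps ev_eq intro: add_mono len_le)

lemma F_ev_le: "F (ev l) l <= m * mean_length_const N m"
proof -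
 have "N > 0" using card_E_pos N by simp
 moreover have "wt (len G l) summable_on hit e0" "infsum (wt (len G l)) (hit e0) = 1"
  using l(2) critical_summable[OF l(2)] by (simp_all add: critical_def F_one_eq wt_summable)
 ultimately have mean: "(%q. length q * wt (len G l) q) summable_on hit e0"
  "infsum (%q. length q * wt (len G l) q) (hit e0) <= mean_length_const N m"
  using summable_length_wt[OF _ m(1) _ _ N len_le] infsum_length_wt_le[OF _ m(1) _ _ N len_le]
  by (simp_all add: mean_length_const_def)
 have "F (ev l) l <= infsum (%q. m*(length q * wt (len G l) q)) (hit e0)"
  unfolding F_def
 proof (rule infsum_mono[OF F_summable[OF critical_exp_summable[OF l(2)] tempered_ev] summable_on_cmult_right[OF mean(1)]])
  fix q assume "q:hit e0"
  then have q: "set q <= gE G" by (rule hit_set)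
  show "ev l q * exp (- ev l q) <= m*(length q * wt (len G l) q)"
   unfolding wt_ev[OF q] mult.assoc[symmetric] using ev_le[OF q] by (intro mult_right_mono) auto
 qed
 also have "... <= m * mean_length_const N m" unfolding infsum_cmult_right' using mean(2) m(1) by (rule mult_left_mono)
 finally show ?thesis .
qed

lemma loop_variation_le:
 assumes v: "F (ev v) l = 0" and p: "p:hit e0" "length p <= 2 * N+1"
 shows "6*\<bar>ev v p\<bar> <= speed_const N m * sqrt (hess_form G l v)"
proof -
 let ?H = "hess_form G l v" and ?m = "m * mean_length_const N m"
 note pos = F_ev_pos[OF positive_cone[OF l(1)] l(2)] and H = hess_form_nonneg[OF l v]
 have "(%q. (ev v q)\<^sup>2 * exp (- ev l q)) summable_on hit e0"
  using F_summable[OF critical_exp_summable[OF l(2)] tempered_mult[OF tempered_ev tempered_ev], of v v]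
  by (simp add: power2_eq_square)
 then have "(ev v p)\<^sup>2 * exp (- ev l p) <= F (%q. (ev v q)\<^sup>2) l"
  unfolding F_def using finite_sum_le_infsum[of _ "hit e0" "{p}"] p(1) by fastforce
 also have "... = ?H * F (ev l) l" using pos by (simp add: hess_form_eq[OF l v])
 also have "... <= ?H*?m" using F_ev_le H by (intro mult_left_mono)
 finally have "(ev v p)\<^sup>2 <= ?H*?m * exp (ev l p)" by (simp add: exp_minus field_simps)
 also have "... <= ?H*?m * exp (real (2 * N+1) * m)"
 proof (rule mult_left_mono)
  have "ev l p <= m * real (length p)" by (rule ev_le[OF hit_set[OF p(1)]])
  also have "... <= m * real (2 * N+1)" using p(2) m(1) by (intro mult_left_mono) (simp_all only: of_nat_le_iff)
  finally show "exp (ev l p) <= exp (real (2 * N+1) * m)" by (simp add: mult.commute)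
  show "0 <= ?H*?m" using mult_nonneg_nonneg[OF H, of ?m] pos F_ev_le by linarith
 qed
 finally have "sqrt ((ev v p)\<^sup>2) <= sqrt ((?m * exp (real (2 * N+1) * m))*?H)"
  by (intro real_sqrt_le_mono) (simp add: mult_ac)
 then show ?thesis by (simp add: speed_const_def real_sqrt_mult)
qed

end

lemma edge_potential:
 assumes loops: "!!p. p:hit e0 ==> length p <= 2 * card (gE G)+1 ==> \<bar>ev v p\<bar> <= \<beta>"
 obtains \<phi> where "!!e f. nb G e f ==> \<bar>\<phi> e+len G v f-\<phi> f\<bar> <= 2*\<beta>"
proof -
 let ?N = "card (gE G)"
 have "ALL e:gE G. EX a. successively (nb G) (e0#a) & last (e0#a) = e & e0 ~: set a & length a <= ?N"
 proof
  fix e assume e: "e:gE G"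
  show "EX a. successively (nb G) (e0#a) & last (e0#a) = e & e0 ~: set a & length a <= ?N"
  proof (cases "e = e0")
   case False
   with e obtain a where "a ~= []" "successively (nb G) (e0#a)" "last a = e" "length a <= ?N" "e0 ~: set a"
    by (rule short_path_from_base)
   then show ?thesis by (intro exI[of _ a]) auto
  qed (auto intro: exI[of _ "[]"])
 qed
 then obtain a where a: "!!e. e:gE G ==> successively (nb G) (e0#a e)" "!!e. e:gE G ==> last (e0#a e) = e"
  "!!e. e:gE G ==> e0 ~: set (a e)" "!!e. e:gE G ==> length (a e) <= ?N" by metis
 define V where "V p = sum_list (map (len G v) p)" for p
 have V: "\<bar>V (a e@q)\<bar> <= \<beta>" if "e:gE G" "q:hit e" "length q <= ?N+1" for e q
 proof -
  have "a e@q:hit e0" by (rule hit_prepend[OF a(1-3)[OF that(1)] that(2)])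
  then show ?thesis using loops[of "a e@q"] a(4)[OF that(1)] that(3) ev_eq[OF hit_set] by (simp add: V_def)
 qed
 have "\<bar>V (a e)+len G v f-V (a f)\<bar> <= 2*\<beta>" if ef: "nb G e f" for e f
 proof -
  have E: "e:gE G" "f:gE G" using ef by (auto simp: nb_def)
  obtain q where q: "q:hit f" "length q <= ?N" using short_hit[OF E(2)] .
  show ?thesis
  proof (cases "f = e0")
   case True
   have "a e0 = []" using a(2,3)[OF e0] by (metis last_ConsR last_in_set)
   moreover have "[e0]:hit e" using ef True by (auto simp: hit_def)
   ultimately show ?thesis using V[OF E(1), of "[e0]"] True by (simp add: V_def)
  next
   case False
   then have "f#q:hit e" using ef q(1) by (auto simp: hit_Cons) (auto simp: hit_def)
   then show ?thesis using V[OF E(1), of "f#q"] V[OF E(2) q(1)] q(2) by (simp add: V_def)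
  qed
 qed
 then show ?thesis by (rule that)
qed

lemma edge_bound_from_potential:
 assumes step: "!!e f. nb G e f ==> \<bar>\<phi> e+len G v f-\<phi> f\<bar> <= c" and b: "b:gE G"
 shows "\<bar>len G v b\<bar> <= 3 * c"
proof -
 have same_end: "\<bar>\<phi> a-\<phi> a'\<bar> <= 2 * c" if ends: "a:gE G" "a':gE G" "tm G a = tm G a'" for a a'
 proof -
  obtain g where "nb G a g" "nb G a' g" using common_nb_successor[OF og ends] by auto
  from step[OF this(1)] step[OF this(2)] show ?thesis by linarith
 qed
 have one_sided: "\<bar>len G v d-(\<phi> d-\<phi> (gbar G d))\<bar> <= 3 * c" if d: "d:gE G" for d
 proof -
  have bar_d: "gbar G d:gE G" "tm G (gbar G d) = gorg G d" by (auto simp: serreD[OF sg d])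
  obtain g where "nb G (gbar G d) g" using common_nb_successor[OF og bar_d(1) bar_d(1)] by blast
  then have g: "g:gE G" "gorg G g = gorg G d" "g ~= d" using bar_d serreD(4)[OF sg d] by (auto simp: nb_def)
  have "nb G (gbar G g) d" using g d by (auto simp: nb_def serreD[OF sg])
  moreover have "\<bar>\<phi> (gbar G g)-\<phi> (gbar G d)\<bar> <= 2 * c"
   by (rule same_end) (use g d in \<open>auto simp: serreD[OF sg]\<close>)
  ultimately show ?thesis using step by fastforce
 qed
 have "\<bar>len G v b-(\<phi> (gbar G b)-\<phi> b)\<bar> <= 3 * c"
  using one_sided[OF serreD(2)[OF sg b]] by (simp add: serreD[OF sg b] len_gbar[OF sg b])
 with one_sided[OF b] show ?thesis by linarith
qed

lemma hess_lower_bound: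
 assumes l: "pos_len G l" "critical l" and v: "F (ev v) l = 0"
  and m: "m >= 0" "ALL i:gEp G. l i <= m" and N: "card (gE G) <= N" and b: "b:gEp G"
 shows "\<bar>v b\<bar> <= speed_const N m * sqrt (hess_form G l v)"
proof -
 let ?B = "speed_const N m * sqrt (hess_form G l v)"
 have "\<bar>ev v p\<bar> <= ?B/6" if p: "p:hit e0" "length p <= 2 * card (gE G)+1" for p
  using loop_variation_le[OF l m N v p(1)] p(2) N by simp
 from edge_potential[OF this] obtain \<phi> where "!!e f. nb G e f ==> \<bar>\<phi> e+len G v f-\<phi> f\<bar> <= 2*(?B/6)" by blast
 from edge_bound_from_potential[OF this, of b] show ?thesis using b serre_fin(3)[OF sg] by (auto simp: len_def)
qed

end

section \<open>Collapses\<close>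

locale connected_subgraph =
 fixes G :: sgraph and F X :: "nat set" and x0 :: nat
 assumes sg: "serre_graph G" and FE: "F <= gE G" and Fbar: "e:F ==> gbar G e:F"
  and FX: "e:F ==> gorg G e:X" and XV: "X <= gV G" and x0: "x0:X"
  and conn: "a:X ==> b:X ==> EX p. walk G F p a b"
begin

definition depth :: "nat => nat" where "depth v = (LEAST k. EX p. walk G F p v x0 & length p = k)"

lemma F_E: "e:F ==> e:gE G" using FE by auto

lemma depth_le: "walk G F p v x0 ==> depth v <= length p"
 unfolding depth_def by (rule Least_le) auto

lemma edge_towards_root:
 assumes "v:X" "v ~= x0"
 obtains e where "e:F" "gorg G e = v" "depth (tm G e) < depth v"
proof -
 have "EX k p. walk G F p v x0 & length p = k" using conn[OF assms(1) x0] by auto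
 then have "EX p. walk G F p v x0 & length p = depth v" unfolding depth_def by (rule LeastI_ex)
 then obtain p where p: "walk G F p v x0" "length p = depth v" by auto
 then obtain e q where e: "p = e#q" using assms(2) by (cases p) auto
 then have "depth (tm G e) <= length q" using p by (intro depth_le) auto
 then show ?thesis using p e that by auto
qed

definition parent_edge :: "nat => nat" where
 "parent_edge v = (SOME e. e:F & gorg G e = v & depth (tm G e) < depth v)"

lemma parent_edge:
 assumes "v:X" "v ~= x0"
 shows "parent_edge v:F" "gorg G (parent_edge v) = v" "depth (tm G (parent_edge v)) < depth v"
proof -
 have "EX e. e:F & gorg G e = v & depth (tm G e) < depth v" using edge_towards_root[OF assms] by blast
 from someI_ex[OF this] show "parent_edge v:F" "gorg G (parent_edge v) = v"
  "depth (tm G (parent_edge v)) < depth v" by (simp_all add: parent_edge_def)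
qed

lemma tm_gbar_parent_edge: "v:X ==> v ~= x0 ==> tm G (gbar G (parent_edge v)) = v"
 using parent_edge F_E serreD(6)[OF sg] by metis

abbreviation "upward \<equiv> parent_edge ` (X-{x0})"

definition tree :: "nat set" where "tree = upward \<union> gbar G ` upward"

lemma tree_F: "tree <= F" unfolding tree_def using parent_edge Fbar by auto

lemma tree_E: "tree <= gE G" using tree_F FE by auto

lemma upward_gbar: "e:upward ==> gbar G (gbar G e) = e"
 using parent_edge(1) F_E serreD(4)[OF sg] by blast

lemma tree_cases: "e:tree ==> e:upward | gbar G e:upward"
 unfolding tree_def using upward_gbar by auto

lemma tree_gbar: "e:tree ==> gbar G e:tree"
 unfolding tree_def using upward_gbar by auto

lemma finite_X: "finite X" using XV serre_fin(1)[OF sg] finite_subset by blast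
lemma finite_F: "finite F" using FE serre_fin(2)[OF sg] finite_subset by blast

lemma card_tree: "card tree = 2*(card X-1)"
proof -
 have inj: "inj_on parent_edge (X-{x0})" by (rule inj_on_inverseI[of _ "gorg G"]) (use parent_edge in auto)
 have inj_gbar: "inj_on (gbar G) upward"
  by (rule inj_on_inverseI[of _ "gbar G"]) (rule upward_gbar)
 have "upward \<inter> gbar G ` upward = {}"
 proof (rule ccontr)
  assume "~ ?thesis"
  then obtain v w where v: "v:X" "v ~= x0" and w: "w:X" "w ~= x0"
   and vw: "parent_edge v = gbar G (parent_edge w)" by auto
  have "tm G (parent_edge v) = w" using tm_gbar_parent_edge[OF w] vw by simp
  moreover have "tm G (parent_edge w) = v"
   using parent_edge[OF v] parent_edge[OF w] vw serreD(7)[OF sg] F_E by metis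
  ultimately show False using parent_edge(3)[OF v] parent_edge(3)[OF w] by simp
 qed
 then have "card tree = card upward+card (gbar G ` upward)"
  unfolding tree_def using finite_X by (intro card_Un_disjoint) auto
 then show ?thesis using x0 finite_X by (simp add: card_image[OF inj] card_image[OF inj_gbar])
qed

lemma tree_walk_to_root: "v:X ==> EX p. walk G tree p v x0"
proof (induction "depth v" arbitrary: v rule: less_induct)
 case less
 show ?case
 proof (cases "v = x0")
  case True
  then show ?thesis using XV x0 by (intro exI[of _ "[]"]) auto
 next
  case False
  note e = parent_edge[OF less.prems False]
  have "tm G (parent_edge v):X" using e(1) Fbar FX unfolding tm_def by auto
  then obtain p where "walk G tree p (tm G (parent_edge v)) x0" using less.hyps e by blast
  then show ?thesis using e False less.prems by (intro exI[of _ "parent_edge v#p"]) (auto simp: tree_def)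
 qed
qed

lemma tree_connected:
 assumes "a:X" "b:X"
 obtains p where "walk G tree p a b"
proof -
 obtain p q where "walk G tree p a x0" "walk G tree q b x0" using tree_walk_to_root assms by blast
 then show ?thesis using walk_rev[OF sg tree_E tree_gbar] walk_append[OF sg tree_E] that by blast
qed

lemma card_if_acyclic:
 assumes acyclic: "!!p a. walk G F p a a ==> reduced G p ==> p = []"
 shows "card F = 2*(card X-1)"
proof -
 have "e:tree" if e: "e:F" for e
 proof (rule ccontr)
  assume e_tree: "e ~: tree"
  have "tm G e:X" using Fbar[OF e] FX unfolding tm_def by auto
  then obtain p where p: "walk G tree p (tm G e) (gorg G e)" using tree_connected FX[OF e] by blast
  have walk_p: "walk G tree (red G p) (tm G e) (gorg G e)" by (rule walk_red[OF sg tree_E p])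
  have "gbar G e ~: tree" using e_tree tree_gbar[of "gbar G e"] serreD(4)[OF sg F_E[OF e]] by auto
  then have "red G p = [] | hd (red G p) ~= gbar G e"
   using walk_ends(3)[OF sg tree_E walk_p] hd_in_set[of "red G p"] by (metis subsetD)
  then have "reduced G (e#red G p)" by (simp add: reduced_Cons)
  moreover have "walk G F (e#red G p) (gorg G e) (gorg G e)" using e walk_mono[OF tree_F walk_p] by auto
  ultimately show False using acyclic by blast
 qed
 then have "F = tree" using tree_F by blast
 then show ?thesis using card_tree by simp
qed

lemma downward_edge:
 assumes "e:tree" "gbar G e:upward"
 shows "gbar G e = parent_edge (tm G e)" "depth (gorg G e) < depth (tm G e)"
proof -
 have e: "e:gE G" using assms(1) tree_E by auto
 obtain v where v: "v:X" "v ~= x0" "gbar G e = parent_edge v" using assms(2) by auto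
 have "v = tm G e" using parent_edge(2)[OF v(1,2)] v(3) serreD(7)[OF sg e] by simp
 then show "gbar G e = parent_edge (tm G e)" using v(3) by simp
 then show "depth (gorg G e) < depth (tm G e)"
  using parent_edge(3)[OF v(1,2)] \<open>v = tm G e\<close> serreD(6)[OF sg e] by simp
qed

text \<open>Once a reduced walk in the tree descends, it can never turn back.\<close>
lemma depth_less_if_downward:
 assumes "walk G tree (e#p) a b" "reduced G (e#p)" "gbar G e:upward"
 shows "depth a < depth b"
 using assms
proof (induction p arbitrary: e a)
 case Nil
 then show ?case using downward_edge(2)[of e] by simp
next
 case (Cons f p)
 have e: "e:tree" "gorg G e = a" and f: "f:tree" "gorg G f = tm G e" using Cons.prems(1) by auto
 have "gbar G f:upward"
 proof (rule ccontr)
  assume "gbar G f ~: upward"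
  then have "f = parent_edge (tm G e)" using tree_cases[OF f(1)] f(2) parent_edge(2) by auto
  then have "f = gbar G e" using downward_edge(1)[OF e(1) Cons.prems(3)] by simp
  then show False using Cons.prems(2) by (simp add: reduced_Cons)
 qed
 then have "depth (tm G e) < depth b" using Cons.prems by (intro Cons.IH[of f]) (auto simp: reduced_Cons)
 then show ?case using downward_edge(2)[OF e(1) Cons.prems(3)] e(2) by simp
qed

lemma hd_closed_tree_walk:
 assumes "walk G tree p a a" "reduced G p" "p ~= []"
 shows "hd p = parent_edge a"
proof -
 obtain e q where p: "p = e#q" using assms(3) by (cases p) auto
 have e: "e:tree" "gorg G e = a" using assms(1) p by auto
 have "gbar G e ~: upward" using depth_less_if_downward[of e q a a] assms p by auto
 then show ?thesis using tree_cases[OF e(1)] e(2) parent_edge(2) p by auto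
qed

lemma tree_acyclic: "walk G tree p a a ==> reduced G p ==> p = []"
proof (induction "length p" arbitrary: p a rule: less_induct)
 case less
 show ?case
 proof (rule ccontr)
  assume "p ~= []"
  then obtain e q where p: "p = e#q" by (cases p) auto
  have e: "e:tree" using less.prems p by auto
  then have eE: "e:gE G" using tree_E by auto
  have p_tree: "set p <= tree" by (rule walk_ends(3)[OF sg tree_E less.prems(1)])
  have "hd (rev_path G p) = parent_edge a"
   by (rule hd_closed_tree_walk[OF walk_rev[OF sg tree_E tree_gbar less.prems(1)]
      reduced_rev_path[OF sg _ less.prems(2)]]) (use p_tree tree_E p in auto)
  moreover have "hd p = parent_edge a" using hd_closed_tree_walk[OF less.prems] p by simp
  moreover have "hd (rev_path G p) = gbar G (last p)"
   using p by (simp add: rev_path_def hd_rev last_map del: list.map)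
  ultimately have "gbar G (last p) = e" using p by simp
  then have last_p: "last p = gbar G e"
   using gbar_eq_iff(2)[OF sg _ eE] last_in_set[OF \<open>p ~= []\<close>] p_tree tree_E by blast
  then have "q ~= []" using p serreD(3)[OF sg eE] by auto
  then have q: "q = butlast q@[gbar G e]" using last_p p by (metis append_butlast_last_id last_ConsR)
  have "walk G tree (butlast q@[gbar G e]) (tm G e) a" using less.prems(1) p q by auto
  then have "walk G tree (butlast q) (tm G e) (tm G e)"
   using walk_append[OF sg tree_E] serreD(7)[OF sg eE] by auto
  moreover have "reduced G (butlast q)"
   using less.prems(2) p q reduced_append[of G "butlast q" "[gbar G e]"] by (simp add: reduced_Cons)
  ultimately have "butlast q = []" using less.hyps[of "butlast q" "tm G e"] p by simp
  then show False using less.prems(2) p q by (simp add: reduced_Cons)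
 qed
qed

lemma card_iff_acyclic:
 "card F = 2*(card X-1) \<longleftrightarrow> (ALL p a. walk G F p a a & reduced G p --> p = [])"
proof
 assume "card F = 2*(card X-1)"
 then have F: "F = tree" using card_subset_eq[OF finite_F tree_F] card_tree by simp
 show "ALL p a. walk G F p a a & reduced G p --> p = []" using tree_acyclic walk_mono[OF equalityD1[OF F]] by blast
qed (rule card_if_acyclic, blast)

end

definition collapsed_edges :: "sgraph => (nat => nat option) => nat set" where
 "collapsed_edges G cE = {e:gE G. cE e = None}"

lemma collapsed_edges_E: "collapsed_edges G cE <= gE G" by (auto simp: collapsed_edges_def)

definition edge_compatible :: "sgraph => sgraph => (nat => nat) => (nat => nat option) => bool" where
 "edge_compatible G H cV cE \<longleftrightarrow> (ALL e:gE G. case cE e of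
     Some f => f:gE H & gorg H f = cV (gorg G e) & cE (gbar G e) = Some (gbar H f)
    | None => cV (gorg G e) = cV (tm G e) & cE (gbar G e) = None)"

lemma edge_compatibleI:
 assumes "!!e f. e:gE G ==> cE e = Some f ==> f:gE H & gorg H f = cV (gorg G e) & cE (gbar G e) = Some (gbar H f)"
  "!!e. e:gE G ==> cE e = None ==> cV (gorg G e) = cV (tm G e) & cE (gbar G e) = None"
 shows "edge_compatible G H cV cE"
 using assms by (auto simp: edge_compatible_def split: option.split)

lemma edge_compatible_None:
 "edge_compatible G H cV cE ==> e:gE G ==> cE e = None ==> cV (gorg G e) = cV (tm G e) & cE (gbar G e) = None"
 by (force simp: edge_compatible_def)

lemma edge_compatible_Some:
 "edge_compatible G H cV cE ==> e:gE G ==> cE e = Some f ==>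
   f:gE H & gorg H f = cV (gorg G e) & cE (gbar G e) = Some (gbar H f)"
 by (force simp: edge_compatible_def)

definition forest_collapse :: "sgraph => sgraph => (nat => nat) => (nat => nat option) => bool" where
 "forest_collapse G H cV cE \<longleftrightarrow> cV ` gV G = gV H & edge_compatible G H cV cE &
   (ALL f:gE H. EX! e. e:gE G & cE e = Some f) &
   (ALL a:gV G. ALL b:gV G. cV a = cV b --> (EX p. walk G (collapsed_edges G cE) p a b)) &
   (ALL p a. walk G (collapsed_edges G cE) p a a & reduced G p --> p = [])"

lemma forest_collapseI:
 assumes "cV ` gV G = gV H" "edge_compatible G H cV cE"
  "!!f. f:gE H ==> EX e:gE G. cE e = Some f"
  "!!e e' f. e:gE G ==> e':gE G ==> cE e = Some f ==> cE e' = Some f ==> e = e'"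
  "!!a b. a:gV G ==> b:gV G ==> cV a = cV b ==> EX p. walk G (collapsed_edges G cE) p a b"
  "!!p a. walk G (collapsed_edges G cE) p a a ==> reduced G p ==> p = []"
 shows "forest_collapse G H cV cE"
proof -
 have "EX! e. e:gE G & cE e = Some f" if "f:gE H" for f using assms(3)[OF that] assms(4) by blast
 then show ?thesis unfolding forest_collapse_def using assms(1,2,5,6) by auto
qed

abbreviation fiber_edges :: "sgraph => (nat => nat) => (nat => nat option) => nat => nat set" where
 "fiber_edges G cV cE w \<equiv> {e:gE G. cE e = None & cV (gorg G e) = w}"
abbreviation fiber_vertices :: "sgraph => (nat => nat) => nat => nat set" where
 "fiber_vertices G cV w \<equiv> {v:gV G. cV v = w}"

lemma walk_collapsed_iff_fiber:
 assumes "edge_compatible G H cV cE" "cV a = w"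
 shows "walk G (collapsed_edges G cE) p a b \<longleftrightarrow> walk G (fiber_edges G cV cE w) p a b"
proof
 assume "walk G (collapsed_edges G cE) p a b"
 then show "walk G (fiber_edges G cV cE w) p a b" using assms(2)
 proof (induction p arbitrary: a)
  case (Cons e p)
  then have e: "e:gE G" "cE e = None" "gorg G e = a" by (auto simp: collapsed_edges_def)
  then have "cV (tm G e) = w" using edge_compatible_None[OF assms(1) e(1,2)] Cons.prems by simp
  then show ?case using Cons e by auto
 qed auto
qed (erule walk_mono[rotated], auto simp: collapsed_edges_def)

lemma connected_subgraph_fiber:
 assumes sg: "serre_graph G" and ec: "edge_compatible G H cV cE" and x: "x:gV G"
  and conn: "!!a b. a:gV G ==> b:gV G ==> cV a = cV x ==> cV b = cV x ==>
    EX p. walk G (fiber_edges G cV cE (cV x)) p a b"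
 shows "connected_subgraph G (fiber_edges G cV cE (cV x)) (fiber_vertices G cV (cV x)) x"
proof
 fix e assume e: "e:fiber_edges G cV cE (cV x)"
 then show "gbar G e:fiber_edges G cV cE (cV x)"
  using edge_compatible_None[OF ec, of e] by (simp add: serreD[OF sg])
 show "gorg G e:fiber_vertices G cV (cV x)" using e by (simp add: serreD[OF sg])
qed (use sg x conn in auto)

lemma fibers_connected_iff:
 assumes im: "cV ` gV G = gV H" and ec: "edge_compatible G H cV cE"
 shows "(ALL w:gV H. ALL a:fiber_vertices G cV w. ALL b:fiber_vertices G cV w.
    EX p. walk G (fiber_edges G cV cE w) p a b) \<longleftrightarrow>
  (ALL a:gV G. ALL b:gV G. cV a = cV b --> (EX p. walk G (collapsed_edges G cE) p a b))" (is "?L \<longleftrightarrow> ?R")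
proof
 assume L: ?L
 show ?R
 proof (intro ballI impI)
  fix a b assume ab: "a:gV G" "b:gV G" "cV a = cV b"
  then have "cV a:gV H" using im by auto
  then show "EX p. walk G (collapsed_edges G cE) p a b"
   using L ab walk_collapsed_iff_fiber[OF ec refl] by simp
 qed
next
 assume R: ?R
 show ?L
 proof (intro ballI)
  fix w a b assume "a:fiber_vertices G cV w" "b:fiber_vertices G cV w"
  then show "EX p. walk G (fiber_edges G cV cE w) p a b"
   using bspec[OF bspec[OF R, of a], of b] walk_collapsed_iff_fiber[OF ec, of a w] by simp
 qed
qed

lemma fibers_acyclic_iff:
 assumes sg: "serre_graph G" and im: "cV ` gV G = gV H" and ec: "edge_compatible G H cV cE"
 shows "(ALL w:gV H. ALL p a. walk G (fiber_edges G cV cE w) p a a & reduced G p --> p = []) \<longleftrightarrow>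
  (ALL p a. walk G (collapsed_edges G cE) p a a & reduced G p --> p = [])" (is "?L \<longleftrightarrow> ?R")
proof
 assume L: ?L
 show ?R
 proof (intro allI impI, elim conjE)
  fix p a assume p: "walk G (collapsed_edges G cE) p a a" "reduced G p"
  have "cV a:gV H" using walk_ends(1)[OF sg collapsed_edges_E p(1)] im by blast
  moreover have "walk G (fiber_edges G cV cE (cV a)) p a a"
   using p(1) walk_collapsed_iff_fiber[OF ec refl] by simp
  ultimately show "p = []" using L p(2) by blast
 qed
next
 assume R: ?R
 show ?L
 proof (intro ballI allI impI, elim conjE)
  fix w p a assume p: "walk G (fiber_edges G cV cE w) p a a" "reduced G p"
  have "walk G (collapsed_edges G cE) p a a"
   by (rule walk_mono[OF _ p(1)]) (auto simp: collapsed_edges_def)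
  then show "p = []" using R p(2) by blast
 qed
qed

lemma collapse_iff_forest_collapse:
 assumes sg: "serre_graph G"
 shows "collapse G H cV cE \<longleftrightarrow> forest_collapse G H cV cE"
proof -
 let ?F = "fiber_edges G cV cE" and ?X = "fiber_vertices G cV"
 let ?conn = "%w. ALL a:?X w. ALL b:?X w. EX p. walk G (?F w) p a b"
 let ?acyc = "%w. ALL p a. walk G (?F w) p a a & reduced G p --> p = []"
 have "(ALL w:gV H. ?conn w & card (?F w) = 2*(card (?X w)-1)) \<longleftrightarrow>
   (ALL a:gV G. ALL b:gV G. cV a = cV b --> (EX p. walk G (collapsed_edges G cE) p a b)) &
   (ALL p a. walk G (collapsed_edges G cE) p a a & reduced G p --> p = [])" (is "?L \<longleftrightarrow> ?R")
  if im: "cV ` gV G = gV H" and ec: "edge_compatible G H cV cE"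
 proof -
  have "card (?F w) = 2*(card (?X w)-1) \<longleftrightarrow> ?acyc w" if w: "w:gV H" and conn: "?conn w" for w
  proof -
   obtain x where x: "x:gV G" "w = cV x" using w im by blast
   interpret connected_subgraph G "?F w" "?X w" x
    unfolding x(2) by (rule connected_subgraph_fiber[OF sg ec x(1)]) (use conn x(2) in auto)
   show ?thesis by (rule card_iff_acyclic)
  qed
  then have "?L \<longleftrightarrow> (ALL w:gV H. ?conn w) & (ALL w:gV H. ?acyc w)" by blast
  then show "?L \<longleftrightarrow> ?R"
   unfolding fibers_connected_iff[OF im ec] fibers_acyclic_iff[OF sg im ec] .
 qed
 then show ?thesis unfolding collapse_def forest_collapse_def edge_compatible_def[symmetric]
  by (intro conj_cong refl)
qed

definition edge_image :: "(nat => nat option) => nat => nat list" where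
 "edge_image cE e = (case cE e of None => [] | Some f => [f])"

lemma edge_image_simps:
 "cE e = None ==> edge_image cE e = []" "cE e = Some f ==> edge_image cE e = [f]"
 by (simp_all add: edge_image_def)

lemma collapse_path_subst: "collapse_path cE p = subst (edge_image cE) p"
 by (simp add: collapse_path_def subst_def edge_image_def[abs_def])

locale graph_collapse =
 fixes G H :: sgraph and cV :: "nat => nat" and cE :: "nat => nat option"
 assumes sG: "serre_graph G" and sH: "serre_graph H" and co: "forest_collapse G H cV cE"
begin

abbreviation push :: "nat list => nat list" where "push \<equiv> subst (edge_image cE)"

lemma cV_image: "cV ` gV G = gV H" using co unfolding forest_collapse_def by blast
lemma compatible: "edge_compatible G H cV cE" using co unfolding forest_collapse_def by blast

lemma cV_in: "v:gV G ==> cV v:gV H" using cV_image by auto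

lemma edge_Some: "e:gE G ==> cE e = Some f ==> f:gE H & gorg H f = cV (gorg G e) & cE (gbar G e) = Some (gbar H f)"
 using edge_compatible_Some[OF compatible] by blast

lemma edge_None: "e:gE G ==> cE e = None ==> cV (gorg G e) = cV (tm G e) & cE (gbar G e) = None"
 using edge_compatible_None[OF compatible] by blast

lemma edge_Some_tm: "e:gE G ==> cE e = Some f ==> tm H f = cV (tm G e)"
 using edge_Some[of e f] edge_Some[of "gbar G e" "gbar H f"] serreD[OF sG, of e] serreD[OF sH, of f] by auto

lemma edge_ex: "f:gE H ==> EX e:gE G. cE e = Some f"
 using co unfolding forest_collapse_def by blast

lemma edge_unique: "e:gE G ==> e':gE G ==> cE e = Some f ==> cE e' = Some f ==> e = e'"
proof -
 assume e: "e:gE G" "e':gE G" "cE e = Some f" "cE e' = Some f"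
 then have "f:gE H" using edge_Some by blast
 then have "EX! e. e:gE G & cE e = Some f" using co unfolding forest_collapse_def by blast
 then show ?thesis using e by blast
qed

lemma fiber_connected: "a:gV G ==> b:gV G ==> cV a = cV b ==> EX p. walk G (collapsed_edges G cE) p a b"
 using co unfolding forest_collapse_def by blast

lemma fiber_acyclic: "walk G (collapsed_edges G cE) p a a ==> reduced G p ==> p = []"
 using co unfolding forest_collapse_def by blast

lemma edge_image_hom: "hom_map G H (edge_image cE)"
 unfolding hom_map_def
proof (intro ballI conjI)
 fix e assume e: "e:gE G"
 show "set (edge_image cE e) <= gE H" using edge_Some[OF e] by (auto simp: edge_image_def split: option.splits)
 show "red H (edge_image cE (gbar G e)) = red H (rev_path H (edge_image cE e))"
 proof (cases "cE e")
  case None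
  then show ?thesis using edge_None[OF e] by (simp add: edge_image_def)
 next
  case (Some f)
  then show ?thesis using edge_Some[OF e] by (simp add: edge_image_def)
 qed
qed

lemma walk_push: "walk G (gE G) p a b ==> walk H (gE H) (push p) (cV a) (cV b)"
proof (induction p arbitrary: a)
 case Nil
 then show ?case using cV_in by auto
next
 case (Cons e p)
 then have e: "e:gE G" "gorg G e = a" and p: "walk H (gE H) (push p) (cV (tm G e)) (cV b)" by auto
 show ?case
 proof (cases "cE e")
  case None
  then show ?thesis using edge_None[OF e(1)] e p by (simp add: edge_image_simps)
 next
  case (Some f)
  then show ?thesis using edge_Some[OF e(1)] edge_Some_tm[OF e(1)] e p by (simp add: edge_image_simps)
 qed
qed

lemma push_Nil_iff: "set p <= gE G ==> push p = [] \<longleftrightarrow> set p <= collapsed_edges G cE"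
 by (induction p) (auto simp: edge_image_def collapsed_edges_def split: option.splits)

lemma push_Cons_split:
 assumes "set p <= gE G" "push p = f#q"
 shows "EX x e y. p = x@e#y & set x <= collapsed_edges G cE & cE e = Some f & push y = q"
 using assms
proof (induction p)
 case (Cons e p)
 show ?case
 proof (cases "cE e")
  case None
  then have "push p = f#q" using Cons.prems by (simp add: edge_image_simps)
  then obtain x e' y where "p = x@e'#y" "set x <= collapsed_edges G cE" "cE e' = Some f" "push y = q" using Cons by auto
  then show ?thesis using None Cons.prems by (intro exI[of _ "e#x"]) (auto simp: collapsed_edges_def)
 next
  case (Some f')
  then show ?thesis using Cons.prems by (intro exI[of _ "[]"]) (auto simp: edge_image_simps)
 qed
qed simp

lemma reduced_push:
 assumes "walk G (gE G) p a b" "reduced G p"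
 shows "reduced H (push p)"
 using assms
proof (induction p arbitrary: a)
 case (Cons e p)
 then have e: "e:gE G" and w: "walk G (gE G) p (tm G e) b" and r: "reduced G p" by (auto simp: reduced_Cons)
 have pE: "set p <= gE G" by (rule walk_E[OF sG w])
 have IH: "reduced H (push p)" using Cons.IH[OF w r] .
 show ?case
 proof (cases "cE e")
  case None
  then show ?thesis using IH by (simp add: edge_image_simps)
 next
  case (Some f)
  have "push p = [] | hd (push p) ~= gbar H f"
  proof (rule ccontr)
   assume "~ ?thesis"
   then obtain q where q: "push p = gbar H f#q" by (cases "push p") auto
   obtain x e' y where x: "p = x@e'#y" "set x <= collapsed_edges G cE" "cE e' = Some (gbar H f)"
    using push_Cons_split[OF pE q] by blast
   have e'E: "e':gE G" using pE x by auto
   have e': "e' = gbar G e"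
    using edge_unique[OF e'E serreD(2)[OF sG e] x(3)] edge_Some[OF e Some] by simp
   have "walk G (gE G) x (tm G e) (gorg G e')" using w x(1) walk_append[OF sG order_refl] by auto
   then have "walk G (collapsed_edges G cE) x (tm G e) (tm G e)" using walk_restrict[OF _ x(2)] e' serreD(7)[OF sG e] by simp
   moreover have "reduced G x" using r x(1) reduced_append by blast
   ultimately have "x = []" by (rule fiber_acyclic)
   then show False using Cons.prems(2) x(1) e' by (simp add: reduced_Cons)
  qed
  then show ?thesis using IH Some by (simp add: edge_image_simps reduced_Cons)
 qed
qed simp

lemma push_red:
 assumes "walk G (gE G) p a b"
 shows "push (red G p) = red H (push p)"
proof -
 have pE: "set p <= gE G" by (rule walk_E[OF sG assms])
 have "reduced H (push (red G p))" by (rule reduced_push[OF walk_red[OF sG order_refl assms] red_reduced])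
 then show ?thesis using red_subst_red[OF sG sH edge_image_hom pE] by (simp add: red_id)
qed

lemma walk_lift:
 assumes "walk H (gE H) q (cV a) (cV b)" "a:gV G" "b:gV G"
 shows "EX p. walk G (gE G) p a b & push p = q"
 using assms(1,2)
proof (induction q arbitrary: a)
 case Nil
 then obtain p where p: "walk G (collapsed_edges G cE) p a b" using fiber_connected assms(3) by auto
 then have "set p <= collapsed_edges G cE" by (rule walk_ends(3)[OF sG collapsed_edges_E])
 then have "push p = []" using push_Nil_iff collapsed_edges_E by blast
 then show ?case using walk_mono[OF collapsed_edges_E p] by blast
next
 case (Cons f q)
 then have f: "f:gE H" "gorg H f = cV a" "walk H (gE H) q (tm H f) (cV b)" by auto
 obtain e where e: "e:gE G" "cE e = Some f" using edge_ex[OF f(1)] by auto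
 have tme: "tm H f = cV (tm G e)" using edge_Some_tm[OF e] .
 then obtain p where p: "walk G (gE G) p (tm G e) b" "push p = q"
  using Cons.IH[of "tm G e"] f(3) serreD(5)[OF sG e(1)] by auto
 have "cV a = cV (gorg G e)" using edge_Some[OF e] f(2) by simp
 then obtain x where x: "walk G (collapsed_edges G cE) x a (gorg G e)" using fiber_connected[OF Cons.prems(2) serreD(1)[OF sG e(1)]] by blast
 then have "set x <= collapsed_edges G cE" by (rule walk_ends(3)[OF sG collapsed_edges_E])
 then have "push x = []" using push_Nil_iff collapsed_edges_E by blast
 moreover have "walk G (gE G) (x@e#p) a b"
  using walk_append[OF sG order_refl] walk_mono[OF collapsed_edges_E x] p(1) e(1) by auto
 ultimately show ?case using p(2) e(2) by (intro exI[of _ "x@e#p"]) (auto simp: edge_image_simps)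
qed

lemma red_push_Nil_iff:
 assumes "walk G (gE G) p a a"
 shows "red H (push p) = [] \<longleftrightarrow> red G p = []"
proof
 assume p: "red H (push p) = []"
 have w: "walk G (gE G) (red G p) a a" by (rule walk_red[OF sG order_refl assms])
 have "push (red G p) = []" using push_red[OF assms] p by simp
 then have "walk G (collapsed_edges G cE) (red G p) a a"
  using push_Nil_iff[OF walk_E[OF sG w]] walk_restrict[OF w] by blast
 then show "red G p = []" by (rule fiber_acyclic) simp
qed (simp flip: push_red[OF assms])

lemma red_push_eq_iff:
 assumes p: "walk G (gE G) p a b" and q: "walk G (gE G) q a b"
 shows "red H (push p) = red H (push q) \<longleftrightarrow> red G p = red G q"
proof -
 have "walk G (gE G) (p@rev_path G q) a a" using p walk_rev_E[OF sG q] walk_append[OF sG order_refl] by blast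
 then show ?thesis unfolding red_subst_eq_iff[OF sG sH edge_image_hom walk_E[OF sG p] walk_E[OF sG q]]
  red_eq_iff[OF sG walk_E[OF sG p] walk_E[OF sG q]] by (rule red_push_Nil_iff)
qed

lemma collapsed_edges_push:
 assumes "!!e. e:gE G ==> dE e = Option.bind (cE e) bE" "set p <= gE G"
 shows "set p <= collapsed_edges G dE \<longleftrightarrow> set (push p) <= collapsed_edges H bE"
 using assms(2)
proof (induction p)
 case (Cons e p)
 then show ?case using edge_Some[of e] assms(1)[of e]
  by (cases "cE e") (auto simp: edge_image_def collapsed_edges_def)
qed simp

lemma walk_collapsed_push:
 assumes "!!e. e:gE G ==> dE e = Option.bind (cE e) bE" "walk G (collapsed_edges G dE) p a b"
 shows "walk H (collapsed_edges H bE) (push p) (cV a) (cV b)"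
proof -
 have w: "walk G (gE G) p a b" by (rule walk_mono[OF collapsed_edges_E assms(2)])
 then show ?thesis using walk_restrict[OF walk_push[OF w]] collapsed_edges_push[of dE bE, OF assms(1) walk_E[OF sG w]]
   walk_ends(3)[OF sG collapsed_edges_E assms(2)] by blast
qed

lemma walk_collapsed_lift:
 assumes "!!e. e:gE G ==> dE e = Option.bind (cE e) bE" "walk H (collapsed_edges H bE) q (cV a) (cV b)"
  "a:gV G" "b:gV G"
 obtains p where "walk G (collapsed_edges G dE) p a b" "push p = q"
proof -
 obtain p where p: "walk G (gE G) p a b" "push p = q"
  using walk_lift[OF walk_mono[OF collapsed_edges_E assms(2)] assms(3,4)] by blast
 have "set p <= collapsed_edges G dE" using collapsed_edges_push[of dE bE, OF assms(1) walk_E[OF sG p(1)]] p(2)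
   walk_ends(3)[OF sH collapsed_edges_E assms(2)] by simp
 then show ?thesis using walk_restrict[OF p(1)] p(2) that by blast
qed

end

lemma edge_compatible_compose:
 assumes "graph_collapse G H cV cE" "edge_compatible H K bV bE"
 shows "edge_compatible G K (bV \<circ> cV) (%e. Option.bind (cE e) bE)"
proof -
 interpret graph_collapse G H cV cE by fact
 note bSome = edge_compatible_Some[OF assms(2)] and bNone = edge_compatible_None[OF assms(2)]
 show ?thesis
 proof (rule edge_compatibleI)
  fix e g assume e: "e:gE G" "Option.bind (cE e) bE = Some g"
  then obtain f where f: "cE e = Some f" "bE f = Some g" by (cases "cE e") auto
  then show "g:gE K & gorg K g = (bV \<circ> cV) (gorg G e) & Option.bind (cE (gbar G e)) bE = Some (gbar K g)"
   using edge_Some[OF e(1) f(1)] bSome[of f g] by simp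
 next
  fix e assume e: "e:gE G" "Option.bind (cE e) bE = None"
  show "(bV \<circ> cV) (gorg G e) = (bV \<circ> cV) (tm G e) & Option.bind (cE (gbar G e)) bE = None"
  proof (cases "cE e")
   case None
   then show ?thesis using edge_None[OF e(1)] by simp
  next
   case (Some f)
   then show ?thesis using e edge_Some[OF e(1) Some] edge_Some_tm[OF e(1) Some] bNone[of f] by simp
  qed
 qed
qed

lemma forest_collapse_compose:
 assumes "serre_graph G" "serre_graph H" "serre_graph K" "forest_collapse G H cV cE" "forest_collapse H K bV bE"
 shows "forest_collapse G K (bV \<circ> cV) (%e. Option.bind (cE e) bE)"
proof -
 interpret c: graph_collapse G H cV cE using assms by unfold_locales
 interpret b: graph_collapse H K bV bE using assms by unfold_locales
 let ?d = "%e. Option.bind (cE e) bE"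
 show ?thesis
 proof (rule forest_collapseI)
  show "(bV \<circ> cV) ` gV G = gV K" unfolding image_comp[symmetric] c.cV_image by (rule b.cV_image)
  show "edge_compatible G K (bV \<circ> cV) ?d"
   by (rule edge_compatible_compose[OF c.graph_collapse_axioms b.compatible])
 next
  fix f assume "f:gE K"
  then obtain g e where "g:gE H" "bE g = Some f" "e:gE G" "cE e = Some g"
   using b.edge_ex c.edge_ex by metis
  then show "EX e:gE G. ?d e = Some f" by force
 next
  fix e e' f assume e: "e:gE G" "e':gE G" "?d e = Some f" "?d e' = Some f"
  then obtain g g' where g: "cE e = Some g" "bE g = Some f" "cE e' = Some g'" "bE g' = Some f"
   by (cases "cE e"; cases "cE e'") auto
  then have "g = g'" using b.edge_unique[of g g' f] c.edge_Some e by blast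
  then show "e = e'" using c.edge_unique e g by blast
 next
  fix x y assume xy: "x:gV G" "y:gV G" "(bV \<circ> cV) x = (bV \<circ> cV) y"
  then obtain q where q: "walk H (collapsed_edges H bE) q (cV x) (cV y)"
   using b.fiber_connected[of "cV x" "cV y"] c.cV_in by auto
  show "EX p. walk G (collapsed_edges G ?d) p x y"
   by (rule c.walk_collapsed_lift[OF refl q xy(1,2)]) blast
 next
  fix p x assume p: "walk G (collapsed_edges G ?d) p x x" "reduced G p"
  have w: "walk G (gE G) p x x" by (rule walk_mono[OF collapsed_edges_E p(1)])
  have "c.push p = []"
   by (rule b.fiber_acyclic[OF c.walk_collapsed_push[OF refl p(1)] c.reduced_push[OF w p(2)]])
  then have "walk G (collapsed_edges G cE) p x x"
   using c.push_Nil_iff[OF walk_E[OF assms(1) w]] walk_restrict[OF w] by blast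
  then show "p = []" by (rule c.fiber_acyclic[OF _ p(2)])
 qed
qed

lemma edge_compatible_cancel:
 assumes "graph_collapse G H cV cE" "edge_compatible G K dV dE"
  and V: "!!v. v:gV G ==> bV (cV v) = dV v" and E: "!!e. e:gE G ==> dE e = Option.bind (cE e) bE"
 shows "edge_compatible H K bV bE"
proof -
 interpret graph_collapse G H cV cE by fact
 note dSome = edge_compatible_Some[OF assms(2)] and dNone = edge_compatible_None[OF assms(2)]
 have preimage: "EX e:gE G. dE e = bE f & dE (gbar G e) = bE (gbar H f) &
   bV (gorg H f) = dV (gorg G e) & bV (tm H f) = dV (tm G e)" if f: "f:gE H" for f
 proof -
  obtain e where e: "e:gE G" "cE e = Some f" using edge_ex[OF f] ..
  then show ?thesis using E[of e] E[of "gbar G e"] V[of "gorg G e"] V[of "tm G e"] edge_Some[OF e] edge_Some_tm[OF e]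
    serreD[OF sG e(1)] by (intro bexI[of _ e]) auto
 qed
 show ?thesis
 proof (rule edge_compatibleI)
  fix f g assume "f:gE H" "bE f = Some g"
  then show "g:gE K & gorg K g = bV (gorg H f) & bE (gbar H f) = Some (gbar K g)"
   using preimage[of f] dSome by force
 next
  fix f assume "f:gE H" "bE f = None"
  then show "bV (gorg H f) = bV (tm H f) & bE (gbar H f) = None" using preimage[of f] dNone by force
 qed
qed

lemma forest_collapse_cancel:
 assumes "serre_graph G" "serre_graph H" "serre_graph K" "forest_collapse G H cV cE" "forest_collapse G K dV dE"
  and V: "!!v. v:gV G ==> bV (cV v) = dV v" and E: "!!e. e:gE G ==> dE e = Option.bind (cE e) bE"
 shows "forest_collapse H K bV bE"
proof -
 interpret c: graph_collapse G H cV cE using assms by unfold_locales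
 interpret d: graph_collapse G K dV dE using assms by unfold_locales
 show ?thesis
 proof (rule forest_collapseI)
  show "bV ` gV H = gV K"
   unfolding c.cV_image[symmetric] d.cV_image[symmetric] image_image using V by (intro image_cong) auto
  show "edge_compatible H K bV bE"
   by (rule edge_compatible_cancel[OF c.graph_collapse_axioms d.compatible V E])
 next
  fix g assume "g:gE K"
  then obtain e where e: "e:gE G" "dE e = Some g" using d.edge_ex by blast
  then obtain f where f: "cE e = Some f" "bE f = Some g" using E[OF e(1)] by (cases "cE e") auto
  then show "EX f:gE H. bE f = Some g" using c.edge_Some[OF e(1)] by blast
 next
  fix f f' g assume f: "f:gE H" "f':gE H" "bE f = Some g" "bE f' = Some g"
  obtain e e' where e: "e:gE G" "cE e = Some f" "e':gE G" "cE e' = Some f'" using c.edge_ex f(1,2) by metis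
  then have "e = e'" using d.edge_unique[of e e' g] E f(3,4) by simp
  then show "f = f'" using e by simp
 next
  fix x y assume "x:gV H" "y:gV H" and xy: "bV x = bV y"
  then have "x:cV ` gV G" "y:cV ` gV G" using c.cV_image by simp_all
  then obtain u v where uv: "u:gV G" "v:gV G" "x = cV u" "y = cV v" by blast
  then obtain p where p: "walk G (collapsed_edges G dE) p u v" using d.fiber_connected xy V by metis
  then show "EX p. walk H (collapsed_edges H bE) p x y"
   using c.walk_collapsed_push[of dE bE, OF E p] uv by blast
 next
  fix q x assume q: "walk H (collapsed_edges H bE) q x x" "reduced H q"
  then obtain u where u: "u:gV G" "x = cV u"
   using walk_ends(1)[OF assms(2) collapsed_edges_E] c.cV_image by blast
  obtain p where p: "walk G (collapsed_edges G dE) p u u" "c.push p = q"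
   by (rule c.walk_collapsed_lift[of dE bE, OF E q(1)[unfolded u(2)] u(1) u(1)])
  have "red G p = []" by (rule d.fiber_acyclic[OF walk_red[OF assms(1) collapsed_edges_E p(1)] red_reduced])
  then show "q = []"
   using c.push_red[OF walk_mono[OF collapsed_edges_E p(1)]] p(2) red_id[OF q(2)] by simp
 qed
qed

lemma forest_collapse_factor:
 assumes "serre_graph G" "serre_graph H" "serre_graph K" "forest_collapse G H cV cE" "forest_collapse G K dV dE"
  and sub: "!!e. e:gE G ==> cE e = None ==> dE e = None"
 obtains bV bE where "forest_collapse H K bV bE" "!!v. v:gV G ==> bV (cV v) = dV v"
  "!!e. e:gE G ==> dE e = Option.bind (cE e) bE"
proof -
 interpret c: graph_collapse G H cV cE using assms by unfold_locales
 interpret d: graph_collapse G K dV dE using assms by unfold_locales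
 have "dV a = dV b" if "walk G (collapsed_edges G cE) p a b" for p a b
  using that by (induction p arbitrary: a) (use d.edge_None sub in \<open>auto simp: collapsed_edges_def\<close>)
 then have fiber: "dV a = dV b" if "a:gV G" "b:gV G" "cV a = cV b" for a b
  using c.fiber_connected that by blast
 define bV where "bV w = dV (SOME v. v:gV G & cV v = w)" for w
 define bE where "bE f = dE (THE e. e:gE G & cE e = Some f)" for f
 have V: "bV (cV v) = dV v" if v: "v:gV G" for v
 proof -
  let ?u = "SOME u. u:gV G & cV u = cV v"
  have "?u:gV G & cV ?u = cV v" by (rule someI[of _ v]) (use v in simp)
  then show ?thesis unfolding bV_def using fiber v by blast
 qed
 have "bE f = dE e" if e: "e:gE G" "cE e = Some f" for e f
 proof -
  have "(THE e. e:gE G & cE e = Some f) = e" by (rule the_equality) (use e c.edge_unique in auto)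
  then show ?thesis by (simp add: bE_def)
 qed
 then have E: "dE e = Option.bind (cE e) bE" if "e:gE G" for e
  using sub[OF that] that by (cases "cE e") auto
 show ?thesis by (rule that[OF forest_collapse_cancel[OF assms(1-5) V E] V E])
qed

section \<open>Markings\<close>

definition rose :: "nat => sgraph" where
 "rose r = \<lparr>gV = {0},gE = {..<2 * r},gorg = (%_. 0),gbar = (%e. if even e then e+1 else e-1),
   gEp = {e. e < 2 * r & even e}\<rparr>"

lemma rose_sel [simp]:
 "gV (rose r) = {0}" "gE (rose r) = {..<2 * r}" "gorg (rose r) e = 0" "tm (rose r) e = 0"
 "gbar (rose r) e = (if even e then e+1 else e-1)" "gEp (rose r) = {e. e < 2 * r & even e}"
 by (auto simp: rose_def tm_def)

lemma rose_serre: "serre_graph (rose r)"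
proof -
 have "gbar (rose r) e:gE (rose r) & gbar (rose r) e ~= e & gbar (rose r) (gbar (rose r) e) = e &
   (e:gEp (rose r) \<longleftrightarrow> gbar (rose r) e ~: gEp (rose r))" if e: "e < 2 * r" for e
 proof (cases "even e")
  case True
  then obtain k where "e = 2 * k" by (rule evenE)
  then show ?thesis using e by simp
 next
  case False
  then obtain k where "e = 2 * k+1" by (rule oddE)
  then show ?thesis using e by simp
 qed
 moreover have "gEp (rose r) <= gE (rose r)" by auto
 ultimately show ?thesis unfolding serre_graph_def by simp
qed

definition letter_edge :: "nat \<times> bool => nat" where "letter_edge x = (if snd x then 2 * fst x else 2 * fst x+1)"
definition petal :: "sgraph => nat list list => nat => nat list" where
 "petal G ws e = (if even e then ws ! (e div 2) else rev_path G (ws ! (e div 2)))"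

lemma petal_letter_edge: "petal G ws (letter_edge x) = letter_img G ws x"
 by (auto simp: petal_def letter_edge_def letter_img_def)

lemma eval_word_eq_subst: "eval_word G ws u = red G (subst (petal G ws) (map letter_edge u))"
 by (simp add: eval_word_def subst_def petal_letter_edge comp_def)

lemma letter_edge_word_exhaust:
 "set q <= gE (rose r) \<longleftrightarrow> (EX u. set (map fst u) <= {..<r} & q = map letter_edge u)"
proof
 assume q: "set q <= gE (rose r)"
 have "letter_edge (e div 2,even e) = e" for e by (auto simp: letter_edge_def)
 then have "q = map letter_edge (map (%e. (e div 2,even e)) q)" by (simp add: comp_def)
 moreover have "set (map fst (map (%e. (e div 2,even e)) q)) <= {..<r}" using q by auto
 ultimately show "EX u. set (map fst u) <= {..<r} & q = map letter_edge u" by blast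
qed (fastforce simp: letter_edge_def)

lemma freely_reduced_iff: "freely_reduced u \<longleftrightarrow> reduced (rose r) (map letter_edge u)"
proof -
 have "letter_edge y = gbar (rose r) (letter_edge x) \<longleftrightarrow> fst y = fst x & snd y ~= snd x" for x y
  by (cases "snd x"; cases "snd y") (auto simp: letter_edge_def, presburger+)
 then show ?thesis by (auto simp: freely_reduced_def reduced_def)
qed

definition premarking :: "nat => sgraph => nat \<times> nat list list => bool" where
 "premarking r G M \<longleftrightarrow> fst M:gV G & length (snd M) = r &
  (ALL w:set (snd M). walk G (gE G) w (fst M) (fst M) & reduced G w)"

lemma premarkingD:
 assumes "premarking r G M"
 shows "fst M:gV G" "length (snd M) = r" "w:set (snd M) ==> walk G (gE G) w (fst M) (fst M)"
  "w:set (snd M) ==> reduced G w"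
 using assms by (auto simp: premarking_def)

lemma premarking_edges: "serre_graph G ==> premarking r G M ==> w:set (snd M) ==> set w <= gE G"
 by (rule walk_E[OF _ premarkingD(3)])

lemma valid_marking_iff:
 "valid_marking r G M \<longleftrightarrow> premarking r G M &
   (ALL c. walk G (gE G) c (fst M) (fst M) & reduced G c -->
     (EX q. set q <= gE (rose r) & red G (subst (petal G (snd M)) q) = c)) &
   (ALL q. set q <= gE (rose r) & reduced (rose r) q & red G (subst (petal G (snd M)) q) = [] --> q = [])"
proof -
 obtain v ws where M: "M = (v,ws)" by (metis surj_pair)
 have ex: "(EX q. set q <= gE (rose r) & P q) \<longleftrightarrow> (EX u. set (map fst u) <= {..<r} & P (map letter_edge u))" for P
  unfolding letter_edge_word_exhaust by blast
 have all: "(ALL q. set q <= gE (rose r) & P q --> q = []) \<longleftrightarrow>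
   (ALL u. set (map fst u) <= {..<r} & P (map letter_edge u) --> u = [])" for P
  unfolding letter_edge_word_exhaust by (metis map_is_Nil_conv)
 show ?thesis unfolding M ex all valid_marking_def premarking_def eval_word_eq_subst freely_reduced_iff[of _ r]
  by (simp add: all_set_conv_all_nth cong: conj_cong)
qed

lemma valid_premarking: "valid_marking r G M ==> premarking r G M"
 by (simp add: valid_marking_iff)

lemma petal_walk:
 assumes "serre_graph G" "premarking r G M" "e:gE (rose r)"
 shows "walk G (gE G) (petal G (snd M) e) (fst M) (fst M)"
proof -
 have "snd M ! (e div 2):set (snd M)" using assms(3) premarkingD(2)[OF assms(2)] by (intro nth_mem) auto
 then show ?thesis using premarkingD(3)[OF assms(2)] walk_rev_E[OF assms(1)] by (auto simp: petal_def)
qed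

lemma petal_hom:
 assumes "serre_graph G" "premarking r G M"
 shows "hom_map (rose r) G (petal G (snd M))"
 unfolding hom_map_def
proof (intro ballI conjI)
 fix e assume e: "e:gE (rose r)"
 show petal_E: "set (petal G (snd M) e) <= gE G" by (rule walk_E[OF assms(1) petal_walk[OF assms e]])
 have "(e-1) div 2 = e div 2" if "odd e"
  using that by (metis odd_two_times_div_two_nat nonzero_mult_div_cancel_left zero_neq_numeral)
 moreover have "rev_path G (rev_path G (snd M ! (e div 2))) = snd M ! (e div 2)"
  using e premarkingD(2)[OF assms(2)] by (intro rev_path_rev_path[OF assms(1) premarking_edges[OF assms]] nth_mem) auto
 ultimately show "red G (petal G (snd M) (gbar (rose r) e)) = red G (rev_path G (petal G (snd M) e))"
  by (auto simp: petal_def)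
qed

lemma subst_walk:
 assumes "v:gV G" "serre_graph G" "!!e. e:set q ==> walk G (gE G) (\<phi> e) v v"
 shows "walk G (gE G) (subst \<phi> q) v v"
 using assms(3)
proof (induction q)
 case (Cons e q)
 then show ?case using walk_append[OF assms(2) order_refl, of "\<phi> e" "subst \<phi> q" v v] by auto
qed (use assms in auto)

lemma walk_petal_subst:
 assumes "serre_graph G" "premarking r G M" "set q <= gE (rose r)"
 shows "walk G (gE G) (subst (petal G (snd M)) q) (fst M) (fst M)"
 using assms(3) by (intro subst_walk[OF premarkingD(1)[OF assms(2)] assms(1)] petal_walk[OF assms(1,2)]) auto

definition conjugate :: "sgraph => nat list => nat list => nat list" where
 "conjugate G p w = red G (rev_path G p@w@p)"

lemma conjugate_conjugate:
 assumes sg: "serre_graph G" and p: "set p <= gE G" and w: "set w <= gE G"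
 shows "conjugate G q (conjugate G p w) = conjugate G (p@q) w"
proof -
 have "red G (red G (rev_path G p@w@p)@q) = red G ((rev_path G p@w@p)@q)"
  by (rule red_append_left[OF sg]) (use p w set_rev_path[OF sg p] in auto)
 then have "red G (rev_path G q@red G (rev_path G p@w@p)@q) = red G (rev_path G q@(rev_path G p@w@p)@q)"
  by (metis red_append_right)
 then show ?thesis by (simp add: conjugate_def)
qed

lemma conjugate_rev_path:
 assumes sg: "serre_graph G" and p: "set p <= gE G" and w: "set w <= gE G"
 shows "conjugate G (rev_path G p) (conjugate G p w) = red G w"
proof -
 have "conjugate G (rev_path G p) (conjugate G p w) = red G (p@rev_path G p@w@p@rev_path G p)"
  unfolding conjugate_conjugate[OF assms] by (simp add: conjugate_def rev_path_rev_path[OF sg p])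
 also have "... = red G (w@p@rev_path G p)" by (rule red_rev_path_right[OF sg p])
 also have "... = red G w"
  using red_rev_path_right[OF sg p, of "[]"] by (metis append_Nil2 red_append_right red.simps(1))
 finally show ?thesis .
qed

lemma conjugate_red: "conjugate G p (red G w) = conjugate G p w" if "serre_graph G" "set w <= gE G"
 unfolding conjugate_def by (metis red_append_left red_append_right that)

lemma conjugate_Nil: "serre_graph G ==> set p <= gE G ==> conjugate G p [] = []"
 by (simp add: conjugate_def red_rev_path_Nil)

lemma conjugate_eq_Nil:
 assumes sg: "serre_graph G" and p: "set p <= gE G" and w: "set w <= gE G" "conjugate G p w = []"
 shows "red G w = []"
 using conjugate_rev_path[OF sg p w(1)] conjugate_Nil[OF sg set_rev_path[OF sg p]] w(2) by simp

lemma conjugate_append: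
 assumes sg: "serre_graph G" and "set g <= gE G" "set p <= gE G"
 shows "red G (conjugate G g p@conjugate G g q) = conjugate G g (p@q)"
proof -
 have "red G (conjugate G g p@conjugate G g q) = red G ((rev_path G g@p@g)@rev_path G g@q@g)"
  unfolding conjugate_def red_append_right
  by (rule red_append_left[OF sg]) (use assms set_rev_path[OF sg] in auto)
 also have "... = red G ((rev_path G g@p)@red G (g@rev_path G g@q@g))" unfolding red_append_right by simp
 also have "... = conjugate G g (p@q)"
  unfolding red_rev_path_right[OF assms(1,2)] red_append_right by (simp add: conjugate_def)
 finally show ?thesis .
qed

lemma walk_conjugate:
 assumes sg: "serre_graph G" and p: "walk G (gE G) p a b" and w: "walk G (gE G) w a a"
 shows "walk G (gE G) (conjugate G p w) b b"
 unfolding conjugate_def using walk_rev_E[OF sg p] p w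
 by (intro walk_red[OF sg order_refl]) (use walk_append[OF sg order_refl] in blast)

lemma red_subst_conjugate:
 assumes sg: "serre_graph G" "serre_graph H" and hom: "hom_map G H \<phi>" and p: "set p <= gE G" and w: "set w <= gE G"
 shows "red H (subst \<phi> (conjugate G p w)) = conjugate H (subst \<phi> p) (red H (subst \<phi> w))"
proof -
 note sets = p w set_rev_path[OF sg(1) p] set_subst[OF hom]
 have "red H (subst \<phi> (conjugate G p w)) = red H (subst \<phi> (rev_path G p@w@p))"
  unfolding conjugate_def by (rule red_subst_red[OF sg hom]) (use sets in auto)
 also have "... = conjugate H (subst \<phi> p) (red H (subst \<phi> w))"
  unfolding subst_simps conjugate_def
  by (intro red_append_cong[OF sg(2)] sets set_rev_path[OF sg(2)] order_trans[OF set_red]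
    red_subst_rev_path[OF sg hom] refl red_red[symmetric])
 finally show ?thesis .
qed

lemma marking_equiv_iff:
 "marking_equiv G M M' \<longleftrightarrow>
  (EX p. walk G (gE G) p (fst M) (fst M') & snd M' = map (conjugate G p) (snd M))"
 by (cases M; cases M') (auto simp: marking_equiv_def conjugate_def list_eq_iff_nth_eq)

lemma marking_equiv_refl: "serre_graph G ==> premarking r G M ==> marking_equiv G M M"
 unfolding marking_equiv_iff
 by (rule exI[of _ "[]"]) (auto simp: premarking_def conjugate_def red_id intro: map_idI[symmetric])

lemma marking_equiv_trans:
 assumes sg: "serre_graph G" and w: "premarking r G M1" and "marking_equiv G M1 M2" "marking_equiv G M2 M3"
 shows "marking_equiv G M1 M3"
proof -
 obtain p where p: "walk G (gE G) p (fst M1) (fst M2)" "snd M2 = map (conjugate G p) (snd M1)"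
  using assms(3) unfolding marking_equiv_iff by blast
 obtain q where q: "walk G (gE G) q (fst M2) (fst M3)" "snd M3 = map (conjugate G q) (snd M2)"
  using assms(4) unfolding marking_equiv_iff by blast
 have "walk G (gE G) (p@q) (fst M1) (fst M3)" using p q walk_append[OF sg order_refl] by blast
 moreover have "snd M3 = map (conjugate G (p@q)) (snd M1)"
  using conjugate_conjugate[OF sg walk_E[OF sg p(1)] premarking_edges[OF sg w]] by (simp add: p(2) q(2))
 ultimately show ?thesis unfolding marking_equiv_iff by blast
qed

lemma marking_equiv_sym:
 assumes sg: "serre_graph G" and w: "premarking r G M" and "marking_equiv G M M'"
 shows "marking_equiv G M' M"
proof -
 obtain p where p: "walk G (gE G) p (fst M) (fst M')" "snd M' = map (conjugate G p) (snd M)"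
  using assms(3) unfolding marking_equiv_iff by blast
 have "conjugate G (rev_path G p) (conjugate G p u) = u" if "u:set (snd M)" for u
  using conjugate_rev_path[OF sg walk_E[OF sg p(1)] premarking_edges[OF sg w that]] premarkingD(4)[OF w that]
  by (simp add: red_id)
 then have "snd M = map (conjugate G (rev_path G p)) (snd M')" unfolding p(2) by (simp add: map_idI comp_def)
 then show ?thesis unfolding marking_equiv_iff using walk_rev_E[OF sg p(1)] by blast
qed

context graph_collapse
begin

lemma comp_marking_eq: "comp_marking H cV cE M = (cV (fst M),map (%w. red H (push w)) (snd M))"
 by (simp add: comp_marking_def collapse_path_subst)

lemma comp_premarking: "premarking r G M ==> premarking r H (comp_marking H cV cE M)"
 by (auto simp: comp_marking_eq premarking_def cV_in intro!: walk_red[OF sH order_refl] walk_push)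

lemma comp_marking_equiv:
 assumes w: "premarking r G M" and "marking_equiv G M M'"
 shows "marking_equiv H (comp_marking H cV cE M) (comp_marking H cV cE M')"
proof -
 obtain p where p: "walk G (gE G) p (fst M) (fst M')" "snd M' = map (conjugate G p) (snd M)"
  using assms(2) unfolding marking_equiv_iff by blast
 have "snd (comp_marking H cV cE M') = map (conjugate H (push p)) (snd (comp_marking H cV cE M))"
  using red_subst_conjugate[OF sG sH edge_image_hom walk_E[OF sG p(1)] premarking_edges[OF sG w]] by (simp add: p(2) comp_marking_eq)
 then show ?thesis unfolding marking_equiv_iff using walk_push[OF p(1)] by (auto simp: comp_marking_eq)
qed

lemma marking_equiv_if_comp:
 assumes w: "premarking r G M" "premarking r G M'"
  and "marking_equiv H (comp_marking H cV cE M) (comp_marking H cV cE M')"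
 shows "marking_equiv G M M'"
proof -
 obtain q where q: "walk H (gE H) q (cV (fst M)) (cV (fst M'))"
  "map (%w. red H (push w)) (snd M') = map (conjugate H q) (map (%w. red H (push w)) (snd M))"
  using assms(3) unfolding marking_equiv_iff comp_marking_eq by auto
 obtain p where p: "walk G (gE G) p (fst M) (fst M')" "push p = q"
  using walk_lift[OF q(1)] premarkingD(1) w by blast
 have conj: "walk G (gE G) (conjugate G p u) (fst M') (fst M')" if "u:set (snd M)" for u
  by (rule walk_conjugate[OF sG p(1) premarkingD(3)[OF w(1) that]])
 have "map (%w. red H (push w)) (snd M') = map (%w. red H (push w)) (map (conjugate G p) (snd M))"
  using q(2) p(2) red_subst_conjugate[OF sG sH edge_image_hom walk_E[OF sG p(1)] premarking_edges[OF sG w(1)]] by simp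
 moreover have "inj_on (%w. red H (push w)) (set (snd M') \<union> set (map (conjugate G p) (snd M)))"
 proof (rule inj_onI)
  fix u u' assume u: "u:set (snd M') \<union> set (map (conjugate G p) (snd M))"
   "u':set (snd M') \<union> set (map (conjugate G p) (snd M))" and eq: "red H (push u) = red H (push u')"
  have "walk G (gE G) u (fst M') (fst M') & red G u = u" "walk G (gE G) u' (fst M') (fst M') & red G u' = u'"
   using u conj premarkingD(3,4)[OF w(2)] by (auto simp: red_id conjugate_def)
  then show "u = u'" using red_push_eq_iff[of u "fst M'" "fst M'" u'] eq by simp
 qed
 ultimately have "snd M' = map (conjugate G p) (snd M)" by (rule map_inj_on)
 then show ?thesis unfolding marking_equiv_iff using p(1) by blast
qed

lemma red_subst_petal_comp:
 assumes w: "premarking r G M" and q: "set q <= gE (rose r)"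
 shows "red H (subst (petal H (snd (comp_marking H cV cE M))) q) = red H (push (subst (petal G (snd M)) q))"
proof -
 have "push (subst (petal G (snd M)) q) = subst (%e. push (petal G (snd M) e)) q" by (induction q) auto
 moreover have "red H (subst (petal H (snd (comp_marking H cV cE M))) q) = red H (subst (%e. push (petal G (snd M) e)) q)"
 proof (rule red_subst_letterwise[OF sH])
  fix e assume "e:set q"
  then have e: "e:gE (rose r)" "e div 2 < r" using q by auto
  let ?u = "snd M ! (e div 2)"
  have u: "set ?u <= gE G"
   by (rule premarking_edges[OF sG w nth_mem]) (use e premarkingD(2)[OF w] in simp)
  note pu = set_subst[OF edge_image_hom u]
  then have "red H (rev_path H (red H (push ?u))) = red H (push (rev_path G ?u))"
   using red_rev_path[OF sH order_trans[OF set_red]] red_rev_path[OF sH]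
    red_subst_rev_path[OF sG sH edge_image_hom u] by simp
  moreover have "petal H (snd (comp_marking H cV cE M)) e = (if even e then red H (push ?u) else rev_path H (red H (push ?u)))"
   using e premarkingD(2)[OF w] by (simp add: petal_def comp_marking_eq)
  ultimately have "red H (petal H (snd (comp_marking H cV cE M)) e) = red H (push (petal G (snd M) e))"
   by (simp add: petal_def)
  then show "set (petal H (snd (comp_marking H cV cE M)) e) <= gE H & set (push (petal G (snd M) e)) <= gE H &
   red H (petal H (snd (comp_marking H cV cE M)) e) = red H (push (petal G (snd M) e))"
   using walk_E[OF sH petal_walk[OF sH comp_premarking[OF w] e(1)]]
    set_subst[OF edge_image_hom walk_E[OF sG petal_walk[OF sG w e(1)]]] by blast
 qed
 ultimately show ?thesis by simp
qed

lemma valid_comp_marking_iff: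
 assumes w: "premarking r G M"
 shows "valid_marking r H (comp_marking H cV cE M) \<longleftrightarrow> valid_marking r G M"
proof -
 let ?v = "fst M" and ?g = "subst (petal G (snd M))" and ?h = "subst (petal H (snd (comp_marking H cV cE M)))"
 note walk_g = walk_petal_subst[OF sG w] and h_eq = red_subst_petal_comp[OF w]
 have inj: "red H (?h q) = [] \<longleftrightarrow> red G (?g q) = []" if "set q <= gE (rose r)" for q
  using h_eq[OF that] red_push_Nil_iff[OF walk_g[OF that]] by simp
 have surj: "red H (?h q) = red H (push c) \<longleftrightarrow> red G (?g q) = red G c"
  if "set q <= gE (rose r)" "walk G (gE G) c ?v ?v" for q c
  using h_eq[OF that(1)] red_push_eq_iff[OF walk_g[OF that(1)] that(2)] by simp
 have "(ALL c. walk H (gE H) c (cV ?v) (cV ?v) & reduced H c --> (EX q. set q <= gE (rose r) & red H (?h q) = c)) \<longleftrightarrow>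
  (ALL c. walk G (gE G) c ?v ?v & reduced G c --> (EX q. set q <= gE (rose r) & red G (?g q) = c))" (is "?H \<longleftrightarrow> ?G")
 proof
  assume H: ?H
  show ?G
  proof (intro allI impI, elim conjE)
   fix c assume c: "walk G (gE G) c ?v ?v" "reduced G c"
   obtain q where "set q <= gE (rose r)" "red H (?h q) = push c"
    using H walk_push[OF c(1)] reduced_push[OF c] by blast
   then show "EX q. set q <= gE (rose r) & red G (?g q) = c"
    using surj[OF _ c(1)] red_id[OF c(2)] red_id[OF reduced_push[OF c]] by metis
  qed
 next
  assume G: ?G
  show ?H
  proof (intro allI impI, elim conjE)
   fix c assume c: "walk H (gE H) c (cV ?v) (cV ?v)" "reduced H c"
   obtain p where p: "walk G (gE G) p ?v ?v" "push p = c" using walk_lift[OF c(1)] premarkingD(1)[OF w] by blast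
   obtain q where "set q <= gE (rose r)" "red G (?g q) = red G p"
    using G walk_red[OF sG order_refl p(1)] red_reduced by blast
   then show "EX q. set q <= gE (rose r) & red H (?h q) = c"
    using surj[OF _ p(1)] p(2) red_id[OF c(2)] by metis
  qed
 qed
 moreover have "(ALL q. set q <= gE (rose r) & reduced (rose r) q & red H (?h q) = [] --> q = []) \<longleftrightarrow>
  (ALL q. set q <= gE (rose r) & reduced (rose r) q & red G (?g q) = [] --> q = [])"
  using inj by (intro all_cong1) auto
 ultimately show ?thesis unfolding valid_marking_iff using w comp_premarking[OF w] by (simp only: comp_marking_eq fst_conv simp_thms)
qed

lemma valid_comp_marking: "valid_marking r G M ==> valid_marking r H (comp_marking H cV cE M)"
 by (simp add: valid_comp_marking_iff valid_premarking)

lemma marking_lift: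
 assumes "valid_marking r H N"
 obtains M where "valid_marking r G M" "comp_marking H cV cE M = N"
proof -
 note N = premarkingD[OF valid_premarking[OF assms]]
 have "fst N:cV ` gV G" using N(1) cV_image by simp
 then obtain v where v: "v:gV G" "cV v = fst N" by (metis imageE)
 have "EX p. walk G (gE G) p v v & push p = u" if "u:set (snd N)" for u
  using walk_lift[of u v v] N(3)[OF that] v by simp
 then obtain P where P: "!!u. u:set (snd N) ==> walk G (gE G) (P u) v v & push (P u) = u" by metis
 define M where "M = (v,map (%u. red G (P u)) (snd N))"
 have M: "premarking r G M" using v(1) N(2) P walk_red[OF sG order_refl] by (auto simp: M_def premarking_def)
 have "red H (push (red G (P u))) = u" if u: "u:set (snd N)" for u
  using push_red[of "P u" v v] P[OF u] N(4)[OF u] by (simp add: red_id)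
 then have "comp_marking H cV cE M = N"
  by (simp add: comp_marking_eq M_def v(2) comp_def map_idI prod_eq_iff)
 then show ?thesis using that assms valid_comp_marking_iff[OF M] by simp
qed

end

definition marked_collapse :: "sgraph => nat \<times> nat list list => sgraph => nat \<times> nat list list => (nat => nat) => (nat => nat option) => bool" where
 "marked_collapse G M H N cV cE \<longleftrightarrow> forest_collapse G H cV cE & marking_equiv H N (comp_marking H cV cE M)"

lemma edge_image_bind: "subst (edge_image (%e. Option.bind (cE e) bE)) p = subst (edge_image bE) (subst (edge_image cE) p)"
proof (induction p)
 case (Cons e p)
 then show ?case by (cases "cE e") (simp_all add: edge_image_def[of _ e] edge_image_def[of bE])
qed simp

lemma comp_marking_compose:
 assumes sg: "serre_graph G" "serre_graph H" "serre_graph K" and c: "forest_collapse G H cV cE" and b: "forest_collapse H K bV bE" and w: "premarking r G M"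
 shows "comp_marking K (bV \<circ> cV) (%e. Option.bind (cE e) bE) M = comp_marking K bV bE (comp_marking H cV cE M)"
proof -
 interpret c: graph_collapse G H cV cE using sg c by unfold_locales
 interpret b: graph_collapse H K bV bE using sg b by unfold_locales
 have "red K (b.push (red H (c.push u))) = red K (b.push (c.push u))" if "u:set (snd M)" for u
  by (rule red_subst_red[OF sg(2,3) b.edge_image_hom set_subst[OF c.edge_image_hom premarking_edges[OF sg(1) w that]]])
 then show ?thesis by (simp add: comp_marking_def collapse_path_subst edge_image_bind)
qed

lemma marked_collapse_compose:
 assumes sg: "serre_graph G" "serre_graph H" "serre_graph K" and w: "premarking r G M" "premarking r H N" "premarking r K J"
  and c: "marked_collapse G M H N cV cE" and b: "marked_collapse H N K J bV bE"
 shows "marked_collapse G M K J (bV \<circ> cV) (%e. Option.bind (cE e) bE)"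
proof -
 interpret c: graph_collapse G H cV cE using sg c by unfold_locales (auto simp: marked_collapse_def)
 interpret b: graph_collapse H K bV bE using sg b by unfold_locales (auto simp: marked_collapse_def)
 have "marking_equiv K J (comp_marking K bV bE N)" using b by (simp add: marked_collapse_def)
 moreover have "marking_equiv K (comp_marking K bV bE N) (comp_marking K bV bE (comp_marking H cV cE M))"
  by (rule b.comp_marking_equiv[OF w(2)]) (use c in \<open>simp add: marked_collapse_def\<close>)
 ultimately have "marking_equiv K J (comp_marking K bV bE (comp_marking H cV cE M))"
  by (rule marking_equiv_trans[OF sg(3) w(3)])
 then show ?thesis unfolding marked_collapse_def
  using forest_collapse_compose[OF sg c.co b.co] comp_marking_compose[OF sg c.co b.co w(1)] by simp
qed

lemma comp_marking_cong:
 assumes "serre_graph G" "premarking r G M" "cV (fst M) = dV (fst M)" "!!e. e:gE G ==> cE e = dE e"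
 shows "comp_marking H cV cE M = comp_marking H dV dE M"
proof -
 have "subst (edge_image cE) p = subst (edge_image dE) p" if "set p <= gE G" for p
  using that assms(4) by (induction p) (auto simp: edge_image_def)
 then show ?thesis using assms(3) premarking_edges[OF assms(1,2)]
  by (simp add: comp_marking_def collapse_path_subst)
qed

lemma marked_collapse_factor:
 assumes sg: "serre_graph G" "serre_graph H" "serre_graph K" and w: "premarking r G M" "premarking r H N" "premarking r K J"
  and c: "marked_collapse G M H N cV cE" and d: "marked_collapse G M K J dV dE"
  and sub: "!!e. e:gE G ==> cE e = None ==> dE e = None"
 obtains bV bE where "marked_collapse H N K J bV bE" "!!e. e:gE G ==> dE e = Option.bind (cE e) bE"
proof -
 have forest_c: "forest_collapse G H cV cE" and forest_d: "forest_collapse G K dV dE" using c d by (auto simp: marked_collapse_def)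
 obtain bV bE where b: "forest_collapse H K bV bE" "!!v. v:gV G ==> bV (cV v) = dV v" "!!e. e:gE G ==> dE e = Option.bind (cE e) bE"
  using forest_collapse_factor[OF sg forest_c forest_d sub] by blast
 interpret b: graph_collapse H K bV bE using sg b(1) by unfold_locales
 have "comp_marking K dV dE M = comp_marking K (bV \<circ> cV) (%e. Option.bind (cE e) bE) M"
  by (rule comp_marking_cong[OF sg(1) w(1)]) (use b(2,3) premarkingD(1)[OF w(1)] in auto)
 also have "... = comp_marking K bV bE (comp_marking H cV cE M)" by (rule comp_marking_compose[OF sg forest_c b(1) w(1)])
 finally have "marking_equiv K (comp_marking K bV bE N) (comp_marking K dV dE M)"
  using b.comp_marking_equiv[OF w(2)] c by (simp add: marked_collapse_def)
 then have "marking_equiv K (comp_marking K dV dE M) (comp_marking K bV bE N)"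
  by (rule marking_equiv_sym[OF sg(3) b.comp_premarking[OF w(2)]])
 then have "marking_equiv K J (comp_marking K bV bE N)"
  using marking_equiv_trans[OF sg(3) w(3)] d unfolding marked_collapse_def by blast
 then show ?thesis using that b(1,3) by (auto simp: marked_collapse_def)
qed

lemma forest_collapse_id: "serre_graph G ==> forest_collapse G G id Some"
proof (rule forest_collapseI)
 assume sg: "serre_graph G"
 then show "edge_compatible G G id Some" by (intro edge_compatibleI) (auto simp: serreD)
 fix p a assume "walk G (collapsed_edges G Some) p a a"
 then show "p = []" by (cases p) (auto simp: collapsed_edges_def)
qed (auto intro: exI[of _ "[]"])

lemma subst_edge_image_Some: "subst (edge_image (%e. Some (f e))) p = map f p"
 by (induction p) (auto simp: edge_image_def)

lemma comp_marking_Some: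
 assumes "premarking r G M" "!!w. w:set (snd M) ==> red H (map fE w) = map fE w"
 shows "comp_marking H fV (%e. Some (fE e)) M = (fV (fst M),map (map fE) (snd M))"
 using assms(2) by (simp add: comp_marking_def collapse_path_subst subst_edge_image_Some)

lemma comp_marking_id: "premarking r G M ==> comp_marking G id Some M = M"
 using comp_marking_Some[of r G M G "%e. e" id] by (simp add: premarkingD(4) red_id)

lemma marked_collapse_id: "serre_graph G ==> premarking r G M ==> marked_collapse G M G M id Some"
 by (simp add: marked_collapse_def forest_collapse_id marking_equiv_refl comp_marking_id)

lemma len_pullback:
 assumes "serre_graph G" "serre_graph H" "forest_collapse G H cV cE" "e:gE G"
 shows "len G (pullback G cE H l) e = (case cE e of Some f => len H l f | None => 0)"
proof (cases "e:gEp G")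
 case False
 interpret graph_collapse G H cV cE using assms by unfold_locales
 have "gbar G e:gEp G" using serre_Ep[OF assms(1,4)] False by simp
 then show ?thesis using False edge_None[OF assms(4)] edge_Some[OF assms(4)] len_gbar[OF assms(2)]
  by (cases "cE e") (auto simp: len_def[of G] pullback_def)
qed (simp add: len_def pullback_def)

lemma pullback_eqI:
 assumes "serre_graph G" "serre_graph H" "forest_collapse G H cV cE" "!!e. e ~: gEp G ==> lam e = 0"
  "!!e. e:gE G ==> len G lam e = (case cE e of Some f => len H l f | None => 0)"
 shows "lam = pullback G cE H l"
proof
 fix e show "lam e = pullback G cE H l e"
  using assms(4)[of e] assms(5)[of e] serre_fin(3)[OF assms(1)] by (auto simp: pullback_def len_def)
qed

definition isometric :: "mmg => mmg => bool" where
 "isometric t t' \<longleftrightarrow> (case t of (G,M,l) => case t' of (G',M',l') =>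
   EX cV cE. marked_collapse G M G' M' cV cE & (ALL e:gE G. EX f. cE e = Some f & len G' l' f = len G l e))"

lemma isometricI:
 assumes "marked_collapse G M G' M' cV cE" "!!e. e:gE G ==> EX f. cE e = Some f & len G' l' f = len G l e"
 shows "isometric (G,M,l) (G',M',l')"
 using assms unfolding isometric_def by auto

lemma isometricE:
 assumes "isometric (G,M,l) (G',M',l')"
 obtains cV cE where "marked_collapse G M G' M' cV cE" "!!e. e:gE G ==> EX f. cE e = Some f & len G' l' f = len G l e"
 using assms unfolding isometric_def by auto

lemma graph_iso_forest_collapse:
 assumes "serre_graph G" "serre_graph G'" "graph_iso G G' fV fE"
 shows "forest_collapse G G' fV (%e. Some (fE e))"
proof -
 have V: "inj_on fV (gV G)" "fV ` gV G = gV G'" and E: "inj_on fE (gE G)" "fE ` gE G = gE G'"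
  and ends: "!!e. e:gE G ==> gorg G' (fE e) = fV (gorg G e) & fE (gbar G e) = gbar G' (fE e)"
  using assms(3) by (auto simp: graph_iso_def bij_betw_def)
 have no_edges: "collapsed_edges G (%e. Some (fE e)) = {}" by (auto simp: collapsed_edges_def)
 show ?thesis
 proof (rule forest_collapseI)
  show "edge_compatible G G' fV (%e. Some (fE e))" by (rule edge_compatibleI) (use E ends in auto)
  fix p a assume "walk G (collapsed_edges G (%e. Some (fE e))) p a a"
  then show "p = []" by (cases p) (auto simp: no_edges)
 next
  fix a b assume "a:gV G" "b:gV G" "fV a = fV b"
  then have "a = b" using V(1) by (simp add: inj_on_eq_iff)
  then show "EX p. walk G (collapsed_edges G (%e. Some (fE e))) p a b" using \<open>a : gV G\<close> by (intro exI[of _ "[]"]) simp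
 next
  fix f assume "f:gE G'"
  then show "EX e:gE G. Some (fE e) = Some f" unfolding E(2)[symmetric] by blast
 qed (use V E in \<open>auto simp: inj_on_eq_iff\<close>)
qed

lemma comp_marking_graph_iso:
 assumes "serre_graph G" "serre_graph G'" "graph_iso G G' fV fE" "premarking r G M"
 shows "comp_marking G' fV (%e. Some (fE e)) M = (fV (fst M),map (map fE) (snd M))"
proof (rule comp_marking_Some[OF assms(4)])
 interpret graph_collapse G G' fV "%e. Some (fE e)"
  using assms graph_iso_forest_collapse[OF assms(1-3)] by unfold_locales
 fix w assume "w:set (snd M)"
 then show "red G' (map fE w) = map fE w"
  using reduced_push[OF premarkingD(3,4)[OF assms(4)]] by (simp add: subst_edge_image_Some red_id)
qed

lemma (in graph_collapse) graph_iso_if_nothing_collapsed: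
 assumes fE: "!!e. e:gE G ==> cE e = Some (fE e)"
 shows "graph_iso G H cV fE"
proof -
 have "collapsed_edges G cE = {}" using fE by (auto simp: collapsed_edges_def)
 then have "a = b" if "a:gV G" "b:gV G" "cV a = cV b" for a b
  using fiber_connected[OF that] by (metis empty_iff walk.elims(2))
 then have "bij_betw cV (gV G) (gV H)" using cV_image by (auto simp: bij_betw_def inj_on_def)
 moreover have "bij_betw fE (gE G) (gE H)"
 proof (rule bij_betw_imageI)
  show "inj_on fE (gE G)" by (rule inj_onI) (metis fE edge_unique)
  show "fE ` gE G = gE H" using edge_Some edge_ex fE by force
 qed
 ultimately show ?thesis unfolding graph_iso_def
  using edge_Some[OF _ fE] serreD(2)[OF sG] fE by (metis option.inject)
qed

lemma mmg_equiv_iff_isometric: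
 assumes sg: "serre_graph G" "serre_graph G'" and w: "premarking r G M" "premarking r G' M'"
 shows "mmg_equiv (G,M,l) (G',M',l') \<longleftrightarrow> isometric (G,M,l) (G',M',l')"
proof
 assume "mmg_equiv (G,M,l) (G',M',l')"
 then obtain fV fE where f: "graph_iso G G' fV fE" "ALL e:gE G. len G' l' (fE e) = len G l e"
  "marking_equiv G' (fV (fst M),map (map fE) (snd M)) M'" by (auto simp: mmg_equiv_def)
 interpret graph_collapse G G' fV "%e. Some (fE e)" using sg graph_iso_forest_collapse[OF sg f(1)] by unfold_locales
 have "marking_equiv G' M' (comp_marking G' fV (%e. Some (fE e)) M)"
  using marking_equiv_sym[OF sg(2) comp_premarking[OF w(1)]] f(3) comp_marking_graph_iso[OF sg f(1) w(1)] by simp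
 then show "isometric (G,M,l) (G',M',l')" using co f(2)
  by (intro isometricI[of _ _ _ _ fV "%e. Some (fE e)"]) (auto simp: marked_collapse_def)
next
 assume "isometric (G,M,l) (G',M',l')"
 then obtain cV cE where c: "marked_collapse G M G' M' cV cE"
   "!!e. e:gE G ==> EX f. cE e = Some f & len G' l' f = len G l e" by (rule isometricE) blast
 interpret graph_collapse G G' cV cE using sg c(1) by unfold_locales (auto simp: marked_collapse_def)
 define fE where "fE e = the (cE e)" for e
 have fE: "cE e = Some (fE e)" "len G' l' (fE e) = len G l e" if "e:gE G" for e using c(2)[OF that] by (auto simp: fE_def)
 have iso: "graph_iso G G' cV fE" by (rule graph_iso_if_nothing_collapsed[OF fE(1)])
 have "comp_marking G' cV cE M = comp_marking G' cV (%e. Some (fE e)) M"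
  by (rule comp_marking_cong[OF sg(1) w(1) refl fE(1)])
 moreover have "marking_equiv G' (comp_marking G' cV cE M) M'"
  by (rule marking_equiv_sym[OF sg(2) w(2)]) (use c(1) in \<open>simp add: marked_collapse_def\<close>)
 ultimately have "marking_equiv G' (cV (fst M),map (map fE) (snd M)) M'" using comp_marking_graph_iso[OF sg iso w(1)] by simp
 then show "mmg_equiv (G,M,l) (G',M',l')"
  unfolding mmg_equiv_def prod.case using iso fE(2) by blast
qed

lemma valid_mmgD:
 assumes "valid_mmg r (G,M,l)"
 shows "outer_graph G" "serre_graph G" "valid_marking r G M" "premarking r G M" "l:lengths G"
 using assms outerD(1) valid_premarking by (auto simp: valid_mmg_def)

lemma isometric_refl:
 assumes "valid_mmg r t"
 shows "isometric t t"
proof -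
 obtain G M l where t: "t = (G,M,l)" by (metis surj_pair)
 show ?thesis unfolding t by (rule isometricI[OF marked_collapse_id[OF valid_mmgD(2,4)[OF assms[unfolded t]]]]) simp
qed

lemma isometric_trans:
 assumes "valid_mmg r t1" "valid_mmg r t2" "valid_mmg r t3" "isometric t1 t2" "isometric t2 t3"
 shows "isometric t1 t3"
proof -
 obtain G1 M1 l1 G2 M2 l2 G3 M3 l3 where t: "t1 = (G1,M1,l1)" "t2 = (G2,M2,l2)" "t3 = (G3,M3,l3)" by (metis surj_pair)
 note D1 = valid_mmgD[OF assms(1)[unfolded t]] and D2 = valid_mmgD[OF assms(2)[unfolded t]] and D3 = valid_mmgD[OF assms(3)[unfolded t]]
 obtain cV cE where c: "marked_collapse G1 M1 G2 M2 cV cE" "!!e. e:gE G1 ==> EX f. cE e = Some f & len G2 l2 f = len G1 l1 e"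
  using assms(4) unfolding t by (rule isometricE) blast
 obtain bV bE where b: "marked_collapse G2 M2 G3 M3 bV bE" "!!e. e:gE G2 ==> EX f. bE e = Some f & len G3 l3 f = len G2 l2 e"
  using assms(5) unfolding t by (rule isometricE) blast
 interpret graph_collapse G1 G2 cV cE using D1 D2 c by unfold_locales (auto simp: marked_collapse_def)
 have "EX f. Option.bind (cE e) bE = Some f & len G3 l3 f = len G1 l1 e" if e: "e:gE G1" for e
  using c(2)[OF e] b(2) edge_Some[OF e] by fastforce
 then show ?thesis unfolding t
  by (rule isometricI[OF marked_collapse_compose[OF D1(2) D2(2) D3(2) D1(4) D2(4) D3(4) c(1) b(1)]])
qed

lemma isometric_sym:
 assumes "valid_mmg r t1" "valid_mmg r t2" "isometric t1 t2"
 shows "isometric t2 t1"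
proof -
 obtain G1 M1 l1 G2 M2 l2 where t: "t1 = (G1,M1,l1)" "t2 = (G2,M2,l2)" by (metis surj_pair)
 note D1 = valid_mmgD[OF assms(1)[unfolded t]] and D2 = valid_mmgD[OF assms(2)[unfolded t]]
 obtain cV cE where c: "marked_collapse G1 M1 G2 M2 cV cE" "!!e. e:gE G1 ==> EX f. cE e = Some f & len G2 l2 f = len G1 l1 e"
  using assms(3) unfolding t by (rule isometricE) blast
 interpret graph_collapse G1 G2 cV cE using D1 D2 c by unfold_locales (auto simp: marked_collapse_def)
 obtain bV bE where b: "marked_collapse G2 M2 G1 M1 bV bE" "!!e. e:gE G1 ==> Some e = Option.bind (cE e) bE"
  by (rule marked_collapse_factor[OF D1(2) D2(2) D1(2) D1(4) D2(4) D1(4) c(1) marked_collapse_id[OF D1(2,4)]])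
   (auto dest!: c(2))
 have "EX e. bE f = Some e & len G1 l1 e = len G2 l2 f" if f: "f:gE G2" for f
  using edge_ex[OF f] b(2) c(2) by force
 then show ?thesis unfolding t by (rule isometricI[OF b(1)])
qed

lemma cls_isometric:
 assumes "valid_mmg r t"
 shows "cls r t = {t'. valid_mmg r t' & isometric t t'}"
proof -
 obtain G M l where t: "t = (G,M,l)" by (metis surj_pair)
 have "mmg_equiv t t' \<longleftrightarrow> isometric t t'" if "valid_mmg r t'" for t'
  using mmg_equiv_iff_isometric valid_mmgD(2,4) assms that unfolding t by (cases t') blast
 then show ?thesis by (auto simp: cls_def)
qed

lemma cls_eq_iff:
 assumes "valid_mmg r t" "valid_mmg r t'"
 shows "cls r t = cls r t' \<longleftrightarrow> isometric t t'"
proof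
 assume "cls r t = cls r t'"
 moreover have "t':cls r t'" using assms(2) isometric_refl by (simp add: cls_isometric[OF assms(2)])
 ultimately have "t':cls r t" by (simp only:)
 then show "isometric t t'" by (simp add: cls_isometric[OF assms(1)])
next
 assume m: "isometric t t'"
 have "isometric t s \<longleftrightarrow> isometric t' s" if s: "valid_mmg r s" for s
  using isometric_trans[OF assms(1,2) s m] isometric_trans[OF assms(2,1) s isometric_sym[OF assms m]] by blast
 then show "cls r t = cls r t'" by (auto simp: cls_isometric assms)
qed

lemma cell_rel_iff:
 assumes "serre_graph G"
 shows "cell_rel r G M lam x \<longleftrightarrow> (EX G0 M0 l0 cV cE. valid_mmg r (G0,M0,l0) & marked_collapse G M G0 M0 cV cE &
  lam = pullback G cE G0 l0 & x = cls r (G0,M0,l0))"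
 unfolding cell_rel_def marked_collapse_def collapse_iff_forest_collapse[OF assms] by blast

lemma cell_relE:
 assumes "serre_graph G" "cell_rel r G M lam x"
 obtains G0 M0 l0 cV cE where "valid_mmg r (G0,M0,l0)" "marked_collapse G M G0 M0 cV cE"
  "lam = pullback G cE G0 l0" "x = cls r (G0,M0,l0)"
 using assms(2) unfolding cell_rel_iff[OF assms(1)] by blast

lemma len_lengths_pos: "serre_graph G ==> l:lengths G ==> e:gE G ==> len G l e > 0"
 by (rule len_pos) (auto simp: lengths_def)

lemma len_pullback_zero_iff:
 assumes "serre_graph G" "serre_graph H" "forest_collapse G H cV cE" "l:lengths H" "e:gE G"
 shows "len G (pullback G cE H l) e = 0 \<longleftrightarrow> cE e = None"
proof (cases "cE e")
 case (Some f)
 interpret graph_collapse G H cV cE using assms by unfold_locales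
 show ?thesis using edge_Some[OF assms(5) Some] Some len_lengths_pos[OF assms(2,4), of f]
  by (simp add: len_pullback[OF assms(1,2,3,5)])
qed (simp add: len_pullback[OF assms(1,2,3,5)])

lemma cell_rel_unique:
 assumes "outer_graph G" "valid_marking r G M" "cell_rel r G M lam x" "cell_rel r G M lam y"
 shows "x = y"
proof -
 note sg = outerD(1)[OF assms(1)] and w = valid_premarking[OF assms(2)]
 obtain G1 M1 l1 cV cE where v1: "valid_mmg r (G1,M1,l1)" and c: "marked_collapse G M G1 M1 cV cE"
   and lam1: "lam = pullback G cE G1 l1" and x: "x = cls r (G1,M1,l1)" by (rule cell_relE[OF sg assms(3)])
 obtain G2 M2 l2 dV dE where v2: "valid_mmg r (G2,M2,l2)" and d: "marked_collapse G M G2 M2 dV dE"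
   and lam2: "lam = pullback G dE G2 l2" and y: "y = cls r (G2,M2,l2)" by (rule cell_relE[OF sg assms(4)])
 note D1 = valid_mmgD[OF v1] and D2 = valid_mmgD[OF v2]
 have forest_c: "forest_collapse G G1 cV cE" and forest_d: "forest_collapse G G2 dV dE" using c d by (auto simp: marked_collapse_def)
 interpret graph_collapse G G1 cV cE using sg D1 forest_c by unfold_locales
 have same_zeros: "cE e = None \<longleftrightarrow> dE e = None" if "e:gE G" for e
  using len_pullback_zero_iff[OF sg D1(2) forest_c D1(5) that] len_pullback_zero_iff[OF sg D2(2) forest_d D2(5) that] lam1 lam2 by simp
 obtain bV bE where b: "marked_collapse G1 M1 G2 M2 bV bE" "!!e. e:gE G ==> dE e = Option.bind (cE e) bE"
  by (rule marked_collapse_factor[OF sg D1(2) D2(2) w D1(4) D2(4) c d]) (use same_zeros in auto)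
 have "EX f'. bE f = Some f' & len G2 l2 f' = len G1 l1 f" if f: "f:gE G1" for f
 proof -
  obtain e where e: "e:gE G" "cE e = Some f" using edge_ex[OF f] by auto
  then obtain f' where f': "dE e = Some f'" "bE f = Some f'" using b(2)[OF e(1)] same_zeros[OF e(1)] by auto
  then show ?thesis using len_pullback[OF sg D1(2) forest_c e(1), of l1] len_pullback[OF sg D2(2) forest_d e(1), of l2] e lam1 lam2 by simp
 qed
 then show ?thesis unfolding x y cls_eq_iff[OF v1 v2] by (rule isometricI[OF b(1)])
qed

section \<open>Normalized segments in a closed cell\<close>

abbreviation segment :: "(nat => real) => (nat => real) => real => nat => real" where
 "segment a b t \<equiv> (%i. a i+t*(b i-a i))"

context loop_sums
begin

definition controlled :: "real => (nat => real) => real => bool" where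
 "controlled C c k \<longleftrightarrow> 1/C <= k & k <= C & 1/C <= c i0 & (ALL i:I. c i <= C) &
   F sz (%i. k * c i) <= C & F (%p. sz p * sz p) (%i. k * c i) <= C"

lemma eventually_controlled:
 assumes c: "!!i. i:I ==> ((%y. c y i) \<longlongrightarrow> a i) net" and a: "cone a" "critical (%i. k0 * a i)" "k0 > 0"
  and crit: "eventually (%y. cone (c y) & critical (%i. k y * c y i)) net"
 obtains C where "C > 0" "eventually (%y. controlled C (c y) (k y)) net"
proof -
 have k: "(k \<longlongrightarrow> k0) net" by (rule critical_scale_tendsto[OF c a(1,2) crit])
 have F: "((%y. F w (%i. k y * c y i)) \<longlongrightarrow> F w (%i. k0 * a i)) net" if "tempered w" for w
  by (rule F_tendsto[OF _ critical_exp_summable[OF a(2)] that]) (intro tendsto_mult k c)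
 note F_sz = F[OF tempered_sz] and F_sz2 = F[OF tempered_mult[OF tempered_sz tempered_sz]]
 have a_i0: "a i0 > 0" using a(1) by (simp add: cone_def)
 define C where "C = 1+\<bar>F sz (%i. k0 * a i)\<bar>+\<bar>F (%p. sz p * sz p) (%i. k0 * a i)\<bar>+(\<Sum>i\<in>I. \<bar>a i\<bar>)+k0+2/k0+2/a i0"
 have summands: "0 <= (\<Sum>i\<in>I. \<bar>a i\<bar>)" "0 < 2/k0" "0 < 2/a i0" using a(3) a_i0 by (auto intro: sum_nonneg)
 have C: "C > 0" "2/k0 <= C" "2/a i0 <= C" "k0 < C" "F sz (%i. k0 * a i) < C" "F (%p. sz p * sz p) (%i. k0 * a i) < C"
  unfolding C_def using summands a(3) by linarith+
 have C_inv: "1/C < x" if "2/x <= C" "x > 0" for x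
 proof -
  have "2 <= C * x" using that by (simp add: pos_divide_le_eq)
  then show ?thesis using C(1) by (simp add: pos_divide_less_eq mult.commute)
 qed
 have "a i < C" if "i:I" for i
 proof -
  have "\<bar>a i\<bar> <= (\<Sum>i\<in>I. \<bar>a i\<bar>)" by (rule member_le_sum) (use that finI in auto)
  then show ?thesis unfolding C_def using summands a(3) by linarith
 qed
 then have "eventually (%y. ALL i:I. c y i < C) net"
  by (intro eventually_ball_finite[OF finI]) (use order_tendstoD(2)[OF c] in blast)
 then have "eventually (%y. controlled C (c y) (k y)) net"
  using order_tendstoD(1)[OF k C_inv[OF C(2) a(3)]] order_tendstoD(2)[OF k C(4)]
   order_tendstoD(1)[OF c[OF i0] C_inv[OF C(3) a_i0]] order_tendstoD(2)[OF F_sz C(5)] order_tendstoD(2)[OF F_sz2 C(6)]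
  by eventually_elim (auto simp: controlled_def less_imp_le)
 then show ?thesis using that C(1) by blast
qed

lemma controlled_near:
 assumes a: "cone a" "critical (%i. k0 * a i)" "k0 > 0"
 obtains \<delta> C where "\<delta> > 0" "C > 0"
  "!!c k. (!!i. i:I ==> \<bar>c i-a i\<bar> < \<delta>) ==> cone c ==> critical (%i. k * c i) ==> controlled C c k"
proof -
 define S where "S \<delta> = {z::real \<times> (nat => real). (ALL i:I. \<bar>snd z i-a i\<bar> < \<delta>) & cone (snd z) & critical (%i. fst z * snd z i)}" for \<delta>
 define net where "net = (INF \<delta>\<in>{0<..}. principal (S \<delta>))"
 have eventually_net: "eventually P net \<longleftrightarrow> (EX \<delta>>0. ALL z:S \<delta>. P z)" for P
  unfolding net_def
 proof (subst eventually_INF_base)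
  show "EX x:{0<..}. principal (S x) <= inf (principal (S d)) (principal (S e))" if "d:{0<..}" "e:{0<..}" for d e
   using that by (intro bexI[of _ "min d e"]) (auto simp: S_def)
 qed (auto simp: eventually_principal)
 have lim: "((%z. snd z i) \<longlongrightarrow> a i) net" if "i:I" for i
  by (rule tendstoI, unfold eventually_net dist_real_def) (use that in \<open>auto simp: S_def\<close>)
 have crit: "eventually (%z. cone (snd z) & critical (%i. fst z * snd z i)) net"
  unfolding eventually_net by (rule exI[of _ 1]) (auto simp: S_def)
 obtain C where C: "C > 0" "eventually (%z. controlled C (snd z) (fst z)) net"
  by (rule eventually_controlled[of "%z. snd z", OF lim a crit])
 then obtain \<delta> where \<delta>: "\<delta> > 0" "!!z. z:S \<delta> ==> controlled C (snd z) (fst z)" unfolding eventually_net by blast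
 have "controlled C c k"
  if "!!i. i:I ==> \<bar>c i-a i\<bar> < \<delta>" "cone c" "critical (%i. k * c i)" for c k
  using \<delta>(2)[of "(k,c)"] that by (simp add: S_def)
 then show ?thesis using that \<delta>(1) C(1) by blast
qed

definition speed :: "(nat => real) => (nat => real) => real => real" where
 "speed c u k = sqrt (F (%p. (ev (velocity c u k) p)\<^sup>2) (%i. k * c i)/F (ev (%i. k * c i)) (%i. k * c i))"

lemma F_ev_scale: "exp_summable L ==> F (ev (%i. k * c i)) L = k * F (ev c) L"
 by (simp add: F_ev sum_distrib_left mult.assoc)

lemma velocity_tangent:
 assumes "cone c" "critical (%i. k * c i)"
 shows "F (ev (velocity c u k)) (%i. k * c i) = 0"
proof -
 let ?L = "%i. k * c i"
 note summable = critical_exp_summable[OF assms(2)]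
 have "F (ev (velocity c u k)) ?L = rate c u k*(\<Sum>i\<in>I. c i * F (%p. n p i) ?L)+k*(\<Sum>i\<in>I. u i * F (%p. n p i) ?L)"
  unfolding F_ev[OF summable] velocity_def by (simp add: algebra_simps sum.distrib sum_distrib_left)
 also have "... = rate c u k * F (ev c) ?L+k * F (ev u) ?L" unfolding F_ev[OF summable] ..
 also have "... = 0" using F_ev_pos[OF assms] by (simp add: rate_def)
 finally show ?thesis .
qed

lemma abs_F_ev_le:
 assumes "exp_summable L" "!!i. i:I ==> \<bar>u i\<bar> <= D"
 shows "\<bar>F (ev u) L\<bar> <= D * F sz L"
proof -
 have summable_sz: "(%p. D*(sz p * exp (- ev L p))) summable_on P"
  by (intro summable_on_cmult_right F_summable[OF assms(1)] tempered_sz)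
 have abs: "(%p. norm (ev u p * exp (- ev L p))) summable_on P"
  using F_abs_summable[OF assms(1) tempered_ev[of u]] by (simp add: abs_mult)
 have "norm (ev u p * exp (- ev L p)) <= D*(sz p * exp (- ev L p))" for p
  using abs_ev_le[of u D p] assms(2) by (simp add: abs_mult mult.assoc[symmetric] mult_right_mono)
 then have "infsum (%p. norm (ev u p * exp (- ev L p))) P <= infsum (%p. D*(sz p * exp (- ev L p))) P"
  by (rule infsum_mono[OF abs summable_sz])
 then show ?thesis unfolding F_def using norm_infsum_bound[OF abs] by (simp add: infsum_cmult_right')
qed

lemma F_ev_square_le:
 assumes "exp_summable L" "!!i. i:I ==> \<bar>u i\<bar> <= D"
 shows "F (%p. (ev u p)\<^sup>2) L <= D\<^sup>2 * F (%p. sz p * sz p) L"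
proof -
 have summable_sz_sz: "(%p. D\<^sup>2*(sz p * sz p * exp (- ev L p))) summable_on P"
  by (intro summable_on_cmult_right F_summable[OF assms(1)] tempered_mult tempered_sz)
 have summable_ev_sq: "(%p. (ev u p)\<^sup>2 * exp (- ev L p)) summable_on P"
  using F_summable[OF assms(1) tempered_mult[OF tempered_ev tempered_ev], of u u] by (simp add: power2_eq_square)
 have "(ev u p)\<^sup>2 * exp (- ev L p) <= D\<^sup>2*(sz p * sz p * exp (- ev L p))" for p
 proof -
  have "\<bar>ev u p\<bar>\<^sup>2 <= (D * sz p)\<^sup>2" using abs_ev_le[of u D p] assms(2) by (intro power_mono) auto
  then have "(ev u p)\<^sup>2 * exp (- ev L p) <= (D * sz p)\<^sup>2 * exp (- ev L p)" by (intro mult_right_mono) auto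
  then show ?thesis by (simp add: power2_eq_square mult_ac)
 qed
 from infsum_mono[OF summable_ev_sq summable_sz_sz this] show ?thesis by (simp add: F_def infsum_cmult_right')
qed

lemma abs_velocity_le:
 assumes c: "cone c" "critical (%i. k * c i)" and C: "C > 0" "controlled C c k"
  and u: "!!i. i:I ==> \<bar>u i\<bar> <= D" and D: "D >= 0" and i: "i:I"
 shows "\<bar>velocity c u k i\<bar> <= (C^4+C) * D"
proof -
 let ?L = "%i. k * c i"
 note C_bounds = C(2)[unfolded controlled_def]
 have C_inv: "1/C > 0" using C(1) by simp
 then have k: "k > 0" using C_bounds by linarith
 have F_u: "\<bar>F (ev u) ?L\<bar> <= D * C"
  by (rule order_trans[OF abs_F_ev_le[OF critical_exp_summable[OF c(2)] u]]) (use C_bounds D in \<open>auto intro: mult_left_mono\<close>)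
 have F_c: "F (ev c) ?L >= 1/C" using F_ev_ge[OF c] C_bounds by linarith
 have "\<bar>rate c u k\<bar> = k*\<bar>F (ev u) ?L\<bar>/F (ev c) ?L" using k F_ev_pos[OF c] by (simp add: rate_def abs_mult)
 also have "... <= (C*(D * C))/(1/C)"
  using k C_bounds F_u F_c C_inv D by (intro frac_le mult_mono) auto
 finally have rate: "\<bar>rate c u k\<bar> <= C^3 * D" by (simp add: eval_nat_numeral mult_ac)
 have "\<bar>velocity c u k i\<bar> <= \<bar>rate c u k * c i\<bar>+\<bar>k * u i\<bar>" unfolding velocity_def by (rule abs_triangle_ineq)
 also have "\<bar>rate c u k * c i\<bar> <= (C^3 * D) * C" unfolding abs_mult
  using rate C_bounds c(1) i by (intro mult_mono) (auto simp: cone_def intro: order_trans[OF abs_ge_zero])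
 also have "\<bar>k * u i\<bar> <= C * D" unfolding abs_mult using k C(1) C_bounds u[OF i] by (intro mult_mono) auto
 finally show ?thesis by (simp add: algebra_simps eval_nat_numeral)
qed

lemma speed_le:
 assumes c: "cone c" "critical (%i. k * c i)" and C: "C > 0" "controlled C c k"
  and u: "!!i. i:I ==> \<bar>u i\<bar> <= D" and D: "D >= 0"
 shows "speed c u k <= (C^4+C) * sqrt (C^3) * D"
proof -
 let ?L = "%i. k * c i" and ?B = "(C^4+C) * D"
 note C_bounds = C(2)[unfolded controlled_def] and summable = critical_exp_summable[OF c(2)]
 have "F (%p. (ev (velocity c u k) p)\<^sup>2) ?L <= ?B\<^sup>2 * F (%p. sz p * sz p) ?L"
  by (rule F_ev_square_le[OF summable abs_velocity_le[OF c C u D]])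
 also have "... <= ?B\<^sup>2 * C" using C_bounds by (intro mult_left_mono) auto
 finally have num: "F (%p. (ev (velocity c u k) p)\<^sup>2) ?L <= ?B\<^sup>2 * C" .
 have "1/C*(1/C) <= k * F (ev c) ?L"
  using C(1) C_bounds F_ev_ge[OF c] order_trans[of "1/C" "c i0"] by (intro mult_mono) (auto intro: order_trans[of 0 "1/C"])
 then have "F (%p. (ev (velocity c u k) p)\<^sup>2) ?L/F (ev ?L) ?L <= (?B\<^sup>2 * C)/(1/C*(1/C))"
  using num C(1) by (intro frac_le) (auto simp: F_ev_scale[OF summable])
 also have "... = ?B\<^sup>2 * C^3" by (simp add: eval_nat_numeral)
 finally have "speed c u k <= sqrt (?B\<^sup>2 * C^3)" unfolding speed_def by (rule real_sqrt_le_mono)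
 also have "... = ?B * sqrt (C^3)" using C(1) D by (simp add: real_sqrt_mult)
 finally show ?thesis by (simp add: mult_ac)
qed

context
 fixes c :: "'t::topological_space => nat => real" and k :: "'t => real" and S
 assumes c: "!!i. continuous_on S (%t. c t i)"
  and crit: "!!t. t:S ==> cone (c t) & critical (%i. k t * c t i)" and k_pos: "!!t. t:S ==> k t > 0"
begin

lemma continuous_on_critical_scale: "continuous_on S k"
 unfolding continuous_on_def
proof
 fix t assume t: "t:S"
 have "((%y. c y i) \<longlongrightarrow> c t i) (at t within S)" for i using c t by (simp add: continuous_on_def)
 moreover have "eventually (%y. cone (c y) & critical (%i. k y * c y i)) (at t within S)"
  unfolding eventually_at_filter using crit by (intro always_eventually) blast
 ultimately show "(k \<longlongrightarrow> k t) (at t within S)" using crit[OF t] critical_scale_tendsto[of c "c t"] by blast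
qed

private lemma summable: "t:S ==> exp_summable (%i. k t * c t i)"
 using crit critical_exp_summable by blast

lemma continuous_on_F:
 assumes "tempered w"
 shows "continuous_on S (%t. F w (%i. k t * c t i))"
 unfolding continuous_on_def
proof
 fix t assume t: "t:S"
 have "((%y. k y * c y i) \<longlongrightarrow> k t * c t i) (at t within S)" for i
  using continuous_on_mult[OF continuous_on_critical_scale c] t by (simp add: continuous_on_def)
 then show "((%y. F w (%i. k y * c y i)) \<longlongrightarrow> F w (%i. k t * c t i)) (at t within S)"
  by (rule F_tendsto[OF _ summable[OF t] assms])
qed

lemma continuous_on_F_ev:
 assumes "!!i. continuous_on S (%t. v t i)"
 shows "continuous_on S (%t. F (ev (v t)) (%i. k t * c t i))"
proof -
 have "continuous_on S (%t. \<Sum>i\<in>I. v t i * F (%p. n p i) (%i. k t * c t i))"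
  by (intro continuous_on_sum continuous_on_mult assms continuous_on_F tempered_n)
 then show ?thesis by (rule continuous_on_cong[THEN iffD1, rotated 2]) (auto simp: F_ev[OF summable])
qed

lemma continuous_on_velocity: "continuous_on S (%t. velocity (c t) u (k t) i)"
 unfolding velocity_def rate_def
 using F_ev_pos crit
 by (intro continuous_intros c continuous_on_critical_scale continuous_on_F_ev) fastforce

lemma continuous_on_speed: "continuous_on S (%t. speed (c t) u (k t))"
proof -
 let ?V = "%t. velocity (c t) u (k t)"
 have "continuous_on S (%t. \<Sum>e\<in>I. \<Sum>f\<in>I. ?V t e * ?V t f * F (%p. n p f * n p e) (%i. k t * c t i))"
  by (intro continuous_on_sum continuous_on_mult continuous_on_velocity continuous_on_F tempered_mult tempered_n)
 then have "continuous_on S (%t. F (%p. (ev (?V t) p)\<^sup>2) (%i. k t * c t i))"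
  by (rule continuous_on_cong[THEN iffD1, rotated 2]) (auto simp: F_square[OF summable])
 moreover have "F (ev (%i. k t * c t i)) (%i. k t * c t i) ~= 0" if "t:S" for t
  using F_ev_pos[of "c t" "%i. k t * c t i"] crit[OF that] k_pos[OF that] by (simp add: F_ev_scale[OF summable[OF that]])
 ultimately show ?thesis unfolding speed_def
  by (intro continuous_on_real_sqrt continuous_on_divide continuous_on_F_ev continuous_on_mult
    continuous_on_critical_scale c) auto
qed

end

end

lemma (in outer_loops) hit_iff_closed_walk:
 "p:hit e0 \<longleftrightarrow> p ~= [] & walk G (gE G) p (tm G e0) (tm G e0) & reduced G p &
  hd p ~= gbar G e0 & last p = e0 & e0 ~: set (butlast p)"
proof (cases "p = []")
 case False
 have "p:hit e0 \<longleftrightarrow> (set p <= gE G & successively (nb G) p & gorg G (hd p) = tm G e0 & tm G (last p) = tm G e0) &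
  hd p ~= gbar G e0 & last p = e0 & e0 ~: set (butlast p)" (is "_ \<longleftrightarrow> ?R")
 proof
  assume p: "p:hit e0"
  then have "successively (nb G) (e0#p)" "last p = e0" "e0 ~: set (butlast p)" by (auto simp: hit_def)
  then show ?R using hit_set[OF p] False by (auto simp: successively_Cons nb_def)
 next
  assume R: ?R
  then have "hd p:gE G" using hd_in_set[OF False] by blast
  then show "p:hit e0" using R False e0 by (auto simp: hit_def successively_Cons nb_def)
 qed
 also have "... \<longleftrightarrow> (walk G (gE G) p (tm G e0) (tm G e0) & reduced G p) & hd p ~= gbar G e0 & last p = e0 & e0 ~: set (butlast p)"
  unfolding walk_reduced_iff[OF sg False] ..
 finally show ?thesis using False by blast
qed (simp add: hit_def)

lemma (in graph_collapse) pullback_onto: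
 assumes "f:gEp H"
 obtains e where "e:gEp G" "!!x. pullback G cE H x e = x f"
proof -
 have f: "f:gE H" using assms serre_fin(3)[OF sH] by blast
 obtain e where e: "e:gE G" "cE e = Some f" using edge_ex[OF f] by blast
 have "pullback G cE H x (if e:gEp G then e else gbar G e) = x f" for x
  using assms e edge_Some[OF e] serre_Ep[OF sG e(1)] len_gbar[OF sH f, of x] by (simp add: pullback_def len_def[of H x f])
 then show ?thesis using that[of "if e:gEp G then e else gbar G e"] serre_Ep[OF sG e(1)] by simp
qed

locale collapse_loops = graph_collapse +
 fixes e0 f0 :: nat
 assumes oG: "outer_graph G" and oH: "outer_graph H" and e0: "e0:gE G" and ce0: "cE e0 = Some f0"
begin

lemma f0: "f0:gE H" using edge_Some[OF e0 ce0] by simp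

sublocale g: outer_loops G e0 by unfold_locales (rule oG, rule e0)
sublocale h: outer_loops H f0 by unfold_locales (rule oH, rule f0)

lemma mem_push_iff: "set p <= gE G ==> f0:set (push p) \<longleftrightarrow> e0:set p"
proof (induction p)
 case (Cons e p)
 have "f0:set (edge_image cE e) \<longleftrightarrow> e0 = e" using Cons.prems edge_unique[OF _ e0 _ ce0, of e] ce0
  by (cases "cE e") (auto simp: edge_image_simps)
 then show ?case using Cons by auto
qed simp

lemma tm_f0: "tm H f0 = cV (tm G e0)" by (rule edge_Some_tm[OF e0 ce0])

lemma push_hit:
 assumes p: "p:g.hit e0"
 shows "push p:h.hit f0"
proof -
 note P = p[unfolded g.hit_iff_closed_walk]
 have w: "walk G (gE G) p (tm G e0) (tm G e0)" using P by simp
 obtain q where q: "p = q@[e0]" "e0 ~: set q" using g.hitE[OF p] by blast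
 have push_p: "push p = push q@[f0]" using q(1) ce0 by (simp add: edge_image_simps)
 have "f0 ~: set (push q)" using mem_push_iff[of q] q g.hit_set[OF p] by auto
 moreover have "walk H (gE H) (push p) (tm H f0) (tm H f0)" using walk_push[OF w] tm_f0 by simp
 moreover have "walk G (gE G) (e0#p) (gorg G e0) (tm G e0)" "reduced G (e0#p)" using w e0 P by (auto simp: reduced_Cons)
 from reduced_push[OF this] have "reduced H (f0#push p)" using ce0 by (simp add: edge_image_simps)
 ultimately show ?thesis unfolding h.hit_iff_closed_walk using push_p by (auto simp: reduced_Cons)
qed

lemma hit_lift:
 assumes q: "q:h.hit f0"
 obtains p where "p:g.hit e0" "push p = q"
proof -
 note Q = q[unfolded h.hit_iff_closed_walk]
 have tV: "tm G e0:gV G" by (rule serreD(5)[OF sG e0])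
 obtain p' where p': "walk G (gE G) p' (tm G e0) (tm G e0)" "push p' = q"
  using walk_lift[OF _ tV tV, of q] Q tm_f0 by auto
 define p where "p = red G p'"
 have w: "walk G (gE G) p (tm G e0) (tm G e0)" unfolding p_def by (rule walk_red[OF sG order_refl p'(1)])
 have reduced_p: "reduced G p" by (simp add: p_def)
 have push_p: "push p = q" using push_red[OF p'(1)] p'(2) Q by (simp add: p_def red_id)
 have pE: "set p <= gE G" by (rule walk_E[OF sG w])
 obtain b where b: "q = b@[f0]" "f0 ~: set b" using h.hitE[OF q] by blast
 have "e0:set p" using mem_push_iff[OF pE] push_p b by auto
 then obtain x y where xy: "p = x@e0#y" "e0 ~: set x" by (meson split_list_first)
 have "b@[f0] = push x@f0#push y" using push_p b xy ce0 by (simp add: edge_image_simps)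
 then have "push y = []" using append_Cons_eq_iff[of f0 b "[]" "push x" "push y"] b(2) by simp
 moreover have "walk G (gE G) y (tm G e0) (tm G e0)" using w xy(1) walk_append[OF sG order_refl, of x "e0#y"] by auto
 ultimately have "walk G (collapsed_edges G cE) y (tm G e0) (tm G e0)"
  using push_Nil_iff[of y] pE xy(1) walk_restrict by auto
 moreover have "reduced G y" using reduced_p xy(1) by (simp add: reduced_append reduced_Cons)
 ultimately have "y = []" by (rule fiber_acyclic)
 moreover have "hd p ~= gbar G e0"
 proof
  assume "hd p = gbar G e0"
  moreover have "cE (gbar G e0) = Some (gbar H f0)" using edge_Some[OF e0 ce0] by simp
  ultimately have "hd (push p) = gbar H f0" using xy(1) by (cases x) (auto simp: edge_image_simps)
  then show False using push_p Q by simp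
 qed
 ultimately have "p:g.hit e0" unfolding g.hit_iff_closed_walk using w xy reduced_p by simp
 then show ?thesis using push_p that by blast
qed

lemma push_bij_hit: "bij_betw push (g.hit e0) (h.hit f0)"
proof (rule bij_betw_imageI)
 show "inj_on push (g.hit e0)"
 proof (rule inj_onI)
  fix p q assume "p:g.hit e0" "q:g.hit e0" and eq: "push p = push q"
  then have "walk G (gE G) p (tm G e0) (tm G e0) & red G p = p" "walk G (gE G) q (tm G e0) (tm G e0) & red G q = q"
   by (simp_all add: g.hit_iff_closed_walk red_id)
  then show "p = q" using red_push_eq_iff[of p "tm G e0" "tm G e0" q] eq by simp
 qed
 show "push ` g.hit e0 = h.hit f0" using push_hit hit_lift by blast
qed

lemma ev_pullback:
 assumes "set p <= gE G"
 shows "g.ev (pullback G cE H l) p = h.ev l (push p)"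
proof -
 have "sum_list (map (len G (pullback G cE H l)) p) = sum_list (map (len H l) (push p))"
  using assms
 proof (induction p)
  case (Cons e p)
  then show ?case using len_pullback[OF sG sH co, of e l] by (cases "cE e") (auto simp: edge_image_simps)
 qed simp
 then show ?thesis using g.ev_eq[OF assms] h.ev_eq[OF set_subst[OF edge_image_hom assms]] by simp
qed

lemma F_pullback: "h.F w l = g.F (%p. w (push p)) (pullback G cE H l)"
proof -
 have "h.F w l = infsum (%p. w (push p) * exp (- h.ev l (push p))) (g.hit e0)"
  unfolding h.F_def using infsum_reindex_bij_betw[OF push_bij_hit, of "%q. w q * exp (- h.ev l q)"] by simp
 also have "... = g.F (%p. w (push p)) (pullback G cE H l)"
  unfolding g.F_def by (rule infsum_cong) (simp add: ev_pullback g.hit_set)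
 finally show ?thesis .
qed

lemma critical_pullback_iff: "g.critical (pullback G cE H l) \<longleftrightarrow> h.critical l"
 unfolding h.critical_def g.critical_def F_pullback ..

lemma sz_push_le: "p:g.hit e0 ==> h.sz (push p) <= g.sz p"
proof -
 assume "p:g.hit e0"
 then have pE: "set p <= gE G" by (rule g.hit_set)
 have "length (push q) <= length q" for q by (induction q) (auto simp: edge_image_def split: option.splits)
 then show ?thesis using g.sz_eq[OF pE] h.sz_eq[OF set_subst[OF edge_image_hom pE]] by simp
qed

lemma F_pullback_le:
 assumes "h.critical l" "g.tempered w" "!!p. p:g.hit e0 ==> 0 <= w' (push p) & w' (push p) <= w p"
 shows "h.F w' l <= g.F w (pullback G cE H l)"
proof -
 let ?L = "pullback G cE H l"
 have g: "(%p. w p * exp (- g.ev ?L p)) summable_on g.hit e0"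
  using assms(1) by (intro g.F_summable[OF g.critical_exp_summable] assms(2)) (simp add: critical_pullback_iff)
 have "(%p. w' (push p) * exp (- g.ev ?L p)) summable_on g.hit e0"
  by (rule summable_on_comparison_test[OF g]) (use assms(3) in \<open>auto intro!: mult_right_mono\<close>)
 then show ?thesis unfolding F_pullback unfolding g.F_def
  using g by (rule infsum_mono) (use assms(3) in \<open>auto intro!: mult_right_mono\<close>)
qed

lemma pullback_i0: "pullback G cE H x g.i0 = x h.i0"
 using len_pullback[OF sG sH co e0, of x] by (simp add: ce0 g.len_i0 h.len_i0)

lemma cone_pullback:
 assumes "h.cone x"
 shows "g.cone (pullback G cE H x)"
proof -
 have "len H x f >= 0" if "f:gE H" for f using assms serre_Ep[OF sH that] by (auto simp: len_def h.cone_def)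
 then have "pullback G cE H x i >= 0" for i
  using edge_Some[of i] serre_fin(3)[OF sG] by (auto simp: pullback_def split: option.split)
 then show ?thesis using assms by (auto simp: g.cone_def h.cone_def pullback_i0)
qed

lemma controlled_pullback:
 assumes "h.critical (%i. k * x i)" "pullback G cE H (%i. k * x i) = (%i. k * pullback G cE H x i)"
  and "g.controlled C (pullback G cE H x) k"
 shows "h.controlled C x k"
proof -
 have "x f <= C" if "f:gEp H" for f
  using pullback_onto[OF that] assms(3) unfolding g.controlled_def by metis
 moreover have "h.F h.sz (%i. k * x i) <= g.F g.sz (%i. k * pullback G cE H x i)"
  unfolding assms(2)[symmetric] by (rule F_pullback_le[OF assms(1) g.tempered_sz]) (use sz_push_le h.sz_nonneg in auto)
 moreover have "h.F (%p. h.sz p * h.sz p) (%i. k * x i) <= g.F (%p. g.sz p * g.sz p) (%i. k * pullback G cE H x i)"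
  unfolding assms(2)[symmetric] by (rule F_pullback_le[OF assms(1) g.tempered_mult[OF g.tempered_sz g.tempered_sz]])
   (use sz_push_le h.sz_nonneg g.sz_nonneg in \<open>auto intro!: mult_mono\<close>)
 ultimately show ?thesis using assms(3) by (auto simp: g.controlled_def h.controlled_def pullback_i0)
qed

end

lemma pullback_segment: "pullback G cE H (segment x y t) = segment (pullback G cE H x) (pullback G cE H y) t"
 by (auto simp: pullback_def len_def split: option.splits)

lemma pullback_scale: "pullback G cE H (%f. k * x f) = (%i. k * pullback G cE H x i)"
 by (auto simp: pullback_def len_def split: option.splits)

lemma hess_form_cong: "(!!e. e:gEp G ==> v e = w e) ==> hess_form G l v = hess_form G l w"
 unfolding hess_form_def by (intro sum.cong refl) auto

definition normalized :: "nat => mmg => mmg set" where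
 "normalized r t = (case t of (G,M,l) => cls r (G,M,%i. entropy G l * l i))"

lemma outer_edge:
 assumes "outer_graph G"
 obtains e where "e:gE G"
proof -
 obtain v where "v:gV G" using serre_fin(4)[OF outerD(1)[OF assms]] by auto
 then have "card {e:gE G. gorg G e = v} >= 3" by (rule outerD(3)[OF assms])
 then have "{e:gE G. gorg G e = v} ~= {}" by (metis card.empty not_numeral_le_zero)
 then show ?thesis using that by blast
qed

lemma entropy_normalized:
 assumes "outer_graph G" "pos_len G l"
 shows "entropy G l > 0" "entropy G (%i. entropy G l * l i) = 1"
proof -
 obtain e where "e:gE G" using outer_edge[OF assms(1)] .
 then interpret outer_loops G e using assms(1) by unfold_locales
 show pos: "entropy G l > 0" by (rule entropy_pos[OF assms(2)])
 show "entropy G (%i. entropy G l * l i) = 1"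
  using entropy_1_iff[of "%i. entropy G l * l i"] critical_entropy[OF assms(2)] assms(2) pos by simp
qed

lemma valid_mmg_pos_len: "valid_mmg r (G,M,l) ==> pos_len G l"
 by (auto dest: valid_mmgD(5) simp: lengths_def)

lemma normalized_in_outer_space1:
 assumes "valid_mmg r (G,M,l)"
 shows "valid_mmg r (G,M,%i. entropy G l * l i)" "normalized r (G,M,l):outer_space1 r"
proof -
 note entropy = entropy_normalized[OF valid_mmgD(1)[OF assms] valid_mmg_pos_len[OF assms]]
 show valid: "valid_mmg r (G,M,%i. entropy G l * l i)" using assms entropy(1) by (auto simp: valid_mmg_def lengths_def)
 show "normalized r (G,M,l):outer_space1 r" unfolding normalized_def outer_space1_def prod.case
  by (rule imageI) (use valid entropy(2) in simp)
qed

lemma cell_relI: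
 "serre_graph G ==> valid_mmg r (G0,M0,l0) ==> marked_collapse G M G0 M0 cV cE ==>
  cell_rel r G M (pullback G cE G0 l0) (cls r (G0,M0,l0))"
 unfolding cell_rel_iff by blast

locale cell_segment =
 fixes r :: nat and G :: sgraph and M :: "nat \<times> nat list list" and G0 M0 l0 cV cE G1 M1 l1 dV dE e0
 assumes og: "outer_graph G" and vM: "valid_marking r G M"
  and v0: "valid_mmg r (G0,M0,l0)" and c: "marked_collapse G M G0 M0 cV cE"
  and v1: "valid_mmg r (G1,M1,l1)" and d: "marked_collapse G M G1 M1 dV dE"
  and sub: "!!e. e:gE G ==> dE e = None ==> cE e = None"
  and e0: "e0:gE G" and ce0: "cE e0 ~= None"
begin

definition g0 where "g0 = the (cE e0)"
definition f0 where "f0 = the (dE e0)"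

lemma cE_e0: "cE e0 = Some g0" using ce0 by (auto simp: g0_def)
lemma dE_e0: "dE e0 = Some f0" using sub[OF e0] ce0 by (cases "dE e0") (auto simp: f0_def)

lemma sg: "serre_graph G" by (rule outerD(1)[OF og])
lemmas D0 = valid_mmgD[OF v0]
lemmas D1 = valid_mmgD[OF v1]
lemma cc: "forest_collapse G G0 cV cE" using c by (simp add: marked_collapse_def)
lemma cd: "forest_collapse G G1 dV dE" using d by (simp add: marked_collapse_def)

sublocale z: collapse_loops G G0 cV cE e0 g0
 by unfold_locales (use sg D0 D1 cc og e0 cE_e0 in auto)
sublocale y: collapse_loops G G1 dV dE e0 f0
 by unfold_locales (use sg D0 D1 cd og e0 dE_e0 in auto)

abbreviation a where "a \<equiv> pullback G cE G0 l0"
abbreviation b where "b \<equiv> pullback G dE G1 l1"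

definition preimage :: "nat => nat" where "preimage f = (THE e. e:gE G & dE e = Some f)"

lemma preimage: "e:gE G ==> dE e = Some f ==> preimage f = e"
 unfolding preimage_def by (rule the_equality) (use y.edge_unique in auto)

text \<open>The coordinates of the possibly degenerate starting point on the edges of the terminal graph.\<close>
definition a1 :: "nat => real" where "a1 f = (if f:gEp G1 then len G a (preimage f) else 0)"

lemma len_a1: "e:gE G ==> dE e = Some f ==> len G1 a1 f = len G a e"
proof -
 assume e: "e:gE G" "dE e = Some f"
 have f: "f:gE G1" "dE (gbar G e) = Some (gbar G1 f)" using y.edge_Some[OF e] by auto
 show ?thesis
 proof (cases "f:gEp G1")
  case True
  then show ?thesis using preimage[OF e] by (simp add: len_def a1_def)
 next
  case False
  then have "gbar G1 f:gEp G1" using serre_Ep[OF D1(2) f(1)] by simp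
  moreover have "preimage (gbar G1 f) = gbar G e" by (rule preimage[OF serreD(2)[OF sg e(1)] f(2)])
  ultimately have "len G1 a1 f = len G a (gbar G e)" using False by (simp add: len_def[of G1] a1_def)
  then show ?thesis using len_gbar[OF sg e(1)] by simp
 qed
qed

lemma pullback_a1: "pullback G dE G1 a1 = a"
proof (rule pullback_eqI[OF sg D1(2) cd, symmetric])
 show "a e = 0" if "e ~: gEp G" for e using that by (simp add: pullback_def)
 fix e assume e: "e:gE G"
 show "len G a e = (case dE e of Some f => len G1 a1 f | None => 0)"
  using len_a1[OF e] sub[OF e] len_pullback[OF sg D0(2) cc e] by (cases "dE e") auto
qed

lemma cone_a: "z.g.cone a"
 by (rule z.cone_pullback[OF z.h.positive_cone[OF valid_mmg_pos_len[OF v0]]])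

lemma cone_a1: "y.h.cone a1"
proof -
 have "a1 f >= 0" if "f:gEp G1" for f
  using y.pullback_onto[OF that] cone_a unfolding pullback_a1[symmetric] z.g.cone_def by metis
 then show ?thesis using cone_a y.pullback_i0[of a1] by (simp add: y.h.cone_def z.g.cone_def pullback_a1)
qed

abbreviation s1 :: "real => nat => real" where "s1 t \<equiv> segment a1 l1 t"
abbreviation u1 :: "nat => real" where "u1 \<equiv> (%i. l1 i-a1 i)"

lemma l1_pos: "pos_len G1 l1" by (rule valid_mmg_pos_len[OF v1])

lemma s1_pos:
 assumes "0 < t" "t <= 1" "i:gEp G1"
 shows "s1 t i > 0"
proof -
 have "s1 t i = (1-t) * a1 i+t * l1 i" by (simp add: algebra_simps)
 moreover have "(1-t) * a1 i >= 0" using assms cone_a1 by (simp add: y.h.cone_def)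
 moreover have "t * l1 i > 0" using assms l1_pos by simp
 ultimately show ?thesis by linarith
qed

lemma cone_s1: "0 <= t ==> t <= 1 ==> y.h.cone (s1 t)"
 using cone_a1 s1_pos[of t] by (cases "t = 0") (auto intro!: y.h.positive_cone)

lemma critical_a1: "y.h.critical (%i. entropy G0 l0 * a1 i)"
 using z.h.critical_entropy[OF valid_mmg_pos_len[OF v0]]
 by (simp add: pullback_scale pullback_a1 flip: z.critical_pullback_iff y.critical_pullback_iff)

definition k :: "real => real" where "k t = (SOME k. k > 0 & y.h.critical (%i. k * s1 t i))"

lemma k:
 assumes "t:{0..1}"
 shows "k t > 0" "y.h.critical (%i. k t * s1 t i)"
proof -
 have "EX k. k > 0 & y.h.critical (%i. k * s1 t i)"
 proof (cases "t = 0")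
  case True
  then show ?thesis using critical_a1 entropy_normalized(1)[OF D0(1) valid_mmg_pos_len[OF v0]]
   by (intro exI[of _ "entropy G0 l0"]) simp
 next
  case False
  then have "pos_len G1 (s1 t)" using s1_pos[of t] assms by auto
  then show ?thesis by (rule y.h.critical_exists) blast
 qed
 from someI_ex[OF this] show "k t > 0" "y.h.critical (%i. k t * s1 t i)" by (auto simp: k_def)
qed

lemma k_0: "k 0 = entropy G0 l0"
 using y.h.critical_scale_unique[OF cone_a1 _ critical_a1, of "k 0"] k(2)[of 0] by simp

lemma k_1: "k 1 = entropy G1 l1"
 using y.h.critical_scale_unique[OF y.h.positive_cone[OF l1_pos] _ y.h.critical_entropy[OF l1_pos], of "k 1"] k(2)[of 1]
 by simp

definition L :: "real => nat => real" where "L t = (%i. k t * s1 t i)"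

lemma L_lengths: "0 < t ==> t <= 1 ==> L t:lengths G1"
 using s1_pos[of t] k(1)[of t] D1(5) by (auto simp: lengths_def L_def a1_def)

lemma L_entropy: "0 < t ==> t <= 1 ==> entropy G1 (L t) = 1"
 using y.h.entropy_1_iff[of "L t"] L_lengths[of t] k(2)[of t] by (simp add: lengths_def L_def)

lemma L_valid: "0 < t ==> t <= 1 ==> valid_mmg r (G1,M1,L t)"
 using L_lengths D1 by (simp add: valid_mmg_def)

definition \<gamma> :: "real => mmg set" where
 "\<gamma> t = (if t = 0 then normalized r (G0,M0,l0) else cls r (G1,M1,L t))"

lemma gamma_0: "\<gamma> 0 = normalized r (G0,M0,l0)" by (simp add: \<gamma>_def)

lemma gamma_1: "\<gamma> 1 = normalized r (G1,M1,l1)" by (simp add: \<gamma>_def normalized_def L_def k_1)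

lemma pullback_L: "pullback G dE G1 (L t) = (%i. k t * segment a b t i)"
 unfolding L_def pullback_scale pullback_segment pullback_a1 ..

lemma gamma_cell:
 assumes "t:{0..1}"
 shows "cell_rel r G M (%i. k t * segment a b t i) (\<gamma> t)"
proof (cases "t = 0")
 case True
 then show ?thesis using cell_relI[OF sg normalized_in_outer_space1(1)[OF v0] c]
  by (simp add: \<gamma>_def normalized_def pullback_scale k_0)
next
 case False
 then have "valid_mmg r (G1,M1,L t)" using L_valid assms by simp
 then show ?thesis using cell_relI[OF sg _ d, of r "L t"] False by (simp add: \<gamma>_def pullback_L)
qed

lemma gamma_in:
 assumes "t:{0..1}"
 shows "\<gamma> t:outer_space1 r"
proof (cases "t = 0")
 case True
 then show ?thesis using normalized_in_outer_space1(2)[OF v0] by (simp add: \<gamma>_def)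
next
 case False
 then have "0 < t" "t <= 1" using assms by auto
 then show ?thesis using False L_valid[of t] L_entropy[of t] unfolding \<gamma>_def outer_space1_def by auto
qed

lemma s1_continuous: "continuous_on {0..1} (%t. s1 t i)" by (intro continuous_intros)

lemma s1_critical: "t:{0..1} ==> y.h.cone (s1 t) & y.h.critical (%i. k t * s1 t i)"
 using cone_s1[of t] k(2) by simp

lemma gamma_weak_cont: "weak_cont r \<gamma>"
 unfolding weak_cont_def
proof (intro allI impI)
 fix V assume V: "weak_open r V"
 let ?C = "{lam. EX x. cell_rel r G M lam x}" and ?W = "{lam. EX x:V. cell_rel r G M lam x}"
 let ?K = "%t i. k t * segment a b t i"
 have "continuous_on {0..1} ?K"
  by (rule continuous_on_coordinatewise_then_product)
   (intro continuous_intros y.h.continuous_on_critical_scale[OF s1_continuous s1_critical k(1)])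
 moreover have "?K:{0..1} \<rightarrow> ?C" using gamma_cell by blast
 moreover have "openin (top_of_set ?C) ?W" using V og vM unfolding weak_open_def by blast
 ultimately have "openin (top_of_set {0..1}) ({0..1} \<inter> ?K -` ?W)" by (rule continuous_openin_preimage)
 moreover have "{0..1} \<inter> ?K -` ?W = {t:{0..1}. \<gamma> t:V}"
  using gamma_cell cell_rel_unique[OF og vM] by blast
 ultimately show "openin (top_of_set {0..1}) {t:{0..1}. \<gamma> t:V}" by simp
qed

definition gamma_speed :: "real => real" where "gamma_speed t = y.h.speed (s1 t) u1 (k t)"

lemma gamma_speed_continuous: "continuous_on {0..1} gamma_speed"
 unfolding gamma_speed_def[abs_def] by (rule y.h.continuous_on_speed[OF s1_continuous s1_critical k(1)])

lemma sqrt_hess_form_L: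
 assumes t: "t:{0<..<1}"
 shows "sqrt (hess_form G1 (L t) (%e. deriv (%s. L s e) t)) = gamma_speed t"
proof -
 let ?v = "y.h.velocity (s1 t) u1 (k t)"
 have t01: "t:{0..1}" "0 < t" "t <= 1" using t by auto
 have "deriv (%s. L s e) t = ?v e" for e unfolding L_def
  by (rule DERIV_imp_deriv, rule y.h.segment_DERIV[of a1 l1 k t e, OF _ t]) (rule s1_critical, auto)
 then have "hess_form G1 (L t) (%e. deriv (%s. L s e) t) = hess_form G1 (L t) ?v" by simp
 also have "... = y.h.F (%p. (y.h.ev ?v p)\<^sup>2) (L t)/y.h.F (y.h.ev (L t)) (L t)"
  using L_lengths[OF t01(2,3)] s1_critical[OF t01(1)] y.h.velocity_tangent[of "s1 t" "k t" u1]
  by (intro y.h.hess_form_eq) (auto simp: L_def lengths_def)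
 finally show ?thesis by (simp add: gamma_speed_def y.h.speed_def L_def)
qed

lemma gamma_smooth_piece: "smooth_piece r 0 1 \<gamma> (integral {0..1} gamma_speed)"
 unfolding smooth_piece_def
proof (intro exI[of _ G1] exI[of _ M1] exI[of _ L] conjI ballI)
 show "outer_graph G1" "valid_marking r G1 M1" by (rule D1)+
 fix t :: real assume t: "t:{0<..<1}"
 show "L t:lengths G1" "entropy G1 (L t) = 1" using L_lengths L_entropy t by auto
 show "\<gamma> t = cls r (G1,M1,L t)" using t by (simp add: \<gamma>_def)
next
 fix e show "smooth_on {0<..<1} (%t. L t e)"
  unfolding L_def by (rule y.h.segment_smooth) (rule s1_critical, auto)
next
 have "(gamma_speed has_integral integral {0..1} gamma_speed) {0..1}"
  by (rule integrable_integral[OF integrable_continuous_real[OF gamma_speed_continuous]])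
 then show "((%t. sqrt (hess_form G1 (L t) (%e. deriv (%s. L s e) t))) has_integral integral {0..1} gamma_speed) {0..1}"
  by (rule has_integral_spike_finite[of "{0,1}", rotated 2]) (use sqrt_hess_form_L in auto)
qed

lemma gamma_length_in_path_lengths:
 "integral {0..1} gamma_speed:path_lengths r (normalized r (G0,M0,l0)) (normalized r (G1,M1,l1))"
 unfolding path_lengths_def
proof (rule CollectI, intro exI[of _ \<gamma>] exI[of _ "[0,1::real]"] exI[of _ "%_::nat. integral {0..1} gamma_speed"] conjI)
 show "ALL n. Suc n < length [0,1::real] --> smooth_piece r ([0,1::real] ! n) ([0,1] ! Suc n) \<gamma> (integral {0..1} gamma_speed)"
  using gamma_smooth_piece by (auto simp: less_Suc_eq)
qed (use gamma_0 gamma_1 gamma_in gamma_weak_cont in auto)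

lemma gamma_length_le:
 assumes C: "C > 0" and D: "D >= 0" "!!i. i:gEp G ==> \<bar>b i-a i\<bar> <= D"
  and controlled: "!!c k. (!!i. i:gEp G ==> \<bar>c i-a i\<bar> <= D) ==> z.g.cone c ==> z.g.critical (%i. k * c i) ==> z.g.controlled C c k"
 shows "integral {0..1} gamma_speed <= (C^4+C) * sqrt (C^3) * D"
proof -
 have "gamma_speed t <= (C^4+C) * sqrt (C^3) * D" if t: "t:{0..1}" for t
 proof -
  have pull_s1: "pullback G dE G1 (s1 t) = segment a b t" unfolding pullback_segment pullback_a1 ..
  note s1 = s1_critical[OF t]
  have "z.g.controlled C (segment a b t) (k t)"
  proof (rule controlled)
   show "z.g.cone (segment a b t)" using y.cone_pullback s1 by (simp flip: pull_s1)
   have "z.g.critical (pullback G dE G1 (%i. k t * s1 t i))" using s1 y.critical_pullback_iff by blast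
   then show "z.g.critical (%i. k t * segment a b t i)" by (simp only: pullback_scale pull_s1)
   fix i assume "i:gEp G"
   then have "t*\<bar>b i-a i\<bar> <= 1 * D" using t D by (intro mult_mono) auto
   then show "\<bar>segment a b t i-a i\<bar> <= D" using t by (simp add: abs_mult)
  qed
  then have "y.h.controlled C (s1 t) (k t)"
   using s1 by (intro y.controlled_pullback pullback_scale) (simp_all add: pull_s1)
  moreover have "\<bar>u1 f\<bar> <= D" if "f:gEp G1" for f
   using y.pullback_onto[OF that] D(2) unfolding pullback_a1[symmetric] by metis
  ultimately show ?thesis unfolding gamma_speed_def using s1 C D(1) by (intro y.h.speed_le) auto
 qed
 then have "integral {0..1} gamma_speed <= integral {0..1} (%t::real. (C^4+C) * sqrt (C^3) * D)"
  by (intro integral_le integrable_continuous_real gamma_speed_continuous continuous_on_const)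
 then show ?thesis by simp
qed

end

section \<open>Concatenation of paths\<close>

lemma deriv_affine:
 fixes f :: "real => real"
 assumes "f differentiable (at (c+d * t))"
 shows "deriv (%t. f (c+d * t)) t = d * deriv f (c+d * t)"
proof -
 have D: "(f has_real_derivative deriv f (c+d * t)) (at (c+d * t))"
  using assms DERIV_imp_deriv by (auto simp: real_differentiable_def)
 have "((%t. c+d * t) has_real_derivative d) (at t)" by (auto intro!: derivative_eq_intros)
 from DERIV_chain2[OF D this] show ?thesis using DERIV_imp_deriv by (simp add: mult.commute)
qed

lemma smooth_on_affine:
 assumes f: "smooth_on U f" and V: "open V" "!!t. t:V ==> c+d * t:U"
 shows "smooth_on V (%t. f (c+d * t))"
proof (rule smooth_on_if_derivatives[where S = "%g. EX C n. g = (%t. C*(deriv ^^ n) f (c+d * t))", OF V(1)])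
 show "EX C n. (%t. f (c+d * t)) = (%t. C*(deriv ^^ n) f (c+d * t))" by (rule exI[of _ 1], rule exI[of _ 0]) simp
 fix g assume "EX C n. g = (%t. C*(deriv ^^ n) f (c+d * t))"
 then obtain C n where g: "g = (%t. C*(deriv ^^ n) f (c+d * t))" by blast
 have "(g has_real_derivative (C * d)*(deriv ^^ Suc n) f (c+d * t)) (at t)" if "t:V" for t
 proof -
  have "((deriv ^^ n) f has_real_derivative (deriv ^^ Suc n) f (c+d * t)) (at (c+d * t))"
   using f V(2)[OF that] DERIV_imp_deriv by (fastforce simp: smooth_on_def real_differentiable_def)
  moreover have "((%t. c+d * t) has_real_derivative d) (at t)" by (auto intro!: derivative_eq_intros)
  ultimately show ?thesis unfolding g mult.assoc mult.commute[of d] by (intro DERIV_cmult DERIV_chain2)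
 qed
 then show "EX g'. (EX C n. g' = (%t. C*(deriv ^^ n) f (c+d * t))) & (ALL t:V. (g has_real_derivative g' t) (at t))"
  by blast
qed

lemma hess_form_scale: "hess_form G l (%e. d * v e) = d\<^sup>2 * hess_form G l v"
 unfolding hess_form_def by (simp add: sum_distrib_left power2_eq_square mult_ac)

lemma has_integral_affine_real:
 fixes f :: "real => real"
 assumes f: "(f has_integral I) {a..b}" and d: "d ~= 0" and ab: "!!t. t:{a'..b'} \<longleftrightarrow> c+d * t:{a..b}"
 shows "((%t. \<bar>d\<bar> * f (c+d * t)) has_integral I) {a'..b'}"
proof -
 let ?inv = "%x. (1/d) *\<^sub>R x + - ((1/d) *\<^sub>R c)"
 have "?inv ` {a..b} = {a'..b'}"
 proof (rule set_eqI)
  fix t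
  have inv: "t = ?inv x \<longleftrightarrow> c+d * t = x" for x using d by (auto simp: field_simps)
  show "t:?inv ` {a..b} \<longleftrightarrow> t:{a'..b'}" unfolding ab image_iff inv by simp
 qed
 moreover have "((%t. f (d *\<^sub>R t+c)) has_integral (1/\<bar>d\<bar>^DIM(real)) *\<^sub>R I) (?inv ` cbox a b)"
  by (rule has_integral_affinity) (use f d in auto)
 ultimately have "((%t. f (c+d * t)) has_integral (1/\<bar>d\<bar>) * I) {a'..b'}" by (simp add: add.commute)
 from has_integral_mult_right[OF this, of "\<bar>d\<bar>"] show ?thesis using d by simp
qed

lemma smooth_piece_affine:
 assumes p: "smooth_piece r a b \<gamma> I" and d: "d ~= 0" and ab: "!!t. t:{a'..b'} \<longleftrightarrow> c+d * t:{a..b}"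
  and inner: "!!t. t:{a'<..<b'} ==> c+d * t:{a<..<b} & \<gamma>' t = \<gamma> (c+d * t)"
 shows "smooth_piece r a' b' \<gamma>' I"
proof -
 obtain G M L where L: "outer_graph G" "valid_marking r G M"
   "!!t. t:{a<..<b} ==> L t:lengths G & entropy G (L t) = 1 & \<gamma> t = cls r (G,M,L t)"
   "!!e. e:gEp G ==> smooth_on {a<..<b} (%t. L t e)"
   "((%t. sqrt (hess_form G (L t) (%e. deriv (%s. L s e) t))) has_integral I) {a..b}"
  using p unfolding smooth_piece_def by blast
 note affine = has_integral_affine_real[OF L(5) d ab]
 show ?thesis unfolding smooth_piece_def
 proof (intro exI[of _ G] exI[of _ M] exI[of _ "%t. L (c+d * t)"] conjI ballI L(1,2))
  fix t assume "t:{a'<..<b'}"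
  then show "L (c+d * t):lengths G" "entropy G (L (c+d * t)) = 1" "\<gamma>' t = cls r (G,M,L (c+d * t))"
   using L(3) inner by auto
 next
  fix e assume "e:gEp G"
  then show "smooth_on {a'<..<b'} (%t. L (c+d * t) e)"
   using inner by (intro smooth_on_affine[OF L(4)] open_greaterThanLessThan) auto
 next
  show "((%t. sqrt (hess_form G (L (c+d * t)) (%e. deriv (%s. L (c+d * s) e) t))) has_integral I) {a'..b'}"
  proof (rule has_integral_spike_finite[of "{a',b'}", OF _ _ affine])
   fix t assume "t:{a'..b'}-{a',b'}"
   then have "c+d * t:{a<..<b}" using inner by auto
   then have "(%s. L s e) differentiable (at (c+d * t))" if "e:gEp G" for e
    using L(4)[OF that] unfolding smooth_on_def by (metis funpow_0)
   then have "hess_form G (L (c+d * t)) (%e. deriv (%s. L (c+d * s) e) t)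
     = hess_form G (L (c+d * t)) (%e. d * deriv (%s. L s e) (c+d * t))"
    by (intro hess_form_cong deriv_affine)
   then show "sqrt (hess_form G (L (c+d * t)) (%e. deriv (%s. L (c+d * s) e) t)) =
     \<bar>d\<bar> * sqrt (hess_form G (L (c+d * t)) (%e. deriv (%s. L s e) (c+d * t)))"
    by (simp add: hess_form_scale real_sqrt_mult)
  qed simp
 qed
qed

definition smoothly_joined :: "nat => mmg set => mmg set => bool" where
 "smoothly_joined r x y \<longleftrightarrow> (EX \<gamma> I. \<gamma> 0 = x & \<gamma> 1 = y & (ALL t:{0..1}. \<gamma> t:outer_space1 r) & weak_cont r \<gamma> & smooth_piece r 0 1 \<gamma> I)"

lemma smoothly_joined_sym:
 assumes "smoothly_joined r x y"
 shows "smoothly_joined r y x"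
proof -
 obtain \<gamma> I where g: "\<gamma> 0 = x" "\<gamma> 1 = y" "!!t. t:{0..1} ==> \<gamma> t:outer_space1 r" "weak_cont r \<gamma>" "smooth_piece r 0 1 \<gamma> I"
  using assms unfolding smoothly_joined_def by blast
 have "weak_cont r (%t. \<gamma> (1-t))" unfolding weak_cont_def
 proof (intro allI impI)
  fix V assume "weak_open r V"
  then have "openin (top_of_set {0..1}) {t:{0..1}. \<gamma> t:V}" using g(4) by (simp add: weak_cont_def)
  moreover have "continuous_on {0..1} (%t::real. 1-t)" by (intro continuous_intros)
  moreover have "(%t::real. 1-t):{0..1} \<rightarrow> {0..1}" by auto
  ultimately have "openin (top_of_set {0..1}) ({0..1} \<inter> (%t::real. 1-t) -` {t:{0..1}. \<gamma> t:V})"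
   using continuous_openin_preimage by blast
  moreover have "{0..1} \<inter> (%t::real. 1-t) -` {t:{0..1}. \<gamma> t:V} = {t:{0..1}. \<gamma> (1-t):V}" by auto
  ultimately show "openin (top_of_set {0..1}) {t:{0..1}. \<gamma> (1-t):V}" by simp
 qed
 moreover have "smooth_piece r 0 1 (%t. \<gamma> (1-t)) I"
  by (rule smooth_piece_affine[OF g(5), of "-1" _ _ 1]) auto
 ultimately show ?thesis unfolding smoothly_joined_def using g by (intro exI[of _ "%t. \<gamma> (1-t)"] exI[of _ I]) auto
qed

lemma weak_cont_join:
 assumes "weak_cont r \<gamma>1" "weak_cont r \<gamma>2" "\<gamma>1 1 = \<gamma>2 0"
 shows "weak_cont r (%t. if t <= 1/2 then \<gamma>1 (2 * t) else \<gamma>2 (2 * t-1))"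
 unfolding weak_cont_def
proof (intro allI impI)
 fix V assume V: "weak_open r V"
 obtain T1 where T1: "open T1" "{t:{0..1}. \<gamma>1 t:V} = {0..1} \<inter> T1" using assms(1) V unfolding weak_cont_def openin_open by blast
 obtain T2 where T2: "open T2" "{t:{0..1}. \<gamma>2 t:V} = {0..1} \<inter> T2" using assms(2) V unfolding weak_cont_def openin_open by blast
 have mem1: "\<gamma>1 t:V \<longleftrightarrow> t:T1" if "t:{0..1}" for t using T1(2) that by blast
 have mem2: "\<gamma>2 t:V \<longleftrightarrow> t:T2" if "t:{0..1}" for t using T2(2) that by blast
 define A1 where "A1 = (%t::real. 2 * t) -` T1"
 define A2 where "A2 = (%t::real. 2 * t-1) -` T2"
 have open_A: "open A1" "open A2" unfolding A1_def A2_def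
  by (intro continuous_open_vimage T1 T2 continuous_intros)+
 define T where "T = ({..<1/2} \<inter> A1) \<union> ({1/2<..} \<inter> A2) \<union> (A1 \<inter> A2)"
 have "open T" unfolding T_def using open_A by (intro open_Un open_Int) auto
 moreover have "{t:{0..1}. (if t <= 1/2 then \<gamma>1 (2 * t) else \<gamma>2 (2 * t-1)):V} = {0..1} \<inter> T"
 proof (rule set_eqI)
  fix t :: real
  consider (left) "t < 1/2" | (middle) "t = 1/2" | (right) "t > 1/2" by linarith
  then show "t:{t:{0..1}. (if t <= 1/2 then \<gamma>1 (2 * t) else \<gamma>2 (2 * t-1)):V} \<longleftrightarrow> t:{0..1} \<inter> T"
  proof cases
   case left
   then show ?thesis using mem1[of "2 * t"] by (auto simp: T_def A1_def)
  next
   case middle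
   have "\<gamma>1 1:V \<longleftrightarrow> 1:T1" "\<gamma>2 0:V \<longleftrightarrow> 0:T2" using mem1[of 1] mem2[of 0] by auto
   then show ?thesis unfolding middle using assms(3) by (simp add: T_def A1_def A2_def)
  next
   case right
   then show ?thesis using mem2[of "2 * t-1"] by (auto simp: T_def A2_def)
  qed
 qed
 ultimately show "openin (top_of_set {0..1}) {t:{0..1}. (if t <= 1/2 then \<gamma>1 (2 * t) else \<gamma>2 (2 * t-1)):V}"
  unfolding openin_open by blast
qed

lemma strict_sorted_bounds:
 fixes ts :: "real list"
 assumes "sorted_wrt (<) ts" "t:set ts"
 shows "hd ts <= t" "t <= last ts"
proof -
 obtain i where i: "i < length ts" "t = ts ! i" using assms(2) by (metis in_set_conv_nth)
 have "sorted ts" by (rule strict_sorted_imp_sorted[OF assms(1)])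
 then show "hd ts <= t" "t <= last ts"
  using i sorted_nth_mono[of ts 0 i] sorted_nth_mono[of ts i "length ts-1"]
   hd_conv_nth[of ts] last_conv_nth[of ts] by force+
qed

lemma path_lengths_extend:
 assumes "path_lengths r x y ~= {}" "smoothly_joined r y z"
 shows "path_lengths r x z ~= {}"
proof -
 obtain s where "s:path_lengths r x y" using assms(1) by blast
 then obtain \<gamma>1 ts I where g1: "\<gamma>1 0 = x" "\<gamma>1 1 = y" "!!t. t:{0..1} ==> \<gamma>1 t:outer_space1 r" "weak_cont r \<gamma>1"
  "length ts >= 2" "hd ts = 0" "last ts = 1" "sorted_wrt (<) ts"
  "!!k. Suc k < length ts ==> smooth_piece r (ts ! k) (ts ! Suc k) \<gamma>1 (I k)"
  unfolding path_lengths_def by blast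
 obtain \<gamma>2 J where g2: "\<gamma>2 0 = y" "\<gamma>2 1 = z" "!!t. t:{0..1} ==> \<gamma>2 t:outer_space1 r" "weak_cont r \<gamma>2" "smooth_piece r 0 1 \<gamma>2 J"
  using assms(2) unfolding smoothly_joined_def by blast
 define \<gamma> where "\<gamma> = (%t::real. if t <= 1/2 then \<gamma>1 (2 * t) else \<gamma>2 (2 * t-1))"
 define us where "us = map (%t. t/2) ts@[1]"
 define K where "K k = (if Suc k < length ts then I k else J)" for k
 have ts_nonempty: "ts ~= []" using g1(5) by auto
 have le1: "t <= 1" if "t:set ts" for t using strict_sorted_bounds(2)[OF g1(8) that] g1(7) by simp
 have "sorted_wrt (<) us" unfolding us_def sorted_wrt_append
  using g1(8) le1 by (auto simp: sorted_wrt_map) (fastforce dest: le1)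
 moreover have "smooth_piece r (us ! k) (us ! Suc k) \<gamma> (K k)" if k: "Suc k < length us" for k
 proof (cases "Suc k < length ts")
  case True
  then have "us ! k = ts ! k/2" "us ! Suc k = ts ! Suc k/2" "K k = I k" by (auto simp: us_def K_def nth_append)
  moreover have "smooth_piece r (ts ! k/2) (ts ! Suc k/2) \<gamma> (I k)"
   by (rule smooth_piece_affine[OF g1(9)[OF True], of 2 _ _ 0]) (use le1[of "ts ! Suc k"] True in \<open>auto simp: \<gamma>_def\<close>)
  ultimately show ?thesis by (simp only:)
 next
  case False
  then have "k = length ts-1" using k ts_nonempty by (simp add: us_def)
  then have "us ! k = 1/2" "us ! Suc k = 1" "K k = J"
   using ts_nonempty g1(7) last_conv_nth[OF ts_nonempty] by (auto simp: us_def K_def nth_append)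
  moreover have "smooth_piece r (1/2) 1 \<gamma> J"
   by (rule smooth_piece_affine[OF g2(5), of 2 _ _ "-1"]) (auto simp: \<gamma>_def)
  ultimately show ?thesis by (simp only:)
 qed
 moreover have "\<gamma> 0 = x" "\<gamma> 1 = z" "ALL t:{0..1}. \<gamma> t:outer_space1 r" using g1(1,3) g2(2,3) by (auto simp: \<gamma>_def)
 moreover have "weak_cont r \<gamma>" unfolding \<gamma>_def using weak_cont_join[OF g1(4) g2(4)] g1(2) g2(1) by simp
 moreover have "length us >= 2" "hd us = 0" "last us = 1" using g1(5,6) ts_nonempty by (auto simp: us_def hd_map)
 ultimately have "(\<Sum>k<length us-1. K k):path_lengths r x z"
  unfolding path_lengths_def by blast
 then show ?thesis by blast
qed

section \<open>Metrically open sets are weakly open\<close>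

lemma smoothly_joined_collapse:
 assumes v0: "valid_mmg r (G0,M0,l0)" and v: "valid_mmg r (G,M,l)" and c: "marked_collapse G M G0 M0 cV cE"
 shows "smoothly_joined r (normalized r (G0,M0,l0)) (normalized r (G,M,l))"
proof -
 note D0 = valid_mmgD[OF v0] and D = valid_mmgD[OF v]
 interpret graph_collapse G G0 cV cE using D D0 c by unfold_locales (auto simp: marked_collapse_def)
 obtain g e0 where e0: "e0:gE G" "cE e0 = Some g" using outer_edge[OF D0(1)] edge_ex by metis
 interpret s: cell_segment r G M G0 M0 l0 cV cE G M l id Some e0
  by unfold_locales (use D D0 v v0 c e0 marked_collapse_id[OF D(2,4)] in auto)
 show ?thesis unfolding smoothly_joined_def
  using s.gamma_0 s.gamma_1 s.gamma_in s.gamma_weak_cont s.gamma_smooth_piece by blast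
qed

lemma isometric_pullbackE:
 assumes v: "valid_mmg r (G,M,l)" "valid_mmg r (G',M',l')" and m: "isometric (G,M,l) (G',M',l')"
 obtains cV cE where "marked_collapse G M G' M' cV cE" "!!e. e:gE G ==> cE e ~= None" "l = pullback G cE G' l'"
proof -
 note D = valid_mmgD[OF v(1)] and D' = valid_mmgD[OF v(2)]
 obtain cV cE where c: "marked_collapse G M G' M' cV cE" "!!e. e:gE G ==> EX f. cE e = Some f & len G' l' f = len G l e"
  using m by (rule isometricE) blast
 have "l = pullback G cE G' l'"
 proof (rule pullback_eqI[OF D(2) D'(2)])
  show "forest_collapse G G' cV cE" using c(1) by (simp add: marked_collapse_def)
  show "l e = 0" if "e ~: gEp G" for e using D(5) that by (simp add: lengths_def)
  show "len G l e = (case cE e of Some f => len G' l' f | None => 0)" if "e:gE G" for e using c(2)[OF that] by auto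
 qed
 then show ?thesis using that c by force
qed

lemma isometric_entropy:
 assumes v: "valid_mmg r (G,M,l)" "valid_mmg r (G',M',l')" and m: "isometric (G,M,l) (G',M',l')"
 shows "entropy G l = entropy G' l'"
proof -
 note D = valid_mmgD[OF v(1)] and D' = valid_mmgD[OF v(2)] and pos = valid_mmg_pos_len[OF v(1)] valid_mmg_pos_len[OF v(2)]
 obtain cV cE where c: "marked_collapse G M G' M' cV cE" "!!e. e:gE G ==> cE e ~= None" and l: "l = pullback G cE G' l'"
  using isometric_pullbackE[OF assms] by blast
 obtain e0 f0 where e0: "e0:gE G" "cE e0 = Some f0" using outer_edge[OF D(1)] c(2) by blast
 interpret collapse_loops G G' cV cE e0 f0 by unfold_locales (use D D' c(1) e0 in \<open>auto simp: marked_collapse_def\<close>)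
 have "g.critical (%i. entropy G' l' * l i)"
  using h.critical_entropy[OF pos(2)] critical_pullback_iff by (simp add: l flip: pullback_scale)
 then show ?thesis by (intro g.entropy_eq[OF pos(1)] h.entropy_pos[OF pos(2)])
qed

lemma normalized_cong:
 assumes v: "valid_mmg r t" "valid_mmg r t'" and m: "isometric t t'"
 shows "normalized r t = normalized r t'"
proof -
 obtain G M l G' M' l' where t: "t = (G,M,l)" "t' = (G',M',l')" by (metis surj_pair)
 have entropy: "entropy G l = entropy G' l'" by (rule isometric_entropy[OF v[unfolded t] m[unfolded t]])
 obtain cV cE where c: "marked_collapse G M G' M' cV cE" "!!e. e:gE G ==> EX f. cE e = Some f & len G' l' f = len G l e"
  using m unfolding t by (rule isometricE) blast
 have "isometric (G,M,%i. entropy G l * l i) (G',M',%i. entropy G' l' * l' i)"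
  using c(2) by (intro isometricI[OF c(1)]) (fastforce simp: len_scale entropy)
 then show ?thesis unfolding t normalized_def prod.case
  using cls_eq_iff normalized_in_outer_space1(1) v[unfolded t] by blast
qed

definition lengths_close :: "sgraph => real => (nat => real) => (nat => real) => bool" where
 "lengths_close G \<delta> x y \<longleftrightarrow> (ALL i:gEp G. \<bar>x i-y i\<bar> < \<delta>)"

lemma lengths_closeD: "serre_graph G ==> lengths_close G \<delta> x y ==> e:gE G ==> \<bar>len G x e-len G y e\<bar> < \<delta>"
 using serre_Ep[of G e] by (auto simp: len_def lengths_close_def)

lemma openin_if_lengths_close:
 assumes "serre_graph G" "W <= C"
  and ball: "!!lam. lam:W ==> EX \<delta>>0. ALL lam':C. lengths_close G \<delta> lam' lam --> lam':W"
 shows "openin (top_of_set C) W"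
proof (subst openin_subopen, rule ballI)
 fix lam assume lam: "lam:W"
 obtain \<delta> where \<delta>: "\<delta> > 0" "ALL lam':C. lengths_close G \<delta> lam' lam --> lam':W" using ball[OF lam] by blast
 have "open {f :: nat => real. \<bar>f i-lam i\<bar> < \<delta>}" for i
  by (intro open_Collect_less continuous_intros continuous_on_product_coordinates)
 then have "open (\<Inter>i\<in>gEp G. {f. \<bar>f i-lam i\<bar> < \<delta>})" using serre_fin(5)[OF assms(1)] by (intro open_INT) auto
 moreover have "(\<Inter>i\<in>gEp G. {f. \<bar>f i-lam i\<bar> < \<delta>}) = {f. lengths_close G \<delta> f lam}" by (auto simp: lengths_close_def)
 ultimately have "openin (top_of_set C) (C \<inter> {f. lengths_close G \<delta> f lam})" by (simp add: openin_open_Int)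
 moreover have "lam:C \<inter> {f. lengths_close G \<delta> f lam}" using lam assms(2) \<delta>(1) by (auto simp: lengths_close_def)
 ultimately show "EX T. openin (top_of_set C) T & lam:T & T <= W" using \<delta>(2) by blast
qed

lemma lengths_bounded_below:
 assumes "outer_graph G" "l:lengths G"
 obtains \<delta> where "\<delta> > 0" "!!e. e:gE G ==> \<delta> <= len G l e"
proof -
 have fin: "finite (len G l ` gE G)" using serre_fin(2)[OF outerD(1)[OF assms(1)]] by simp
 obtain e where e: "e:gE G" using outer_edge[OF assms(1)] .
 show ?thesis
 proof (rule that)
  show "Min (len G l ` gE G) > 0" using fin e len_lengths_pos[OF outerD(1)[OF assms(1)] assms(2)] by (subst Min_gr_iff) auto
  show "Min (len G l ` gE G) <= len G l e" if "e:gE G" for e using fin that by (intro Min_le) auto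
 qed
qed

lemma collapsed_if_lengths_close:
 assumes sg: "serre_graph G" "serre_graph G0" "serre_graph G1"
  and c: "forest_collapse G G0 cV cE" and d: "forest_collapse G G1 dV dE" and l0: "!!f. f:gE G0 ==> \<delta> <= len G0 l0 f"
  and close: "lengths_close G \<delta> (pullback G dE G1 l1) (pullback G cE G0 l0)" and e: "e:gE G" "dE e = None"
 shows "cE e = None"
proof (rule ccontr)
 interpret graph_collapse G G0 cV cE using sg c by unfold_locales
 assume "cE e ~= None"
 then obtain f where f: "cE e = Some f" by blast
 have "\<delta> <= len G (pullback G cE G0 l0) e"
  using l0 edge_Some[OF e(1) f] len_pullback[OF sg(1,2) c e(1), of l0] f by simp
 moreover have "len G (pullback G dE G1 l1) e = 0" using len_pullback[OF sg(1,3) d e(1), of l1] e(2) by simp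
 ultimately show False using lengths_closeD[OF sg(1) close e(1)] by linarith
qed

lemma (in cell_segment) controlled_near_start:
 obtains \<delta> C where "\<delta> > 0" "C > 0" "!!c k. (!!i. i:gEp G ==> \<bar>c i-a i\<bar> < \<delta>) ==> z.g.cone c ==>
  z.g.critical (%i. k * c i) ==> z.g.controlled C c k"
proof -
 note pos = valid_mmg_pos_len[OF v0]
 have "z.g.critical (%i. entropy G0 l0 * a i)"
  using z.h.critical_entropy[OF pos] z.critical_pullback_iff by (simp flip: pullback_scale)
 from z.g.controlled_near[OF cone_a this entropy_normalized(1)[OF D0(1) pos]] that show ?thesis by blast
qed

lemma d_h_small_near_face:
 assumes og: "outer_graph G" and vM: "valid_marking r G M" and v0: "valid_mmg r (G0,M0,l0)"
  and c: "marked_collapse G M G0 M0 cV cE" and \<epsilon>: "\<epsilon> > 0"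
 obtains \<delta> where "\<delta> > 0" "!!G1 M1 l1 dV dE. valid_mmg r (G1,M1,l1) ==> marked_collapse G M G1 M1 dV dE ==>
  lengths_close G \<delta> (pullback G dE G1 l1) (pullback G cE G0 l0) ==>
  d_h r (normalized r (G0,M0,l0)) (normalized r (G1,M1,l1)) < ereal \<epsilon>"
proof -
 note D0 = valid_mmgD[OF v0] and sg = outerD(1)[OF og]
 have forest_c: "forest_collapse G G0 cV cE" using c by (simp add: marked_collapse_def)
 interpret graph_collapse G G0 cV cE using sg D0 forest_c by unfold_locales
 obtain g e0 where e0: "e0:gE G" "cE e0 = Some g" using outer_edge[OF D0(1)] edge_ex by metis
 interpret s0: cell_segment r G M G0 M0 l0 cV cE G0 M0 l0 cV cE e0
  by unfold_locales (use og vM v0 c e0 in auto)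
 let ?a = "pullback G cE G0 l0"
 obtain \<delta>1 C where C: "\<delta>1 > 0" "C > 0" "!!c k. (!!i. i:gEp G ==> \<bar>c i-?a i\<bar> < \<delta>1) ==> s0.z.g.cone c ==>
   s0.z.g.critical (%i. k * c i) ==> s0.z.g.controlled C c k"
  using s0.controlled_near_start by blast
 obtain \<delta>2 where \<delta>2: "\<delta>2 > 0" "!!f. f:gE G0 ==> \<delta>2 <= len G0 l0 f" using lengths_bounded_below[OF D0(1,5)] by blast
 define B where "B = (C^4+C) * sqrt (C^3)"
 have B: "B > 0" unfolding B_def using C(2) by (intro mult_pos_pos add_pos_pos) auto
 define \<delta> where "\<delta> = min (\<delta>1/2) (min \<delta>2 (\<epsilon>/(2 * B)))"
 have \<delta>: "\<delta> > 0" "\<delta> < \<delta>1" "\<delta> <= \<delta>2" using C(1) \<delta>2(1) \<epsilon> B by (auto simp: \<delta>_def)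
 have "B*\<delta> <= B*(\<epsilon>/(2 * B))" using B by (intro mult_left_mono) (auto simp: \<delta>_def)
 also have "... < \<epsilon>" using B \<epsilon> by simp
 finally have B\<delta>: "B*\<delta> < \<epsilon>" .
 have "d_h r (normalized r (G0,M0,l0)) (normalized r (G1,M1,l1)) < ereal \<epsilon>"
  if v1: "valid_mmg r (G1,M1,l1)" and d: "marked_collapse G M G1 M1 dV dE"
   and close: "lengths_close G \<delta> (pullback G dE G1 l1) ?a" for G1 M1 l1 dV dE
 proof -
  have forest_d: "forest_collapse G G1 dV dE" using d by (simp add: marked_collapse_def)
  have "cE e = None" if "e:gE G" "dE e = None" for e
   using collapsed_if_lengths_close[OF sg D0(2) valid_mmgD(2)[OF v1] forest_c forest_d _ close that] \<delta>(3) \<delta>2(2) by fastforce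
  then interpret s: cell_segment r G M G0 M0 l0 cV cE G1 M1 l1 dV dE e0
   by unfold_locales (use og vM v0 c v1 d e0 in auto)
  have "integral {0..1} s.gamma_speed <= B*\<delta>" unfolding B_def
  proof (rule s.gamma_length_le[OF C(2)])
   show "0 <= \<delta>" using \<delta>(1) by simp
   show "\<bar>pullback G dE G1 l1 i-?a i\<bar> <= \<delta>" if "i:gEp G" for i using close that by (force simp: lengths_close_def)
   show "s0.z.g.controlled C x k" if "!!i. i:gEp G ==> \<bar>x i-?a i\<bar> <= \<delta>" "s0.z.g.cone x" "s0.z.g.critical (%i. k * x i)" for x k
    using C(3)[of x k] that \<delta>(2) by force
  qed
  then have "integral {0..1} s.gamma_speed < \<epsilon>" using B\<delta> by linarith
  then show ?thesis unfolding d_h_def INF_less_iff using s.gamma_length_in_path_lengths by force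
 qed
 then show ?thesis using that \<delta>(1) by blast
qed

definition rescalings :: "nat => mmg set set => mmg set set" where
 "rescalings r U = {cls r t |t. valid_mmg r t & normalized r t:U}"

lemma cls_in_rescalings_iff:
 assumes "valid_mmg r t"
 shows "cls r t:rescalings r U \<longleftrightarrow> normalized r t:U"
proof
 assume "cls r t:rescalings r U"
 then obtain t' where t': "valid_mmg r t'" "cls r t = cls r t'" "normalized r t':U" unfolding rescalings_def by blast
 then have "isometric t t'" using cls_eq_iff[OF assms t'(1)] by simp
 then show "normalized r t:U" using normalized_cong[OF assms t'(1)] t'(3) by simp
qed (use assms rescalings_def in blast)

lemma outer_space1E:
 assumes "x:outer_space1 r"
 obtains G M l where "valid_mmg r (G,M,l)" "entropy G l = 1" "x = cls r (G,M,l)"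
 using assms unfolding outer_space1_def by blast

lemma rescalings_Int_outer_space1:
 assumes U: "U <= outer_space1 r"
 shows "rescalings r U \<inter> outer_space1 r = U"
proof -
 have "x:rescalings r U \<longleftrightarrow> x:U" if x: "x:outer_space1 r" for x
 proof -
  obtain G M l where t: "valid_mmg r (G,M,l)" "entropy G l = 1" "x = cls r (G,M,l)" by (rule outer_space1E[OF x])
  then have "normalized r (G,M,l) = x" by (simp add: normalized_def)
  then show ?thesis using cls_in_rescalings_iff[OF t(1)] t(3) by simp
 qed
 then show ?thesis using U by blast
qed

lemma weak_open_rescalings:
 assumes "!!x. x:U ==> EX \<epsilon>>0. ALL y:outer_space1 r. d_h r x y < ereal \<epsilon> --> y:U"
 shows "weak_open r (rescalings r U)"
 unfolding weak_open_def
proof (intro conjI allI impI)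
 show "rescalings r U <= outer_space r" unfolding rescalings_def outer_space_def by blast
 fix G M assume "outer_graph G & valid_marking r G M"
 then have outer_G: "outer_graph G" and valid_M: "valid_marking r G M" by auto
 note sg = outerD(1)[OF outer_G]
 let ?C = "{lam. EX x. cell_rel r G M lam x}" and ?W = "{lam. EX x:rescalings r U. cell_rel r G M lam x}"
 show "openin (top_of_set ?C) ?W"
 proof (rule openin_if_lengths_close[OF sg])
  fix lam assume "lam:?W"
  then obtain x where x: "x:rescalings r U" "cell_rel r G M lam x" by blast
  obtain G0 M0 l0 cV cE where t0: "valid_mmg r (G0,M0,l0)" "marked_collapse G M G0 M0 cV cE"
   "lam = pullback G cE G0 l0" "x = cls r (G0,M0,l0)" by (rule cell_relE[OF sg x(2)])
  have "normalized r (G0,M0,l0):U" using cls_in_rescalings_iff[OF t0(1)] x(1) t0(4) by simp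
  then obtain \<epsilon> where \<epsilon>: "\<epsilon> > 0" "!!y. y:outer_space1 r ==> d_h r (normalized r (G0,M0,l0)) y < ereal \<epsilon> ==> y:U"
   using assms by blast
  obtain \<delta> where \<delta>: "\<delta> > 0" "!!G1 M1 l1 dV dE. valid_mmg r (G1,M1,l1) ==> marked_collapse G M G1 M1 dV dE ==>
    lengths_close G \<delta> (pullback G dE G1 l1) (pullback G cE G0 l0) ==>
    d_h r (normalized r (G0,M0,l0)) (normalized r (G1,M1,l1)) < ereal \<epsilon>"
   using d_h_small_near_face[OF outer_G valid_M t0(1,2) \<epsilon>(1)] by blast
  have "lam':?W" if C: "lam':?C" and close: "lengths_close G \<delta> lam' lam" for lam'
  proof -
   obtain y where y: "cell_rel r G M lam' y" using C by blast
   obtain G1 M1 l1 dV dE where t1: "valid_mmg r (G1,M1,l1)" "marked_collapse G M G1 M1 dV dE"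
    "lam' = pullback G dE G1 l1" "y = cls r (G1,M1,l1)" by (rule cell_relE[OF sg y])
   have "normalized r (G1,M1,l1):U"
    using \<epsilon>(2)[OF normalized_in_outer_space1(2)[OF t1(1)] \<delta>(2)[OF t1(1,2)]] close t1(3) t0(3) by simp
   then show ?thesis using y cls_in_rescalings_iff[OF t1(1)] t1(4) by blast
  qed
  then show "EX \<delta>>0. ALL lam':?C. lengths_close G \<delta> lam' lam --> lam':?W" using \<delta>(1) by blast
 qed blast
qed

lemma metric_open_weak_open:
 assumes "U <= outer_space1 r" "ALL x:U. EX \<epsilon>>0. ALL y:outer_space1 r. d_h r x y < ereal \<epsilon> --> y:U"
 shows "EX V. weak_open r V & U = V \<inter> outer_space1 r"
 using weak_open_rescalings[of U r] rescalings_Int_outer_space1[OF assms(1)] assms(2) by blast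

section \<open>Star neighbourhoods\<close>

lemma pullback_compose:
 assumes sg: "serre_graph G" "serre_graph H" "serre_graph K" and c: "forest_collapse G H cV cE" and b: "forest_collapse H K bV bE"
 shows "pullback G (%e. Option.bind (cE e) bE) K l = pullback G cE H (pullback H bE K l)"
proof
 fix e
 interpret graph_collapse G H cV cE using sg c by unfold_locales
 show "pullback G (%e. Option.bind (cE e) bE) K l e = pullback G cE H (pullback H bE K l) e"
  using edge_Some[of e] serre_fin(3)[OF sg(1)] len_pullback[OF sg(2,3) b, of _ l]
  by (cases "cE e") (auto simp: pullback_def[of G])
qed

lemma (in graph_collapse) lengths_close_if_pullback:
 "lengths_close G \<delta> (pullback G cE H x) (pullback G cE H y) ==> lengths_close H \<delta> x y"
 unfolding lengths_close_def using pullback_onto by metis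

lemma (in graph_collapse) lengths_close_pullback:
 assumes "lengths_close H \<delta> x y" "\<delta> > 0"
 shows "lengths_close G \<delta> (pullback G cE H x) (pullback G cE H y)"
 unfolding lengths_close_def
proof
 fix i assume i: "i:gEp G"
 then have "i:gE G" using serre_fin(3)[OF sG] by blast
 then show "\<bar>pullback G cE H x i-pullback G cE H y i\<bar> < \<delta>"
  using i lengths_closeD[OF sH assms(1)] edge_Some assms(2) by (cases "cE i") (auto simp: pullback_def)
qed

lemma lengths_close_mono: "lengths_close G \<alpha> x y ==> \<alpha> <= \<beta> ==> lengths_close G \<beta> x y"
 by (force simp: lengths_close_def)

lemma lengths_close_trans: "lengths_close G \<alpha> x y ==> lengths_close G \<beta> y z ==> lengths_close G (\<alpha>+\<beta>) x z"
 by (fastforce simp: lengths_close_def)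

lemma lengths_close_slack:
 assumes "serre_graph G" "lengths_close G \<delta> x y" "\<delta> > 0"
 obtains \<eta> where "\<eta> > 0" "\<eta> < \<delta>" "lengths_close G (\<delta>-\<eta>) x y"
proof -
 let ?S = "insert \<delta> ((%i. \<delta>-\<bar>x i-y i\<bar>) ` gEp G)"
 have fin: "finite ?S" using serre_fin(5)[OF assms(1)] by simp
 have pos: "Min ?S > 0" using fin assms(2,3) by (subst Min_gr_iff) (auto simp: lengths_close_def)
 have "Min ?S <= \<delta>-\<bar>x i-y i\<bar>" if "i:gEp G" for i using fin that by (intro Min_le) auto
 moreover have "Min ?S <= \<delta>" using fin by (intro Min_le) auto
 ultimately show ?thesis using that[of "Min ?S/2"] pos by (fastforce simp: lengths_close_def)
qed

definition star_nbhd :: "nat => sgraph => nat \<times> nat list list => (nat => real) => real => mmg set set" where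
 "star_nbhd r G0 M0 l0 \<delta> = {y. EX G M l cV cE. valid_mmg r (G,M,l) & marked_collapse G M G0 M0 cV cE &
   lengths_close G \<delta> l (pullback G cE G0 l0) & y = cls r (G,M,l)}"

lemma star_nbhd_mono: "\<alpha> <= \<beta> ==> star_nbhd r G M l \<alpha> <= star_nbhd r G M l \<beta>"
 unfolding star_nbhd_def using lengths_close_mono by blast

lemma star_nbhdI:
 "valid_mmg r (G,M,l) ==> marked_collapse G M G0 M0 cV cE ==> lengths_close G \<delta> l (pullback G cE G0 l0) ==>
  cls r (G,M,l):star_nbhd r G0 M0 l0 \<delta>"
 unfolding star_nbhd_def by blast

lemma star_nbhdE:
 assumes v: "valid_mmg r (G,M,l)" and v0: "valid_mmg r (G0,M0,l0)" and "\<delta> > 0"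
  and "cls r (G,M,l):star_nbhd r G0 M0 l0 \<delta>"
 obtains cV cE where "marked_collapse G M G0 M0 cV cE" "lengths_close G \<delta> l (pullback G cE G0 l0)"
proof -
 obtain G1 M1 l1 cV cE where v1: "valid_mmg r (G1,M1,l1)" and c: "marked_collapse G1 M1 G0 M0 cV cE"
  and close: "lengths_close G1 \<delta> l1 (pullback G1 cE G0 l0)" and eq: "cls r (G,M,l) = cls r (G1,M1,l1)"
  using assms(4) by (auto simp: star_nbhd_def)
 note D = valid_mmgD[OF v] and D0 = valid_mmgD[OF v0] and D1 = valid_mmgD[OF v1]
 obtain iV iE where i: "marked_collapse G M G1 M1 iV iE" and l: "l = pullback G iE G1 l1"
  using isometric_pullbackE[OF v v1 iffD1[OF cls_eq_iff[OF v v1] eq]] by metis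
 interpret graph_collapse G G1 iV iE using D D1 i by unfold_locales (auto simp: marked_collapse_def)
 have "marked_collapse G M G0 M0 (cV \<circ> iV) (%e. Option.bind (iE e) cE)"
  by (rule marked_collapse_compose[OF D(2) D1(2) D0(2) D(4) D1(4) D0(4) i c])
 moreover have "lengths_close G \<delta> l (pullback G (%e. Option.bind (iE e) cE) G0 l0)"
  using lengths_close_pullback[OF close assms(3)] c pullback_compose[OF D(2) D1(2) D0(2) co, of cV cE l0]
  by (simp add: l marked_collapse_def)
 ultimately show ?thesis by (rule that)
qed

lemma star_nbhd_factor:
 assumes og: "outer_graph G" and vM: "valid_marking r G M"
  and v1: "valid_mmg r (G1,M1,l1)" and c: "marked_collapse G M G1 M1 cV cE"
  and v0: "valid_mmg r (G0,M0,l0)" and d: "marked_collapse G M G0 M0 dV dE"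
  and sub: "!!e. e:gE G ==> cE e = None ==> dE e = None"
  and close: "lengths_close G \<delta> (pullback G cE G1 l1) (pullback G dE G0 l0)"
 shows "cls r (G1,M1,l1):star_nbhd r G0 M0 l0 \<delta>"
proof -
 note sg = outerD(1)[OF og] and w = valid_premarking[OF vM] and D1 = valid_mmgD[OF v1] and D0 = valid_mmgD[OF v0]
 interpret graph_collapse G G1 cV cE using sg D1 c by unfold_locales (auto simp: marked_collapse_def)
 obtain bV bE where b: "marked_collapse G1 M1 G0 M0 bV bE" "!!e. e:gE G ==> dE e = Option.bind (cE e) bE"
  by (rule marked_collapse_factor[OF sg D1(2) D0(2) w D1(4) D0(4) c d]) (use sub in blast)+
 have "pullback G dE G0 l0 = pullback G (%e. Option.bind (cE e) bE) G0 l0"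
  using b(2) serre_fin(3)[OF sg] by (intro ext) (auto simp: pullback_def subset_iff)
 also have "... = pullback G cE G1 (pullback G1 bE G0 l0)"
  by (rule pullback_compose[OF sg D1(2) D0(2) co, of bV]) (use b(1) in \<open>simp add: marked_collapse_def\<close>)
 finally show ?thesis using star_nbhdI[OF v1 b(1)] lengths_close_if_pullback close by simp
qed

lemma star_nbhd_pull:
 assumes og: "outer_graph G" and vM: "valid_marking r G M"
  and v1: "valid_mmg r (G1,M1,l1)" and c: "marked_collapse G M G1 M1 cV cE"
  and v0: "valid_mmg r (G0,M0,l0)" and star: "cls r (G1,M1,l1):star_nbhd r G0 M0 l0 \<delta>" and \<delta>: "\<delta> > 0"
 obtains hV hE \<eta> where "marked_collapse G M G0 M0 hV hE" "!!e. cE e = None ==> hE e = None" "\<eta> > 0"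
  "lengths_close G (\<delta>-\<eta>) (pullback G cE G1 l1) (pullback G hE G0 l0)"
proof -
 note sg = outerD(1)[OF og] and w = valid_premarking[OF vM] and D1 = valid_mmgD[OF v1] and D0 = valid_mmgD[OF v0]
 interpret graph_collapse G G1 cV cE using sg D1 c by unfold_locales (auto simp: marked_collapse_def)
 obtain bV bE where b: "marked_collapse G1 M1 G0 M0 bV bE" "lengths_close G1 \<delta> l1 (pullback G1 bE G0 l0)"
  by (rule star_nbhdE[OF v1 v0 \<delta> star])
 obtain \<eta> where \<eta>: "\<eta> > 0" "\<eta> < \<delta>" "lengths_close G1 (\<delta>-\<eta>) l1 (pullback G1 bE G0 l0)"
  by (rule lengths_close_slack[OF D1(2) b(2) \<delta>])
 let ?hE = "%e. Option.bind (cE e) bE"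
 have "marked_collapse G M G0 M0 (bV \<circ> cV) ?hE"
  by (rule marked_collapse_compose[OF sg D1(2) D0(2) w D1(4) D0(4) c b(1)])
 moreover have "lengths_close G (\<delta>-\<eta>) (pullback G cE G1 l1) (pullback G ?hE G0 l0)"
  using lengths_close_pullback[OF \<eta>(3)] \<eta>(2) b(1) pullback_compose[OF sg D1(2) D0(2) co, of bV bE l0]
  by (simp add: marked_collapse_def)
 ultimately show ?thesis using that[of _ ?hE] \<eta>(1) by simp
qed

lemma star_nbhd_weak_open:
 assumes v0: "valid_mmg r (G0,M0,l0)" and \<delta>: "\<delta> > 0"
 shows "weak_open r (star_nbhd r G0 M0 l0 \<delta>)"
 unfolding weak_open_def
proof (intro conjI allI impI)
 show "star_nbhd r G0 M0 l0 \<delta> <= outer_space r" unfolding star_nbhd_def outer_space_def by blast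
 fix G M assume "outer_graph G & valid_marking r G M"
 then have outer_G: "outer_graph G" and valid_M: "valid_marking r G M" by auto
 note sg = outerD(1)[OF outer_G]
 let ?C = "{lam. EX x. cell_rel r G M lam x}" and ?W = "{lam. EX x:star_nbhd r G0 M0 l0 \<delta>. cell_rel r G M lam x}"
 show "openin (top_of_set ?C) ?W"
 proof (rule openin_if_lengths_close[OF sg])
  fix lam assume "lam:?W"
  then obtain x where x: "x:star_nbhd r G0 M0 l0 \<delta>" "cell_rel r G M lam x" by blast
  obtain G1 M1 l1 cV cE where v1: "valid_mmg r (G1,M1,l1)" and c: "marked_collapse G M G1 M1 cV cE"
   and lam: "lam = pullback G cE G1 l1" and x_cls: "x = cls r (G1,M1,l1)" by (rule cell_relE[OF sg x(2)])
  note D1 = valid_mmgD[OF v1]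
  have forest_c: "forest_collapse G G1 cV cE" using c by (simp add: marked_collapse_def)
  obtain hV hE \<eta> where h: "marked_collapse G M G0 M0 hV hE" and sub: "!!e. cE e = None ==> hE e = None"
   and \<eta>: "\<eta> > 0" "lengths_close G (\<delta>-\<eta>) lam (pullback G hE G0 l0)"
   using star_nbhd_pull[OF outer_G valid_M v1 c v0 _ \<delta>] x(1) x_cls lam by metis
  obtain \<mu> where \<mu>: "\<mu> > 0" "!!f. f:gE G1 ==> \<mu> <= len G1 l1 f" using lengths_bounded_below[OF D1(1,5)] by blast
  have "lam':?W" if C: "lam':?C" and close: "lengths_close G (min \<mu> \<eta>) lam' lam" for lam'
  proof -
   obtain y where y: "cell_rel r G M lam' y" using C by blast
   obtain G2 M2 l2 dV dE where v2: "valid_mmg r (G2,M2,l2)" and d: "marked_collapse G M G2 M2 dV dE"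
    and lam': "lam' = pullback G dE G2 l2" and y_cls: "y = cls r (G2,M2,l2)" by (rule cell_relE[OF sg y])
   have forest_d: "forest_collapse G G2 dV dE" using d by (simp add: marked_collapse_def)
   have "y:star_nbhd r G0 M0 l0 \<delta>" unfolding y_cls
   proof (rule star_nbhd_factor[OF outer_G valid_M v2 d v0 h])
    have "lengths_close G \<mu> (pullback G dE G2 l2) (pullback G cE G1 l1)"
     using lengths_close_mono[OF close] by (simp add: lam lam')
    then show "hE e = None" if "e:gE G" "dE e = None" for e
     using collapsed_if_lengths_close[OF sg D1(2) valid_mmgD(2)[OF v2] forest_c forest_d \<mu>(2) _ that] sub by blast
    show "lengths_close G \<delta> (pullback G dE G2 l2) (pullback G hE G0 l0)"
     using lengths_close_trans[OF lengths_close_mono[OF close, of \<eta>] \<eta>(2)] by (simp add: lam')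
   qed
   then show ?thesis using y by blast
  qed
  then show "EX d>0. ALL lam':?C. lengths_close G d lam' lam --> lam':?W" using \<mu>(1) \<eta>(1) by (intro exI[of _ "min \<mu> \<eta>"]) auto
 qed blast
qed

subsection \<open>Local finiteness\<close>

lemma card_eq_sum_fibers:
 assumes "finite A" "finite B" "f ` A <= B"
 shows "card A = (\<Sum>b\<in>B. card {a:A. f a = b})"
 using sum.group[OF assms, of "%_. 1::nat"] by simp

lemma (in graph_collapse) card_edges_le: "card (gE G)+2 * card (gV H) <= 2 * card (gV G)+card (gE H)"
proof -
 note finG = serre_fin(1,2)[OF sG] and finH = serre_fin(1,2)[OF sH]
 have fiber: "card (fiber_edges G cV cE w)+2 = 2 * card (fiber_vertices G cV w)" if w: "w:gV H" for w
 proof -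
  have "w:cV ` gV G" using w cV_image by simp
  then have "fiber_vertices G cV w ~= {}" by blast
  then have "card (fiber_vertices G cV w) >= 1" using finG by (simp add: Suc_le_eq card_gt_0_iff)
  moreover have "card (fiber_edges G cV cE w) = 2*(card (fiber_vertices G cV w)-1)"
   using co w unfolding collapse_iff_forest_collapse[OF sG, symmetric] collapse_def by blast
  ultimately show ?thesis by linarith
 qed
 have "card (collapsed_edges G cE) = (\<Sum>w\<in>gV H. card {e:collapsed_edges G cE. cV (gorg G e) = w})"
  using finG finH cV_in serreD(1)[OF sG]
  by (intro card_eq_sum_fibers) (auto simp: collapsed_edges_def)
 also have "... = (\<Sum>w\<in>gV H. card (fiber_edges G cV cE w))" by (simp add: collapsed_edges_def conj_ac)
 finally have "card (collapsed_edges G cE)+2 * card (gV H) = (\<Sum>w\<in>gV H. card (fiber_edges G cV cE w)+2)"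
  unfolding sum.distrib by simp
 also have "... = 2*(\<Sum>w\<in>gV H. card (fiber_vertices G cV w))" unfolding sum_distrib_left by (rule sum.cong[OF refl fiber])
 also have "... = 2 * card (gV G)" using card_eq_sum_fibers[OF finG(1) finH(1), of cV] cV_image by simp
 finally have collapsed: "card (collapsed_edges G cE)+2 * card (gV H) = 2 * card (gV G)" .
 have "card (gE G-collapsed_edges G cE) <= card (gE H)"
 proof (rule card_inj_on_le[of "%e. the (cE e)"])
  show "inj_on (%e. the (cE e)) (gE G-collapsed_edges G cE)"
   by (rule inj_onI) (use edge_unique in \<open>auto simp: collapsed_edges_def\<close>)
  show "(%e. the (cE e)) ` (gE G-collapsed_edges G cE) <= gE H"
   using edge_Some by (fastforce simp: collapsed_edges_def)
 qed (rule finH)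
 moreover have "card (gE G) = card (collapsed_edges G cE)+card (gE G-collapsed_edges G cE)"
  using finG collapsed_edges_E by (metis card_Diff_subset card_mono finite_subset le_add_diff_inverse)
 ultimately show ?thesis using collapsed by linarith
qed

lemma outer_card_vertices_le:
 assumes "outer_graph G"
 shows "3 * card (gV G) <= card (gE G)"
proof -
 note sg = outerD(1)[OF assms]
 have "(\<Sum>v\<in>gV G. 3) <= (\<Sum>v\<in>gV G. card {e:gE G. gorg G e = v})" by (rule sum_mono[OF outerD(3)[OF assms]])
 also have "... = card (gE G)"
  using serre_fin[OF sg] serreD(1)[OF sg] by (intro card_eq_sum_fibers[symmetric]) auto
 finally show ?thesis by simp
qed

lemma card_le_if_collapse:
 assumes oH: "outer_graph H" and s0: "serre_graph G0" and c: "forest_collapse H G0 cV cE"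
 shows "card (gE H) <= 3 * card (gE G0)" "card (gV H) <= card (gE G0)"
proof -
 interpret graph_collapse H G0 cV cE using outerD(1)[OF oH] s0 c by unfold_locales
 show "card (gE H) <= 3 * card (gE G0)" "card (gV H) <= card (gE G0)"
  using card_edges_le outer_card_vertices_le[OF oH] by linarith+
qed

lemma open_fun_contains_box:
 fixes a :: "nat => real"
 assumes "open T" "a:T"
 obtains J \<delta> where "finite J" "\<delta> > 0" "!!f. (!!i. i:J ==> \<bar>f i-a i\<bar> < \<delta>) ==> f:T"
proof -
 have "openin (product_topology (%i. euclidean) UNIV) T" using assms(1) by (simp add: open_fun_def)
 from product_topology_open_contains_basis[OF this assms(2)]
 obtain X where X: "a:(\<Pi>\<^sub>E i\<in>UNIV. X i)" "!!i. open (X i)" "finite {i. X i ~= topspace (euclidean::real topology)}" "(\<Pi>\<^sub>E i\<in>UNIV. X i) <= T"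
  by auto
 let ?J = "{i. X i ~= UNIV}"
 have "EX d>0. ALL y. \<bar>y-a i\<bar> < d --> y:X i" for i
  using X(1) X(2)[of i] unfolding open_dist dist_real_def by (auto simp: PiE_def)
 then obtain d where d: "!!i. d i > 0" "!!i y. \<bar>y-a i\<bar> < d i ==> y:X i" by metis
 define \<delta> where "\<delta> = Min (insert 1 (d ` ?J))"
 have \<delta>: "\<delta> > 0" unfolding \<delta>_def using X(3) d(1) by (subst Min_gr_iff) auto
 have "f:T" if f: "!!i. i:?J ==> \<bar>f i-a i\<bar> < \<delta>" for f
 proof -
  have "f i:X i" for i
  proof (cases "i:?J")
   case True
   have "\<delta> <= d i" unfolding \<delta>_def using X(3) True by (intro Min_le) auto
   then show ?thesis using f[OF True] d(2)[of "f i" i] by linarith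
  qed simp
  then show ?thesis using X(4) by (auto simp: PiE_def)
 qed
 then show ?thesis using that[of ?J \<delta>] X(3) \<delta> by simp
qed

lemma pullback_id:
 assumes "serre_graph G" "l:lengths G"
 shows "pullback G Some G l = l"
 using pullback_eqI[OF assms(1,1) forest_collapse_id[OF assms(1)], of l l] assms(2) by (simp add: lengths_def)

lemma cell_rel_self:
 assumes "valid_mmg r (G,M,l)"
 shows "cell_rel r G M l (cls r (G,M,l))"
proof -
 note D = valid_mmgD[OF assms]
 show ?thesis using cell_relI[OF D(2) assms marked_collapse_id[OF D(2,4)]] by (simp add: pullback_id[OF D(2,5)])
qed

lemma cls_eq_if_same_collapse:
 assumes v: "valid_mmg r (H,M,l)" "valid_mmg r (H,N,l)" and v0: "valid_mmg r (G0,M0,l0)"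
  and c: "marked_collapse H M G0 M0 cV cE" "marked_collapse H N G0 M0 cV cE"
 shows "cls r (H,N,l) = cls r (H,M,l)"
proof -
 note DM = valid_mmgD[OF v(1)] and DN = valid_mmgD[OF v(2)] and D0 = valid_mmgD[OF v0]
 interpret graph_collapse H G0 cV cE using DM D0 c by unfold_locales (auto simp: marked_collapse_def)
 have "marking_equiv G0 (comp_marking G0 cV cE M) (comp_marking G0 cV cE N)"
  using c marking_equiv_trans[OF D0(2) comp_premarking[OF DM(4)]] marking_equiv_sym[OF D0(2,4)]
  unfolding marked_collapse_def by blast
 then have "marking_equiv H M N" by (rule marking_equiv_if_comp[OF DM(4) DN(4)])
 then have "marked_collapse H N H M id Some"
  using forest_collapse_id[OF DN(2)] comp_marking_id[OF DN(4)] by (simp add: marked_collapse_def)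
 then have "isometric (H,N,l) (H,M,l)" by (rule isometricI) simp
 then show ?thesis using cls_eq_iff[OF v(2,1)] by simp
qed

lemma weak_open_contains_collapse_nbhd:
 assumes W: "weak_open r W" "cls r (G0,M0,l0):W" and v0: "valid_mmg r (G0,M0,l0)"
 obtains \<delta> where "\<delta> > 0" "!!M l. valid_mmg r (H,M,l) ==> marked_collapse H M G0 M0 cV cE ==>
   lengths_close H \<delta> l (pullback H cE G0 l0) ==> cls r (H,M,l):W"
proof (cases "EX N l. valid_mmg r (H,N,l) & marked_collapse H N G0 M0 cV cE")
 case False
 then show ?thesis using that[of 1] by auto
next
 case True
 then obtain N l1 where N: "valid_mmg r (H,N,l1)" "marked_collapse H N G0 M0 cV cE" by blast
 note D = valid_mmgD[OF N(1)]
 let ?C = "{lam. EX x. cell_rel r H N lam x}" and ?W = "{lam. EX x:W. cell_rel r H N lam x}" and ?a = "pullback H cE G0 l0"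
 have "openin (top_of_set ?C) ?W" using W(1) D(1,3) unfolding weak_open_def by blast
 then obtain T where T: "open T" "?W = ?C \<inter> T" unfolding openin_open by blast
 have "?a:T" using cell_relI[OF D(2) v0 N(2)] W(2) T(2) by blast
 then obtain J \<delta> where \<delta>: "\<delta> > 0" "!!f. (!!i. i:J ==> \<bar>f i-?a i\<bar> < \<delta>) ==> f:T"
  using open_fun_contains_box[OF T(1)] by metis
 have "cls r (H,M,l):W" if M: "valid_mmg r (H,M,l)" "marked_collapse H M G0 M0 cV cE" "lengths_close H \<delta> l ?a" for M l
 proof -
  have valid_N: "valid_mmg r (H,N,l)" using N(1) M(1) by (simp add: valid_mmg_def)
  note cell = cell_rel_self[OF valid_N]
  have "\<bar>l i-?a i\<bar> < \<delta>" for i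
   using M(3) valid_mmgD(5)[OF M(1)] \<delta>(1) by (cases "i:gEp H") (auto simp: lengths_close_def lengths_def pullback_def)
  then have "l:?W" using \<delta>(2) T(2) cell by blast
  then have "cls r (H,N,l):W" using cell_rel_unique[OF D(1,3) cell] by blast
  then show ?thesis using cls_eq_if_same_collapse[OF M(1) valid_N v0 M(2) N(2)] by simp
 qed
 then show ?thesis using that \<delta>(1) by blast
qed

lemma forest_collapse_cong:
 assumes sG: "serre_graph G" and sH: "serre_graph H" and c: "forest_collapse G H cV cE"
  and V: "!!v. v:gV G ==> dV v = cV v" and E: "!!e. e:gE G ==> dE e = cE e"
 shows "forest_collapse G H dV dE"
proof -
 interpret graph_collapse G H cV cE using sG sH c by unfold_locales
 have collapsed: "collapsed_edges G dE = collapsed_edges G cE" using E by (auto simp: collapsed_edges_def)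
 show ?thesis
 proof (rule forest_collapseI)
  show "dV ` gV G = gV H" using cV_image V by (simp cong: image_cong)
  show "edge_compatible G H dV dE"
   by (rule edge_compatibleI) (use edge_Some edge_None E V serreD[OF sG] in auto)
  show "EX e:gE G. dE e = Some f" if "f:gE H" for f using edge_ex[OF that] E by auto
  show "e = e'" if "e:gE G" "e':gE G" "dE e = Some f" "dE e' = Some f" for e e' f
   using edge_unique[of e e' f] that E by simp
  show "EX p. walk G (collapsed_edges G dE) p a b" if "a:gV G" "b:gV G" "dV a = dV b" for a b
   using fiber_connected[of a b] that V by (simp add: collapsed)
  show "p = []" if "walk G (collapsed_edges G dE) p a a" "reduced G p" for p a
   using fiber_acyclic that by (simp add: collapsed)
 qed
qed

context graph_collapse
begin

lemma connected_image: "connected_graph G ==> connected_graph H"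
 unfolding connected_graph_def cV_image[symmetric] using walk_push by blast

lemma connected_if_image_connected: "connected_graph H ==> connected_graph G"
 unfolding connected_graph_def using walk_lift cV_in by meson

end

lemma outer_graph_iso:
 assumes oG: "outer_graph G" and sH: "serre_graph H" and i: "graph_iso G H fV fE"
 shows "outer_graph H"
proof -
 note sG = outerD(1)[OF oG]
 interpret graph_collapse G H fV "%e. Some (fE e)" using sG sH graph_iso_forest_collapse[OF sG sH i] by unfold_locales
 have E: "inj_on fE (gE G)" "fE ` gE G = gE H" and org: "!!e. e:gE G ==> gorg H (fE e) = fV (gorg G e)"
  using i by (auto simp: graph_iso_def bij_betw_def)
 have "card {e:gE H. gorg H e = v} >= 3" if v: "v:gV H" for v
 proof -
  obtain u where u: "u:gV G" "fV u = v" using v cV_image by (metis imageE)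
  have "card {e:gE G. gorg G e = u} = card (fE ` {e:gE G. gorg G e = u})"
   by (rule card_image[symmetric, OF inj_on_subset[OF E(1)]]) blast
  also have "... <= card {e:gE H. gorg H e = v}"
   by (rule card_mono) (use serre_fin(2)[OF sH] E(2) org u in auto)
  finally show ?thesis using outerD(3)[OF oG u(1)] by simp
 qed
 then show ?thesis using sH connected_image outerD(2)[OF oG] by (simp add: outer_graph_def)
qed

lemma mmg_transport:
 assumes v: "valid_mmg r (G,M,l)" and sH: "serre_graph H" and i: "graph_iso G H fV fE"
 obtains M' l' where "valid_mmg r (H,M',l')" "cls r (G,M,l) = cls r (H,M',l')"
proof -
 note D = valid_mmgD[OF v]
 interpret graph_collapse G H fV "%e. Some (fE e)" using D(2) sH graph_iso_forest_collapse[OF D(2) sH i] by unfold_locales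
 let ?M = "comp_marking H fV (%e. Some (fE e)) M"
 have E: "inj_on fE (gE G)" "fE ` gE G = gE H" using i by (auto simp: graph_iso_def bij_betw_def)
 define g where "g = inv_into (gE G) fE"
 have g: "g (fE e) = e" if "e:gE G" for e using E(1) that by (simp add: g_def inv_into_f_f)
 define l' where "l' x = (if x:gEp H then len G l (g x) else 0)" for x
 have len_l': "len H l' (fE e) = len G l e" if e: "e:gE G" for e
 proof -
  have "gbar H (fE e) = fE (gbar G e)" "fE e:gE H" using i e E(2) by (auto simp: graph_iso_def)
  then show ?thesis using g[OF e] g[OF serreD(2)[OF D(2) e]] serre_Ep[OF sH, of "fE e"] len_gbar[OF D(2) e]
   by (simp add: len_def[of H] l'_def)
 qed
 have "l':lengths H"
 proof -
  have "l' x > 0" if "x:gEp H" for x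
  proof -
   have "x:fE ` gE G" using that serre_fin(3)[OF sH] E(2) by auto
   then obtain e where "e:gE G" "x = fE e" by blast
   then show ?thesis using that g len_lengths_pos[OF D(2,5)] by (simp add: l'_def)
  qed
  then show ?thesis by (simp add: lengths_def l'_def)
 qed
 then have valid: "valid_mmg r (H,?M,l')"
  using outer_graph_iso[OF D(1) sH i] valid_comp_marking[OF D(3)] by (simp add: valid_mmg_def)
 have "marked_collapse G M H ?M fV (%e. Some (fE e))"
  unfolding marked_collapse_def using co marking_equiv_refl[OF sH comp_premarking[OF D(4)]] by simp
 then have "isometric (G,M,l) (H,?M,l')" by (rule isometricI) (simp add: len_l')
 then show ?thesis by (intro that[OF valid]) (simp add: cls_eq_iff[OF v valid])
qed

definition relabelled :: "(nat => nat) => (nat => nat) => sgraph => sgraph" where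
 "relabelled fV fE G = \<lparr>gV = fV ` gV G,gE = fE ` gE G,
   gorg = (%x. if x:fE ` gE G then fV (gorg G (inv_into (gE G) fE x)) else 0),
   gbar = (%x. if x:fE ` gE G then fE (gbar G (inv_into (gE G) fE x)) else 0),gEp = fE ` gEp G\<rparr>"

lemma relabelled_sel [simp]:
 "gV (relabelled fV fE G) = fV ` gV G" "gE (relabelled fV fE G) = fE ` gE G" "gEp (relabelled fV fE G) = fE ` gEp G"
 "inj_on fE (gE G) ==> e:gE G ==> gorg (relabelled fV fE G) (fE e) = fV (gorg G e)"
 "inj_on fE (gE G) ==> e:gE G ==> gbar (relabelled fV fE G) (fE e) = fE (gbar G e)"
 "x ~: fE ` gE G ==> gorg (relabelled fV fE G) x = 0" "x ~: fE ` gE G ==> gbar (relabelled fV fE G) x = 0"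
 by (simp_all add: relabelled_def)

lemma serre_graph_relabelled:
 assumes sg: "serre_graph G" and E: "inj_on fE (gE G)"
 shows "serre_graph (relabelled fV fE G)"
 unfolding serre_graph_def
proof (intro conjI ballI)
 note fin = serre_fin[OF sg] and inj = inj_on_eq_iff[OF E]
 let ?H = "relabelled fV fE G"
 show "finite (gV ?H)" "finite (gE ?H)" "gV ?H ~= {}" "gEp ?H <= gE ?H" using fin by auto
 fix x assume "x:gE ?H"
 then obtain e where e: "e:gE G" "x = fE e" by auto
 note D = serreD[OF sg e(1)]
 show "gorg ?H x:gV ?H" "gbar ?H x:gE ?H" "gbar ?H x ~= x" "gbar ?H (gbar ?H x) = x"
  using E e D inj by simp_all
 have "fE f:fE ` gEp G \<longleftrightarrow> f:gEp G" if "f:gE G" for f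
  using inj_on_image_mem_iff[OF E that fin(3)] .
 then show "(x:gEp ?H) = (gbar ?H x ~: gEp ?H)" using E e D serre_Ep[OF sg e(1)] by simp
qed

lemma graph_iso_relabelled:
 "inj_on fV (gV G) ==> inj_on fE (gE G) ==> graph_iso G (relabelled fV fE G) fV fE"
 by (auto simp: graph_iso_def bij_betw_def)

definition standard_graphs :: "nat => sgraph set" where
 "standard_graphs N = {H. (EX n<=N. gV H = {..<n}) & (EX m<=N. gE H = {..<m}) & gEp H <= {..<N} &
   (ALL x. (x:{..<N} --> gorg H x:{..N}) & (x ~: {..<N} --> gorg H x = 0)) &
   (ALL x. (x:{..<N} --> gbar H x:{..N}) & (x ~: {..<N} --> gbar H x = 0))}"

lemma finite_standard_graphs: "finite (standard_graphs N)"
proof -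
 let ?F = "{f :: nat => nat. ALL x. (x:{..<N} --> f x:{..N}) & (x ~: {..<N} --> f x = 0)}"
 let ?mk = "%(n,m,org,bar,P). \<lparr>gV = {..<n::nat},gE = {..<m::nat},gorg = org,gbar = bar,gEp = P\<rparr> :: sgraph"
 have "finite ?F" by (rule finite_set_of_finite_funs) auto
 then have "finite ({..N} \<times> {..N} \<times> ?F \<times> ?F \<times> Pow {..<N})" by simp
 moreover have "H:?mk ` ({..N} \<times> {..N} \<times> ?F \<times> ?F \<times> Pow {..<N})" if H: "H:standard_graphs N" for H
 proof -
  obtain n m where n: "n <= N" "gV H = {..<n}" and m: "m <= N" "gE H = {..<m}"
   using H unfolding standard_graphs_def by blast
  have "H = ?mk (n,m,gorg H,gbar H,gEp H)" using n m by simp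
  moreover have "(n,m,gorg H,gbar H,gEp H):{..N} \<times> {..N} \<times> ?F \<times> ?F \<times> Pow {..<N}"
   using H n m by (simp add: standard_graphs_def)
  ultimately show ?thesis by (rule image_eqI)
 qed
 ultimately show ?thesis by (meson finite_surj subsetI)
qed

lemma standard_representative:
 assumes v: "valid_mmg r (G,M,l)" and N: "card (gV G) <= N" "card (gE G) <= N"
 obtains H M' l' where "H:standard_graphs N" "valid_mmg r (H,M',l')" "cls r (G,M,l) = cls r (H,M',l')"
proof -
 note sg = valid_mmgD(2)[OF v] and fin = serre_fin[OF valid_mmgD(2)[OF v]]
 obtain fV where V: "inj_on fV (gV G)" "fV ` gV G = {..<card (gV G)}"
  using ex_bij_betw_finite_nat[OF fin(1)] by (auto simp: atLeast0LessThan bij_betw_def)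
 obtain fE where E: "inj_on fE (gE G)" "fE ` gE G = {..<card (gE G)}"
  using ex_bij_betw_finite_nat[OF fin(2)] by (auto simp: atLeast0LessThan bij_betw_def)
 let ?H = "relabelled fV fE G"
 have sH: "serre_graph ?H" by (rule serre_graph_relabelled[OF sg E(1)])
 have "gorg ?H x <= N & gbar ?H x <= N" for x
 proof (cases "x:gE ?H")
  case True
  then have "gorg ?H x:{..<card (gV G)}" "gbar ?H x:{..<card (gE G)}"
   using serreD(1,2)[OF sH True] unfolding relabelled_sel V(2) E(2) by blast+
  then show ?thesis using N by simp
 qed simp
 moreover have "x ~: gE ?H" if "~ x < N" for x using that N(2) by (simp add: E(2))
 moreover have "gEp ?H <= {..<N}" using serre_fin(3)[OF sH] N(2) unfolding relabelled_sel E(2) by auto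
 ultimately have "?H:standard_graphs N" using N by (simp add: standard_graphs_def V(2) E(2))
 then show ?thesis using that mmg_transport[OF v sH graph_iso_relabelled[OF V(1) E(1)]] by metis
qed

lemma marked_collapse_extensional:
 assumes D: "serre_graph H" "premarking r H M" and s0: "serre_graph G0" and b: "marked_collapse H M G0 M0 bV bE"
  and sub: "gV H <= {..<N}" "gE H <= {..<N}"
 obtains dV dE where "marked_collapse H M G0 M0 dV dE" "pullback H dE G0 l = pullback H bE G0 l"
  "dV:{f. ALL x. (x:{..<N} --> f x:insert 0 (gV G0)) & (x ~: {..<N} --> f x = 0)}"
  "dE:{f. ALL x. (x:{..<N} --> f x:insert None (Some ` gE G0)) & (x ~: {..<N} --> f x = None)}"
proof -
 have forest_b: "forest_collapse H G0 bV bE" using b by (simp add: marked_collapse_def)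
 interpret graph_collapse H G0 bV bE using D s0 forest_b by unfold_locales
 define dV where "dV x = (if x:gV H then bV x else 0)" for x
 define dE where "dE x = (if x:gE H then bE x else None)" for x
 have "forest_collapse H G0 dV dE" by (rule forest_collapse_cong[OF D(1) s0 forest_b]) (auto simp: dV_def dE_def)
 moreover have "comp_marking G0 dV dE M = comp_marking G0 bV bE M"
  by (rule comp_marking_cong[OF D]) (auto simp: dV_def dE_def premarkingD(1)[OF D(2)])
 ultimately have "marked_collapse H M G0 M0 dV dE" using b by (simp add: marked_collapse_def)
 moreover have "pullback H dE G0 l = pullback H bE G0 l"
  using serre_fin(3)[OF D(1)] unfolding pullback_def dE_def by (intro ext) auto
 moreover have "dV:{f. ALL x. (x:{..<N} --> f x:insert 0 (gV G0)) & (x ~: {..<N} --> f x = 0)}"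
  using sub(1) cV_in by (auto simp: dV_def)
 moreover have "dE x:insert None (Some ` gE G0)" for x using edge_Some[of x] by (cases "bE x") (auto simp: dE_def)
 then have "dE:{f. ALL x. (x:{..<N} --> f x:insert None (Some ` gE G0)) & (x ~: {..<N} --> f x = None)}"
  using sub(2) by (auto simp: dE_def)
 ultimately show ?thesis by (rule that)
qed

text \<open>Only finitely many collapses of standard graphs onto the given graph matter, so one radius serves all of them.\<close>
lemma weak_open_contains_star_nbhd:
 assumes W: "weak_open r W" "cls r (G0,M0,l0):W" and v0: "valid_mmg r (G0,M0,l0)"
 obtains \<delta> where "\<delta> > 0" "star_nbhd r G0 M0 l0 \<delta> <= W"
proof -
 note D0 = valid_mmgD[OF v0] and F0 = serre_fin[OF valid_mmgD(2)[OF v0]]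
 define N where "N = 3 * card (gE G0)"
 let ?V = "{f :: nat => nat. ALL x. (x:{..<N} --> f x:insert 0 (gV G0)) & (x ~: {..<N} --> f x = 0)}"
 let ?E = "{f :: nat => nat option. ALL x. (x:{..<N} --> f x:insert None (Some ` gE G0)) & (x ~: {..<N} --> f x = None)}"
 define K where "K = standard_graphs N \<times> ?V \<times> ?E"
 have fin: "finite K" unfolding K_def
  using F0 by (intro finite_cartesian_product finite_standard_graphs finite_set_of_finite_funs) auto
 have "EX \<delta>>0. ALL M l. valid_mmg r (H,M,l) --> marked_collapse H M G0 M0 cV cE -->
   lengths_close H \<delta> l (pullback H cE G0 l0) --> cls r (H,M,l):W" for H cV cE
  using weak_open_contains_collapse_nbhd[OF W v0, of H cV cE] by metis
 then obtain \<Delta> where \<Delta>: "!!H cV cE. \<Delta> H cV cE > 0" "!!H cV cE M l. valid_mmg r (H,M,l) ==> marked_collapse H M G0 M0 cV cE ==>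
   lengths_close H (\<Delta> H cV cE) l (pullback H cE G0 l0) ==> cls r (H,M,l):W" by metis
 define \<delta> where "\<delta> = Min (insert 1 ((%(H,cV,cE). \<Delta> H cV cE) ` K))"
 have \<delta>: "\<delta> > 0" unfolding \<delta>_def using fin \<Delta>(1) by (subst Min_gr_iff) auto
 have "y:W" if y: "y:star_nbhd r G0 M0 l0 \<delta>" for y
 proof -
  obtain G M l cV cE where G: "valid_mmg r (G,M,l)" "forest_collapse G G0 cV cE" "y = cls r (G,M,l)"
   using y unfolding star_nbhd_def marked_collapse_def by blast
  have "card (gV G) <= N" "card (gE G) <= N"
   using card_le_if_collapse[OF valid_mmgD(1)[OF G(1)] D0(2) G(2)] by (auto simp: N_def)
  then obtain H M' l' where H: "H:standard_graphs N" "valid_mmg r (H,M',l')" "y = cls r (H,M',l')"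
   using standard_representative[OF G(1)] G(3) by metis
  note DH = valid_mmgD[OF H(2)]
  obtain bV bE where b: "marked_collapse H M' G0 M0 bV bE" "lengths_close H \<delta> l' (pullback H bE G0 l0)"
   using star_nbhdE[OF H(2) v0 \<delta>] y H(3) by blast
  have "gV H <= {..<N}" "gE H <= {..<N}" using H(1) unfolding standard_graphs_def by auto
  then obtain dV dE where d: "marked_collapse H M' G0 M0 dV dE" "pullback H dE G0 l0 = pullback H bE G0 l0"
   and dV: "dV:?V" and dE: "dE:?E"
   by (rule marked_collapse_extensional[OF DH(2,4) D0(2) b(1)])
  have "(H,dV,dE):K" unfolding K_def by (intro SigmaI H(1) dV dE)
  from imageI[OF this, of "%(H,cV,cE). \<Delta> H cV cE"] have "\<delta> <= \<Delta> H dV dE"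
   unfolding \<delta>_def using fin by (intro Min_le) auto
  then have "lengths_close H (\<Delta> H dV dE) l' (pullback H dE G0 l0)" using lengths_close_mono[OF b(2)] d(2) by simp
  then show ?thesis unfolding H(3) by (rule \<Delta>(2)[OF H(2) d(1)])
 qed
 then show ?thesis using that \<delta> by blast
qed

section \<open>Weakly open sets are metrically open\<close>

lemma (in loop_sums) tangent_if_critical:
 assumes D: "!!i. i:I ==> ((%s. L s i) has_real_derivative v i) (at t)" and crit: "eventually (%s. critical (L s)) (nhds t)"
 shows "F (ev v) (L t) = 0"
proof -
 have summable: "exp_summable (L t)" using critical_exp_summable eventually_nhds_x_imp_x[OF crit] by blast
 have deriv: "((%s. F (%_. 1) (L s)) has_real_derivative-(\<Sum>i\<in>I. v i * F (%p. 1 * n p i) (L t))) (at t)"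
  by (rule F_DERIV[OF D summable tempered_const])
 have const: "eventually (%s. F (%_. 1) (L s) = 1) (nhds t)" using crit by eventually_elim (simp add: critical_def)
 have "-(\<Sum>i\<in>I. v i * F (%p. 1 * n p i) (L t)) = 0"
  by (rule DERIV_unique[OF deriv iffD2[OF DERIV_cong_ev[OF refl const refl] DERIV_const]])
 then show ?thesis by (simp add: F_ev[OF summable])
qed

definition unit_curve :: "sgraph => real => real => (real => nat => real) => bool" where
 "unit_curve G a b L \<longleftrightarrow> (ALL t:{a<..<b}. L t:lengths G & entropy G (L t) = 1) &
   (ALL e:gEp G. smooth_on {a<..<b} (%t. L t e))"

lemma unit_curve_DERIV:
 assumes "unit_curve G a b L" "i:gEp G" "t:{a<..<b}"
 shows "((%s. L s i) has_real_derivative deriv (%s. L s i) t) (at t)"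
proof -
 have "(%s. L s i) differentiable (at t)" using assms unfolding unit_curve_def smooth_on_def by (metis funpow_0)
 then show ?thesis using DERIV_imp_deriv by (auto simp: real_differentiable_def)
qed

lemma unit_curve_hess_form:
 assumes og: "outer_graph G" and L: "unit_curve G a b L" and t: "t:{a<..<b}"
 shows "hess_form G (L t) (%e. deriv (%s. L s e) t) >= 0"
  "m >= 0 ==> ALL i:gEp G. L t i <= m ==> card (gE G) <= N ==> i:gEp G ==>
   \<bar>deriv (%s. L s i) t\<bar> <= speed_const N m * sqrt (hess_form G (L t) (%e. deriv (%s. L s e) t))"
proof -
 let ?v = "%e. deriv (%s. L s e) t"
 obtain e0 where "e0:gE G" using outer_edge[OF og] .
 then interpret outer_loops G e0 using og by unfold_locales
 have crit: "pos_len G (L s) & critical (L s)" if "s:{a<..<b}" for s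
  using L that entropy_1_iff[of "L s"] by (auto simp: unit_curve_def lengths_def)
 have "eventually (%s. critical (L s)) (nhds t)"
  using eventually_nhds_in_open[OF open_greaterThanLessThan t] by eventually_elim (use crit in blast)
 from tangent_if_critical[OF unit_curve_DERIV[OF L _ t] this] have tangent: "F (ev ?v) (L t) = 0" .
 show "hess_form G (L t) ?v >= 0" using crit[OF t] tangent by (intro hess_form_nonneg) auto
 show "m >= 0 ==> ALL i:gEp G. L t i <= m ==> card (gE G) <= N ==> i:gEp G ==>
   \<bar>?v i\<bar> <= speed_const N m * sqrt (hess_form G (L t) ?v)"
  using crit[OF t] tangent by (intro hess_lower_bound) auto
qed

lemma smooth_pieceE:
 assumes "smooth_piece r a b \<gamma> I"
 obtains G M L f where "outer_graph G" "valid_marking r G M" "unit_curve G a b L"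
  "!!t. t:{a<..<b} ==> \<gamma> t = cls r (G,M,L t)"
  "!!t. t:{a<..<b} ==> f t = sqrt (hess_form G (L t) (%e. deriv (%s. L s e) t))"
  "!!t. f t >= 0" "(f has_integral I) {a..b}"
proof -
 obtain G M L where G: "outer_graph G" "valid_marking r G M" and L: "unit_curve G a b L"
  and \<gamma>: "!!t. t:{a<..<b} ==> \<gamma> t = cls r (G,M,L t)"
  and int: "((%t. sqrt (hess_form G (L t) (%e. deriv (%s. L s e) t))) has_integral I) {a..b}"
  using assms unfolding smooth_piece_def unit_curve_def by blast
 define f where "f t = (if t:{a<..<b} then sqrt (hess_form G (L t) (%e. deriv (%s. L s e) t)) else 0)" for t
 have "(f has_integral I) {a..b}"
  by (rule has_integral_spike_finite[of "{a,b}", OF _ _ int]) (auto simp: f_def)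
 moreover have "f t >= 0" for t using unit_curve_hess_form(1)[OF G(1) L] by (simp add: f_def)
 ultimately show ?thesis using that[OF G L \<gamma>, of f] by (simp add: f_def)
qed

lemma smooth_piece_nonneg: "smooth_piece r a b \<gamma> I ==> I >= 0"
 by (erule smooth_pieceE) (rule has_integral_nonneg)

lemma weak_cont_near:
 assumes "weak_cont r \<gamma>" "weak_open r S" "t:{0..1}" "\<gamma> t:S"
 obtains d where "d > 0" "!!s. s:{0..1} ==> \<bar>s-t\<bar> < d ==> \<gamma> s:S"
proof -
 obtain T where T: "open T" "{t:{0..1}. \<gamma> t:S} = {0..1} \<inter> T"
  using assms(1,2) unfolding weak_cont_def openin_open by blast
 have "t:T" using T(2) assms(3,4) by blast
 then obtain d where d: "d > 0" "!!s. dist s t < d ==> s:T" using T(1) unfolding open_dist by blast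
 have "\<gamma> s:S" if "s:{0..1}" "\<bar>s-t\<bar> < d" for s
 proof -
  have "s:{0..1} \<inter> T" using d(2)[of s] that by (simp add: dist_real_def)
  then show ?thesis using T(2) by blast
 qed
 then show ?thesis using d(1) that by blast
qed

lemma star_nbhd_self:
 assumes v: "valid_mmg r (G,M,l)" and "\<eta> > 0"
 shows "cls r (G,M,l):star_nbhd r G M l \<eta>"
proof -
 note D = valid_mmgD[OF v]
 show ?thesis using assms(2)
  by (intro star_nbhdI[OF v marked_collapse_id[OF D(2,4)]]) (simp add: lengths_close_def pullback_id[OF D(2,5)])
qed

lemma unit_curve_displacement_le:
 assumes og: "outer_graph G" and L: "unit_curve G a b L"
  and f: "!!t. t:{a<..<b} ==> f t = sqrt (hess_form G (L t) (%e. deriv (%s. L s e) t))" "!!t. f t >= 0" "(f has_integral I) {a..b}"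
  and C: "speed_const N m <= C" "0 <= C" and N: "card (gE G) <= N" and m: "m >= 0"
  and st: "a < s" "s <= t" "t < b" and bounded: "!!u j. u:{s..t} ==> j:gEp G ==> L u j <= m" and i: "i:gEp G"
 shows "\<bar>L t i-L s i\<bar> <= C * I"
proof -
 let ?v = "%u. deriv (%w. L w i) u"
 have sub: "u:{a<..<b}" if "u:{s..t}" for u using that st by auto
 have "(?v has_integral (L t i-L s i)) {s..t}"
  by (rule fundamental_theorem_of_calculus[OF st(2)], rule has_vector_derivative_at_within,
    rule iffD1[OF has_real_derivative_iff_has_vector_derivative unit_curve_DERIV[OF L i sub]])
 then have v: "?v integrable_on {s..t}" "integral {s..t} ?v = L t i-L s i" by (auto simp: integral_unique)
 have f_ab: "f integrable_on {a..b}" using f(3) by blast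
 have f_st: "f integrable_on {s..t}" by (rule integrable_subinterval_real[OF f_ab]) (use st in auto)
 have "norm (integral {s..t} ?v) <= integral {s..t} (%u. C * f u)"
 proof (rule integral_norm_bound_integral[OF v(1)])
  show "(%u. C * f u) integrable_on {s..t}" using integrable_cmul[OF f_st, of C] by simp
  fix u assume u: "u:{s..t}"
  have "\<bar>?v u\<bar> <= speed_const N m * f u"
   using unit_curve_hess_form(2)[OF og L sub[OF u] m _ N i] bounded[OF u] f(1)[OF sub[OF u]] by simp
  also have "... <= C * f u" using C(1) f(2) by (intro mult_right_mono) auto
  finally show "norm (?v u) <= C * f u" by simp
 qed
 also have "integral {s..t} (%u. C * f u) = C * integral {s..t} f" by simp
 also have "... <= C * integral {a..b} f"
  using st f(2) f_st f_ab C(2) by (intro mult_left_mono integral_subset_le) auto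
 also have "integral {a..b} f = I" by (rule integral_unique[OF f(3)])
 finally show ?thesis using v(2) by simp
qed

lemma real_closed_exit_induct:
 fixes s t :: real
 assumes exits: "closed {u:{s..t}. ~ P u}" and st: "s <= t"
  and step: "!!u. s <= u ==> u <= t ==> (!!w. s <= w ==> w < u ==> P w) ==> P u"
 shows "P t"
proof (rule ccontr)
 assume "~ P t"
 then have failing_nonempty: "{u:{s..t}. ~ P u} ~= {}" using st by auto
 have "compact {u:{s..t}. ~ P u}" unfolding compact_eq_bounded_closed
  using exits by (intro conjI bounded_subset[OF bounded_closed_interval[of s t]]) auto
 from compact_attains_inf[OF this failing_nonempty] obtain u where u: "u:{s..t}" "~ P u"
  and first: "!!w. w:{s..t} ==> ~ P w ==> u <= w" by blast
 have "P w" if "s <= w" "w < u" for w using first[of w] u(1) that by (auto simp: not_le[symmetric])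
 then show False using step[of u] u by auto
qed

text \<open>As long as the curve stays close to \<^term>\<open>q\<close> its lengths are bounded, and then its displacement is bounded by its entropy length.\<close>
lemma unit_curve_stays_close:
 assumes og: "outer_graph G" and L: "unit_curve G a b L"
  and f: "!!t. t:{a<..<b} ==> f t = sqrt (hess_form G (L t) (%e. deriv (%s. L s e) t))" "!!t. f t >= 0" "(f has_integral I) {a..b}"
  and C: "speed_const N m <= C" "0 <= C" and N: "card (gE G) <= N" and m: "m >= 0"
  and q: "!!i. i:gEp G ==> q i+R <= m" and R: "\<rho>+C * I < R"
  and st: "a < s" "s <= t" "t < b" and start: "lengths_close G \<rho> (L s) q"
 shows "lengths_close G R (L t) q"
proof (rule real_closed_exit_induct[OF _ st(2)])
 have cont: "isCont (%s. L s j) u" if "j:gEp G" "u:{a<..<b}" for j u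
  by (rule DERIV_isCont[OF unit_curve_DERIV[OF L that]])
 have failing_closed: "{u:{s..t}. ~ lengths_close G R (L u) q} = (\<Union>j\<in>gEp G. {s..t} \<inter> (%u. \<bar>L u j-q j\<bar>) -` {R..})"
  by (auto simp: lengths_close_def not_less)
 show "closed {u:{s..t}. ~ lengths_close G R (L u) q}" unfolding failing_closed
  by (intro closed_UN serre_fin(5)[OF outerD(1)[OF og]] ballI continuous_closed_preimage continuous_intros
    continuous_at_imp_continuous_on cont) (use st in auto)
next
 fix u assume u: "s <= u" "u <= t" and before: "!!w. s <= w ==> w < u ==> lengths_close G R (L w) q"
 have below: "L w j <= m" if "s <= w" "w < u" "j:gEp G" for w j
  using before[OF that(1,2)] q[OF that(3)] that(3) by (force simp: lengths_close_def)
 have at_u: "L u j <= m" if j: "j:gEp G" for j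
 proof (cases "s = u")
  case True
  have "0 <= C * I" using C(2) has_integral_nonneg[OF f(3)] f(2) by simp
  then show ?thesis using start j q[OF j] R True by (force simp: lengths_close_def)
 next
  case False
  have "u:{a<..<b}" using u st by auto
  then have "((%w. L w j) \<longlongrightarrow> L u j) (at_left u)"
   using DERIV_isCont[OF unit_curve_DERIV[OF L j]] by (auto simp: isCont_def intro: tendsto_mono[rotated] at_le)
  moreover have "eventually (%w. L w j <= m) (at_left u)"
   by (rule eventually_at_leftI[of s]) (use below j u(1) False in auto)
  ultimately show ?thesis by (rule tendsto_upperbound) simp
 qed
 have "\<bar>L u j-L s j\<bar> <= C * I" if j: "j:gEp G" for j
 proof (rule unit_curve_displacement_le[OF og L f C N m st(1) u(1) _ _ j])
  show "u < b" using u(2) st(3) by simp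
  show "L w i <= m" if "w:{s..u}" "i:gEp G" for w i using below[of w i] at_u[of i] that by (cases "w = u") auto
 qed
 then show "lengths_close G R (L u) q" using start R by (force simp: lengths_close_def)
qed

lemma star_nbhd_endpoint:
 assumes v0: "valid_mmg r (G0,M0,l0)" and \<delta>: "!!e. e:gE G0 ==> \<delta> <= len G0 l0 e"
  and G: "outer_graph G" "valid_marking r G M" and c: "marked_collapse G M G0 M0 cV cE"
  and L: "!!t. t:{s..<b} ==> L t:lengths G & \<gamma> t = cls r (G,M,L t) & lengths_close G R (L t) (pullback G cE G0 l0)"
  and \<gamma>: "weak_cont r \<gamma>" "\<gamma> b:outer_space1 r" and sb: "0 <= s" "s < b" "b <= 1" and R: "R < R'" "R' <= \<delta>"
 shows "\<gamma> b:star_nbhd r G0 M0 l0 R'"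
proof -
 obtain G1 M1 l1 where v1: "valid_mmg r (G1,M1,l1)" and b: "\<gamma> b = cls r (G1,M1,l1)" by (rule outer_space1E[OF \<gamma>(2)])
 note D0 = valid_mmgD[OF v0] and D1 = valid_mmgD[OF v1] and sg = outerD(1)[OF G(1)]
 have \<eta>: "R'-R > 0" using R by simp
 have "\<gamma> b:star_nbhd r G1 M1 l1 (R'-R)" unfolding b by (rule star_nbhd_self[OF v1 \<eta>])
 then obtain d where d: "d > 0" "!!t. t:{0..1} ==> \<bar>t-b\<bar> < d ==> \<gamma> t:star_nbhd r G1 M1 l1 (R'-R)"
  using weak_cont_near[OF \<gamma>(1) star_nbhd_weak_open[OF v1 \<eta>], of b] sb by auto
 define t where "t = b-min (d/2) ((b-s)/2)"
 have t: "t:{s..<b}" "t:{0..1}" "\<bar>t-b\<bar> < d" using d(1) sb by (auto simp: t_def min_def field_simps)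
 have valid_L: "valid_mmg r (G,M,L t)" using G L[OF t(1)] by (simp add: valid_mmg_def)
 obtain dV dE where e: "marked_collapse G M G1 M1 dV dE" "lengths_close G (R'-R) (L t) (pullback G dE G1 l1)"
  using star_nbhdE[OF valid_L v1 \<eta>] d(2)[OF t(2,3)] L[OF t(1)] by metis
 have "lengths_close G (R'-R) (pullback G dE G1 l1) (L t)"
  using e(2) by (simp add: lengths_close_def abs_minus_commute)
 from lengths_close_trans[OF this] L[OF t(1)]
 have close: "lengths_close G R' (pullback G dE G1 l1) (pullback G cE G0 l0)" by fastforce
 have "forest_collapse G G0 cV cE" "forest_collapse G G1 dV dE" using c e(1) by (auto simp: marked_collapse_def)
 then have "cE e = None" if "e:gE G" "dE e = None" for e
  by (rule collapsed_if_lengths_close[OF sg D0(2) D1(2) _ _ \<delta> lengths_close_mono[OF close R(2)] that])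
 then show ?thesis unfolding b by (rule star_nbhd_factor[OF G v1 e(1) v0 c _ close])
qed

lemma star_nbhd_step:
 assumes v0: "valid_mmg r (G0,M0,l0)"
  and m: "!!e. e:gE G0 ==> len G0 l0 e+\<delta> <= m" and \<delta>: "\<delta> > 0" "!!e. e:gE G0 ==> \<delta> <= len G0 l0 e"
  and C: "speed_const (3 * card (gE G0)) m <= C" "0 <= C"
  and \<gamma>: "weak_cont r \<gamma>" and ab: "0 <= a" "a < b" "b <= 1" and p: "smooth_piece r a b \<gamma> I"
  and b: "\<gamma> b:outer_space1 r" and a: "\<gamma> a:star_nbhd r G0 M0 l0 \<rho>" and \<rho>: "\<rho> > 0" "\<rho>+C * I < R'" "R' <= \<delta>"
 shows "\<gamma> b:star_nbhd r G0 M0 l0 R'"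
proof -
 note D0 = valid_mmgD[OF v0]
 obtain G M L f where G: "outer_graph G" "valid_marking r G M" and L: "unit_curve G a b L"
  and \<gamma>_L: "!!t. t:{a<..<b} ==> \<gamma> t = cls r (G,M,L t)"
  and f: "!!t. t:{a<..<b} ==> f t = sqrt (hess_form G (L t) (%e. deriv (%s. L s e) t))" "!!t. f t >= 0" "(f has_integral I) {a..b}"
  using smooth_pieceE[OF p] by blast
 note sg = outerD(1)[OF G(1)]
 obtain d where d: "d > 0" "!!s. s:{0..1} ==> \<bar>s-a\<bar> < d ==> \<gamma> s:star_nbhd r G0 M0 l0 \<rho>"
  using weak_cont_near[OF \<gamma> star_nbhd_weak_open[OF v0 \<rho>(1)] _ a] ab by auto
 define s where "s = a+min (d/2) ((b-a)/2)"
 have s: "a < s" "s < b" "\<bar>s-a\<bar> < d" "s:{0..1}" using d(1) ab by (auto simp: s_def min_def field_simps)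
 have valid_L: "valid_mmg r (G,M,L t)" if "t:{a<..<b}" for t using G L that by (simp add: valid_mmg_def unit_curve_def)
 obtain cV cE where c: "marked_collapse G M G0 M0 cV cE" and start: "lengths_close G \<rho> (L s) (pullback G cE G0 l0)"
  using star_nbhdE[OF valid_L v0 \<rho>(1), of s] d(2)[OF s(4,3)] \<gamma>_L[of s] s by auto
 let ?q = "pullback G cE G0 l0"
 have forest_c: "forest_collapse G G0 cV cE" using c by (simp add: marked_collapse_def)
 interpret graph_collapse G G0 cV cE using sg D0 forest_c by unfold_locales
 define R where "R = (\<rho>+C * I+R')/2"
 have R: "\<rho>+C * I < R" "R < R'" using \<rho>(2) by (auto simp: R_def)
 obtain g where "g:gE G0" using outer_edge[OF D0(1)] .
 then have m\<delta>: "m-\<delta> >= 0" using m[of g] \<delta> by force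
 have q: "?q i+R <= m" if "i:gEp G" for i
  using edge_Some[of i] serre_fin(3)[OF sg] m R(2) \<rho>(3) m\<delta> that by (cases "cE i") (force simp: pullback_def)+
 show ?thesis
 proof (rule star_nbhd_endpoint[OF v0 \<delta>(2) G c _ \<gamma> b _ s(2) ab(3) R(2) \<rho>(3)])
  show "0 <= s" using s(4) by simp
  fix t assume t: "t:{s..<b}"
  then have "t:{a<..<b}" using s(1) by auto
  moreover have "lengths_close G R (L t) ?q"
   by (rule unit_curve_stays_close[OF G(1) L f C card_le_if_collapse(1)[OF G(1) D0(2) forest_c] _ q R(1) s(1) _ _ start])
    (use t m\<delta> \<delta>(1) in auto)
  ultimately show "L t:lengths G & \<gamma> t = cls r (G,M,L t) & lengths_close G R (L t) ?q"
   using L \<gamma>_L by (simp add: unit_curve_def)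
 qed
qed

lemma star_nbhd_path:
 assumes v0: "valid_mmg r (G0,M0,l0)"
  and m: "!!e. e:gE G0 ==> len G0 l0 e+\<delta> <= m" and \<delta>: "\<delta> > 0" "!!e. e:gE G0 ==> \<delta> <= len G0 l0 e"
  and C: "speed_const (3 * card (gE G0)) m <= C" "0 <= C"
  and s: "s:path_lengths r (cls r (G0,M0,l0)) y" "C * s < \<delta>"
 shows "y:star_nbhd r G0 M0 l0 \<delta>"
proof -
 obtain \<gamma> ts I where \<gamma>: "\<gamma> 0 = cls r (G0,M0,l0)" "\<gamma> 1 = y" "!!t. t:{0..1} ==> \<gamma> t:outer_space1 r" "weak_cont r \<gamma>"
  and ts: "length ts >= 2" "hd ts = 0" "last ts = 1" "sorted_wrt (<) ts"
  and piece: "!!k. Suc k < length ts ==> smooth_piece r (ts ! k) (ts ! Suc k) \<gamma> (I k)" and s_eq: "s = (\<Sum>k<length ts-1. I k)"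
  using s(1) unfolding path_lengths_def by blast
 have ts_nonempty: "ts ~= []" using ts(1) by auto
 have bounds: "0 <= ts ! k" "ts ! k <= 1" if "k < length ts" for k
  using strict_sorted_bounds[OF ts(4), of "ts ! k"] ts(2,3) that by simp_all
 have partial: "C*(\<Sum>j<k. I j) < \<delta>" if "k < length ts" for k
 proof -
  have "(\<Sum>j<k. I j) <= s" unfolding s_eq using that smooth_piece_nonneg[OF piece] by (intro sum_mono2) auto
  then show ?thesis using mult_left_mono[OF _ C(2)] s(2) by fastforce
 qed
 have "\<gamma> (ts ! k):star_nbhd r G0 M0 l0 R" if "k < length ts" "C*(\<Sum>j<k. I j) < R" "R <= \<delta>" for k R
  using that
 proof (induction k arbitrary: R)
  case 0
  then show ?case using star_nbhd_self[OF v0] \<gamma>(1) ts(2) ts_nonempty by (simp add: hd_conv_nth)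
 next
  case (Suc k)
  note k = Suc.prems(1) Suc_lessD[OF Suc.prems(1)]
  define \<rho> where "\<rho> = (C*(\<Sum>j<k. I j)+(R-C * I k))/2"
  have "C*(\<Sum>j<k. I j)+C * I k < R" using Suc.prems(2) by (simp add: distrib_left)
  then have \<rho>: "C*(\<Sum>j<k. I j) < \<rho>" "\<rho>+C * I k < R" by (simp_all add: \<rho>_def field_simps)
  have "0 <= C*(\<Sum>j<k. I j)" using C(2) k smooth_piece_nonneg[OF piece] by (intro mult_nonneg_nonneg sum_nonneg) auto
  then have "\<rho> > 0" using \<rho>(1) by simp
  have "0 <= C * I k" using C(2) smooth_piece_nonneg[OF piece[OF k(1)]] by simp
  then have "\<rho> <= \<delta>" using \<rho>(2) Suc.prems(3) by simp
  have ts_less: "ts ! k < ts ! Suc k" by (rule sorted_wrt_nth_less[OF ts(4)]) (use k in auto)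
  have "\<gamma> (ts ! Suc k):outer_space1 r" using \<gamma>(3) bounds[OF k(1)] by simp
  then show ?case using star_nbhd_step[OF v0 m \<delta> C \<gamma>(4) bounds(1)[OF k(2)] ts_less bounds(2)[OF k(1)] piece[OF k(1)] _
    Suc.IH[OF k(2) \<rho>(1) \<open>\<rho> <= \<delta>\<close>] \<open>\<rho> > 0\<close> \<rho>(2) Suc.prems(3)] by blast
 qed
 from this[of "length ts-1" \<delta>] show ?thesis
  using partial[of "length ts-1"] \<gamma>(2) ts(3) ts_nonempty by (simp add: last_conv_nth)
qed

lemma weak_open_metric_open:
 assumes W: "weak_open r W" and x: "x:W" "x:outer_space1 r"
 shows "EX \<epsilon>>0. ALL y:outer_space1 r. d_h r x y < ereal \<epsilon> --> y:W"
proof -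
 obtain G0 M0 l0 where v0: "valid_mmg r (G0,M0,l0)" and x_cls: "x = cls r (G0,M0,l0)" by (rule outer_space1E[OF x(2)])
 note D0 = valid_mmgD[OF v0]
 obtain \<delta>1 where \<delta>1: "\<delta>1 > 0" "star_nbhd r G0 M0 l0 \<delta>1 <= W"
  using weak_open_contains_star_nbhd[OF W _ v0] x(1) x_cls by blast
 obtain \<delta>2 where \<delta>2: "\<delta>2 > 0" "!!e. e:gE G0 ==> \<delta>2 <= len G0 l0 e" using lengths_bounded_below[OF D0(1,5)] by blast
 define \<delta> where "\<delta> = min \<delta>1 \<delta>2"
 have \<delta>: "\<delta> > 0" "!!e. e:gE G0 ==> \<delta> <= len G0 l0 e" using \<delta>1(1) \<delta>2 by (force simp: \<delta>_def)+
 define m where "m = Max (len G0 l0 ` gE G0)+\<delta>"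
 have m: "len G0 l0 e+\<delta> <= m" if "e:gE G0" for e unfolding m_def using serre_fin(2)[OF D0(2)] that by simp
 define C where "C = \<bar>speed_const (3 * card (gE G0)) m\<bar>"
 have C: "speed_const (3 * card (gE G0)) m <= C" "0 <= C" by (auto simp: C_def)
 define \<epsilon> where "\<epsilon> = \<delta>/(C+1)"
 have \<epsilon>: "\<epsilon> > 0" "C*\<epsilon> < \<delta>" using \<delta>(1) C(2) by (auto simp: \<epsilon>_def field_simps)
 have "y:W" if y: "d_h r x y < ereal \<epsilon>" for y
 proof -
  obtain s where s: "s:path_lengths r x y" "s < \<epsilon>" using y unfolding d_h_def INF_less_iff by auto
  have "C * s <= C*\<epsilon>" using s(2) C(2) by (intro mult_left_mono) auto
  then have "C * s < \<delta>" using \<epsilon>(2) by linarith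
  from star_nbhd_path[OF v0 m \<delta> C s(1)[unfolded x_cls] this] show ?thesis
   using star_nbhd_mono[of \<delta> \<delta>1 r G0 M0 l0] \<delta>1(2) unfolding \<delta>_def by fastforce
 qed
 then show ?thesis using \<epsilon>(1) by blast
qed

section \<open>Labelled graphs\<close>

declare rose_sel [simp del]

definition labelling :: "nat => sgraph => (nat => nat list) => bool" where
 "labelling r G \<mu> \<longleftrightarrow> (ALL e:gE G. set (\<mu> e) <= gE (rose r) & reduced (rose r) (\<mu> e) & \<mu> (gbar G e) = rev_path (rose r) (\<mu> e))"

text \<open>The labels record a homotopy inverse of the marking, hence the conjugation by one fixed word.\<close>

definition inverse_labelling :: "nat => sgraph => nat \<times> nat list list => (nat => nat list) => bool" where
 "inverse_labelling r G M \<mu> \<longleftrightarrow> labelling r G \<mu> & (EX g. set g <= gE (rose r) &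
   (ALL x:gE (rose r). red (rose r) (subst \<mu> (petal G (snd M) x)) = conjugate (rose r) g [x]))"

lemma inverse_labellingE:
 assumes "inverse_labelling r G M \<mu>"
 obtains g where "set g <= gE (rose r)"
  "!!x. x:gE (rose r) ==> red (rose r) (subst \<mu> (petal G (snd M) x)) = conjugate (rose r) g [x]"
 using assms unfolding inverse_labelling_def by blast

locale rank = fixes r :: nat
begin

abbreviation R :: sgraph where "R \<equiv> rose r"
lemmas sR = rose_serre[of r]

end

locale marked_graph = rank r for r +
 fixes G :: sgraph and M :: "nat \<times> nat list list"
 assumes sG: "serre_graph G" and con: "connected_graph G" and valid: "valid_marking r G M"
begin

abbreviation loop :: "nat list => nat list" where "loop \<equiv> subst (petal G (snd M))"

lemmas pre = valid_premarking[OF valid]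
lemmas loop_hom = petal_hom[OF sG pre]
lemmas loop_walk = walk_petal_subst[OF sG pre]
lemmas loop_E = set_subst[OF loop_hom]

lemma loop_surj:
 assumes "walk G (gE G) c (fst M) (fst M)"
 obtains q where "set q <= gE R" "reduced R q" "red G (loop q) = red G c"
proof -
 have "walk G (gE G) (red G c) (fst M) (fst M) & reduced G (red G c)" using walk_red[OF sG order_refl assms] by simp
 then obtain q where q: "set q <= gE R" "red G (loop q) = red G c" using valid unfolding valid_marking_iff by blast
 show ?thesis
  by (rule that[of "red R q"]) (use q red_subst_red[OF sR sG loop_hom q(1)] order_trans[OF set_red q(1)] in auto)
qed

lemma loop_inj:
 assumes q: "set q <= gE R" "set q' <= gE R" and eq: "red G (loop q) = red G (loop q')"
 shows "red R q = red R q'"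
proof -
 let ?z = "q@rev_path R q'"
 have z: "set ?z <= gE R" using q set_rev_path[OF sR q(2)] by simp
 have "red G (loop ?z) = []" using eq red_subst_eq_iff[OF sR sG loop_hom q] by simp
 then have "red G (loop (red R ?z)) = []" using red_subst_red[OF sR sG loop_hom z] by simp
 then have "red R ?z = []" using valid order_trans[OF set_red z] unfolding valid_marking_iff by (meson red_reduced)
 then show ?thesis using red_eq_iff[OF sR q] by simp
qed

lemma spanning_paths:
 obtains P where "P (fst M) = []" "!!w. w:gV G ==> walk G (gE G) (P w) (fst M) w"
proof -
 have base: "fst M:gV G" by (rule premarkingD(1)[OF pre])
 then obtain P where P: "!!w. w:gV G ==> walk G (gE G) (P w) (fst M) w"
  using con unfolding connected_graph_def by metis
 show ?thesis by (rule that[of "P(fst M := [])"]) (use P base in auto)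
qed

context
 fixes P :: "nat => nat list"
 assumes P: "!!w. w:gV G ==> walk G (gE G) (P w) (fst M) w"
begin

private abbreviation detour :: "nat => nat list" where
 "detour e \<equiv> P (gorg G e)@[e]@rev_path G (P (tm G e))"

lemma detour_walk: "e:gE G ==> walk G (gE G) (detour e) (fst M) (fst M)"
proof -
 assume e: "e:gE G"
 note s = serreD[OF sG e]
 have "walk G (gE G) [e] (gorg G e) (tm G e)" using e s by simp
 then show ?thesis using P[OF s(1)] walk_rev_E[OF sG P[OF s(5)]] walk_append[OF sG order_refl] by blast
qed

lemma detour_labelling:
 obtains \<mu> where "labelling r G \<mu>" "!!e. e:gE G ==> red G (loop (\<mu> e)) = red G (detour e)"
proof -
 have "ALL e:gE G. EX q. set q <= gE R & reduced R q & red G (loop q) = red G (detour e)"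
  using loop_surj[OF detour_walk] by metis
 then obtain \<mu> where \<mu>: "!!e. e:gE G ==> set (\<mu> e) <= gE R" "!!e. e:gE G ==> reduced R (\<mu> e)"
  "!!e. e:gE G ==> red G (loop (\<mu> e)) = red G (detour e)" by metis
 have \<mu>_bar: "\<mu> (gbar G e) = rev_path R (\<mu> e)" if e: "e:gE G" for e
 proof -
  note s = serreD[OF sG e]
  have detour_rev: "rev_path G (detour e) = detour (gbar G e)"
   using s rev_path_rev_path[OF sG walk_E[OF sG P[OF s(5)]]] by simp
  have "red G (loop (rev_path R (\<mu> e))) = red G (rev_path G (loop (\<mu> e)))"
   by (rule red_subst_rev_path[OF sR sG loop_hom \<mu>(1)[OF e]])
  also have "... = rev_path G (red G (detour e))" unfolding red_rev_path[OF sG loop_E[OF \<mu>(1)[OF e]]] \<mu>(3)[OF e] ..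
  also have "... = red G (detour (gbar G e))"
   unfolding red_rev_path[OF sG walk_E[OF sG detour_walk[OF e]], symmetric] detour_rev ..
  also have "... = red G (loop (\<mu> (gbar G e)))" using \<mu>(3)[OF s(2)] by simp
  finally have "red R (rev_path R (\<mu> e)) = red R (\<mu> (gbar G e))"
   by (rule loop_inj[OF set_rev_path[OF sR \<mu>(1)[OF e]] \<mu>(1)[OF s(2)]])
  then show ?thesis
   using red_id[OF \<mu>(2)[OF s(2)]] red_id[OF reduced_rev_path[OF sR \<mu>(1,2)[OF e]]] by simp
 qed
 show ?thesis by (rule that[of \<mu>]) (simp_all add: labelling_def \<mu> \<mu>_bar)
qed

lemma detours_telescope:
 assumes \<mu>: "labelling r G \<mu>" "!!e. e:gE G ==> red G (loop (\<mu> e)) = red G (detour e)" and p: "walk G (gE G) p a b"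
 shows "red G (loop (subst \<mu> p)) = red G (P a@p@rev_path G (P b))"
 using p
proof (induction p arbitrary: a)
 case Nil
 then show ?case using red_rev_path_Nil(1)[OF sG walk_E[OF sG P]] by auto
next
 case (Cons e p)
 then have e: "e:gE G" "gorg G e = a" "walk G (gE G) p (tm G e) b" by auto
 note s = serreD[OF sG e(1)]
 have "set (\<mu> e) <= gE R" using \<mu>(1) e(1) by (simp add: labelling_def)
 then have "red G (loop (subst \<mu> (e#p))) = red G (detour e@P (tm G e)@p@rev_path G (P b))"
  unfolding subst_simps
  by (intro red_append_cong[OF sG loop_E walk_E[OF sG detour_walk[OF e(1)]] \<mu>(2)[OF e(1)] Cons.IH[OF e(3)]])
 also have "... = red G ((P a@[e])@red G (rev_path G (P (tm G e))@P (tm G e)@p@rev_path G (P b)))"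
  unfolding red_append_right by (simp add: e(2))
 also have "... = red G (P a@(e#p)@rev_path G (P b))"
  unfolding red_rev_path_left[OF sG walk_E[OF sG P[OF s(5)]]] red_append_right by simp
 finally show ?case .
qed

end

lemma inverse_labelling_exists:
 obtains \<mu> where "inverse_labelling r G M \<mu>"
proof -
 obtain P where P: "P (fst M) = []" "!!w. w:gV G ==> walk G (gE G) (P w) (fst M) w" using spanning_paths by blast
 obtain \<mu> where \<mu>: "labelling r G \<mu>"
   "!!e. e:gE G ==> red G (loop (\<mu> e)) = red G (P (gorg G e)@[e]@rev_path G (P (tm G e)))"
  using detour_labelling[OF P(2)] by blast
 have \<mu>_hom: "hom_map G R \<mu>" using \<mu>(1) by (simp add: labelling_def hom_map_def)
 have "red R (subst \<mu> (petal G (snd M) x)) = red R [x]" if x: "x:gE R" for x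
 proof (rule loop_inj)
  note petal = petal_walk[OF sG pre x]
  show "set (subst \<mu> (petal G (snd M) x)) <= gE R" by (rule set_subst[OF \<mu>_hom walk_E[OF sG petal]])
  show "set [x] <= gE R" using x by simp
  show "red G (loop (subst \<mu> (petal G (snd M) x))) = red G (loop [x])"
   using detours_telescope[OF P(2) \<mu> petal] P(1) by simp
 qed
 then have "inverse_labelling r G M \<mu>"
  unfolding inverse_labelling_def using \<mu>(1) by (intro conjI exI[of _ "[]"]) (simp_all add: conjugate_def)
 then show ?thesis by (rule that)
qed

end

locale labelled_graph = rank r for r +
 fixes G :: sgraph and \<mu> :: "nat => nat list"
 assumes sG: "serre_graph G" and labelling: "labelling r G \<mu>"
begin

lemma label:
 assumes "e:gE G"
 shows "set (\<mu> e) <= gE R" "reduced R (\<mu> e)" "\<mu> (gbar G e) = rev_path R (\<mu> e)"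
 using labelling assms unfolding labelling_def by blast+

lemma label_hom: "hom_map G R \<mu>" by (simp add: hom_map_def label)

lemmas label_E = set_subst[OF label_hom]

end

locale labelled_marking =
 fixes r :: nat and G :: sgraph and M :: "nat \<times> nat list list" and \<mu> :: "nat => nat list"
 assumes outer: "outer_graph G" and valid_marking: "valid_marking r G M" and inverse: "inverse_labelling r G M \<mu>"

sublocale labelled_marking \<subseteq> marked_graph r G M
 using outer valid_marking by unfold_locales (auto simp: outerD)

sublocale labelled_marking \<subseteq> labelled_graph r G \<mu>
 using inverse sG by unfold_locales (auto simp: inverse_labelling_def)

context labelled_marking
begin

lemma label_loop:
 assumes g: "set g <= gE R" "!!x. x:gE R ==> red R (subst \<mu> (petal G (snd M) x)) = conjugate R g [x]"
  and q: "set q <= gE R"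
 shows "red R (subst \<mu> (loop q)) = conjugate R g q"
 using q
proof (induction q)
 case Nil
 show ?case by (simp add: conjugate_Nil[OF sR g(1)])
next
 case (Cons x q)
 then have x: "x:gE R" "set q <= gE R" by auto
 have conj_x: "set (conjugate R g [x]) <= gE R"
  unfolding conjugate_def by (rule order_trans[OF set_red]) (use g(1) x set_rev_path[OF sR g(1)] in auto)
 have "red R (subst \<mu> (loop (x#q))) = red R (conjugate R g [x]@conjugate R g q)"
  unfolding subst_simps
  by (rule red_append_cong[OF sR label_E[OF walk_E[OF sG petal_walk[OF sG pre x(1)]]] conj_x])
   (use g(2)[OF x(1)] Cons.IH[OF x(2)] in \<open>simp_all add: conjugate_def\<close>)
 also have "... = conjugate R g (x#q)" using conjugate_append[OF sR g(1), of "[x]" q] x(1) by simp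
 finally show ?case .
qed

lemma label_surj:
 assumes y: "set y <= gE R"
 obtains p where "walk G (gE G) p (fst M) (fst M)" "reduced G p" "red R (subst \<mu> p) = red R y"
proof -
 obtain g where g: "set g <= gE R" "!!x. x:gE R ==> red R (subst \<mu> (petal G (snd M) x)) = conjugate R g [x]"
  using inverse_labellingE[OF inverse] by blast
 note g' = set_rev_path[OF sR g(1)]
 let ?q = "conjugate R (rev_path R g) y"
 have q: "set ?q <= gE R" unfolding conjugate_def
  by (rule order_trans[OF set_red]) (use g' y set_rev_path[OF sR g'] in auto)
 have "red R (subst \<mu> (red G (loop ?q))) = conjugate R g ?q"
  using red_subst_red[OF sG sR label_hom loop_E[OF q]] label_loop[OF g q] by simp
 also have "... = red R y" using conjugate_rev_path[OF sR g' y] by (simp add: rev_path_rev_path[OF sR g(1)])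
 finally show ?thesis using that walk_red[OF sG order_refl loop_walk[OF q]] by simp
qed

lemma label_inj_base:
 assumes p: "walk G (gE G) p (fst M) (fst M)" "red R (subst \<mu> p) = []"
 shows "red G p = []"
proof -
 obtain g where g: "set g <= gE R" "!!x. x:gE R ==> red R (subst \<mu> (petal G (snd M) x)) = conjugate R g [x]"
  using inverse_labellingE[OF inverse] by blast
 obtain q where q: "set q <= gE R" "reduced R q" "red G (loop q) = red G p" using loop_surj[OF p(1)] by blast
 have "conjugate R g q = red R (subst \<mu> p)"
  using red_subst_cong[OF sG sR label_hom loop_E[OF q(1)] walk_E[OF sG p(1)] q(3)] label_loop[OF g q(1)] by simp
 then have "red R q = []" using conjugate_eq_Nil[OF sR g(1) q(1)] p(2) by simp
 then show ?thesis using q by (simp add: red_id)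
qed

lemma label_inj:
 assumes p: "walk G (gE G) p a a" "red R (subst \<mu> p) = []"
 shows "red G p = []"
proof -
 have "a:gV G" by (rule walk_ends(1)[OF sG order_refl p(1)])
 then obtain x where x: "walk G (gE G) x a (fst M)"
  using con premarkingD(1)[OF pre] unfolding connected_graph_def by blast
 note E = walk_E[OF sG x] walk_E[OF sG p(1)]
 have "red R (subst \<mu> (conjugate G x p)) = []"
  unfolding red_subst_conjugate[OF sG sR label_hom E] p(2) by (rule conjugate_Nil[OF sR label_E[OF E(1)]])
 from label_inj_base[OF walk_conjugate[OF sG x p(1)] this] have "conjugate G x p = []"
  by (simp add: conjugate_def)
 then show ?thesis by (rule conjugate_eq_Nil[OF sG E])
qed

lemma unlabelled_edge_no_loop:
 assumes e: "e:gE G" "\<mu> e = []"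
 shows "gorg G e ~= tm G e"
proof
 assume "gorg G e = tm G e"
 then have "walk G (gE G) [e] (gorg G e) (gorg G e)" using e(1) serreD[OF sG e(1)] by simp
 from label_inj[OF this] show False using e(2) by (simp add: red_id)
qed

end

definition end_letter :: "nat => nat => nat => nat list" where "end_letter u a w = (if w = u then [a] else [])"

definition gauge :: "nat => sgraph => nat => nat => (nat => nat list) => nat => nat list" where
 "gauge r G u a \<mu> d = red (rose r) (rev_path (rose r) (end_letter u a (gorg G d))@\<mu> d@end_letter u a (tm G d))"

abbreviation outgoing :: "sgraph => nat => nat set" where "outgoing G u \<equiv> {e:gE G. gorg G e = u}"

definition letter_cost :: "nat => nat list => int" where
 "letter_cost a w = (if w ~= [] & hd w = a then -1 else 1)"

definition label_size :: "sgraph => (nat => nat list) => nat" where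
 "label_size G \<mu> = (\<Sum>d\<in>gE G. length (\<mu> d))"

lemma length_red_Cons:
 assumes "serre_graph R" "a:gE R"
 shows "int (length (red R (gbar R a#w))) <= int (length w)+letter_cost a w"
proof (cases "w ~= [] & hd w = a")
 case True
 then obtain t where t: "w = a#t" by (metis list.collapse)
 have "red R (gbar R a#w) = red R t" using red_rev_path_left[OF assms(1), of "[a]" t] assms(2) by (simp add: t)
 then show ?thesis using length_red[of R t] by (simp add: t letter_cost_def)
next
 case False
 then show ?thesis using length_red[of R "gbar R a#w"] by (auto simp: letter_cost_def)
qed

lemma length_red_snoc:
 assumes R: "serre_graph R" and a: "a:gE R" and w: "set w <= gE R"
 shows "int (length (red R (w@[a]))) <= int (length w)+letter_cost a (rev_path R w)"
proof -
 have "length (red R (w@[a])) = length (red R (rev_path R (w@[a])))"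
  by (subst red_rev_path[OF R]) (use w a in simp_all)
 then show ?thesis using length_red_Cons[OF R a, of "rev_path R w"] by simp
qed

lemma length_red_both_ends:
 assumes R: "serre_graph R" and a: "a:gE R" and w: "set w <= gE R"
 shows "int (length (red R (gbar R a#w@[a]))) <= int (length w)+letter_cost a w+letter_cost a (rev_path R w)"
proof (cases "w ~= [] & hd w = a")
 case True
 then obtain t where t: "w = a#t" by (metis list.collapse)
 have "red R (gbar R a#w@[a]) = red R (t@[a])" using red_rev_path_left[OF R, of "[a]" "t@[a]"] a by (simp add: t)
 moreover have "letter_cost a (rev_path R w) = letter_cost a (rev_path R t)"
  using serreD(3)[OF R a] by (auto simp: t letter_cost_def hd_append)
 ultimately show ?thesis using length_red_snoc[OF R a, of t] w True by (simp add: t letter_cost_def)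
next
 case False
 have "length (red R (gbar R a#red R (w@[a]))) <= Suc (length (red R (w@[a])))"
  using length_red[of R "gbar R a#red R (w@[a])"] by simp
 moreover have "red R (gbar R a#red R (w@[a])) = red R (gbar R a#w@[a])"
  using red_append_right[of R "[gbar R a]" "w@[a]"] by simp
 moreover have "letter_cost a w = 1" using False by (auto simp: letter_cost_def)
 ultimately show ?thesis using length_red_snoc[OF R a w] by simp
qed

context labelled_graph
begin

context
 fixes u a :: nat
 assumes a: "a:gE R"
begin

lemma end_letter_E: "set (end_letter u a w) <= gE R" "set (rev_path R (end_letter u a w)) <= gE R"
 using a serreD(2)[OF sR a] by (auto simp: end_letter_def)

lemma gauge_labelling: "labelling r G (gauge r G u a \<mu>)"
 unfolding labelling_def
proof (intro ballI conjI)
 fix e assume e: "e:gE G"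
 note s = serreD[OF sG e]
 let ?w = "rev_path R (end_letter u a (gorg G e))@\<mu> e@end_letter u a (tm G e)"
 have w: "set ?w <= gE R" using end_letter_E label(1)[OF e] by simp
 show "set (gauge r G u a \<mu> e) <= gE R" unfolding gauge_def using set_red w by (rule order_trans)
 show "reduced R (gauge r G u a \<mu> e)" by (simp add: gauge_def)
 show "gauge r G u a \<mu> (gbar G e) = rev_path R (gauge r G u a \<mu> e)"
  unfolding gauge_def red_rev_path[OF sR w, symmetric]
  by (simp add: s(6,7) label(3)[OF e] rev_path_rev_path[OF sR end_letter_E(1)])
qed

lemma red_subst_gauge:
 assumes "walk G (gE G) p x y"
 shows "red R (subst (gauge r G u a \<mu>) p) = red R (rev_path R (end_letter u a x)@subst \<mu> p@end_letter u a y)"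
 using assms
proof (induction p arbitrary: x)
 case Nil
 then show ?case using red_rev_path_Nil(2)[OF sR end_letter_E(1)] by simp
next
 case (Cons e p)
 then have e: "e:gE G" "gorg G e = x" "walk G (gE G) p (tm G e) y" by auto
 let ?A = "end_letter u a"
 let ?w = "rev_path R (?A x)@\<mu> e"
 have w: "set (?w@?A (tm G e)) <= gE R" using end_letter_E label(1)[OF e(1)] by simp
 have "red R (subst (gauge r G u a \<mu>) (e#p)) = red R ((?w@?A (tm G e))@red R (subst (gauge r G u a \<mu>) p))"
  unfolding red_append_right subst_simps gauge_def[of _ _ _ _ _ e] e(2)
  using red_append_left[OF sR w] by simp
 also have "... = red R (?w@red R (?A (tm G e)@rev_path R (?A (tm G e))@subst \<mu> p@?A y))"
  unfolding Cons.IH[OF e(3)] red_append_right by simp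
 also have "... = red R (rev_path R (?A x)@subst \<mu> (e#p)@?A y)"
  unfolding red_rev_path_right[OF sR end_letter_E(1)] red_append_right by simp
 finally show ?case .
qed

definition gauge_gain :: "nat => int" where
 "gauge_gain d = (if gorg G d = u then letter_cost a (\<mu> d) else 0)"

lemma length_gauge:
 assumes d: "d:gE G"
 shows "int (length (gauge r G u a \<mu> d)) <= int (length (\<mu> d))+gauge_gain d+gauge_gain (gbar G d)"
proof -
 note bounds = length_red_Cons[OF sR a] length_red_snoc[OF sR a label(1)[OF d]]
  length_red_both_ends[OF sR a label(1)[OF d]] length_red[of R "\<mu> d"]
 show ?thesis unfolding gauge_def gauge_gain_def end_letter_def label(3)[OF d] serreD(7)[OF sG d]
  using bounds by (cases "gorg G d = u"; cases "tm G d = u") simp_all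
qed

lemma label_size_gauge:
 assumes majority: "card {d:outgoing G u. \<mu> d = [] | hd (\<mu> d) ~= a} < card {d:outgoing G u. \<mu> d ~= [] & hd (\<mu> d) = a}"
 shows "label_size G (gauge r G u a \<mu>) < label_size G \<mu>"
proof -
 let ?minor = "{d:outgoing G u. \<mu> d = [] | hd (\<mu> d) ~= a}" and ?major = "{d:outgoing G u. \<mu> d ~= [] & hd (\<mu> d) = a}"
 note fin = serre_fin(2)[OF sG]
 have split: "outgoing G u = ?minor \<union> ?major" "?minor \<inter> ?major = {}" by auto
 have "(\<Sum>d\<in>gE G. gauge_gain d) = (\<Sum>d\<in>outgoing G u. gauge_gain d)"
  by (rule sum.mono_neutral_right) (auto simp: fin gauge_gain_def)
 also have "... = (\<Sum>d\<in>?minor. gauge_gain d)+(\<Sum>d\<in>?major. gauge_gain d)"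
  by (subst split(1), rule sum.union_disjoint) (use fin split(2) in auto)
 also have "... = (\<Sum>d\<in>?minor. 1)+(\<Sum>d\<in>?major. - 1)"
  by (intro arg_cong2[of _ _ _ _ "(+)"] sum.cong) (auto simp: gauge_gain_def letter_cost_def)
 finally have gain: "(\<Sum>d\<in>gE G. gauge_gain d) < 0" using majority by simp
 have "bij_betw (gbar G) (gE G) (gE G)" by (rule bij_betwI[of _ _ _ "gbar G"]) (auto simp: serreD[OF sG])
 then have bar: "(\<Sum>d\<in>gE G. gauge_gain (gbar G d)) = (\<Sum>d\<in>gE G. gauge_gain d)" by (rule sum.reindex_bij_betw)
 have "int (label_size G (gauge r G u a \<mu>)) <= (\<Sum>d\<in>gE G. int (length (\<mu> d))+gauge_gain d+gauge_gain (gbar G d))"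
  unfolding label_size_def of_nat_sum by (rule sum_mono) (rule length_gauge)
 also have "... = int (label_size G \<mu>)+2*(\<Sum>d\<in>gE G. gauge_gain d)"
  by (simp add: sum.distrib bar label_size_def)
 finally show ?thesis using gain by linarith
qed

end

end

lemma (in labelled_marking) gauge_labelled_marking:
 assumes a: "a:gE R"
 shows "labelled_marking r G M (gauge r G u a \<mu>)"
proof -
 obtain g where g: "set g <= gE R" "!!x. x:gE R ==> red R (subst \<mu> (petal G (snd M) x)) = conjugate R g [x]"
  using inverse_labellingE[OF inverse] by blast
 let ?A = "end_letter u a (fst M)"
 note A = end_letter_E(1)[OF a]
 have "red R (subst (gauge r G u a \<mu>) (petal G (snd M) x)) = conjugate R (g@?A) [x]" if x: "x:gE R" for x
 proof -
  note petal = petal_walk[OF sG pre x]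
  have "red R (subst (gauge r G u a \<mu>) (petal G (snd M) x)) = conjugate R ?A (subst \<mu> (petal G (snd M) x))"
   unfolding conjugate_def by (rule red_subst_gauge[OF a petal])
  also have "... = conjugate R ?A (conjugate R g [x])"
   using conjugate_red[OF sR label_E[OF walk_E[OF sG petal]]] g(2)[OF x] by metis
  also have "... = conjugate R (g@?A) [x]" using x by (intro conjugate_conjugate[OF sR g(1)]) simp
  finally show ?thesis .
 qed
 moreover have "set (g@?A) <= gE R" using g(1) A by simp
 ultimately show ?thesis
  using outer valid gauge_labelling[OF a] unfolding labelled_marking_def inverse_labelling_def by blast
qed

definition contract_vertex :: "sgraph => nat => nat => nat" where
 "contract_vertex B \<epsilon> x = (if x = gorg B \<epsilon> then tm B \<epsilon> else x)"

definition contract_edge :: "sgraph => nat => nat => nat option" where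
 "contract_edge B \<epsilon> x = (if x:{\<epsilon>,gbar B \<epsilon>} then None else Some x)"

definition edge_contraction :: "sgraph => nat => sgraph => bool" where
 "edge_contraction B \<epsilon> S \<longleftrightarrow> \<epsilon>:gE B & gorg B \<epsilon> ~= tm B \<epsilon> & gV S = gV B-{gorg B \<epsilon>} & gE S = gE B-{\<epsilon>,gbar B \<epsilon>} &
  (ALL x:gE S. gbar S x = gbar B x & gorg S x = contract_vertex B \<epsilon> (gorg B x))"

lemma edge_pair_iff: "serre_graph B ==> \<epsilon>:gE B ==> x:gE B ==> gbar B x:{\<epsilon>,gbar B \<epsilon>} \<longleftrightarrow> x:{\<epsilon>,gbar B \<epsilon>}"
 by (auto simp: gbar_eq_iff serreD)

lemma edge_contraction_compatible:
 assumes sB: "serre_graph B" and c: "edge_contraction B \<epsilon> S"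
 shows "edge_compatible B S (contract_vertex B \<epsilon>) (contract_edge B \<epsilon>)"
proof (rule edge_compatibleI)
 have \<epsilon>: "\<epsilon>:gE B" using c by (simp add: edge_contraction_def)
 note s = serreD[OF sB \<epsilon>]
 fix x assume x: "x:gE B"
 note pair = edge_pair_iff[OF sB \<epsilon> x]
 {
  fix f assume "contract_edge B \<epsilon> x = Some f"
  then have "f = x" "x ~: {\<epsilon>,gbar B \<epsilon>}" by (auto simp: contract_edge_def split: if_splits)
  then show "f:gE S & gorg S f = contract_vertex B \<epsilon> (gorg B x) & contract_edge B \<epsilon> (gbar B x) = Some (gbar S f)"
   using c x pair by (simp add: edge_contraction_def contract_edge_def)
 next
  assume "contract_edge B \<epsilon> x = None"
  then have "x:{\<epsilon>,gbar B \<epsilon>}" by (simp add: contract_edge_def split: if_splits)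
  then show "contract_vertex B \<epsilon> (gorg B x) = contract_vertex B \<epsilon> (tm B x) & contract_edge B \<epsilon> (gbar B x) = None"
   using pair s by (auto simp: contract_vertex_def contract_edge_def)
 }
qed

lemma reduced_walk_single_edge:
 assumes sB: "serre_graph B" and \<epsilon>: "\<epsilon>:gE B" "gorg B \<epsilon> ~= tm B \<epsilon>"
  and p: "walk B {\<epsilon>,gbar B \<epsilon>} p a a" "reduced B p"
 shows "p = []"
proof (rule ccontr)
 assume "p ~= []"
 then obtain x q where xq: "p = x#q" by (cases p) auto
 note s = serreD[OF sB \<epsilon>(1)]
 have no_loop: "gorg B y ~= tm B y" if "y:{\<epsilon>,gbar B \<epsilon>}" for y using that s \<epsilon>(2) by auto
 have x: "x:{\<epsilon>,gbar B \<epsilon>}" "gorg B x = a" "walk B {\<epsilon>,gbar B \<epsilon>} q (tm B x) a" using p(1) xq by auto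
 then obtain y z where yz: "q = y#z" using no_loop[OF x(1)] by (cases q) auto
 then have y: "y:{\<epsilon>,gbar B \<epsilon>}" "gorg B y = tm B x" using x(3) by auto
 then have "y ~= x" using no_loop[OF x(1)] by auto
 then have "y = gbar B x" using x(1) y(1) s by auto
 then show False using p(2) by (simp add: xq yz reduced_Cons)
qed

lemma edge_contraction_collapse:
 assumes sB: "serre_graph B" and c: "edge_contraction B \<epsilon> S"
 shows "forest_collapse B S (contract_vertex B \<epsilon>) (contract_edge B \<epsilon>)"
proof (rule forest_collapseI)
 have \<epsilon>: "\<epsilon>:gE B" "gorg B \<epsilon> ~= tm B \<epsilon>" and S: "gV S = gV B-{gorg B \<epsilon>}" "gE S = gE B-{\<epsilon>,gbar B \<epsilon>}"
  using c by (auto simp: edge_contraction_def)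
 note s = serreD[OF sB \<epsilon>(1)]
 have forest: "collapsed_edges B (contract_edge B \<epsilon>) = {\<epsilon>,gbar B \<epsilon>}"
  using \<epsilon>(1) s by (auto simp: collapsed_edges_def contract_edge_def)
 show "contract_vertex B \<epsilon> ` gV B = gV S" using s \<epsilon>(2) by (auto simp: contract_vertex_def S image_iff)
 show "edge_compatible B S (contract_vertex B \<epsilon>) (contract_edge B \<epsilon>)" by (rule edge_contraction_compatible[OF assms])
 show "EX e:gE B. contract_edge B \<epsilon> e = Some f" if "f:gE S" for f
  using that S(2) by (intro bexI[of _ f]) (auto simp: contract_edge_def)
 show "e = e'" if "contract_edge B \<epsilon> e = Some f" "contract_edge B \<epsilon> e' = Some f" for e e' f
  using that by (auto simp: contract_edge_def split: if_splits)
 show "p = []" if "walk B (collapsed_edges B (contract_edge B \<epsilon>)) p a a" "reduced B p" for p a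
  using reduced_walk_single_edge[OF sB \<epsilon>] that unfolding forest by blast
 fix a b assume ab: "a:gV B" "b:gV B" "contract_vertex B \<epsilon> a = contract_vertex B \<epsilon> b"
 then consider "a = b" | "a = gorg B \<epsilon>" "b = tm B \<epsilon>" | "a = tm B \<epsilon>" "b = gorg B \<epsilon>"
  by (auto simp: contract_vertex_def split: if_splits)
 then show "EX p. walk B (collapsed_edges B (contract_edge B \<epsilon>)) p a b"
 proof cases
  assume "a = b"
  then show ?thesis using ab by (intro exI[of _ "[]"]) simp
 next
  assume "a = gorg B \<epsilon>" "b = tm B \<epsilon>"
  then show ?thesis using s unfolding forest by (intro exI[of _ "[\<epsilon>]"]) simp
 next
  assume "a = tm B \<epsilon>" "b = gorg B \<epsilon>"
  then show ?thesis using s unfolding forest by (intro exI[of _ "[gbar B \<epsilon>]"]) simp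
 qed
qed

definition contract :: "sgraph => nat => sgraph" where
 "contract B \<epsilon> = \<lparr>gV = gV B-{gorg B \<epsilon>},gE = gE B-{\<epsilon>,gbar B \<epsilon>},gorg = (%x. contract_vertex B \<epsilon> (gorg B x)),
  gbar = gbar B,gEp = gEp B-{\<epsilon>,gbar B \<epsilon>}\<rparr>"

lemma contract_sel:
 "gV (contract B \<epsilon>) = gV B-{gorg B \<epsilon>}" "gE (contract B \<epsilon>) = gE B-{\<epsilon>,gbar B \<epsilon>}"
 "gorg (contract B \<epsilon>) x = contract_vertex B \<epsilon> (gorg B x)" "gbar (contract B \<epsilon>) x = gbar B x"
 "gEp (contract B \<epsilon>) = gEp B-{\<epsilon>,gbar B \<epsilon>}"
 by (simp_all add: contract_def)

context
 fixes B :: sgraph and \<epsilon> :: nat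
 assumes oB: "outer_graph B" and \<epsilon>: "\<epsilon>:gE B" "gorg B \<epsilon> ~= tm B \<epsilon>"
begin

private lemma sB: "serre_graph B" by (rule outerD(1)[OF oB])
private lemmas s = serreD[OF sB \<epsilon>(1)]

lemma edge_contraction_contract: "edge_contraction B \<epsilon> (contract B \<epsilon>)"
 using \<epsilon> by (simp add: edge_contraction_def contract_sel)

lemma serre_contract: "serre_graph (contract B \<epsilon>)"
 unfolding serre_graph_def
proof (intro conjI ballI)
 note fin = serre_fin[OF sB]
 show "finite (gV (contract B \<epsilon>))" "finite (gE (contract B \<epsilon>))" "gEp (contract B \<epsilon>) <= gE (contract B \<epsilon>)"
  using fin by (auto simp: contract_sel)
 show "gV (contract B \<epsilon>) ~= {}" using s(5) \<epsilon>(2) by (auto simp: contract_sel)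
 fix x assume "x:gE (contract B \<epsilon>)"
 then have x: "x:gE B" "x ~: {\<epsilon>,gbar B \<epsilon>}" by (auto simp: contract_sel)
 note sx = serreD[OF sB x(1)] and pair = edge_pair_iff[OF sB \<epsilon>(1) x(1)]
 show "gorg (contract B \<epsilon>) x:gV (contract B \<epsilon>)" using sx s \<epsilon>(2) by (simp add: contract_sel contract_vertex_def)
 show "gbar (contract B \<epsilon>) x:gE (contract B \<epsilon>)" using sx pair x(2) by (simp add: contract_sel)
 show "gbar (contract B \<epsilon>) x ~= x" "gbar (contract B \<epsilon>) (gbar (contract B \<epsilon>) x) = x" using sx by (simp_all add: contract_sel)
 show "(x:gEp (contract B \<epsilon>)) = (gbar (contract B \<epsilon>) x ~: gEp (contract B \<epsilon>))"
  using serre_Ep[OF sB x(1)] x(2) pair by (simp add: contract_sel)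
qed

lemma contract_valence:
 assumes w: "w:gV (contract B \<epsilon>)"
 shows "card (outgoing (contract B \<epsilon>) w) >= 3"
proof (cases "w = tm B \<epsilon>")
 note fin = serre_fin[OF sB]
 case True
 let ?X = "outgoing B (gorg B \<epsilon>)-{\<epsilon>}" and ?Y = "outgoing B (tm B \<epsilon>)-{gbar B \<epsilon>}"
 have "card ?X >= 2" "card ?Y >= 2" using outerD(3)[OF oB s(1)] outerD(3)[OF oB s(5)] \<epsilon> s fin by auto
 moreover have "card (?X \<union> ?Y) = card ?X+card ?Y" by (rule card_Un_disjoint) (use fin \<epsilon>(2) in auto)
 moreover have "card (?X \<union> ?Y) <= card (outgoing (contract B \<epsilon>) w)"
  by (rule card_mono) (use fin \<epsilon>(2) True s in \<open>auto simp: contract_sel contract_vertex_def\<close>)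
 ultimately show ?thesis by linarith
next
 case False
 have "outgoing B w <= outgoing (contract B \<epsilon>) w"
  using w False s by (auto simp: contract_sel contract_vertex_def)
 then have "card (outgoing B w) <= card (outgoing (contract B \<epsilon>) w)"
  using serre_fin(2)[OF serre_contract] by (intro card_mono) auto
 moreover have "card (outgoing B w) >= 3" using w by (intro outerD(3)[OF oB]) (simp add: contract_sel)
 ultimately show ?thesis by linarith
qed

lemma outer_contract: "outer_graph (contract B \<epsilon>)"
proof -
 interpret graph_collapse B "contract B \<epsilon>" "contract_vertex B \<epsilon>" "contract_edge B \<epsilon>"
  using sB serre_contract edge_contraction_collapse[OF sB edge_contraction_contract] by unfold_locales
 show ?thesis using serre_contract connected_image[OF outerD(2)[OF oB]] contract_valence by (simp add: outer_graph_def)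
qed

end

lemma (in graph_collapse) inverse_labelling_comp_iff:
 assumes pre: "premarking r G M" and \<nu>: "labelling r H \<nu>"
  and \<mu>: "!!e. e:gE G ==> \<mu> e = (case cE e of None => [] | Some f => \<nu> f)"
 shows "inverse_labelling r H (comp_marking H cV cE M) \<nu> \<longleftrightarrow> inverse_labelling r G M \<mu>"
proof -
 interpret \<nu>: labelled_graph r H \<nu> using sH \<nu> by unfold_locales
 have "labelling r G \<mu>" unfolding labelling_def
 proof
  fix e assume e: "e:gE G"
  note s = serreD(2)[OF sG e]
  show "set (\<mu> e) <= gE (rose r) & reduced (rose r) (\<mu> e) & \<mu> (gbar G e) = rev_path (rose r) (\<mu> e)"
   using \<mu>[OF e] \<mu>[OF s] edge_None[OF e] edge_Some[OF e] \<nu>.label by (cases "cE e") auto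
 qed
 moreover have "red (rose r) (subst \<nu> (petal H (snd (comp_marking H cV cE M)) x)) = red (rose r) (subst \<mu> (petal G (snd M) x))"
  if x: "x:gE (rose r)" for x
 proof -
  have label_push: "subst \<nu> (push p) = subst \<mu> p" if "set p <= gE G" for p
   using that by (induction p) (auto simp: \<mu> edge_image_def split: option.splits)
  note petal_E = walk_E[OF sG petal_walk[OF sG pre x]]
  have "red H (petal H (snd (comp_marking H cV cE M)) x) = red H (push (petal G (snd M) x))"
   using red_subst_petal_comp[OF pre, of "[x]"] x by simp
  then have "red (rose r) (subst \<nu> (petal H (snd (comp_marking H cV cE M)) x)) = red (rose r) (subst \<nu> (push (petal G (snd M) x)))"
   by (rule red_subst_cong[OF sH rose_serre \<nu>.label_hom walk_E[OF sH petal_walk[OF sH comp_premarking[OF pre] x]]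
     set_subst[OF edge_image_hom petal_E]])
  then show ?thesis unfolding label_push[OF petal_E] .
 qed
 ultimately show ?thesis unfolding inverse_labelling_def using \<nu> by simp
qed

lemma (in labelled_marking) contract_unlabelled_edge:
 assumes \<epsilon>: "\<epsilon>:gE G" "\<mu> \<epsilon> = []"
 obtains S N cV cE where "labelled_marking r S N \<mu>" "marked_collapse G M S N cV cE" "gE S \<subset> gE G"
proof -
 note \<epsilon>' = \<epsilon>(1) unlabelled_edge_no_loop[OF \<epsilon>]
 let ?S = "contract G \<epsilon>" and ?V = "contract_vertex G \<epsilon>" and ?E = "contract_edge G \<epsilon>"
 interpret c: graph_collapse G ?S ?V ?E
  using sG serre_contract[OF outer \<epsilon>'] edge_contraction_collapse[OF sG edge_contraction_contract[OF outer \<epsilon>']] by unfold_locales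
 have "labelling r ?S \<mu>" using label by (simp add: labelling_def contract_sel)
 moreover have "\<mu> x = (case ?E x of None => [] | Some f => \<mu> f)" for x
  using \<epsilon>(2) label(3)[OF \<epsilon>(1)] by (auto simp: contract_edge_def)
 ultimately have "inverse_labelling r ?S (comp_marking ?S ?V ?E M) \<mu>"
  using c.inverse_labelling_comp_iff[OF pre] inverse by blast
 then have "labelled_marking r ?S (comp_marking ?S ?V ?E M) \<mu>"
  using outer_contract[OF outer \<epsilon>'] c.valid_comp_marking[OF valid] by unfold_locales
 moreover have "marked_collapse G M ?S (comp_marking ?S ?V ?E M) ?V ?E"
  unfolding marked_collapse_def using c.co marking_equiv_refl[OF c.sH c.comp_premarking[OF pre]] by blast
 moreover have "gE ?S \<subset> gE G" using \<epsilon>(1) by (auto simp: contract_sel)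
 ultimately show ?thesis by (rule that)
qed

locale vertex_expansion =
 fixes G :: sgraph and u :: nat and D :: "nat set" and u' \<epsilon> \<epsilon>' :: nat
 assumes outer: "outer_graph G" and D: "D <= outgoing G u" "card D >= 2" "card (outgoing G u-D) >= 2"
  and fresh: "u' ~: gV G" "\<epsilon> ~: gE G" "\<epsilon>' ~: gE G" "\<epsilon>' ~= \<epsilon>"
begin

definition expanded :: sgraph where
 "expanded = \<lparr>gV = insert u' (gV G),gE = gE G \<union> {\<epsilon>,\<epsilon>'},
  gorg = (%e. if e = \<epsilon> then u' else if e = \<epsilon>' then u else if e:D then u' else gorg G e),
  gbar = (%e. if e = \<epsilon> then \<epsilon>' else if e = \<epsilon>' then \<epsilon> else gbar G e),gEp = insert \<epsilon> (gEp G)\<rparr>"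

lemma expanded_sel:
 "gV expanded = insert u' (gV G)" "gE expanded = gE G \<union> {\<epsilon>,\<epsilon>'}" "gEp expanded = insert \<epsilon> (gEp G)"
 "gorg expanded \<epsilon> = u'" "gorg expanded \<epsilon>' = u" "e:gE G ==> gorg expanded e = (if e:D then u' else gorg G e)"
 "gbar expanded \<epsilon> = \<epsilon>'" "gbar expanded \<epsilon>' = \<epsilon>" "e:gE G ==> gbar expanded e = gbar G e" "tm expanded \<epsilon> = u"
 using fresh by (auto simp: expanded_def tm_def)

lemmas serre = outerD(1)[OF outer]
lemmas fin = serre_fin[OF serre]

lemma u: "u:gV G" "u ~= u'"
proof -
 have "D ~= {}" using D(2) by auto
 then show "u:gV G" using D(1) serreD(1)[OF serre] by blast
 then show "u ~= u'" using fresh(1) by blast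
qed

lemma edges_cases:
 assumes "x:gE expanded"
 obtains "x:gE G" "x ~= \<epsilon>" "x ~= \<epsilon>'" | "x = \<epsilon>" | "x = \<epsilon>'"
 using assms fresh by (auto simp: expanded_sel)

lemma serre_expanded: "serre_graph expanded"
 unfolding serre_graph_def
proof (intro conjI ballI)
 show "finite (gV expanded)" "finite (gE expanded)" "gEp expanded <= gE expanded" "gV expanded ~= {}" using fin by (auto simp: expanded_sel)
 have Ep: "\<epsilon> ~: gEp G" "\<epsilon>' ~: gEp G" using fresh fin(3) by auto
 fix x assume "x:gE expanded"
 then have "gorg expanded x:gV expanded & gbar expanded x:gE expanded & gbar expanded x ~= x & gbar expanded (gbar expanded x) = x & (x:gEp expanded) = (gbar expanded x ~: gEp expanded)"
 proof (cases rule: edges_cases)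
  case 1
  have "gbar G x ~= \<epsilon>" using fresh(2) serreD(2)[OF serre 1(1)] by auto
  then show ?thesis using 1 serreD[OF serre 1(1)] serre_Ep[OF serre 1(1)] by (auto simp: expanded_sel)
 qed (use fresh(4) Ep u in \<open>simp_all add: expanded_sel\<close>)
 then show "gorg expanded x:gV expanded" "gbar expanded x:gE expanded" "gbar expanded x ~= x" "gbar expanded (gbar expanded x) = x" "(x:gEp expanded) = (gbar expanded x ~: gEp expanded)" by auto
qed

lemma edge_contraction_expanded: "edge_contraction expanded \<epsilon> G"
proof -
 have "gorg G e = contract_vertex expanded \<epsilon> (gorg expanded e)" if "e:gE G" for e
  using that D(1) serreD(1)[OF serre that] fresh(1) by (auto simp: contract_vertex_def expanded_sel)
 then show ?thesis unfolding edge_contraction_def using fresh u(2) by (auto simp: expanded_sel)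
qed

sublocale graph_collapse expanded G "contract_vertex expanded \<epsilon>" "contract_edge expanded \<epsilon>"
 using serre_expanded serre edge_contraction_collapse[OF serre_expanded edge_contraction_expanded] by unfold_locales

lemma outgoing_new: "outgoing expanded u' = insert \<epsilon> D"
proof -
 have "d:gE G" if "d:D" for d using that D(1) by blast
 then show ?thesis using u(2) fresh(1) serreD(1)[OF serre] by (auto simp: expanded_sel split: if_splits)
qed

lemma valence:
 assumes w: "w:gV expanded"
 shows "card (outgoing expanded w) >= 3"
proof -
 have fin_out: "finite (outgoing expanded w)" for w using serre_fin(2)[OF serre_expanded] by simp
 consider "w = u'" | "w = u" | "w:gV G" "w ~= u" using w expanded_sel(1) by blast
 then show ?thesis
 proof cases
  assume w: "w = u'"
  have "\<epsilon> ~: D" using D(1) fresh(2) by blast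
  then show ?thesis using D(2) finite_subset[OF D(1)] fin(2) unfolding w outgoing_new by simp
 next
  assume w: "w = u"
  have "insert \<epsilon>' (outgoing G u-D) <= outgoing expanded w" unfolding w by (simp add: expanded_sel subset_iff)
  then have "card (insert \<epsilon>' (outgoing G u-D)) <= card (outgoing expanded w)" by (rule card_mono[OF fin_out])
  moreover have "card (insert \<epsilon>' (outgoing G u-D)) = Suc (card (outgoing G u-D))"
   using fin(2) fresh(3) by (intro card_insert_disjoint) auto
  ultimately show ?thesis using D(3) by linarith
 next
  assume w: "w:gV G" "w ~= u"
  have "outgoing G w <= outgoing expanded w" using D(1) w by (auto simp: expanded_sel)
  then have "card (outgoing G w) <= card (outgoing expanded w)" by (rule card_mono[OF fin_out])
  then show ?thesis using outerD(3)[OF outer w(1)] by linarith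
 qed
qed

lemma outer_expanded: "outer_graph expanded"
 using serre_expanded connected_if_image_connected[OF outerD(2)[OF outer]] valence by (simp add: outer_graph_def)

definition extended_label :: "(nat => nat list) => nat => nat list" where
 "extended_label \<mu> e = (if e:gE G then \<mu> e else [])"

lemma label_size_extended: "label_size expanded (extended_label \<mu>) = label_size G \<mu>"
 unfolding label_size_def
 by (rule sum.mono_neutral_cong_right) (use fin in \<open>auto simp: expanded_sel extended_label_def\<close>)

lemma labelled_marking_lift:
 assumes "labelled_marking r G M \<mu>"
 obtains N where "labelled_marking r expanded N (extended_label \<mu>)"
  "marked_collapse expanded N G M (contract_vertex expanded \<epsilon>) (contract_edge expanded \<epsilon>)"
proof -
 interpret \<mu>: labelled_marking r G M \<mu> by (rule assms)
 obtain N where N: "valid_marking r expanded N" "comp_marking G (contract_vertex expanded \<epsilon>) (contract_edge expanded \<epsilon>) N = M"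
  using marking_lift[OF \<mu>.valid] by blast
 have "extended_label \<mu> x = (case contract_edge expanded \<epsilon> x of None => [] | Some f => \<mu> f)" if "x:gE expanded" for x
  using that fresh by (auto simp: extended_label_def contract_edge_def expanded_sel)
 then have "inverse_labelling r expanded N (extended_label \<mu>)"
  using inverse_labelling_comp_iff[OF valid_premarking[OF N(1)] \<mu>.labelling] \<mu>.inverse N(2) by blast
 then have "labelled_marking r expanded N (extended_label \<mu>)" using outer_expanded N(1) by unfold_locales
 moreover have "marked_collapse expanded N G M (contract_vertex expanded \<epsilon>) (contract_edge expanded \<epsilon>)"
  unfolding marked_collapse_def using co N(2) marking_equiv_refl[OF serre \<mu>.pre] by simp
 ultimately show ?thesis by (rule that)
qed

end

lemma vertex_expansion_exists:
 assumes "outer_graph G" "D <= outgoing G u" "card D >= 2" "card (outgoing G u-D) >= 2"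
 obtains u' \<epsilon> \<epsilon>' where "vertex_expansion G u D u' \<epsilon> \<epsilon>'"
proof -
 note fin = serre_fin[OF outerD(1)[OF assms(1)]]
 obtain u' where "u' ~: gV G" using ex_new_if_finite[OF infinite_UNIV_nat fin(1)] by blast
 moreover obtain \<epsilon> where "\<epsilon> ~: gE G" using ex_new_if_finite[OF infinite_UNIV_nat fin(2)] by blast
 moreover obtain \<epsilon>' where "\<epsilon>' ~: insert \<epsilon> (gE G)"
  using ex_new_if_finite[OF infinite_UNIV_nat finite.insertI[OF fin(2)]] by blast
 ultimately have "vertex_expansion G u D u' \<epsilon> \<epsilon>'" using assms by unfold_locales auto
 then show ?thesis by (rule that)
qed

section \<open>Connectedness\<close>

definition std_marking :: "nat => nat \<times> nat list list" where
 "std_marking r = (0,map (%i. [2 * i]) [0..<r])"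

lemma std_premarking: "premarking r (rose r) (std_marking r)"
 by (auto simp: premarking_def std_marking_def rose_sel)

lemma rose_outer: "r >= 2 ==> outer_graph (rose r)"
proof -
 assume r: "r >= 2"
 have "connected_graph (rose r)" unfolding connected_graph_def rose_sel by (auto intro!: exI[of _ "[]"] simp: rose_sel)
 moreover have "outgoing (rose r) 0 = {..<2 * r}" by (auto simp: rose_sel)
 ultimately show ?thesis using rose_serre r by (simp add: outer_graph_def rose_sel)
qed

lemma std_valid_marking: "valid_marking r (rose r) (std_marking r)"
proof -
 have "petal (rose r) (snd (std_marking r)) x = [x]" if "x:gE (rose r)" for x
 proof -
  have "x div 2 < r" using that by (simp add: rose_sel)
  then show ?thesis by (simp add: petal_def std_marking_def rose_sel)
 qed
 then have loop_id: "subst (petal (rose r) (snd (std_marking r))) q = q" if "set q <= gE (rose r)" for q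
  using that by (induction q) auto
 show ?thesis unfolding valid_marking_iff
 proof (intro conjI allI impI; (elim conjE)?)
  show "premarking r (rose r) (std_marking r)" by (rule std_premarking)
  fix c assume c: "walk (rose r) (gE (rose r)) c (fst (std_marking r)) (fst (std_marking r))" "reduced (rose r) c"
  then show "EX q. set q <= gE (rose r) & red (rose r) (subst (petal (rose r) (snd (std_marking r))) q) = c"
   using walk_E[OF rose_serre c(1)] loop_id red_id by (intro exI[of _ c]) simp
 next
  fix q assume "set q <= gE (rose r)" "reduced (rose r) q" "red (rose r) (subst (petal (rose r) (snd (std_marking r))) q) = []"
  then show "q = []" using loop_id red_id by simp
 qed
qed

text \<open>When no label can be shortened, the labels of reduced paths are reduced, so the loops realising the
 generators are single edges and exhaust the graph.\<close>
context labelled_marking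
begin

context
 assumes label_nonempty: "!!e. e:gE G ==> \<mu> e ~= []"
  and heads_distinct: "!!d d'. d:gE G ==> d':gE G ==> gorg G d = gorg G d' ==> hd (\<mu> d) = hd (\<mu> d') ==> d = d'"
begin

lemma reduced_label: "walk G (gE G) p a b ==> reduced G p ==> reduced R (subst \<mu> p)"
proof (induction p arbitrary: a)
 case (Cons e p)
 have e: "e:gE G" "walk G (gE G) p (tm G e) b" using Cons.prems by auto
 note s = serreD[OF sG e(1)]
 have IH: "reduced R (subst \<mu> p)" using Cons.IH[OF e(2)] Cons.prems(2) by (simp add: reduced_Cons)
 show ?case
 proof (cases p)
  case Nil
  then show ?thesis using label[OF e(1)] by simp
 next
  case (Cons f q)
  have f: "f:gE G" "gorg G f = tm G e" using e(2) Cons by auto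
  have "f ~= gbar G e" using Cons.prems(2) Cons by (simp add: reduced_Cons)
  then have "hd (\<mu> f) ~= hd (\<mu> (gbar G e))" using heads_distinct[OF f(1) s(2)] f(2) s(7) by auto
  also have "hd (\<mu> (gbar G e)) = gbar R (last (\<mu> e))"
   unfolding label(3)[OF e(1)] rev_path_def using label_nonempty[OF e(1)] by (simp add: hd_rev last_map)
  finally have "hd (subst \<mu> p) ~= gbar R (last (\<mu> e))" using label_nonempty[OF f(1)] Cons by simp
  then show ?thesis using label(2)[OF e(1)] IH by (simp add: reduced_append)
 qed
qed simp

lemma single_letter_walk:
 assumes z: "walk G (gE G) z a b" "reduced G z" "red R (subst \<mu> z) = [x]"
 obtains e where "z = [e]" "e:gE G" "gorg G e = a" "tm G e = b" "\<mu> e = [x]"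
proof -
 have label_z: "subst \<mu> z = [x]" using z(3) red_id[OF reduced_label[OF z(1,2)]] by simp
 then obtain e q where q: "z = e#q" by (cases z) auto
 have e: "e:gE G" "gorg G e = a" "walk G (gE G) q (tm G e) b" using z(1) q by auto
 have labels: "\<mu> e = [x]" "subst \<mu> q = []" using label_z q label_nonempty[OF e(1)] by (auto simp: append_eq_Cons_conv)
 have "q = []"
 proof (cases q)
  case (Cons f q')
  then have "f:gE G" using e(3) by simp
  then show ?thesis using label_nonempty[of f] labels(2) Cons by simp
 qed
 then show ?thesis using that q e labels by simp
qed

lemma letter_loops:
 obtains E where "!!x. x:gE R ==> E x:gE G & gorg G (E x) = fst M & tm G (E x) = fst M & \<mu> (E x) = [x]"
proof -
 have "EX e. e:gE G & gorg G e = fst M & tm G e = fst M & \<mu> e = [x]" if x: "x:gE R" for x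
 proof -
  have "set [x] <= gE R" using x by simp
  then obtain p where p: "walk G (gE G) p (fst M) (fst M)" "reduced G p" "red R (subst \<mu> p) = red R [x]"
   using label_surj by blast
  then show ?thesis using single_letter_walk[OF p(1,2)] by (metis red_id reduced_single)
 qed
 then show ?thesis using that by metis
qed

context
 fixes E :: "nat => nat"
 assumes E: "!!x. x:gE R ==> E x:gE G & gorg G (E x) = fst M & tm G (E x) = fst M & \<mu> (E x) = [x]"
begin

lemma outgoing_base:
 assumes e: "e:gE G" "gorg G e = fst M"
 shows "hd (\<mu> e):gE R" "e = E (hd (\<mu> e))"
proof -
 show hd_R: "hd (\<mu> e):gE R" using label(1)[OF e(1)] hd_in_set[OF label_nonempty[OF e(1)]] by blast
 show "e = E (hd (\<mu> e))" by (rule heads_distinct[OF e(1)]) (simp_all add: e E[OF hd_R])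
qed

lemma single_vertex: "gV G = {fst M}"
proof -
 have "walk G (gE G) p a w ==> a = fst M ==> w = fst M" for p a w
 proof (induction p arbitrary: a)
  case (Cons e p)
  then have e: "e:gE G" "gorg G e = fst M" "walk G (gE G) p (tm G e) w" by auto
  have "tm G e = fst M" using outgoing_base[OF e(1,2)] E by metis
  then show ?case by (rule Cons.IH[OF e(3)])
 qed simp
 then show ?thesis using con premarkingD(1)[OF pre] unfolding connected_graph_def by blast
qed

lemma base: "e:gE G ==> gorg G e = fst M"
 using serreD(1)[OF sG] single_vertex by blast

lemma walk_base: "set p <= gE G ==> walk G (gE G) p (fst M) (fst M)"
proof (induction p)
 case (Cons e p)
 then have "e:gE G" "tm G e = fst M" using serreD(5)[OF sG] single_vertex by auto
 then show ?case using Cons base by simp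
qed (simp add: single_vertex)

lemma rose_iso: "graph_iso R G (%_. fst M) E"
 unfolding graph_iso_def
proof (intro conjI ballI)
 show "bij_betw (%_. fst M) (gV R) (gV G)" by (simp add: single_vertex rose_sel bij_betw_def)
 have "inj_on E (gE R)" by (rule inj_onI) (metis E list.inject)
 moreover have "E ` gE R = gE G" using E outgoing_base base by blast
 ultimately show "bij_betw E (gE R) (gE G)" by (simp add: bij_betw_def)
 fix x assume x: "x:gE R"
 show "gorg G (E x) = fst M" using E[OF x] by blast
 have bar: "gbar G (E x):gE G" using serreD(2)[OF sG] E[OF x] by blast
 have "\<mu> (gbar G (E x)) = [gbar R x]" using label(3)[of "E x"] E[OF x] by simp
 then show "E (gbar R x) = gbar G (E x)" using outgoing_base(2)[OF bar base[OF bar]] by simp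
qed

lemma petals_conjugate_letters:
 obtains p where "set p <= gE G" "snd (fst M,map (map E) (snd (std_marking r))) = map (conjugate G p) (snd M)"
proof -
 obtain g where g: "set g <= gE R" "!!x. x:gE R ==> red R (subst \<mu> (petal G (snd M) x)) = conjugate R g [x]"
  using inverse_labellingE[OF inverse] by blast
 define p where "p = map E (rev_path R g)"
 have p: "set p <= gE G" unfolding p_def using set_rev_path[OF sR g(1)] E by auto
 have label_E: "subst \<mu> (map E q) = q" if "set q <= gE R" for q using that by (induction q) (auto simp: E)
 have label_p: "subst \<mu> p = rev_path R g" unfolding p_def by (rule label_E[OF set_rev_path[OF sR g(1)]])
 have "conjugate G p (snd M ! j) = [E (2 * j)]" if j: "j < r" for j
 proof -
  have x: "2 * j:gE R" using j by (simp add: rose_sel)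
  note petal_E = walk_E[OF sG petal_walk[OF sG pre x]]
  let ?z = "conjugate G p (petal G (snd M) (2 * j))"
  have z: "walk G (gE G) ?z (fst M) (fst M)" by (rule walk_conjugate[OF sG walk_base[OF p] petal_walk[OF sG pre x]])
  have "red R (subst \<mu> ?z) = conjugate R (rev_path R g) (conjugate R g [2 * j])"
   unfolding red_subst_conjugate[OF sG sR label_hom p petal_E] label_p g(2)[OF x] ..
  also have "... = [2 * j]" using conjugate_rev_path[OF sR g(1), of "[2 * j]"] x by (simp add: red_id)
  finally obtain e where e: "?z = [e]" "e:gE G" "\<mu> e = [2 * j]"
   using single_letter_walk[OF z] by (auto simp: conjugate_def)
  then show ?thesis using outgoing_base(2)[OF e(2) base[OF e(2)]] by (simp add: petal_def)
 qed
 then have "snd (fst M,map (map E) (snd (std_marking r))) = map (conjugate G p) (snd M)"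
  using premarkingD(2)[OF pre] by (auto simp: std_marking_def list_eq_iff_nth_eq)
 then show ?thesis using that p by blast
qed

end

lemma marked_collapse_from_rose:
 obtains cV cE where "marked_collapse R (std_marking r) G M cV cE"
proof -
 obtain E where E: "!!x. x:gE R ==> E x:gE G & gorg G (E x) = fst M & tm G (E x) = fst M & \<mu> (E x) = [x]"
  using letter_loops by blast
 note iso = rose_iso[OF E]
 obtain p where "set p <= gE G" "snd (fst M,map (map E) (snd (std_marking r))) = map (conjugate G p) (snd M)"
  using petals_conjugate_letters[OF E] by blast
 then have "marking_equiv G M (fst M,map (map E) (snd (std_marking r)))"
  unfolding marking_equiv_iff using walk_base[OF E] by auto
 then have "marked_collapse R (std_marking r) G M (%_. fst M) (%e. Some (E e))"
  unfolding marked_collapse_def using graph_iso_forest_collapse[OF sR sG iso] comp_marking_graph_iso[OF sR sG iso std_premarking] by simp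
 then show ?thesis by (rule that)
qed

end

end

definition same_component :: "nat => mmg => mmg => bool" where
 "same_component r t t' \<longleftrightarrow> (ALL x. path_lengths r x (normalized r t) ~= {} \<longleftrightarrow> path_lengths r x (normalized r t') ~= {})"

lemma same_component_refl: "same_component r t t"
 by (simp add: same_component_def)

lemma same_component_sym: "same_component r t t' ==> same_component r t' t"
 by (simp add: same_component_def)

lemma same_component_trans [trans]: "same_component r t t' ==> same_component r t' t'' ==> same_component r t t''"
 by (simp add: same_component_def)

lemma same_component_collapse:
 assumes "valid_mmg r (G,M,l)" "valid_mmg r (H,N,k)" "marked_collapse G M H N cV cE"
 shows "same_component r (G,M,l) (H,N,k)"
proof -
 have joined: "smoothly_joined r (normalized r (H,N,k)) (normalized r (G,M,l))"
  by (rule smoothly_joined_collapse[OF assms(2,1,3)])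
 show ?thesis unfolding same_component_def
  using path_lengths_extend[OF _ joined] path_lengths_extend[OF _ smoothly_joined_sym[OF joined]] by (intro allI iffI)
qed

definition unit_len :: "sgraph => nat => real" where
 "unit_len G e = (if e:gEp G then 1 else 0)"

lemma valid_mmg_unit_len: "outer_graph G ==> valid_marking r G M ==> valid_mmg r (G,M,unit_len G)"
 by (simp add: valid_mmg_def lengths_def unit_len_def)

context labelled_marking
begin

lemma valid_unit: "valid_mmg r (G,M,unit_len G)"
 by (rule valid_mmg_unit_len[OF outer valid])

lemma expand_and_gauge:
 assumes ne: "!!e. e:gE G ==> \<mu> e ~= []" and a: "a:gE R"
  and two: "card {e:outgoing G u. hd (\<mu> e) = a} >= 2" "card (outgoing G u-{e:outgoing G u. hd (\<mu> e) = a}) >= 2"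
 obtains H N \<nu> where "labelled_marking r H N \<nu>" "label_size H \<nu> < label_size G \<mu>"
  "same_component r (G,M,unit_len G) (H,N,unit_len H)"
proof -
 let ?D = "{e:outgoing G u. hd (\<mu> e) = a}"
 have "?D <= outgoing G u" by auto
 then obtain u' \<epsilon> \<epsilon>' where "vertex_expansion G u ?D u' \<epsilon> \<epsilon>'"
  using vertex_expansion_exists[OF outer _ two] by blast
 then interpret v: vertex_expansion G u ?D u' \<epsilon> \<epsilon>' .
 let ?H = "v.expanded" and ?\<nu> = "v.extended_label \<mu>"
 obtain N where N: "labelled_marking r ?H N ?\<nu>" "marked_collapse ?H N G M (contract_vertex ?H \<epsilon>) (contract_edge ?H \<epsilon>)"
  using v.labelled_marking_lift labelled_marking_axioms by blast
 interpret n: labelled_marking r ?H N ?\<nu> by (rule N(1))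
 have label_\<epsilon>: "?\<nu> \<epsilon> = []" using v.fresh(2) by (simp add: v.extended_label_def)
 have label_D: "?\<nu> e ~= [] & hd (?\<nu> e) = a" if "e:?D" for e using that ne by (simp add: v.extended_label_def)
 have major: "{e:outgoing ?H u'. ?\<nu> e ~= [] & hd (?\<nu> e) = a} = ?D"
  and minor: "{e:outgoing ?H u'. ?\<nu> e = [] | hd (?\<nu> e) ~= a} <= {\<epsilon>}"
  unfolding v.outgoing_new using label_\<epsilon> label_D by blast+
 have "label_size ?H (gauge r ?H u' a ?\<nu>) < label_size ?H ?\<nu>"
  by (rule n.label_size_gauge[OF a], unfold major) (use two(1) card_mono[OF _ minor] in simp)
 moreover have "same_component r (G,M,unit_len G) (?H,N,unit_len ?H)"
  by (rule same_component_sym[OF same_component_collapse[OF n.valid_unit valid_unit N(2)]])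
 ultimately show ?thesis unfolding v.label_size_extended by (rule that[OF n.gauge_labelled_marking[OF a]])
qed

lemma fold_equal_heads:
 assumes ne: "!!e. e:gE G ==> \<mu> e ~= []"
  and d: "d:gE G" "d':gE G" "d ~= d'" "gorg G d = gorg G d'" "hd (\<mu> d) = hd (\<mu> d')"
 obtains H N \<nu> where "labelled_marking r H N \<nu>" "label_size H \<nu> < label_size G \<mu>"
  "same_component r (G,M,unit_len G) (H,N,unit_len H)"
proof -
 define u where "u = gorg G d"
 define a where "a = hd (\<mu> d)"
 have a: "a:gE R" using label(1)[OF d(1)] hd_in_set[OF ne[OF d(1)]] by (auto simp: a_def)
 let ?D = "{e:outgoing G u. hd (\<mu> e) = a}"
 have "{d,d'} <= ?D" using d by (auto simp: u_def a_def)
 then have "card {d,d'} <= card ?D" using serre_fin(2)[OF sG] by (intro card_mono) auto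
 then have two: "card ?D >= 2" using d(3) by simp
 show ?thesis
 proof (cases "card (outgoing G u-?D) >= 2")
  case True
  then show ?thesis using expand_and_gauge[OF ne a two] that by blast
 next
  case False
  have "{e:outgoing G u. \<mu> e ~= [] & hd (\<mu> e) = a} = ?D" "{e:outgoing G u. \<mu> e = [] | hd (\<mu> e) ~= a} = outgoing G u-?D"
   using ne by auto
  then have "label_size G (gauge r G u a \<mu>) < label_size G \<mu>" using False two by (intro label_size_gauge[OF a]) simp
  then show ?thesis by (rule that[OF gauge_labelled_marking[OF a] _ same_component_refl])
 qed
qed

lemma terminal_or_smaller:
 assumes r: "r >= 2"
 shows "same_component r (G,M,unit_len G) (R,std_marking r,unit_len R) |
  (EX H N \<nu>. labelled_marking r H N \<nu> & same_component r (G,M,unit_len G) (H,N,unit_len H) &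
   (label_size H \<nu> < label_size G \<mu> | label_size H \<nu> = label_size G \<mu> & card (gE H) < card (gE G)))"
proof -
 note fin = serre_fin(2)[OF sG]
 consider (unlabelled) \<epsilon> where "\<epsilon>:gE G" "\<mu> \<epsilon> = []"
  | (fold) d d' where "d:gE G" "d':gE G" "d ~= d'" "gorg G d = gorg G d'" "hd (\<mu> d) = hd (\<mu> d')" "ALL e:gE G. \<mu> e ~= []"
  | (terminal) "ALL e:gE G. \<mu> e ~= []" "ALL d:gE G. ALL d':gE G. gorg G d = gorg G d' & hd (\<mu> d) = hd (\<mu> d') --> d = d'" by blast
 then show ?thesis
 proof cases
  case unlabelled
  obtain H N cV cE where H: "labelled_marking r H N \<mu>" "marked_collapse G M H N cV cE" "gE H \<subset> gE G"
   using contract_unlabelled_edge[OF unlabelled] by blast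
  interpret h: labelled_marking r H N \<mu> by (rule H(1))
  have "label_size H \<mu> <= label_size G \<mu>" unfolding label_size_def using H(3) fin by (intro sum_mono2) auto
  then show ?thesis
   using H(1) same_component_collapse[OF valid_unit h.valid_unit H(2)] psubset_card_mono[OF fin H(3)]
   by (metis order_le_less)
 next
  case fold
  then show ?thesis using fold_equal_heads[of d d'] by metis
 next
  case terminal
  obtain cV cE where "marked_collapse R (std_marking r) G M cV cE"
   using marked_collapse_from_rose terminal by metis
  then show ?thesis
   using same_component_collapse[OF valid_mmg_unit_len[OF rose_outer[OF r] std_valid_marking] valid_unit] same_component_sym by blast
 qed
qed

end

lemma same_component_rose:
 assumes r: "r >= 2" and "labelled_marking r G M \<mu>"
 shows "same_component r (G,M,unit_len G) (rose r,std_marking r,unit_len (rose r))"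
 using assms(2)
proof (induction "(label_size G \<mu>,card (gE G))" arbitrary: G M \<mu> rule: wf_induct_rule[OF wf_lex_prod[OF wf_less_than wf_less_than]])
 case 1
 then interpret labelled_marking r G M \<mu> by simp
 from terminal_or_smaller[OF r] show ?case
 proof
  assume "EX H N \<nu>. labelled_marking r H N \<nu> & same_component r (G,M,unit_len G) (H,N,unit_len H) &
   (label_size H \<nu> < label_size G \<mu> | label_size H \<nu> = label_size G \<mu> & card (gE H) < card (gE G))"
  then obtain H N \<nu> where H: "labelled_marking r H N \<nu>" "same_component r (G,M,unit_len G) (H,N,unit_len H)"
   "((label_size H \<nu>,card (gE H)),(label_size G \<mu>,card (gE G))):less_than <*lex*> less_than" by auto
  note H(2)
  also have "same_component r (H,N,unit_len H) (rose r,std_marking r,unit_len (rose r))" by (rule "1.hyps"[OF H(3,1)])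
  finally show ?thesis .
 qed
qed

lemma path_lengths_if_smoothly_joined:
 assumes "smoothly_joined r x y"
 shows "path_lengths r x y ~= {}"
proof -
 obtain \<gamma> I where \<gamma>: "\<gamma> 0 = x" "\<gamma> 1 = y" "ALL t:{0..1}. \<gamma> t:outer_space1 r" "weak_cont r \<gamma>" "smooth_piece r 0 1 \<gamma> I"
  using assms unfolding smoothly_joined_def by blast
 have "I:path_lengths r x y" unfolding path_lengths_def
  by (intro CollectI exI[of _ \<gamma>] exI[of _ "[0,1]"] exI[of _ "%_. I"]) (use \<gamma> in \<open>auto simp: less_Suc_eq\<close>)
 then show ?thesis by blast
qed

lemma outer_space1_rose_component:
 assumes r: "r >= 2" and x: "x:outer_space1 r"
 obtains t where "x = normalized r t" "smoothly_joined r x x" "same_component r t (rose r,std_marking r,unit_len (rose r))"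
proof -
 obtain G M l where G: "valid_mmg r (G,M,l)" "entropy G l = 1" "x = cls r (G,M,l)" using outer_space1E[OF x] by blast
 note D = valid_mmgD[OF G(1)] and id = marked_collapse_id[OF valid_mmgD(2,4)[OF G(1)]]
 interpret marked_graph r G M using D outerD(2) by unfold_locales auto
 obtain \<mu> where "inverse_labelling r G M \<mu>" using inverse_labelling_exists by blast
 then have labelled: "labelled_marking r G M \<mu>" using D(1) valid by unfold_locales
 have "same_component r (G,M,l) (G,M,unit_len G)"
  by (rule same_component_collapse[OF G(1) valid_mmg_unit_len[OF D(1,3)] id])
 also note same_component_rose[OF r labelled]
 finally have component: "same_component r (G,M,l) (R,std_marking r,unit_len R)" .
 have x: "x = normalized r (G,M,l)" using G(2,3) by (simp add: normalized_def)
 then have "smoothly_joined r x x" using smoothly_joined_collapse[OF G(1,1) id] by simp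
 then show ?thesis using that x component by blast
qed

lemma path_lengths_nonempty:
 assumes r: "r >= 2" and x: "x:outer_space1 r" and y: "y:outer_space1 r"
 shows "path_lengths r x y ~= {}"
proof -
 obtain s where s: "x = normalized r s" "smoothly_joined r x x" "same_component r s (rose r,std_marking r,unit_len (rose r))"
  by (rule outer_space1_rose_component[OF r x])
 obtain t where t: "y = normalized r t" "same_component r t (rose r,std_marking r,unit_len (rose r))"
  by (rule outer_space1_rose_component[OF r y])
 have "same_component r s t" by (rule same_component_trans[OF s(3) same_component_sym[OF t(2)]])
 then have "path_lengths r x x ~= {} \<longleftrightarrow> path_lengths r x y ~= {}" unfolding same_component_def s(1) t(1) by blast
 then show ?thesis using path_lengths_if_smoothly_joined[OF s(2)] by blast
qed

theorem mainTheorem10: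
  fixes r :: nat
  assumes "r \<ge> 2"
  shows "(\<forall>x\<in>outer_space1 r. \<forall>y\<in>outer_space1 r. d_h r x y < \<infinity>) \<and>
         (\<forall>U. U \<subseteq> outer_space1 r \<longrightarrow>
            ((\<forall>x\<in>U. \<exists>\<epsilon>>0. \<forall>y\<in>outer_space1 r. d_h r x y < ereal \<epsilon> \<longrightarrow> y \<in> U) \<longleftrightarrow>
             (\<exists>V. weak_open r V \<and> U = V \<inter> outer_space1 r)))"
proof (intro conjI ballI allI impI iffI)
 fix x y assume "x:outer_space1 r" "y:outer_space1 r"
 then obtain s where "s:path_lengths r x y" using path_lengths_nonempty[OF assms] by blast
 then have "d_h r x y <= ereal s" unfolding d_h_def by (intro Inf_lower) simp
 then show "d_h r x y < \<infinity>" by (rule le_less_trans) simp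
next
 fix U assume "U <= outer_space1 r" "ALL x:U. EX \<epsilon>>0. ALL y:outer_space1 r. d_h r x y < ereal \<epsilon> --> y:U"
 then show "EX V. weak_open r V & U = V \<inter> outer_space1 r" by (rule metric_open_weak_open)
next
 fix U x assume "EX V. weak_open r V & U = V \<inter> outer_space1 r" and x: "x:U"
 then obtain V where V: "weak_open r V" "U = V \<inter> outer_space1 r" by blast
 have xV: "x:V" "x:outer_space1 r" using x V(2) by auto
 from weak_open_metric_open[OF V(1) xV] obtain \<epsilon> where "\<epsilon> > 0" "ALL y:outer_space1 r. d_h r x y < ereal \<epsilon> --> y:V" by blast
 then show "EX \<epsilon>>0. ALL y:outer_space1 r. d_h r x y < ereal \<epsilon> --> y:U" unfolding V(2) by (intro exI[of _ \<epsilon>]) simp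
qed

end
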